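(* Let $f:\mathbb{R}^3\to\mathbb{R}^3$ be the Rössler vector field with $a=5.25$, $b=0.2$, $$f(x,y,z)=\big(-y-z,\;x+0.2\,y,\;z(x-5.25)+0.2\big),$$ and consider the delay differential equation $$u'(t)=f(u(t))+\varepsilon\,f(u(t-\tau)),\qquad \tau=0.5,\quad\varepsilon=0.0001 .$$ Then for every $m\in\mathbb{N}$, $m\ge1$, this system has an $m$-periodic orbit.
   Context: The phase space is $\mathcal{C}=C([-\tau,0],\mathbb{R}^3)$; for a solution $u$, $u_t\in\mathcal{C}$ is the segment $u_t(s)=u(t+s)$, $s\in[-\tau,0]$. Write $u=(x,y,z)$. $\bar P$ denotes the (local) Poincaré first return map on the section $\bar S=\{\phi\in\mathcal{C}:\pi_x\phi(0)=0\}$, with crossings in the direction $x'>0$: $\bar P(\phi)=u_{t_*}$, where $u$ is the solution with $u_0=\phi$ and $t_*>0$ is the first positive time with $x(t_* )=0$ and $x'(t_* )>0$. An $m$-periodic orbit of the system is a periodic solution $u:\mathbb{R}\to\mathbb{R}^3$ of the equation such that $x(0)=0$, $x'(0)>0$ and $u_0$ is a periodic point of $\bar P$ with least period exactly $m$. *)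

theory Defs
  imports "HOL-Analysis.Analysis"
begin

definition rossler :: "real \<Rightarrow> real \<Rightarrow> real^3 \<Rightarrow> real^3" where
  "rossler a b v = vector [- (v$2) - v$3, v$1 + b * v$2, v$3 * (v$1 - a) + b]"

text \<open>
  Elements of \<open>C([-\<tau>,0], \<real>\<^sup>3)\<close> are represented by functions on the reals that take the value
  \<^const>\<open>undefined\<close> outside \<open>[-\<tau>,0]\<close>, so that equality is equality on \<open>[-\<tau>,0]\<close>.
\<close>

definition phase_space :: "real \<Rightarrow> (real \<Rightarrow> real^3) set" where
  "phase_space \<tau> = {\<phi> \<in> extensional {-\<tau>..0}. continuous_on {-\<tau>..0} \<phi>}"

definition segment :: "real \<Rightarrow> (real \<Rightarrow> real^3) \<Rightarrow> real \<Rightarrow> (real \<Rightarrow> real^3)" where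
  "segment \<tau> u t = (\<lambda>s\<in>{-\<tau>..0}. u (t + s))"

definition dde_rhs ::
  "(real^3 \<Rightarrow> real^3) \<Rightarrow> real \<Rightarrow> real \<Rightarrow> (real \<Rightarrow> real^3) \<Rightarrow> real \<Rightarrow> real^3" where
  "dde_rhs f \<tau> \<epsilon> u t = f (u t) + \<epsilon> *\<^sub>R f (u (t - \<tau>))"

text \<open>
  Forward solution on \<open>[-\<tau>,T)\<close> with initial segment \<open>\<phi>\<close>; the derivative at \<open>0\<close> is one-sided, and
  the values of \<open>u\<close> outside \<open>[-\<tau>,T)\<close> are irrelevant.
\<close>

definition dde_ivp_solution ::
  "(real^3 \<Rightarrow> real^3) \<Rightarrow> real \<Rightarrow> real \<Rightarrow> (real \<Rightarrow> real^3) \<Rightarrow> real \<Rightarrow> (real \<Rightarrow> real^3) \<Rightarrow> bool" where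
  "dde_ivp_solution f \<tau> \<epsilon> \<phi> T u \<longleftrightarrow>
     segment \<tau> u 0 = \<phi> \<and>
     continuous_on {-\<tau>..<T} u \<and>
     (\<forall>t\<in>{0..<T}. (u has_vector_derivative dde_rhs f \<tau> \<epsilon> u t) (at t within {0..<T}))"

definition dde_solution ::
  "(real^3 \<Rightarrow> real^3) \<Rightarrow> real \<Rightarrow> real \<Rightarrow> (real \<Rightarrow> real^3) \<Rightarrow> bool" where
  "dde_solution f \<tau> \<epsilon> u \<longleftrightarrow> (\<forall>t. (u has_vector_derivative dde_rhs f \<tau> \<epsilon> u t) (at t))"

definition poincare_section :: "real \<Rightarrow> (real \<Rightarrow> real^3) set" where
  "poincare_section \<tau> = {\<phi> \<in> phase_space \<tau>. \<phi> 0 $ 1 = 0}"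

definition up_crossing :: "(real \<Rightarrow> real^3) \<Rightarrow> real \<Rightarrow> bool" where
  "up_crossing u t \<longleftrightarrow> u t $ 1 = 0 \<and> deriv (\<lambda>s. u s $ 1) t > 0"

definition first_return ::
  "(real^3 \<Rightarrow> real^3) \<Rightarrow> real \<Rightarrow> real \<Rightarrow> (real \<Rightarrow> real^3) \<Rightarrow> (real \<Rightarrow> real^3) \<Rightarrow> bool" where
  "first_return f \<tau> \<epsilon> \<phi> \<psi> \<longleftrightarrow>
     (\<exists>T u t. dde_ivp_solution f \<tau> \<epsilon> \<phi> T u \<and> 0 < t \<and> t < T \<and>
        up_crossing u t \<and> (\<forall>s\<in>{0<..<t}. \<not> up_crossing u s) \<and> \<psi> = segment \<tau> u t)"

text \<open>
  The first return map is partial: a solution starting on the section need not exist for long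
  enough, or need not return. Where the initial value problem is uniquely solvable (for instance
  for locally Lipschitz \<open>f\<close>), there is at most one \<open>\<psi>\<close> with \<open>first_return f \<tau> \<epsilon> \<phi> \<psi>\<close>.
\<close>

definition poincare_map ::
  "(real^3 \<Rightarrow> real^3) \<Rightarrow> real \<Rightarrow> real \<Rightarrow> (real \<Rightarrow> real^3) \<Rightarrow> (real \<Rightarrow> real^3) option" where
  "poincare_map f \<tau> \<epsilon> \<phi> =
     (if \<phi> \<in> poincare_section \<tau> \<and> (\<exists>!\<psi>. first_return f \<tau> \<epsilon> \<phi> \<psi>)
      then Some (THE \<psi>. first_return f \<tau> \<epsilon> \<phi> \<psi>) else None)"

definition partial_iterate :: "('a \<Rightarrow> 'a option) \<Rightarrow> nat \<Rightarrow> 'a \<Rightarrow> 'a option" where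
  "partial_iterate P n x = ((\<lambda>y. Option.bind y P) ^^ n) (Some x)"

definition has_least_period :: "('a \<Rightarrow> 'a option) \<Rightarrow> 'a \<Rightarrow> nat \<Rightarrow> bool" where
  "has_least_period P x m \<longleftrightarrow>
     0 < m \<and> partial_iterate P m x = Some x \<and>
     (\<forall>k. 0 < k \<and> k < m \<longrightarrow> partial_iterate P k x \<noteq> Some x)"

definition m_periodic_orbit ::
  "(real^3 \<Rightarrow> real^3) \<Rightarrow> real \<Rightarrow> real \<Rightarrow> nat \<Rightarrow> (real \<Rightarrow> real^3) \<Rightarrow> bool" where
  "m_periodic_orbit f \<tau> \<epsilon> m u \<longleftrightarrow>
     dde_solution f \<tau> \<epsilon> u \<and>
     (\<exists>p>0. \<forall>t. u (t + p) = u t) \<and>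
     up_crossing u 0 \<and>
     has_least_period (poincare_map f \<tau> \<epsilon>) (segment \<tau> u 0) m"

end

theory Submission imports Defs "HOL-Complex_Analysis.Great_Picard" begin

text \<open>
  The flow has a return map to the half plane \<open>y = 0, x < 0\<close>. It acts on \<open>- x\<close> almost like a unimodal map:
  there are two disjoint intervals such that the image of the first covers the second one and the
  image of the second covers both, for every history in a suitable box. This is a finite number of
  strict inequalities, verified by enclosing solutions around Taylor polynomials with integer arithmetic.
  Given a cyclic sequence of the two intervals in which the first one is never repeated, the
  Poincare--Miranda theorem yields a cycle of piecewise linear histories that are reproduced at their
  nodes; refining the nodes, the Arzela--Ascoli theorem gives a genuine periodic solution. Between two
  returns \<open>x\<close> crosses zero upwards exactly once, so the sequence that visits the first interval only once
  in \<open>m\<close> steps (and the constant sequence if \<open>m = 1\<close>) has least period \<open>m\<close> under the Poincare map.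
\<close>

section \<open>Enclosing solutions with integers\<close>

text \<open>The phase space is infinite dimensional and the equation can be solved forward only. Two
  features help. The delayed term carries the factor 1/10000, so one coarse box for the history
  serves all estimates. And only one coordinate, x at the return, is stretched: for it the covering
  inequalities give opposite signs on opposite faces. All other coordinates of a history are merely
  mapped into their own box; retracting the image onto the box makes their sign conditions hold
  trivially, and the retraction turns out to be inactive at the solution. Two sections occur because
  the covering lives on y = 0, x < 0, whereas the claim counts upward crossings of x = 0; equal
  segments at two crossings would force equal points at the next return to y = 0, which lie in
  disjoint intervals. The cross section map is only defined where solutions are unique, yet the
  vector field is quadratic. Truncating the factors of z * (x - 21/4) by \<open>clamp\<close> makes
  it globally Lipschitz, so that solutions exist for all times; those used here stay below the
  threshold and hence solve the original equation.\<close>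

definition clamp :: "real \<Rightarrow> real \<Rightarrow> real" where "clamp R v = max (-R) (min R v)"

lemma clamp_id: "\<bar>v\<bar> \<le> R \<Longrightarrow> clamp R v = v" by (auto simp: clamp_def)

text \<open>Everything that is evaluated is an integer \<open>v\<close> standing for \<open>v / S\<close>, where \<open>S = 2 ^ sh\<close>.
  Rounding is by \<open>shr\<close>, so an upper bound needs the additional \<open>1\<close>. Division by constants is multiplication by
  a dyadic approximation: \<open>52429 / 2 ^ 18\<close> for \<open>1 / 5\<close>, \<open>21845 / 2 ^ 16\<close> for \<open>1 / 3\<close>, and the upper bounds
  \<open>205 / 2 ^ 10\<close>, \<open>105 / 2 ^ 20\<close>, \<open>21 / 2 ^ 20\<close>, \<open>6554 / 2 ^ 16\<close> for \<open>1 / 5\<close>, \<open>1 / 10000\<close>, \<open>1 / 50000\<close>, \<open>1 / 10\<close>.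
  Intermediate values are passed as arguments of auxiliary functions rather than bound by \<open>let\<close>,
  because the simplifier normalises arguments before it unfolds a function.\<close>

definition shr :: "nat \<Rightarrow> int \<Rightarrow> int" where "shr n x = x div 2 ^ n"

definition half :: "int \<Rightarrow> int" where "half x = x div 2"

lemma half_Bit0: "numeral (num.Bit0 m) div 2 = (numeral m :: int)"
  and half_Bit1: "numeral (num.Bit1 m) div 2 = (numeral m :: int)"
  and half_neg_Bit0: "- numeral (num.Bit0 m) div 2 = - (numeral m :: int)"
  and half_neg_Bit1: "- numeral (num.Bit1 m) div 2 = - (numeral (Num.inc m) :: int)"
proof -
  have "numeral (num.Bit0 m) = 2 * (numeral m :: int)" "numeral (num.Bit1 m) = 2 * (numeral m :: int) + 1"
    "numeral (Num.inc m) = (numeral m :: int) + 1"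
    by (subst numeral_Bit0 numeral_Bit1 numeral_inc, simp)+
  moreover have "x div 2 = y \<and> z div 2 = y \<and> - x div 2 = - y \<and> - z div 2 = - w"
    if "x = 2 * y" "z = 2 * y + 1" "w = y + 1" for x y z w :: int
    unfolding that by linarith
  ultimately show "numeral (num.Bit0 m) div 2 = (numeral m :: int)" "numeral (num.Bit1 m) div 2 = (numeral m :: int)"
    "- numeral (num.Bit0 m) div 2 = - (numeral m :: int)" "- numeral (num.Bit1 m) div 2 = - (numeral (Num.inc m) :: int)"
    by blast+
qed

text \<open>Halving drops the last binary digit, with a carry for negative odd numerals because
  \<open>div\<close> rounds down. So \<open>code_simp\<close> shifts numerals digit by digit and
  never runs an integer division.\<close>

lemma half_code [code]:
  "half 0 = 0" "half (Int.Pos num.One) = 0" "half (Int.Pos (num.Bit0 m)) = Int.Pos m"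
  "half (Int.Pos (num.Bit1 m)) = Int.Pos m" "half (Int.Neg num.One) = - 1"
  "half (Int.Neg (num.Bit0 m)) = Int.Neg m" "half (Int.Neg (num.Bit1 m)) = Int.Neg (Num.inc m)"
  by (simp_all only: half_def Int.Pos_def Int.Neg_def half_Bit0 half_Bit1 half_neg_Bit0 half_neg_Bit1 div_0)

lemma shr_code [code]: "shr 0 x = x" "shr (Suc n) x = shr n (half x)"
  by (simp_all add: shr_def half_def zdiv_zmult2_eq mult.commute)

definition mulu :: "nat \<Rightarrow> int \<Rightarrow> int \<Rightarrow> int" where "mulu sh a b = shr sh (a * b) + 1"

section \<open>Polynomials with integer coefficients, constant term first\<close>

fun padd :: "int list \<Rightarrow> int list \<Rightarrow> int list" where
  "padd [] q = q" | "padd (a#p) [] = a # p" | "padd (a#p) (b#q) = (a+b) # padd p q"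
fun psm :: "int \<Rightarrow> int list \<Rightarrow> int list" where
  "psm a [] = []" | "psm a (b#q) = (a*b) # psm a q"
fun pmul :: "int list \<Rightarrow> int list \<Rightarrow> int list" where
  "pmul [] q = []" | "pmul (a#p) q = padd (psm a q) (0 # pmul p q)"
fun pder :: "int list \<Rightarrow> int list" where
  "pder [] = []" | "pder (c#cs) = padd cs (0 # pder cs)"
text \<open>Bounds on the unit interval, where every power of the variable lies between 0 and 1: a
  coefficient contributes at least its negative and at most its positive part. The constant term,
  split off in \<open>lo\<close> and \<open>hi\<close>, is exact.\<close>

fun lo0 :: "int list \<Rightarrow> int" where "lo0 [] = 0" | "lo0 (c#cs) = min c 0 + lo0 cs"
fun hi0 :: "int list \<Rightarrow> int" where "hi0 [] = 0" | "hi0 (c#cs) = max c 0 + hi0 cs"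
fun asum :: "int list \<Rightarrow> int" where "asum [] = 0" | "asum (c#cs) = \<bar>c\<bar> + asum cs"
fun psum :: "int list \<Rightarrow> int" where "psum [] = 0" | "psum (c#cs) = c + psum cs"
fun lo :: "int list \<Rightarrow> int" where "lo [] = 0" | "lo (c#cs) = c + lo0 cs"
fun hi :: "int list \<Rightarrow> int" where "hi [] = 0" | "hi (c#cs) = c + hi0 cs"
fun cadd :: "int \<Rightarrow> int list \<Rightarrow> int list" where "cadd a [] = [a]" | "cadd a (c#cs) = (a+c) # cs"
fun dot :: "int list \<Rightarrow> int list \<Rightarrow> int" where
  "dot (a#p) (b#q) = a * b + dot p q" | "dot _ _ = 0"

type_synonym ivl = "int \<times> int"
type_synonym box = "ivl \<times> ivl \<times> ivl"

text \<open>The coefficients of x, y, z are stored newest first, those of x - a in the last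
  component oldest first. Then \<open>dot\<close> of the third and the last list is the next
  coefficient of the product z * (x - a).\<close>

type_synonym tstate = "int list \<times> int list \<times> int list \<times> int list"
fun push :: "int \<Rightarrow> int \<Rightarrow> int \<Rightarrow> tstate \<Rightarrow> tstate" where
  "push x y z (xr, yr, zr, w) = (x # xr, y # yr, z # zr, w @ [x])"
text \<open>\<open>m / 2 ^ n\<close> stands for the step length divided by the degree of the new
  coefficient.\<close>

fun tstep :: "nat \<Rightarrow> int \<times> nat \<Rightarrow> int \<times> int \<times> int \<Rightarrow> tstate \<Rightarrow> tstate" where
  "tstep sh (m,n) (cx,cy,cz) (xr,yr,zr,w) =
     push (shr n (m * (cx - hd yr - hd zr))) (shr n (m * (cy + hd xr + shr 18 (hd yr * 52429))))
       (shr n (m * (cz + shr sh (dot zr w)))) (xr,yr,zr,w)"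
primrec tay :: "nat \<Rightarrow> (int \<times> nat) list \<Rightarrow> int \<times> int \<times> int \<Rightarrow> tstate \<Rightarrow> tstate" where
  "tay sh [] c st = st"
| "tay sh (d#ds) c st = tay sh ds (0,0,0) (tstep sh d c st)"
fun trev :: "tstate \<Rightarrow> int list \<times> int list \<times> int list" where
  "trev (xr,yr,zr,w) = (rev xr, rev yr, rev zr)"
text \<open>Degree four, in time measured in units of the step. The delayed term is frozen at its
  centre, so it enters the first coefficient only. Rounding and truncation need no analysis, since
  the residual of the resulting polynomial is bounded afterwards.\<close>

fun taylor :: "nat \<Rightarrow> int \<Rightarrow> int \<Rightarrow> nat \<Rightarrow> int \<times> int \<times> int \<Rightarrow> int \<Rightarrow> int \<Rightarrow> int \<Rightarrow> int list \<times> int list \<times> int list" where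
  "taylor sh S a k (x,y,z) cx cy cz =
     trev (tay sh [(1,k),(1,k+1),(21845,k+16),(1,k+2)] (cx, cy, cz + shr 18 (S * 52429)) ([x], [y], [z], [x - a]))"

text \<open>Intervals that contribute to the delayed term are represented as centre and radius.\<close>

definition cr' :: "int \<Rightarrow> int \<Rightarrow> int \<Rightarrow> int \<Rightarrow> int \<Rightarrow> ivl" where
  "cr' D M l h c = (c, shr 20 (max (h - D * c) (D * c - l) * M) + 1)"
definition cr :: "int \<Rightarrow> int \<Rightarrow> int \<Rightarrow> int \<Rightarrow> ivl" where
  "cr D M l h = cr' D M l h (shr 21 ((l + h) * M))"

definition min4 :: "int \<Rightarrow> int \<Rightarrow> int \<Rightarrow> int \<Rightarrow> int" where "min4 p q r s = min (min p q) (min r s)"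
definition max4 :: "int \<Rightarrow> int \<Rightarrow> int \<Rightarrow> int \<Rightarrow> int" where "max4 p q r s = max (max p q) (max r s)"
definition crz :: "nat \<Rightarrow> int \<Rightarrow> int \<Rightarrow> int \<Rightarrow> int \<Rightarrow> int \<Rightarrow> ivl" where
  "crz sh S p q r s = cr 50000 21 (5 * shr sh (min4 p q r s) + S) (5 * shr sh (max4 p q r s) + 5 + S)"

text \<open>The second and third rows are brought to the denominator 50000 because of the
  coefficient 1/5.\<close>

fun delay :: "nat \<Rightarrow> int \<Rightarrow> int \<Rightarrow> box \<Rightarrow> ivl \<times> ivl \<times> ivl" where
  "delay sh S a ((xl,xu),(yl,yu),(zl,zu)) =
     (cr 10000 105 (- yu - zu) (- yl - zl), cr 50000 21 (5 * xl + yl) (5 * xu + yu),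
      crz sh S (zl * (xl - a)) (zl * (xu - a)) (zu * (xl - a)) (zu * (xu - a)))"

text \<open>How far the polynomial is from solving the equation with frozen delayed term, over the
  whole step. \<open>K\<close> is the number of steps per unit of time and enters because the
  derivative is taken in rescaled time. Where 1/5 occurs, the expression is multiplied by 5
  first.\<close>

definition resx :: "int \<Rightarrow> int \<Rightarrow> int list \<Rightarrow> int list \<Rightarrow> int list \<Rightarrow> int" where
  "resx K c xs ys zs = asum (cadd (- c) (padd (psm K (pder xs)) (padd ys zs)))"
definition resy :: "int \<Rightarrow> int \<Rightarrow> int list \<Rightarrow> int list \<Rightarrow> int" where
  "resy K c xs ys = shr 10 (205 * asum (cadd (- 5 * c) (padd (psm (5 * K) (pder ys)) (padd (psm (-5) xs) (psm (-1) ys))))) + 1"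
definition resz :: "nat \<Rightarrow> int \<Rightarrow> int \<Rightarrow> int \<Rightarrow> int \<Rightarrow> int list \<Rightarrow> int list \<Rightarrow> int" where
  "resz sh S a K c xs zs = shr (sh + 10) (205 * asum (cadd (- (S * S + 5 * S * c))
     (padd (psm (5 * S * K) (pder zs)) (psm (- 5) (pmul zs (cadd (- a) xs)))))) + 1"

text \<open>The error \<open>(ex, ey, ez)\<close> of the reference polynomial satisfies \<open>sqrt (quad ex ey) \<le> R\<close> and \<open>\<bar>ez\<bar> \<le> Z\<close> in
  case \<open>MA R Z\<close>, and \<open>quad ex ey + (s * ez)\<^sup>2 \<le> W\<^sup>2\<close> and \<open>\<bar>ez\<bar> \<le> Z\<close> in case \<open>MV W s Z lam\<close>; the last argument is
  only a guess for the growth rate of the next step. The first form suits small \<open>z\<close>, the second one the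
  excursion of \<open>z\<close>.\<close>

datatype (plugins only: code) est = MA int int | MV int int int int
type_synonym stepres = "bool \<times> int \<times> int \<times> est"

text \<open>Upper bounds for the exponential: 1 + h + h^2 / 2 for h <= 0, and in \<open>grow\<close>
  1 + h + h^2 for 0 <= h <= 1.\<close>

definition decay :: "nat \<Rightarrow> int \<Rightarrow> int \<Rightarrow> int" where "decay sh S h = S + h + mulu (sh + 1) h h"
definition grow :: "nat \<Rightarrow> int \<Rightarrow> int \<Rightarrow> int" where "grow sh S h = S + h + mulu sh h h"

text \<open>\<open>Rb\<close> is a guessed bound for the error during the step;
  \<open>R1 < Rb\<close> closes the continuity argument that justifies the guess. Adding a 128th of
  \<open>R1\<close> turns the bound for \<open>sqrt (quad ex ey)\<close> into one for
  \<open>ex\<close> and \<open>ey\<close> separately.\<close>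

definition stA5 :: "int \<Rightarrow> bool \<Rightarrow> int \<Rightarrow> int \<Rightarrow> int \<Rightarrow> stepres" where
  "stA5 Rb ok Zm Z1 R1 = (ok \<and> R1 < Rb, R1 + shr 7 R1 + 1, max Zm Z1, MA R1 Z1)"
text \<open>The factor 1 + 13/128 h bounds exp (h / 10) for steps h <= 1/8.\<close>

definition stA4 :: "nat \<Rightarrow> int \<Rightarrow> bool \<Rightarrow> int \<Rightarrow> int \<Rightarrow> int \<Rightarrow> stepres" where
  "stA4 k Rb ok Zm Z1 v = stA5 Rb ok Zm Z1 (v + shr (k + 7) (13 * v) + 1)"
definition stA3 :: "nat \<Rightarrow> int \<Rightarrow> int \<Rightarrow> int \<Rightarrow> bool \<Rightarrow> int \<Rightarrow> int \<Rightarrow> stepres" where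
  "stA3 k rxy R Rb ok Zm Z1 = stA4 k Rb ok Zm Z1 (R + shr k (Zm + rxy) + 1)"
definition stA3' :: "nat \<Rightarrow> int \<Rightarrow> int \<Rightarrow> int \<Rightarrow> bool \<Rightarrow> int \<Rightarrow> stepres" where
  "stA3' k rxy R Rb ok Z1 = stA3 k rxy R Rb ok Z1 Z1"
text \<open>\<open>d\<close> bounds the rate x - a at which \<open>ez\<close> grows and
  \<open>q\<close> its forcing over the step. If \<open>d\<close> is not positive, the error at the
  end of the step profits from the decay and is bounded apart from the error during the step;
  otherwise one bound serves both.\<close>

definition stA2 :: "nat \<Rightarrow> int \<Rightarrow> nat \<Rightarrow> int \<Rightarrow> int \<Rightarrow> int \<Rightarrow> int \<Rightarrow> int \<Rightarrow> int \<Rightarrow> stepres" where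
  "stA2 sh S k rxy R Z Rb d q =
     (if d \<le> 0 then stA3 k rxy R Rb True (Z + q) (mulu sh Z (decay sh S (min 0 (shr k d + 1))) + q)
      else stA3' k rxy R Rb (shr k d + 1 \<le> S) (mulu sh (grow sh S (shr k d + 1)) (Z + q)))"
definition stA1 :: "nat \<Rightarrow> int \<Rightarrow> int \<Rightarrow> nat \<Rightarrow> int \<Rightarrow> int \<Rightarrow> int \<Rightarrow> int \<Rightarrow> int \<Rightarrow> int \<Rightarrow> int \<Rightarrow> int \<Rightarrow> stepres" where
  "stA1 sh S a k xu zm rxy rz R Z Rb e1 =
     stA2 sh S k rxy R Z Rb (xu + e1 - a) (shr k (mulu sh zm e1 + rz) + 1)"
definition stA0 :: "nat \<Rightarrow> int \<Rightarrow> int \<Rightarrow> nat \<Rightarrow> int \<Rightarrow> int \<Rightarrow> int \<Rightarrow> int \<Rightarrow> int \<Rightarrow> int \<Rightarrow> int \<Rightarrow> stepres" where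
  "stA0 sh S a k xu zm rxy rz R Z Rb = stA1 sh S a k xu zm rxy rz R Z Rb (Rb + shr 7 Rb + 1)"
definition stepA :: "nat \<Rightarrow> int \<Rightarrow> int \<Rightarrow> nat \<Rightarrow> int \<Rightarrow> int \<Rightarrow> int \<Rightarrow> int \<Rightarrow> int \<Rightarrow> int \<Rightarrow> stepres" where
  "stepA sh S a k xu zm rxy rz R Z =
     stA0 sh S a k xu zm rxy rz R Z (R + shr 4 R + shr k (2 * (Z + rxy)) + shr 14 S + 1)"

text \<open>The candidate rates and weights are heuristic; a candidate is used only after its defining
  inequality has been verified, and \<open>- 1\<close> signals failure.\<close>

fun find_lam :: "int \<Rightarrow> int \<Rightarrow> int \<Rightarrow> nat \<Rightarrow> int \<Rightarrow> int list \<Rightarrow> int" where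
  "find_lam te dp M2 sh s2 [] = - 1"
| "find_lam te dp M2 sh s2 (l#ls) =
     (if te \<le> l \<and> dp \<le> l \<and> M2 \<le> 4 * shr sh ((l - te) * (l - dp)) * s2 then l else find_lam te dp M2 sh s2 ls)"
fun find_r :: "int \<Rightarrow> int \<Rightarrow> int list \<Rightarrow> int" where
  "find_r SS s [] = - 1" | "find_r SS s (r#rs) = (if SS \<le> r * s then r else find_r SS s rs)"

definition tenth :: "int \<Rightarrow> int" where "tenth S = shr 16 (6554 * S) + 1"

definition stV9 :: "bool \<Rightarrow> int \<Rightarrow> int \<Rightarrow> int \<Rightarrow> int \<Rightarrow> int \<Rightarrow> stepres" where
  "stV9 ok Wb s1 lam W1 ez = (ok \<and> W1 < Wb, W1 + shr 7 W1 + 1, ez, MV W1 s1 ez lam)"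
definition stV8 :: "nat \<Rightarrow> bool \<Rightarrow> int \<Rightarrow> int \<Rightarrow> int \<Rightarrow> int \<Rightarrow> int \<Rightarrow> stepres" where
  "stV8 sh ok Wb s1 lam r W1 = stV9 (ok \<and> 0 < r) Wb s1 lam W1 (mulu sh W1 r)"
text \<open>Candidates for an upper bound of 1 / s. As s^2 z is kept near 1, the argument s z is
  close to 1 / s, and the factors leave increasing slack.\<close>

definition rcands :: "int \<Rightarrow> int list" where
  "rcands r = [shr 3 (9 * r), shr 2 (5 * r), shr 2 (7 * r), 3 * r]"
definition stV7 :: "nat \<Rightarrow> int \<Rightarrow> bool \<Rightarrow> int \<Rightarrow> int \<Rightarrow> int \<Rightarrow> int \<Rightarrow> int \<Rightarrow> int \<Rightarrow> int \<Rightarrow> int \<Rightarrow> stepres" where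
  "stV7 sh S ok W Wb s1 sm zn rw lam lh =
     stV8 sh (ok \<and> 0 \<le> lam \<and> lh \<le> S) Wb s1 lam (find_r (S * S) sm (rcands (mulu sh sm zn)))
       (mulu sh (grow sh S lh) (W + rw))"
definition stV6 :: "nat \<Rightarrow> int \<Rightarrow> nat \<Rightarrow> bool \<Rightarrow> int \<Rightarrow> int \<Rightarrow> int \<Rightarrow> int \<Rightarrow> int \<Rightarrow> int \<Rightarrow> int \<Rightarrow> stepres" where
  "stV6 sh S k ok W Wb s1 sm zn rw lam = stV7 sh S ok W Wb s1 sm zn rw lam (shr k lam + 1)"
text \<open>The best rate would be the larger eigenvalue of the symmetric matrix with diagonal 1/10,
  \<open>dp\<close> and off-diagonal entry M / (2 s); \<open>ma\<close> approximates M / s.\<close>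

definition lcands :: "int \<Rightarrow> int \<Rightarrow> int \<Rightarrow> int \<Rightarrow> int list" where
  "lcands S dp dm ma = [shr 4 (3*S), shr 4 (5*S), dp + shr 5 ma, dp + shr 4 ma, dp + shr 3 ma,
     dp + shr 2 ma + shr 4 S, dm + shr 3 (5 * ma) + shr 4 S, dm + ma + shr 3 S]"
definition stV5 :: "nat \<Rightarrow> int \<Rightarrow> nat \<Rightarrow> bool \<Rightarrow> int \<Rightarrow> int \<Rightarrow> int \<Rightarrow> int \<Rightarrow> int \<Rightarrow> int \<Rightarrow> int \<Rightarrow> int \<Rightarrow> stepres" where
  "stV5 sh S k ok W Wb s1 sm zn rw dp M =
     stV6 sh S k ok W Wb s1 sm zn rw
       (find_lam (tenth S) dp (M * M) sh (shr sh (sm * sm)) (lcands S dp (max 0 dp) (mulu sh M (mulu sh sm zn))))"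
definition stV4 :: "nat \<Rightarrow> int \<Rightarrow> nat \<Rightarrow> bool \<Rightarrow> int \<Rightarrow> int \<Rightarrow> int \<Rightarrow> int \<Rightarrow> int \<Rightarrow> int \<Rightarrow> int \<Rightarrow> int \<Rightarrow> stepres" where
  "stV4 sh S k ok W Wb s1 sm zn rw dp M = stV5 sh S k ok W Wb s1 sm zn rw dp (M + shr 7 M + 1)"
text \<open>Bounds the distance of s^2 T from 1 for T between \<open>l\<close> and \<open>h\<close>.
  As \<open>s2\<close> is rounded upwards, s^2 lies between \<open>s2 - 1\<close> and
  \<open>s2\<close>; the sign of \<open>l\<close> decides which of them is worse.\<close>

definition defect' :: "nat \<Rightarrow> int \<Rightarrow> int \<Rightarrow> int \<Rightarrow> int \<Rightarrow> int" where
  "defect' sh S s2 l h = max 0 (max (mulu sh s2 h - S) (S - shr sh (min ((s2 - 1) * l) (s2 * l))))"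
definition defect :: "nat \<Rightarrow> int \<Rightarrow> int \<Rightarrow> int list \<Rightarrow> int" where
  "defect sh S s2 T = defect' sh S s2 (shr sh (lo T)) (shr sh (hi T) + 1)"
text \<open>\<open>[S, - 2 * g, b2]\<close> is the quadratic Taylor polynomial of exp (-2 g t), the
  relative change of s^2 across the step, and the product with \<open>mulu sh s2 zm\<close> bounds
  its remainder. The last argument collects what is left of the coupling between \<open>ex\<close>
  and \<open>ez\<close>.\<close>

definition stV3 :: "nat \<Rightarrow> int \<Rightarrow> int \<Rightarrow> nat \<Rightarrow> int \<Rightarrow> int list \<Rightarrow> int \<Rightarrow> int \<Rightarrow> int \<Rightarrow> int \<Rightarrow> int \<Rightarrow> int \<Rightarrow> int \<Rightarrow> int \<Rightarrow> int \<Rightarrow> int \<Rightarrow> int \<Rightarrow> int \<Rightarrow> stepres" where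
  "stV3 sh S a k xu zs zm rxy rz W s zn Wb s2 g s1 sx b2 =
     stV4 sh S k (0 < s1 \<and> \<bar>g\<bar> \<le> half S) W Wb s1 (min s s1) zn (shr k (rxy + mulu sh sx rz) + 1) (xu - a - g * 2 ^ k)
       (defect sh S s2 (pmul zs [S, - 2 * g, b2]) + mulu sh (mulu sh s2 zm) (mulu sh \<bar>2 * g\<bar> (b2 + 1) + 1)
        + tenth S + mulu sh sx Wb)"
text \<open>1 - g bounds exp (-g) from below and gives the new weight; 1 - g + g^2 bounds it from
  above and gives the largest weight when g is negative.\<close>

definition stV2 :: "nat \<Rightarrow> int \<Rightarrow> int \<Rightarrow> nat \<Rightarrow> int \<Rightarrow> int list \<Rightarrow> int \<Rightarrow> int \<Rightarrow> int \<Rightarrow> int \<Rightarrow> int \<Rightarrow> int \<Rightarrow> int \<Rightarrow> int \<Rightarrow> int \<Rightarrow> stepres" where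
  "stV2 sh S a k xu zs zm rxy rz W s zn Wb s2 g =
     stV3 sh S a k xu zs zm rxy rz W s zn Wb s2 g (s - mulu sh s g)
       (if 0 \<le> g then s else s + mulu sh s (mulu sh g g - g)) (shr (sh + 1) (4 * g * g))"
text \<open>The new weight s exp (-g) should be 1 / sqrt z at the end of the step, that is exp (2 g)
  = s^2 z. Linearising the exponential gives g.\<close>

definition stV1 :: "nat \<Rightarrow> int \<Rightarrow> int \<Rightarrow> nat \<Rightarrow> int \<Rightarrow> int list \<Rightarrow> int \<Rightarrow> int \<Rightarrow> int \<Rightarrow> int \<Rightarrow> int \<Rightarrow> int \<Rightarrow> int \<Rightarrow> int \<Rightarrow> stepres" where
  "stV1 sh S a k xu zs zm rxy rz W s zn Wb s2 = stV2 sh S a k xu zs zm rxy rz W s zn Wb s2 (half (mulu sh s2 zn - S))"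
definition stepV :: "nat \<Rightarrow> int \<Rightarrow> int \<Rightarrow> nat \<Rightarrow> int \<Rightarrow> int list \<Rightarrow> int \<Rightarrow> int \<Rightarrow> int \<Rightarrow> int \<Rightarrow> int \<Rightarrow> int \<Rightarrow> int \<Rightarrow> stepres" where
  "stepV sh S a k xu zs zm rxy rz W s lam zn =
     stV1 sh S a k xu zs zm rxy rz W s zn
       (W + mulu sh W (shr (k + 2) (5 * lam)) + shr 4 W + shr k (4 * rxy) + shr 14 S + 1) (mulu sh s s)"

fun step :: "nat \<Rightarrow> int \<Rightarrow> int \<Rightarrow> nat \<Rightarrow> int \<Rightarrow> int list \<Rightarrow> int \<Rightarrow> int \<Rightarrow> int \<Rightarrow> int \<Rightarrow> est \<Rightarrow> stepres" where
  "step sh S a k xu zs zm rxy rz zn (MA R Z) = stepA sh S a k xu zm rxy rz R Z"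
| "step sh S a k xu zs zm rxy rz zn (MV W s Z lam) = stepV sh S a k xu zs zm rxy rz W s lam zn"

type_synonym encres = "bool \<times> box \<times> (int \<times> int \<times> int) \<times> est"

text \<open>The distance 1 to the truncation threshold 100 leaves room for the bootstrap, whose
  provisional bounds exceed the final ones by little more than 1/2.\<close>

definition inner :: "int \<Rightarrow> box \<Rightarrow> bool" where
  "inner S b = (-99 * S < fst (fst b) \<and> snd (fst b) < 99 * S \<and> -99 * S < fst (fst (snd b)) \<and> snd (fst (snd b)) < 99 * S \<and>
     -99 * S < fst (snd (snd b)) \<and> snd (snd (snd b)) < 99 * S)"
fun enc5 :: "int \<Rightarrow> box \<Rightarrow> int \<times> int \<times> int \<Rightarrow> bool \<Rightarrow> est \<Rightarrow> encres" where
  "enc5 S b u ok e = (ok \<and> inner S b, b, u, e)"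
fun enc4 :: "int \<Rightarrow> box \<Rightarrow> int \<times> int \<times> int \<Rightarrow> stepres \<Rightarrow> encres" where
  "enc4 S ((xl,xu),(yl,yu),(zl,zu)) u (ok,ex,ez,e) = enc5 S ((xl-ex,xu+ex),(yl-ex,yu+ex),(zl-ez,zu+ez)) u ok e"
fun enc3 :: "nat \<Rightarrow> int \<Rightarrow> int \<Rightarrow> nat \<Rightarrow> int list \<Rightarrow> est \<Rightarrow> int \<Rightarrow> int \<Rightarrow> box \<Rightarrow> int \<times> int \<times> int \<Rightarrow> encres" where
  "enc3 sh S a k zs e rxy rz ((xl,xu),yb,(zl,zu)) (x,y,z) =
     enc4 S ((xl,xu),yb,(zl,zu)) (x,y,z) (step sh S a k xu zs (max zu (- zl)) rxy rz z e)"
fun enc2 :: "nat \<Rightarrow> int \<Rightarrow> int \<Rightarrow> nat \<Rightarrow> int \<Rightarrow> est \<Rightarrow> ivl \<Rightarrow> ivl \<Rightarrow> ivl \<Rightarrow> int list \<times> int list \<times> int list \<Rightarrow> encres" where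
  "enc2 sh S a k K e (cx,gx) (cy,gy) (cz,gz) (xs,ys,zs) =
     enc3 sh S a k zs e (resx K cx xs ys zs + gx + resy K cy xs ys + gy) (resz sh S a K cz xs zs + gz)
       ((lo xs, hi xs),(lo ys, hi ys),(lo zs, hi zs)) (psum xs, psum ys, psum zs)"
fun enc1 :: "nat \<Rightarrow> int \<Rightarrow> int \<Rightarrow> nat \<Rightarrow> int \<times> int \<times> int \<Rightarrow> est \<Rightarrow> ivl \<times> ivl \<times> ivl \<Rightarrow> encres" where
  "enc1 sh S a k u e (cx,cy,cz) = enc2 sh S a k (2 ^ k) e cx cy cz (taylor sh S a k u (fst cx) (fst cy) (fst cz))"
definition enc :: "nat \<Rightarrow> int \<Rightarrow> int \<Rightarrow> nat \<Rightarrow> box \<Rightarrow> int \<times> int \<times> int \<Rightarrow> est \<Rightarrow> encres" where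
  "enc sh S a k d u e = enc1 sh S a k u e (delay sh S a d)"

fun bhull :: "box \<Rightarrow> box \<Rightarrow> box" where
  "bhull ((a,b),(c,d),(e,f)) ((a',b'),(c',d'),(e',f')) = ((min a a', max b b'),(min c c', max d d'),(min e e',max f f'))"
fun takeh :: "nat \<Rightarrow> box \<Rightarrow> box list \<Rightarrow> box \<times> box list" where
  "takeh 0 h bs = (h, bs)" | "takeh (Suc m) h [] = (h, [])" | "takeh (Suc m) h (b#bs) = takeh m (bhull h b) bs"

fun sub :: "ivl \<Rightarrow> ivl \<Rightarrow> bool" where "sub (a,b) (c,d) = (c \<le> a \<and> b \<le> d)"

text \<open>One loop passes through the phases below in alphabetical order except that \<open>PG\<close> precedes \<open>PE\<close>: \<open>x < 0\<close> in \<open>PA\<close>,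
  \<open>x' > 0\<close> in \<open>PB\<close>, \<open>x > 0\<close> in \<open>PC\<close>, \<open>x' < 0\<close> and \<open>y > 0\<close> in \<open>PD\<close> and \<open>PG\<close>, \<open>x < 0\<close> and \<open>y' < 0\<close> in \<open>PE\<close>, and \<open>y < 0\<close> at the
  beginning of \<open>PF\<close>. So \<open>x\<close> crosses zero upwards exactly once, in \<open>PB\<close>, and the return to \<open>y = 0, x < 0\<close>
  happens in \<open>PE\<close>. \<open>PG\<close> and \<open>PE\<close> must stay in the box of admissible histories.\<close>

datatype (plugins only: code) ph = PA | PB | PC | PD | PG | PE | PF

fun in_hist :: "box \<Rightarrow> box \<Rightarrow> bool" where
  "in_hist (hx,hy,hz) (bx,by,bz) = (sub bx hx \<and> sub by hy \<and> sub bz hz)"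

text \<open>In order: margin for the signs of derivatives, box of histories, band for z at a return,
  band for z at a return into the second interval, smallest value of -x in that interval, range of x
  at a return.\<close>

datatype (plugins only: code) spec = Spec int box ivl ivl int ivl

fun phase_ok :: "spec \<Rightarrow> ph \<Rightarrow> box \<Rightarrow> bool" where
  "phase_ok (Spec t h zb1 zb2 l2 xr) PA ((xl,xu),(yl,yu),(zl,zu)) = (xu < - t \<and> 5 * xu + yu < - t)"
| "phase_ok (Spec t h zb1 zb2 l2 xr) PB ((xl,xu),(yl,yu),(zl,zu)) = (yu < - t \<and> yu + zu < - t)"
| "phase_ok (Spec t h zb1 zb2 l2 xr) PC ((xl,xu),(yl,yu),(zl,zu)) = (0 < xl)"
| "phase_ok (Spec t h zb1 zb2 l2 xr) PD ((xl,xu),(yl,yu),(zl,zu)) = (t < yl \<and> t < yl + zl)"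
| "phase_ok (Spec t h zb1 zb2 l2 xr) PG ((xl,xu),(yl,yu),(zl,zu)) =
     (t < yl \<and> t < yl + zl \<and> in_hist h ((xl,xu),(yl,yu),(zl,zu)))"
| "phase_ok (Spec t h zb1 zb2 l2 xr) PE ((xl,xu),(yl,yu),(zl,zu)) =
     (xu < - t \<and> 5 * xu + yu < - t \<and> sub (xl,xu) xr \<and> in_hist h ((xl,xu),(yl,yu),(zl,zu)) \<and>
      sub (zl,zu) zb1 \<and> (- l2 < xl \<or> sub (zl,zu) zb2))"
| "phase_ok (Spec t h zb1 zb2 l2 xr) PF ((xl,xu),(yl,yu),(zl,zu)) = (yu < 0)"

text \<open>\<open>Step k m p\<close> advances time by \<open>1 / 2 ^ k = (m + 1) / 64\<close>. The state keeps one box for each of the last 32 slots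
  of length \<open>1 / 64\<close>, which together cover the delay \<open>1 / 2\<close>.\<close>

datatype (plugins only: code) cmd = Step nat nat ph | ToV int int | ToA
type_synonym state = "box list \<times> (int \<times> int \<times> int) \<times> est"
datatype (plugins only: code) par = Par nat int int spec

fun chk :: "bool \<Rightarrow> state \<Rightarrow> state option" where "chk True x = Some x" | "chk False x = None"

fun exec2 :: "par \<Rightarrow> ph \<Rightarrow> nat \<Rightarrow> box list \<Rightarrow> encres \<Rightarrow> state option" where
  "exec2 (Par sh S a sp) p m bs (ok, b, u, e) = chk (ok \<and> phase_ok sp p b) (bs @ replicate m b, u, e)"
fun exec1 :: "par \<Rightarrow> nat \<Rightarrow> ph \<Rightarrow> int \<times> int \<times> int \<Rightarrow> est \<Rightarrow> nat \<Rightarrow> box \<times> box list \<Rightarrow> state option" where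
  "exec1 (Par sh S a sp) k p u e m (d, bs) = exec2 (Par sh S a sp) p m bs (enc sh S a k d u e)"
definition okstep :: "nat \<Rightarrow> nat \<Rightarrow> bool" where
  "okstep k m = ((k = 4 \<and> m = 3) \<or> (k = 5 \<and> m = 1) \<or> (k = 6 \<and> m = 0))"
fun exec :: "par \<Rightarrow> cmd \<Rightarrow> state \<Rightarrow> state option" where
  "exec P (Step k m p) (bs, u, e) =
     (if okstep k m then exec1 P k p u e (Suc m) (takeh m (hd bs) (tl bs)) else None)"
| "exec (Par sh S a sp) (ToV W s) (bs, u, MA R Z) =
     chk (0 \<le> W \<and> 0 < s \<and> S * S * R * R + s * s * Z * Z \<le> S * S * W * W) (bs, u, MV W s Z (2 * S))"
| "exec P ToA (bs, u, MV W s Z lam) = Some (bs, u, MA W Z)"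
| "exec P (ToV W s) (bs, u, MV _ _ _ _) = None"
| "exec P ToA (bs, u, MA _ _) = None"

fun run :: "par \<Rightarrow> cmd list \<Rightarrow> state option \<Rightarrow> bool" where
  "run P cs None = False"
| "run P [] (Some st) = True"
| "run P (c#cs) (Some st) = run P cs (exec P c st)"

fun slots :: "cmd list \<Rightarrow> nat" where
  "slots [] = 0" | "slots (Step k m p # cs) = Suc m + slots cs" | "slots (ToV W s # cs) = slots cs" | "slots (ToA # cs) = slots cs"

fun only :: "ph \<Rightarrow> cmd list \<Rightarrow> bool" where
  "only p [] = True" | "only p (Step k m q # cs) = (p = q \<and> only p cs)" | "only p (ToV W s # cs) = only p cs"
| "only p (ToA # cs) = only p cs"

section \<open>Differential inequalities for the error\<close>

lemma le_of_le_add_mult: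
  fixes A B K :: real
  assumes "\<And>d. 0 < d \<Longrightarrow> A \<le> B + K * d"
  shows "A \<le> B"
proof (rule field_le_epsilon)
  fix e :: real assume e: "0 < e"
  have "A \<le> B + K * (e / (\<bar>K\<bar> + 1))" by (rule assms) (use e in simp)
  also have "K * (e / (\<bar>K\<bar> + 1)) \<le> e"
  proof -
    have "K * e \<le> e * (\<bar>K\<bar> + 1)" using e by (smt (verit) mult.commute mult_left_mono)
    then show ?thesis by (simp add: divide_le_eq)
  qed
  finally show "A \<le> B + e" by simp
qed

text \<open>The square root of \<open>q\<close> is not differentiable at zeros of \<open>q\<close>, so the estimate is first
  made for \<open>sqrt (q + d\<^sup>2)\<close>.\<close>

lemma sqrt_diff_ineq:
  fixes q :: "real \<Rightarrow> real"
  assumes t: "t0 \<le> t1"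
    and q': "\<And>t. t \<in> {t0..t1} \<Longrightarrow> (q has_real_derivative q' t) (at t within {t0..t1})"
    and q0: "\<And>t. t \<in> {t0..t1} \<Longrightarrow> 0 \<le> q t"
    and le: "\<And>t. t \<in> {t0..t1} \<Longrightarrow> q' t \<le> 2 * l * q t + 2 * r * sqrt (q t)"
    and r: "0 \<le> r"
  shows "sqrt (q t1) \<le> exp (l * (t1 - t0)) * sqrt (q t0) + r * (t1 - t0) * max 1 (exp (l * (t1 - t0)))"
proof -
  let ?h = "t1 - t0"
  have cont: "continuous_on {t0..t1} q"
    using q' by (intro DERIV_continuous_on) auto
  have main: "sqrt (q t1) \<le> exp (l * ?h) * (sqrt (q t0) + d) + (r + \<bar>l\<bar> * d) * ?h * max 1 (exp (l * ?h))"
    if d: "0 < d" for d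
  proof (cases "t0 = t1")
    case True
    then show ?thesis using d by simp
  next
    case False
    with t have lt: "t0 < t1" by simp
    define s where "s t = sqrt (q t + d\<^sup>2)" for t
    \<comment> \<open>Integrating factor: \<open>C\<close> dominates the rest of the derivative, so
      \<open>v\<close> cannot increase.\<close>
    define C where "C = (r + \<bar>l\<bar> * d) * max 1 (exp (- l * ?h))"
    define v where "v t = exp (- l * (t - t0)) * s t - C * t" for t
    have pos: "0 < q t + d\<^sup>2" if "t \<in> {t0..t1}" for t
      using q0[OF that] d by (simp add: add_nonneg_pos)
    have "v t1 \<le> v t0"
    proof (rule DERIV_nonpos_imp_decreasing_open[OF less_imp_le[OF lt]])
      fix t assume t01: "t0 < t" "t < t1"
      then have t': "t \<in> {t0..t1}" by simp
      have qd: "(q has_real_derivative q' t) (at t)"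
        using q'[OF t'] t01 by (metis at_within_Icc_at)
      have sp: "0 < s t" using pos[OF t'] by (simp add: s_def)
      have ss: "s t * s t = q t + d\<^sup>2" using pos[OF t'] by (simp add: s_def)
      have "(s has_real_derivative (q' t / (2 * s t))) (at t)"
        unfolding s_def using pos[OF t'] qd
        by (auto intro!: derivative_eq_intros simp: field_simps)
      then have vd: "(v has_real_derivative
          (exp (- l * (t - t0)) * (q' t / (2 * s t) - l * s t) - C)) (at t)"
        unfolding v_def by (auto intro!: derivative_eq_intros simp: algebra_simps)
      have sd: "d \<le> s t" using q0[OF t'] d by (simp add: s_def real_le_rsqrt)
      have sq: "sqrt (q t) \<le> s t" by (simp add: s_def)
      have "q' t \<le> 2 * l * q t + 2 * r * s t"
        using le[OF t'] mult_left_mono[OF sq, of "2 * r"] r by simp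
      also have "l * q t = l * (s t * s t) - l * d\<^sup>2" unfolding ss by (simp add: algebra_simps)
      then have "2 * l * q t + 2 * r * s t = 2 * l * (s t * s t) - 2 * l * d\<^sup>2 + 2 * r * s t"
        by simp
      also have "\<dots> \<le> 2 * l * (s t * s t) + 2 * \<bar>l\<bar> * d * s t + 2 * r * s t"
      proof -
        have "- l * d\<^sup>2 \<le> \<bar>l\<bar> * d\<^sup>2" using mult_right_mono[of "- l" "\<bar>l\<bar>" "d\<^sup>2"] by simp
        also have "\<dots> \<le> \<bar>l\<bar> * (d * s t)"
          using sd d by (intro mult_left_mono) (auto simp: power2_eq_square)
        finally show ?thesis by (simp add: algebra_simps)
      qed
      finally have "q' t / (2 * s t) \<le> l * s t + (r + \<bar>l\<bar> * d)"
        using sp by (simp add: divide_le_eq algebra_simps)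
      then have "q' t / (2 * s t) - l * s t \<le> r + \<bar>l\<bar> * d" by simp
      moreover have "exp (- l * (t - t0)) \<le> max 1 (exp (- l * ?h))"
      proof (cases "0 \<le> l")
        case True
        then show ?thesis using t01 by (simp add: max.coboundedI1 mult_nonneg_nonneg)
      next
        case False
        then have "- l * (t - t0) \<le> - l * ?h" using t01 by (intro mult_left_mono) auto
        then show ?thesis by (intro max.coboundedI2) simp
      qed
      ultimately have "exp (- l * (t - t0)) * (q' t / (2 * s t) - l * s t) \<le> max 1 (exp (- l * ?h)) * (r + \<bar>l\<bar> * d)"
        using r d by (smt (verit) exp_gt_zero mult_mono mult_left_mono zero_le_mult_iff abs_ge_zero)
      then have "exp (- l * (t - t0)) * (q' t / (2 * s t) - l * s t) - C \<le> 0"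
        by (simp add: C_def mult.commute)
      with vd show "\<exists>y. (v has_real_derivative y) (at t) \<and> y \<le> 0" by blast
    next
      show "continuous_on {t0..t1} v"
        unfolding v_def s_def by (intro continuous_intros cont)
    qed
    then have "exp (- l * ?h) * s t1 \<le> s t0 + C * ?h"
      by (simp add: v_def algebra_simps)
    then have "exp (l * ?h) * (exp (- l * ?h) * s t1) \<le> exp (l * ?h) * (s t0 + C * ?h)"
      by (intro mult_left_mono) auto
    moreover have "exp (l * ?h) * (exp (- l * ?h) * s t1) = s t1"
      by (simp flip: exp_add mult.assoc)
    ultimately have 1: "s t1 \<le> exp (l * ?h) * s t0 + (exp (l * ?h) * C) * ?h"
      by (simp only: distrib_left mult.assoc)
    have "exp (l * ?h) * max 1 (exp (- l * ?h)) = max (exp (l * ?h)) 1"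
      by (simp add: max_mult_distrib_left flip: exp_add)
    then have 2: "exp (l * ?h) * C = (r + \<bar>l\<bar> * d) * max 1 (exp (l * ?h))"
      by (simp add: C_def max.commute algebra_simps)
    have 3: "s t0 \<le> sqrt (q t0) + d"
      using q0[of t0] t d sqrt_add_le_add_sqrt[of "q t0" "d\<^sup>2"] by (simp add: s_def)
    have "sqrt (q t1) \<le> s t1" by (simp add: s_def)
    also note 1
    also have "exp (l * ?h) * s t0 \<le> exp (l * ?h) * (sqrt (q t0) + d)"
      using 3 by (intro mult_left_mono) auto
    finally show ?thesis unfolding 2 by (simp add: algebra_simps)
  qed
  show ?thesis
  proof (rule le_of_le_add_mult[where K = "exp (l * ?h) + \<bar>l\<bar> * ?h * max 1 (exp (l * ?h))"])
    fix d :: real assume "0 < d"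
    from main[OF this] show "sqrt (q t1) \<le> exp (l * ?h) * sqrt (q t0) + r * ?h * max 1 (exp (l * ?h))
        + (exp (l * ?h) + \<bar>l\<bar> * ?h * max 1 (exp (l * ?h))) * d"
      by (simp add: algebra_simps)
  qed
qed

text \<open>At the first time at which one of the functions reaches its weaker bound,
  \<open>step\<close> already yields both stronger bounds. That time exists because the set of
  violations is closed.\<close>

lemma bootstrap2:
  fixes f g :: "real \<Rightarrow> real"
  assumes f: "continuous_on {t0..t1} f" and g: "continuous_on {t0..t1} g"
    and lt: "B < E" "B' < E'" and init: "f t0 \<le> B" "g t0 \<le> B'"
    and step: "\<And>t. t \<in> {t0..t1} \<Longrightarrow> (\<And>s. s \<in> {t0..t} \<Longrightarrow> f s \<le> E \<and> g s \<le> E') \<Longrightarrow> f t \<le> B \<and> g t \<le> B'"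
    and t: "t \<in> {t0..t1}"
  shows "f t \<le> B \<and> g t \<le> B'"
proof -
  define h where "h t = max (f t - E) (g t - E')" for t
  have hc: "continuous_on {t0..t1} h" unfolding h_def by (intro continuous_intros f g)
  have "h t < 0" if "t \<in> {t0..t1}" for t
  proof (rule ccontr)
    assume "\<not> h t < 0"
    define T where "T = {t0..t1} \<inter> h -` {0..}"
    have "closed T" unfolding T_def by (rule continuous_closed_preimage[OF hc]) simp_all
    moreover have "T \<noteq> {}" using \<open>\<not> h t < 0\<close> that by (auto simp: T_def)
    moreover have "bdd_below T" by (auto simp: T_def bdd_below_def)
    ultimately have inf: "Inf T \<in> T" by (rule closed_contains_Inf[rotated 2])
    define m where "m = Inf T"
    have m: "m \<in> {t0..t1}" "0 \<le> h m" using inf by (auto simp: T_def m_def)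
    have below: "h s < 0" if "t0 \<le> s" "s < m" for s
    proof (rule ccontr)
      assume "\<not> h s < 0"
      then have "s \<in> T" using that m by (auto simp: T_def)
      then have "m \<le> s" unfolding m_def by (intro cInf_lower \<open>bdd_below T\<close>)
      with that show False by simp
    qed
    have h0: "h t0 < 0" using init lt by (auto simp: h_def)
    then have "t0 < m" using m by (cases "t0 = m") auto
    have "h m \<le> 0"
    proof (rule tendsto_upperbound)
      show "(h \<longlongrightarrow> h m) (at_left m)"
      proof -
        have "continuous_on {t0..m} h" using hc m by (auto intro: continuous_on_subset)
        then show ?thesis using \<open>t0 < m\<close> by (metis continuous_on_Icc_at_leftD)
      qed
      show "eventually (\<lambda>s. h s \<le> 0) (at_left m)"
        by (rule eventually_at_leftI[OF _ \<open>t0 < m\<close>]) (use below in \<open>auto intro: less_imp_le\<close>)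
    qed simp
    then have "h s \<le> 0" if "s \<in> {t0..m}" for s using below[of s] that by (cases "s = m") auto
    then have "f m \<le> B \<and> g m \<le> B'" by (intro step m) (force simp: h_def)
    with lt m(2) show False by (auto simp: h_def)
  qed
  then have "f s \<le> E \<and> g s \<le> E'" if "s \<in> {t0..t1}" for s using that by (force simp: h_def)
  then show ?thesis using t by (intro step) auto
qed

text \<open>The system x' = -y, y' = x + y / 5 has complex eigenvalues with real part 1/10. Up to a
  factor this is the only quadratic form that grows along it by exactly exp (t / 5).\<close>

definition quad :: "real \<Rightarrow> real \<Rightarrow> real" where "quad x y = x\<^sup>2 + x * y / 5 + y\<^sup>2"

lemma quad_alt: "quad x y = (x + y / 10)\<^sup>2 + 99 / 100 * y\<^sup>2" "quad x y = (y + x / 10)\<^sup>2 + 99 / 100 * x\<^sup>2"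
  by (simp_all add: quad_def power2_eq_square algebra_simps)

lemma quad_nonneg: "0 \<le> quad x y"
  by (simp add: quad_alt(1))

text \<open>Completing the square in either variable leaves 99/100 of the other square, and 129/128
  is a dyadic upper bound for sqrt (100/99).\<close>

lemma quad_bounds:
  "\<bar>x + y / 10\<bar> \<le> sqrt (quad x y)" "\<bar>y + x / 10\<bar> \<le> sqrt (quad x y)"
  "\<bar>x\<bar> \<le> 129 / 128 * sqrt (quad x y)" "\<bar>y\<bar> \<le> 129 / 128 * sqrt (quad x y)"
proof -
  show "\<bar>x + y / 10\<bar> \<le> sqrt (quad x y)" "\<bar>y + x / 10\<bar> \<le> sqrt (quad x y)"
    by (rule real_le_rsqrt, simp add: quad_alt(1)) (rule real_le_rsqrt, simp add: quad_alt(2))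
  have *: "\<bar>u\<bar> \<le> 129 / 128 * sqrt q" if "99 / 100 * u\<^sup>2 \<le> q" for u q :: real
  proof -
    have "\<bar>u\<bar> \<le> sqrt ((129 / 128)\<^sup>2 * q)"
    proof (rule real_le_rsqrt)
      have "u\<^sup>2 \<le> (129 / 128)\<^sup>2 * (99 / 100 * u\<^sup>2)" by (simp add: power2_eq_square)
      also have "\<dots> \<le> (129 / 128)\<^sup>2 * q" using that by (intro mult_left_mono) auto
      finally show "\<bar>u\<bar>\<^sup>2 \<le> (129 / 128)\<^sup>2 * q" by simp
    qed
    then show ?thesis by (simp add: real_sqrt_mult)
  qed
  show "\<bar>x\<bar> \<le> 129 / 128 * sqrt (quad x y)" "\<bar>y\<bar> \<le> 129 / 128 * sqrt (quad x y)"
    by (rule *, simp add: quad_alt(2)) (rule *, simp add: quad_alt(1))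
qed

lemma quad_deriv:
  assumes "(ex has_real_derivative ex') F" "(ey has_real_derivative ey') F" "F = at t within A"
  shows "((\<lambda>t. quad (ex t) (ey t)) has_real_derivative (2 * (ex t + ey t / 10) * ex' + 2 * (ey t + ex t / 10) * ey')) F"
  using assms unfolding quad_def
  by (auto intro!: derivative_eq_intros simp: field_simps power2_eq_square)

text \<open>\<open>quad\<close> is the quadratic form that the linear part of the flow expands at a uniform rate.\<close>

lemma quad_rate:
  "2 * (x + y / 10) * (- y - z + dx) + 2 * (y + x / 10) * (x + y / 5 + dy)
    = 2 * (1/10) * quad x y + 2 * ((x + y / 10) * (dx - z) + (y + x / 10) * dy)"
  by (simp add: quad_def power2_eq_square field_simps)

lemma four_prod_le: "4 * (a * b) * (p * c)\<^sup>2 \<le> (a * p\<^sup>2 + b * c\<^sup>2)\<^sup>2" for a b p c :: real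
  using zero_le_power2[of "a * p\<^sup>2 - b * c\<^sup>2"] by (simp add: power2_eq_square algebra_simps)

text \<open>\<open>ex\<close>, \<open>ey\<close>, \<open>ez\<close> are the errors of a reference
  path with components \<open>px\<close>, \<open>pz\<close>; \<open>dx\<close>, \<open>dy\<close>,
  \<open>dz\<close> are the disturbances left by residual and delay. The equation for
  \<open>ez\<close> is available only where the truncation is inactive, so that the bounds proving
  this must be established along with the estimate.\<close>

locale error_step =
  fixes ex ey ez px pz dx dy dz :: "real \<Rightarrow> real" and t0 t1 a rx ry rz :: real
  assumes t01: "t0 < t1"
    and dex: "\<And>t. t \<in> {t0..t1} \<Longrightarrow> (ex has_real_derivative (- ey t - ez t + dx t)) (at t within {t0..t1})"
    and dey: "\<And>t. t \<in> {t0..t1} \<Longrightarrow> (ey has_real_derivative (ex t + ey t / 5 + dy t)) (at t within {t0..t1})"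
    and cez: "continuous_on {t0..t1} ez"
    and dez: "\<And>t. t \<in> {t0..t1} \<Longrightarrow> \<bar>px t + ex t\<bar> \<le> 100 \<Longrightarrow> \<bar>pz t + ez t\<bar> \<le> 100 \<Longrightarrow>
        (ez has_real_derivative ((px t - a) * ez t + (pz t + ez t) * ex t + dz t)) (at t within {t0..t1})"
    and rx: "\<And>t. t \<in> {t0..t1} \<Longrightarrow> \<bar>dx t\<bar> \<le> rx"
    and ry: "\<And>t. t \<in> {t0..t1} \<Longrightarrow> \<bar>dy t\<bar> \<le> ry"
    and rz: "\<And>t. t \<in> {t0..t1} \<Longrightarrow> \<bar>dz t\<bar> \<le> rz"
begin

lemma r_nonneg: "0 \<le> rx" "0 \<le> ry" "0 \<le> rz"
  using rx[of t0] ry[of t0] rz[of t0] t01 by auto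

lemma cex: "continuous_on {t0..t1} ex" and cey: "continuous_on {t0..t1} ey"
  by (rule DERIV_continuous_on[OF dex], assumption) (rule DERIV_continuous_on[OF dey], assumption)

lemma exp_mono_step:
  assumes "t \<in> {t0..t1}"
  shows "max 1 (exp (l * (t - t0))) \<le> max 1 (exp (l * (t1 - t0)))"
proof (cases "0 \<le> l")
  case True
  then have "l * (t - t0) \<le> l * (t1 - t0)" using assms by (intro mult_left_mono) auto
  then show ?thesis by (intro max.mono) auto
next
  case False
  then have "l * (t - t0) \<le> 0" using assms by (simp add: mult_nonpos_nonneg)
  then show ?thesis by (simp add: max.coboundedI1)
qed

text \<open>While z is small, the coupling counts as forcing: \<open>ez\<close> disturbs the plane
  by at most \<open>Zm\<close>, and pz * ex disturbs \<open>ez\<close> by at most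
  \<open>zm * e1\<close>. One bootstrap for both errors closes the circle and keeps the truncation
  inactive.\<close>

lemma slow_mode:
  assumes px: "\<And>t. t \<in> {t0..t1} \<Longrightarrow> \<bar>px t\<bar> + e1 \<le> 100"
    and pz: "\<And>t. t \<in> {t0..t1} \<Longrightarrow> \<bar>pz t\<bar> \<le> zm" "zm + Ez \<le> 100"
    and d: "\<And>t. t \<in> {t0..t1} \<Longrightarrow> px t + e1 - a \<le> d"
    and R0: "sqrt (quad (ex t0) (ey t0)) \<le> R0" and Z0: "\<bar>ez t0\<bar> \<le> Z0"
    and q: "zm * e1 + rz \<le> q"
    and Zm: "(Z0 + (t1 - t0) * q) * max 1 (exp (d * (t1 - t0))) \<le> Zm" "Zm < Ez"
    and R1: "exp (1 / 10 * (t1 - t0)) * (R0 + (t1 - t0) * (Zm + rx + ry)) \<le> R1" "R1 < Rb"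
    and e1: "129 / 128 * Rb \<le> e1" "0 \<le> e1"
  shows "\<And>t. t \<in> {t0..t1} \<Longrightarrow> sqrt (quad (ex t) (ey t)) \<le> R1 \<and> \<bar>ez t\<bar> \<le> Zm"
    and "\<bar>ez t1\<bar> \<le> exp (d * (t1 - t0)) * Z0 + (t1 - t0) * q * max 1 (exp (d * (t1 - t0)))"
proof -
  let ?h = "t1 - t0" and ?R = "\<lambda>t. sqrt (quad (ex t) (ey t))"
  have R0n: "0 \<le> R0" using R0 quad_nonneg[of "ex t0" "ey t0"] by (meson order_trans real_sqrt_ge_zero)
  have Z0n: "0 \<le> Z0" using Z0 by linarith
  have zmn: "0 \<le> zm" using pz(1)[of t0] t01 by fastforce
  have cR: "continuous_on {t0..t1} ?R" unfolding quad_def by (intro continuous_intros cex cey) auto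
  have Rle: "\<bar>ex t\<bar> \<le> e1" if "?R t \<le> Rb" for t
    using quad_bounds(3)[of "ex t" "ey t"] that e1(1) by linarith
  have Rn: "0 \<le> ?R t" for t by (simp add: quad_nonneg)
  have q0: "0 \<le> q"
  proof -
    have "0 \<le> zm * e1 + rz" using zmn r_nonneg e1(2) by simp
    then show ?thesis using q by linarith
  qed
  have Zm0: "0 \<le> Zm"
    by (rule order_trans[OF _ Zm(1)]) (use Z0n q0 t01 in \<open>auto intro!: mult_nonneg_nonneg add_nonneg_nonneg\<close>)
  have zest: "\<bar>ez t\<bar> \<le> exp (d * (t - t0)) * Z0 + q * (t - t0) * max 1 (exp (d * (t - t0)))"
    if t: "t \<in> {t0..t1}" and small: "\<And>s. s \<in> {t0..t} \<Longrightarrow> ?R s \<le> Rb \<and> \<bar>ez s\<bar> \<le> Ez" for t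
  proof -
    have "sqrt ((ez t)\<^sup>2) \<le> exp (d * (t - t0)) * sqrt ((ez t0)\<^sup>2) + q * (t - t0) * max 1 (exp (d * (t - t0)))"
    proof (rule sqrt_diff_ineq)
      show "t0 \<le> t" using t by simp
      fix s assume s: "s \<in> {t0..t}"
      then have s1: "s \<in> {t0..t1}" using t by simp
      have b: "\<bar>px s + ex s\<bar> \<le> 100" "\<bar>pz s + ez s\<bar> \<le> 100"
        using small[OF s] Rle[of s] px[OF s1] pz(1)[OF s1] pz(2) by linarith+
      have "(ez has_real_derivative ((px s - a) * ez s + (pz s + ez s) * ex s + dz s)) (at s within {t0..t})"
        by (rule has_field_derivative_subset[OF dez[OF s1 b]]) (use t in auto)
      then show "((\<lambda>t. (ez t)\<^sup>2) has_real_derivative 2 * ez s * ((px s - a) * ez s + (pz s + ez s) * ex s + dz s)) (at s within {t0..t})"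
        by (auto intro!: derivative_eq_intros)
      \<comment> \<open>The product ez * ex joins the rate, which becomes that of the true x; only
        pz * ex and the disturbance remain as forcing.\<close>
      have "ez s * ((px s - a) * ez s + (pz s + ez s) * ex s + dz s)
          = (px s + ex s - a) * (ez s)\<^sup>2 + ez s * (pz s * ex s + dz s)"
        by (simp add: power2_eq_square algebra_simps)
      also have "\<dots> \<le> d * (ez s)\<^sup>2 + \<bar>ez s\<bar> * q"
      proof (rule add_mono)
        have "px s + ex s - a \<le> d" using d[OF s1] Rle[of s] small[OF s] by linarith
        then show "(px s + ex s - a) * (ez s)\<^sup>2 \<le> d * (ez s)\<^sup>2" by (intro mult_right_mono) auto
        have "\<bar>pz s * ex s + dz s\<bar> \<le> zm * e1 + rz"
        proof -
          have "\<bar>pz s * ex s\<bar> \<le> zm * e1"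
            unfolding abs_mult using pz(1)[OF s1] Rle[of s] small[OF s] zmn by (intro mult_mono) auto
          then show ?thesis using rz[OF s1] by linarith
        qed
        then have "\<bar>pz s * ex s + dz s\<bar> \<le> q" using q by linarith
        then have "\<bar>ez s\<bar> * \<bar>pz s * ex s + dz s\<bar> \<le> \<bar>ez s\<bar> * q" by (intro mult_left_mono) auto
        then show "ez s * (pz s * ex s + dz s) \<le> \<bar>ez s\<bar> * q"
          by (metis abs_ge_self abs_mult order_trans)
      qed
      finally show "2 * ez s * ((px s - a) * ez s + (pz s + ez s) * ex s + dz s) \<le> 2 * d * (ez s)\<^sup>2 + 2 * q * sqrt ((ez s)\<^sup>2)"
        by (simp add: algebra_simps)
    qed (use q0 in auto)
    also have "\<dots> \<le> exp (d * (t - t0)) * Z0 + q * (t - t0) * max 1 (exp (d * (t - t0)))"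
      using Z0 by simp
    finally show ?thesis by simp
  qed
  have main: "?R t \<le> R1 \<and> \<bar>ez t\<bar> \<le> Zm" if t: "t \<in> {t0..t1}" for t
  proof (rule bootstrap2[where f = ?R and g = "\<lambda>t. \<bar>ez t\<bar>", OF _ _ R1(2) Zm(2) _ _ _ t])
    show "continuous_on {t0..t1} ?R" by (rule cR)
    show "continuous_on {t0..t1} (\<lambda>t. \<bar>ez t\<bar>)" by (intro continuous_intros cez)
    show "\<bar>ez t0\<bar> \<le> Zm"
    proof -
      have "Z0 * 1 \<le> (Z0 + ?h * q) * max 1 (exp (d * ?h))" using Z0n q0 t01 by (intro mult_mono) auto
      then show ?thesis using Zm Z0 by linarith
    qed
    show "?R t0 \<le> R1"
    proof -
      have "1 * R0 \<le> exp (1 / 10 * ?h) * (R0 + ?h * (Zm + rx + ry))"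
        using R0n t01 Zm0 r_nonneg by (intro mult_mono) auto
      then show ?thesis using R0 R1 by linarith
    qed
    fix t assume t: "t \<in> {t0..t1}" and small: "\<And>s. s \<in> {t0..t} \<Longrightarrow> ?R s \<le> Rb \<and> \<bar>ez s\<bar> \<le> Ez"
    have zb: "\<bar>ez s\<bar> \<le> Zm" if s: "s \<in> {t0..t}" for s
    proof -
      have s1: "s \<in> {t0..t1}" using s t by auto
      have "\<bar>ez s\<bar> \<le> exp (d * (s - t0)) * Z0 + q * (s - t0) * max 1 (exp (d * (s - t0)))"
        using s t small by (intro zest) auto
      also have "\<dots> \<le> max 1 (exp (d * ?h)) * Z0 + q * ?h * max 1 (exp (d * ?h))"
        using exp_mono_step[OF s1, of d] Z0n q0 s1
        by (intro add_mono mult_mono) (auto intro!: mult_left_mono mult_nonneg_nonneg)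
      also have "\<dots> \<le> Zm" using Zm(1) by (simp add: algebra_simps)
      finally show ?thesis .
    qed
    have "?R t \<le> exp (1 / 10 * (t - t0)) * ?R t0 + (Zm + rx + ry) * (t - t0) * max 1 (exp (1 / 10 * (t - t0)))"
    proof (rule sqrt_diff_ineq)
      show "t0 \<le> t" using t by simp
      fix s assume s: "s \<in> {t0..t}"
      then have s1: "s \<in> {t0..t1}" using t by simp
      show "((\<lambda>t. quad (ex t) (ey t)) has_real_derivative
          (2 * (ex s + ey s / 10) * (- ey s - ez s + dx s) + 2 * (ey s + ex s / 10) * (ex s + ey s / 5 + dy s))) (at s within {t0..t})"
        by (rule quad_deriv[OF has_field_derivative_subset[OF dex[OF s1]] has_field_derivative_subset[OF dey[OF s1]] refl]) (use t in auto)
      let ?w = "?R s"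
      have e: "(Zm + rx + ry) * ?w = ?w * (rx + Zm) + ?w * ry" by (simp add: algebra_simps)
      have "(ex s + ey s / 10) * (dx s - ez s) \<le> ?w * (rx + Zm)"
      proof -
        have "\<bar>(ex s + ey s / 10) * (dx s - ez s)\<bar> \<le> ?w * (rx + Zm)"
          unfolding abs_mult using quad_bounds(1)[of "ex s" "ey s"] rx[OF s1] zb[OF s] Rn[of s]
          by (intro mult_mono) auto
        then show ?thesis by linarith
      qed
      moreover have "(ey s + ex s / 10) * dy s \<le> ?w * ry"
      proof -
        have "\<bar>(ey s + ex s / 10) * dy s\<bar> \<le> ?w * ry"
          unfolding abs_mult using quad_bounds(2)[of "ey s" "ex s"] quad_bounds(2)[where x="ex s" and y="ey s"] ry[OF s1] Rn[of s]
          by (intro mult_mono) auto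
        then show ?thesis by linarith
      qed
      ultimately show "2 * (ex s + ey s / 10) * (- ey s - ez s + dx s) + 2 * (ey s + ex s / 10) * (ex s + ey s / 5 + dy s)
          \<le> 2 * (1/10) * quad (ex s) (ey s) + 2 * (Zm + rx + ry) * sqrt (quad (ex s) (ey s))"
        unfolding quad_rate mult.assoc[of 2 "Zm + rx + ry"] e
        by (intro add_mono[OF order_refl mult_left_mono[OF add_mono]]) simp_all
    qed (use Zm0 r_nonneg quad_nonneg in auto)
    also have "\<dots> \<le> exp (1 / 10 * ?h) * R0 + (Zm + rx + ry) * ?h * exp (1 / 10 * ?h)"
      using t t01 R0 R0n Rn[of t0] Zm0 r_nonneg
      by (intro add_mono mult_mono) (auto intro!: mult_left_mono mult_nonneg_nonneg)
    also have "\<dots> \<le> R1" using R1(1) by (simp add: algebra_simps)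
    finally show "?R t \<le> R1 \<and> \<bar>ez t\<bar> \<le> Zm" using zb[of t] t by auto
  qed
  then show "\<And>t. t \<in> {t0..t1} \<Longrightarrow> ?R t \<le> R1 \<and> \<bar>ez t\<bar> \<le> Zm" .
  have "\<bar>ez t1\<bar> \<le> exp (d * ?h) * Z0 + q * ?h * max 1 (exp (d * ?h))"
    using t01 main R1(2) Zm(2) by (intro zest) (auto intro: order_trans less_imp_le)
  then show "\<bar>ez t1\<bar> \<le> exp (d * ?h) * Z0 + ?h * q * max 1 (exp (d * ?h))" by (simp add: mult.commute)
qed

text \<open>The weight \<open>s\<close> follows \<open>1 / sqrt pz\<close>: then the two cross terms between \<open>ex\<close> and \<open>ez\<close> almost
  cancel, and what is left of them is measured by \<open>M\<close>.\<close>

lemma fast_mode: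
  fixes s0 g :: real
  defines "s \<equiv> \<lambda>t. s0 * exp (- g * (t - t0))"
  assumes s0: "0 < s0"
    and px: "\<And>t. t \<in> {t0..t1} \<Longrightarrow> \<bar>px t\<bar> + 129 / 128 * E \<le> 100"
    and pz: "\<And>t. t \<in> {t0..t1} \<Longrightarrow> \<bar>pz t\<bar> \<le> zm" "zm + E / sm \<le> 100"
    and sm: "\<And>t. t \<in> {t0..t1} \<Longrightarrow> sm \<le> s t" "\<And>t. t \<in> {t0..t1} \<Longrightarrow> s t \<le> sx" "0 < sm"
    and d: "\<And>t. t \<in> {t0..t1} \<Longrightarrow> px t - a - g \<le> d"
    and M0: "\<And>t. t \<in> {t0..t1} \<Longrightarrow> \<bar>(s t)\<^sup>2 * pz t - 1\<bar> \<le> M0"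
    and M: "129 / 128 * (M0 + 1 / 10 + sx * E) \<le> M"
    and lam: "1 / 10 \<le> lam" "d \<le> lam" "M\<^sup>2 \<le> 4 * ((lam - 1 / 10) * (lam - d)) * sm\<^sup>2"
    and W0: "quad (ex t0) (ey t0) + (s0 * ez t0)\<^sup>2 \<le> W0\<^sup>2" "0 \<le> W0"
    and W1: "exp (lam * (t1 - t0)) * (W0 + (t1 - t0) * (rx + ry + sx * rz)) \<le> W1" "W1 < E"
  shows "\<And>t. t \<in> {t0..t1} \<Longrightarrow> quad (ex t) (ey t) + (s t * ez t)\<^sup>2 \<le> W1\<^sup>2" "0 \<le> W1"
proof -
  let ?h = "t1 - t0" and ?W = "\<lambda>t. sqrt (quad (ex t) (ey t) + (s t * ez t)\<^sup>2)"
  have sx: "0 < sx" using sm(1)[of t0] sm(2)[of t0] sm(3) t01 by auto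
  have cs: "continuous_on {t0..t1} s" unfolding s_def by (intro continuous_intros)
  have cW: "continuous_on {t0..t1} ?W" unfolding quad_def by (intro continuous_intros cex cey cez cs) auto
  have Wn: "0 \<le> ?W t" for t by (simp add: quad_nonneg)
  have rr: "0 \<le> rx + ry + sx * rz" using r_nonneg sx by simp
  have lam0: "0 \<le> lam" using lam(1) by linarith
  show W1n: "0 \<le> W1"
    by (rule order_trans[OF _ W1(1)]) (use W0(2) rr t01 in \<open>auto intro!: mult_nonneg_nonneg add_nonneg_nonneg\<close>)
  have Mn: "0 \<le> M"
  proof -
    have "0 \<le> M0" using M0[of t0] t01 by fastforce
    then have "0 \<le> 129 / 128 * (M0 + 1 / 10 + sx * E)" using sx W1n W1(2) by simp
    then show ?thesis using M by linarith
  qed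
  have Qle: "sqrt (quad (ex t) (ey t)) \<le> ?W t" for t by (simp add: )
  have zle: "\<bar>s t * ez t\<bar> \<le> ?W t" for t by (rule real_le_rsqrt) (simp add: quad_nonneg)
  have W1': "?W t \<le> W1 \<and> (0::real) \<le> 0" if t: "t \<in> {t0..t1}" for t
  proof (rule bootstrap2[where f = ?W and g = "\<lambda>t. 0" and B' = 0 and E' = 1, OF _ _ W1(2) _ _ _ _ t])
    show "continuous_on {t0..t1} ?W" by (rule cW)
    have W00: "?W t0 \<le> W0" using W0 by (simp add: s_def real_le_lsqrt)
    show "?W t0 \<le> W1"
    proof -
      have "1 * W0 \<le> exp (lam * ?h) * (W0 + ?h * (rx + ry + sx * rz))"
        using W0(2) t01 lam0 rr by (intro mult_mono) auto
      then show ?thesis using W00 W1 by linarith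
    qed
    fix t assume t: "t \<in> {t0..t1}" and small: "\<And>u. u \<in> {t0..t} \<Longrightarrow> ?W u \<le> E \<and> (0::real) \<le> 1"
    have "?W t \<le> exp (lam * (t - t0)) * ?W t0 + (rx + ry + sx * rz) * (t - t0) * max 1 (exp (lam * (t - t0)))"
    proof (rule sqrt_diff_ineq)
      show "t0 \<le> t" using t by simp
      fix u assume u: "u \<in> {t0..t}"
      then have u1: "u \<in> {t0..t1}" using t by simp
      let ?w = "?W u" and ?Q = "quad (ex u) (ey u)"
      have WE: "?w \<le> E" using small[OF u] by simp
      have su: "0 < s u" "sm \<le> s u" "s u \<le> sx" using sm(1)[OF u1] sm(2)[OF u1] sm(3) by auto
      have exE: "\<bar>ex u\<bar> \<le> 129 / 128 * E"
        using quad_bounds(3)[of "ex u" "ey u"] Qle[of u] WE by linarith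
      have ezE: "\<bar>ez u\<bar> \<le> E / sm"
      proof -
        have "sm * \<bar>ez u\<bar> \<le> s u * \<bar>ez u\<bar>" using su by (intro mult_right_mono) auto
        also have "\<dots> \<le> E" using zle[of u] WE su by (simp add: abs_mult)
        finally show ?thesis using sm(3) by (simp add: le_divide_eq mult.commute)
      qed
      have b: "\<bar>px u + ex u\<bar> \<le> 100" "\<bar>pz u + ez u\<bar> \<le> 100"
        using exE ezE px[OF u1] pz(1)[OF u1] pz(2) by linarith+
      have dz': "(ez has_real_derivative ((px u - a) * ez u + (pz u + ez u) * ex u + dz u)) (at u within {t0..t})"
        by (rule has_field_derivative_subset[OF dez[OF u1 b]]) (use t in auto)
      have ds: "(s has_real_derivative (- g * s u)) (at u within {t0..t})"
        unfolding s_def by (auto intro!: derivative_eq_intros)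
      have dq: "((\<lambda>t. quad (ex t) (ey t)) has_real_derivative
          (2 * (ex u + ey u / 10) * (- ey u - ez u + dx u) + 2 * (ey u + ex u / 10) * (ex u + ey u / 5 + dy u))) (at u within {t0..t})"
        by (rule quad_deriv[OF has_field_derivative_subset[OF dex[OF u1]] has_field_derivative_subset[OF dey[OF u1]] refl]) (use t in auto)
      define zd where "zd = (px u - a) * ez u + (pz u + ez u) * ex u + dz u"
      show "((\<lambda>t. quad (ex t) (ey t) + (s t * ez t)\<^sup>2) has_real_derivative
         ((2 * (ex u + ey u / 10) * (- ey u - ez u + dx u) + 2 * (ey u + ex u / 10) * (ex u + ey u / 5 + dy u))
           + 2 * (s u * ez u) * (- g * s u * ez u + zd * s u))) (at u within {t0..t})"
        using dz' ds unfolding zd_def[symmetric]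
        by (intro DERIV_add dq) (auto intro!: derivative_eq_intros simp: algebra_simps power2_eq_square)
      let ?v = "s u * ez u"
      \<comment> \<open>The derivative of the weight lowers the rate of \<open>ez\<close> by g. The
        cross term s^2 pz ex ez meets the term -ex ez coming from the plane, and s^2 pz - 1 is what
        survives.\<close>
      have eq: "2 * (ex u + ey u / 10) * (- ey u - ez u + dx u) + 2 * (ey u + ex u / 10) * (ex u + ey u / 5 + dy u)
           + 2 * ?v * (- g * s u * ez u + zd * s u)
         = 2 * (1/10 * ?Q + (px u - a - g) * ?v\<^sup>2 + ez u * (((s u)\<^sup>2 * pz u - 1) * ex u + s u * ?v * ex u - ey u / 10)
           + ((ex u + ey u / 10) * dx u + (ey u + ex u / 10) * dy u + s u * ?v * dz u))"
        unfolding quad_rate zd_def by (simp add: field_simps power2_eq_square)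
      have A: "(px u - a - g) * ?v\<^sup>2 \<le> d * ?v\<^sup>2" using d[OF u1] by (intro mult_right_mono) auto
      have sxE: "0 \<le> sx * E" using sx W1n W1(2) by simp
      have B: "ez u * (((s u)\<^sup>2 * pz u - 1) * ex u + s u * ?v * ex u - ey u / 10) \<le> \<bar>?v\<bar> / sm * (M * sqrt ?Q)"
      proof -
        have "\<bar>((s u)\<^sup>2 * pz u - 1) * ex u + s u * ?v * ex u - ey u / 10\<bar>
            \<le> M0 * \<bar>ex u\<bar> + sx * E * \<bar>ex u\<bar> + \<bar>ey u\<bar> / 10"
        proof -
          have "\<bar>((s u)\<^sup>2 * pz u - 1) * ex u\<bar> \<le> M0 * \<bar>ex u\<bar>"
            unfolding abs_mult using M0[OF u1] by (intro mult_right_mono) auto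
          moreover have "\<bar>s u * ?v * ex u\<bar> \<le> sx * E * \<bar>ex u\<bar>"
          proof -
            have "\<bar>s u\<bar> * \<bar>?v\<bar> \<le> sx * E" using su zle[of u] WE sx by (intro mult_mono) auto
            then show ?thesis by (metis abs_ge_zero abs_mult mult_right_mono)
          qed
          ultimately show ?thesis by linarith
        qed
        also have "\<dots> \<le> M0 * (129 / 128 * sqrt ?Q) + sx * E * (129 / 128 * sqrt ?Q) + 129 / 128 * sqrt ?Q / 10"
          using quad_bounds(3,4)[where x = "ex u" and y = "ey u"] M0[OF u1] sxE
          by (intro add_mono mult_left_mono divide_right_mono) auto
        also have "\<dots> = 129 / 128 * (M0 + 1 / 10 + sx * E) * sqrt ?Q" by (simp add: algebra_simps)
        also have "\<dots> \<le> M * sqrt ?Q" using M by (intro mult_right_mono) (auto simp: quad_nonneg)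
        finally have 1: "\<bar>((s u)\<^sup>2 * pz u - 1) * ex u + s u * ?v * ex u - ey u / 10\<bar> \<le> M * sqrt ?Q" .
        have "\<bar>ez u\<bar> * sm \<le> \<bar>ez u\<bar> * s u" by (rule mult_left_mono[OF su(2) abs_ge_zero])
        also have "\<dots> = \<bar>?v\<bar>" using su by (simp add: abs_mult)
        finally have "\<bar>ez u\<bar> \<le> \<bar>?v\<bar> / sm" using sm(3) by (simp add: pos_le_divide_eq)
        then have "\<bar>ez u\<bar> * \<bar>((s u)\<^sup>2 * pz u - 1) * ex u + s u * ?v * ex u - ey u / 10\<bar> \<le> \<bar>?v\<bar> / sm * (M * sqrt ?Q)"
          using 1 sm(3) by (intro mult_mono) auto
        then show ?thesis unfolding abs_mult[symmetric] by linarith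
      qed
      \<comment> \<open>A quadratic form in the two partial norms; \<open>lam(3)\<close> is the
        discriminant condition under which \<open>lam\<close> dominates it.\<close>
      have C: "1/10 * ?Q + d * ?v\<^sup>2 + \<bar>?v\<bar> / sm * (M * sqrt ?Q) \<le> lam * (?Q + ?v\<^sup>2)"
      proof -
        define p where "p = sqrt ?Q"
        define c where "c = \<bar>?v\<bar>"
        define m where "m = M / sm"
        have pq: "?Q = p\<^sup>2" "?v\<^sup>2 = c\<^sup>2" "0 \<le> p" "0 \<le> c" "0 \<le> m"
          using quad_nonneg[of "ex u" "ey u"] Mn sm(3) by (auto simp: p_def c_def m_def)
        have m2: "m\<^sup>2 \<le> 4 * ((lam - 1 / 10) * (lam - d))"
          using lam(3) sm(3) by (simp add: m_def power_divide divide_le_eq)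
        have "(m * (p * c))\<^sup>2 \<le> ((lam - 1/10) * p\<^sup>2 + (lam - d) * c\<^sup>2)\<^sup>2"
        proof -
          have "(m * (p * c))\<^sup>2 = m\<^sup>2 * (p * c)\<^sup>2" by (simp add: power_mult_distrib)
          also have "\<dots> \<le> 4 * ((lam - 1 / 10) * (lam - d)) * (p * c)\<^sup>2" using m2 by (intro mult_right_mono) auto
          also have "\<dots> \<le> ((lam - 1/10) * p\<^sup>2 + (lam - d) * c\<^sup>2)\<^sup>2"
            by (rule four_prod_le)
          finally show ?thesis .
        qed
        then have "m * (p * c) \<le> (lam - 1/10) * p\<^sup>2 + (lam - d) * c\<^sup>2"
          by (rule power2_le_imp_le) (use lam(1,2) in \<open>auto intro!: add_nonneg_nonneg mult_nonneg_nonneg\<close>)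
        moreover have "\<bar>?v\<bar> / sm * (M * sqrt ?Q) = m * (p * c)" by (simp add: m_def p_def c_def)
        ultimately show ?thesis unfolding pq(1,2) by (simp add: algebra_simps)
      qed
      have D: "(ex u + ey u / 10) * dx u + (ey u + ex u / 10) * dy u + s u * ?v * dz u \<le> (rx + ry + sx * rz) * ?w"
      proof -
        have "\<bar>(ex u + ey u / 10) * dx u\<bar> \<le> ?w * rx"
          unfolding abs_mult using quad_bounds(1)[of "ex u" "ey u"] Qle[of u] rx[OF u1] Wn[of u]
          by (intro mult_mono) linarith+
        moreover have "\<bar>(ey u + ex u / 10) * dy u\<bar> \<le> ?w * ry"
          unfolding abs_mult using quad_bounds(2)[where x="ex u" and y="ey u"] Qle[of u] ry[OF u1] Wn[of u]
          by (intro mult_mono) linarith+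
        moreover have "\<bar>s u * ?v * dz u\<bar> \<le> sx * ?w * rz"
          unfolding abs_mult using su zle[of u] rz[OF u1] Wn[of u] sx
          by (intro mult_mono) (auto simp: abs_mult)
        ultimately show ?thesis by (simp add: algebra_simps)
      qed
      show "2 * (ex u + ey u / 10) * (- ey u - ez u + dx u) + 2 * (ey u + ex u / 10) * (ex u + ey u / 5 + dy u)
           + 2 * ?v * (- g * s u * ez u + zd * s u)
         \<le> 2 * lam * (?Q + ?v\<^sup>2) + 2 * (rx + ry + sx * rz) * sqrt (?Q + ?v\<^sup>2)"
        unfolding eq using A B C D by (simp add: algebra_simps)
    qed (use rr quad_nonneg in \<open>auto intro!: add_nonneg_nonneg\<close>)
    also have "\<dots> \<le> exp (lam * ?h) * W0 + (rx + ry + sx * rz) * ?h * exp (lam * ?h)"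
    proof (rule add_mono)
      have l: "lam * (t - t0) \<le> lam * ?h" using t lam0 by (intro mult_left_mono) auto
      show "exp (lam * (t - t0)) * ?W t0 \<le> exp (lam * ?h) * W0"
        using l W00 Wn[of t0] by (intro mult_mono) auto
      have A: "max 1 (exp (lam * (t - t0))) \<le> exp (lam * ?h)" using l lam0 t01 by auto
      have B: "(rx + ry + sx * rz) * (t - t0) \<le> (rx + ry + sx * rz) * ?h"
        using t by (intro mult_left_mono rr) auto
      have C: "0 \<le> (rx + ry + sx * rz) * ?h" using rr t01 by simp
      show "(rx + ry + sx * rz) * (t - t0) * max 1 (exp (lam * (t - t0))) \<le> (rx + ry + sx * rz) * ?h * exp (lam * ?h)"
        by (rule mult_mono[OF B A C]) simp
    qed
    also have "\<dots> \<le> W1" using W1(1) by (simp add: algebra_simps)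
    finally show "?W t \<le> W1 \<and> (0::real) \<le> 0" by simp
  qed auto
  show "quad (ex t) (ey t) + (s t * ez t)\<^sup>2 \<le> W1\<^sup>2" if "t \<in> {t0..t1}" for t
    using W1'[OF that] by (metis real_sqrt_le_iff real_sqrt_unique W1n)
qed

end

section \<open>Soundness of the enclosures\<close>

lemma shr_bounds: "real_of_int (shr n x) \<le> x / 2 ^ n" "x / 2 ^ n < real_of_int (shr n x) + 1"
proof -
  have e: "real_of_int (shr n x) = \<lfloor>real_of_int x / 2 ^ n\<rfloor>"
    using floor_divide_of_int_eq[of x "2 ^ n", where 'a = real] by (simp add: shr_def)
  show "real_of_int (shr n x) \<le> x / 2 ^ n" unfolding e by (rule of_int_floor_le)
  show "x / 2 ^ n < real_of_int (shr n x) + 1" unfolding e by linarith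
qed

lemma shr_nonneg: "0 \<le> x \<Longrightarrow> 0 \<le> shr n x" by (simp add: shr_def pos_imp_zdiv_nonneg_iff)

primrec pv :: "int list \<Rightarrow> real \<Rightarrow> real" where
  "pv [] t = 0" | "pv (c#cs) t = c + t * pv cs t"

lemma pv_padd: "pv (padd p q) t = pv p t + pv q t"
  by (induction p q rule: padd.induct) (auto simp: algebra_simps)
lemma pv_psm: "pv (psm a p) t = a * pv p t"
  by (induction p) (auto simp: algebra_simps)
lemma pv_pmul: "pv (pmul p q) t = pv p t * pv q t"
  by (induction p) (auto simp: pv_padd pv_psm algebra_simps)
lemma pv_cadd: "pv (cadd a p) t = a + pv p t"
  by (cases p) auto
lemma pv_pder: "(pv p has_real_derivative pv (pder p) t) (at t within A)"
proof (induction p)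
  case Nil
  have "pv [] = (\<lambda>_. 0)" by (rule ext) simp
  then show ?case by simp
next
  case (Cons c p)
  have "((\<lambda>t. c + t * pv p t) has_real_derivative (pv p t + t * pv (pder p) t)) (at t within A)"
    by (auto intro!: derivative_eq_intros Cons)
  moreover have "pv (c # p) = (\<lambda>t. c + t * pv p t)" by (rule ext) simp
  ultimately show ?case by (simp add: pv_padd)
qed

lemma lo0_hi0:
  assumes "0 \<le> t" "t \<le> 1"
  shows "lo0 p \<le> 0 \<and> lo0 p \<le> t * pv p t" "0 \<le> hi0 p \<and> t * pv p t \<le> hi0 p"
proof -
  have *: "t * pv (c # p) t = t * c + t * (t * pv p t)" for c p by (simp add: algebra_simps)
  show "lo0 p \<le> 0 \<and> lo0 p \<le> t * pv p t"
  proof (induction p)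
    case (Cons c p)
    have "min c 0 \<le> t * c" using assms by (cases "0 \<le> c") (auto simp: mult_le_cancel_right1)
    moreover have "lo0 p \<le> t * (t * pv p t)"
    proof -
      have "real_of_int (lo0 p) \<le> t * lo0 p" using Cons assms by (simp add: mult_le_cancel_right1)
      also have "\<dots> \<le> t * (t * pv p t)" using Cons assms by (intro mult_left_mono) auto
      finally show ?thesis .
    qed
    ultimately show ?case using Cons unfolding * by (auto simp: min_def)
  qed simp
  show "0 \<le> hi0 p \<and> t * pv p t \<le> hi0 p"
  proof (induction p)
    case (Cons c p)
    have "t * c \<le> max c 0" using assms by (cases "0 \<le> c") (auto simp: mult_le_cancel_right2 mult_nonneg_nonpos)
    moreover have "t * (t * pv p t) \<le> hi0 p"
    proof -
      have "t * (t * pv p t) \<le> t * hi0 p" using Cons assms by (intro mult_left_mono) auto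
      also have "\<dots> \<le> hi0 p" using Cons assms by (simp add: mult_le_cancel_right2)
      finally show ?thesis .
    qed
    ultimately show ?case using Cons unfolding * by (auto simp: max_def)
  qed simp
qed

lemma lo_hi:
  assumes "0 \<le> t" "t \<le> 1"
  shows "lo p \<le> pv p t" "pv p t \<le> hi p"
  using lo0_hi0[OF assms] by (cases p; auto)+

lemma asum_nonneg: "0 \<le> asum p" by (induction p) auto

lemma asum_bound:
  assumes "0 \<le> t" "t \<le> 1"
  shows "\<bar>pv p t\<bar> \<le> asum p"
proof (induction p)
  case (Cons c p)
  have "\<bar>t * pv p t\<bar> \<le> \<bar>pv p t\<bar>" using assms by (simp add: abs_mult mult_left_le_one_le)
  then show ?case using Cons by simp
qed simp

lemma pv_1: "pv p 1 = psum p" by (induction p) auto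
lemma pv_0: "p \<noteq> [] \<Longrightarrow> pv p 0 = hd p" by (cases p) auto

lemma exp_le_quadratic:
  fixes x :: real assumes "x \<le> 0" shows "exp x \<le> 1 + x + x\<^sup>2 / 2"
proof -
  have "(\<lambda>x. exp x - (1 + x + x\<^sup>2 / 2)) x \<le> (\<lambda>x. exp x - (1 + x + x\<^sup>2 / 2)) 0"
  proof (rule DERIV_nonneg_imp_nondecreasing[OF assms])
    fix t :: real
    have "((\<lambda>x. exp x - (1 + x + x\<^sup>2 / 2)) has_real_derivative (exp t - (1 + t))) (at t)"
      by (auto intro!: derivative_eq_intros)
    then show "\<exists>y. ((\<lambda>x. exp x - (1 + x + x\<^sup>2 / 2)) has_real_derivative y) (at t) \<and> 0 \<le> y"
      using exp_ge_add_one_self[of t] by (intro exI[of _ "exp t - (1 + t)"]) auto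
  qed
  then show ?thesis by simp
qed

lemma exp_cubic_error:
  fixes u :: real assumes "\<bar>u\<bar> \<le> 1" shows "\<bar>exp u - (1 + u + u\<^sup>2 / 2)\<bar> \<le> \<bar>u\<bar> ^ 3 / 2"
proof -
  obtain t where t: "\<bar>t\<bar> \<le> \<bar>u\<bar>" "exp u = (\<Sum>m<3. u ^ m / fact m) + exp t / fact 3 * u ^ 3"
    using Maclaurin_exp_le[of u 3] by blast
  have "exp t \<le> exp 1" using t(1) assms by simp
  then have "exp t \<le> 3" using exp_le by linarith
  have "exp u - (1 + u + u\<^sup>2 / 2) = exp t / 6 * u ^ 3"
    unfolding t(2) by (simp add: eval_nat_numeral)
  then have "\<bar>exp u - (1 + u + u\<^sup>2 / 2)\<bar> = exp t / 6 * \<bar>u\<bar> ^ 3"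
    by (simp only: abs_mult power_abs) simp
  also have "\<dots> \<le> 3 / 6 * \<bar>u\<bar> ^ 3"
    using \<open>exp t \<le> 3\<close> by (intro mult_right_mono divide_right_mono) auto
  finally show ?thesis by simp
qed

lemma product_range:
  fixes z w :: real
  assumes "zl \<le> z" "z \<le> zu" "wl \<le> w" "w \<le> wu"
  shows "min (min (zl * wl) (zl * wu)) (min (zu * wl) (zu * wu)) \<le> z * w"
    "z * w \<le> max (max (zl * wl) (zl * wu)) (max (zu * wl) (zu * wu))"
proof -
  have 1: "min (zl * w) (zu * w) \<le> z * w" "z * w \<le> max (zl * w) (zu * w)"
    using assms by (cases "0 \<le> w"; auto simp: min_le_iff_disj le_max_iff_disj mult_right_mono mult_right_mono_neg)+
  have 2: "min (c * wl) (c * wu) \<le> c * w" "c * w \<le> max (c * wl) (c * wu)" for c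
    using assms by (cases "0 \<le> c"; auto simp: min_le_iff_disj le_max_iff_disj mult_left_mono mult_left_mono_neg)+
  show "min (min (zl * wl) (zl * wu)) (min (zu * wl) (zu * wu)) \<le> z * w"
    using 1(1) 2(1)[of zl] 2(1)[of zu] by (auto simp: min_le_iff_disj)
  show "z * w \<le> max (max (zl * wl) (zl * wu)) (max (zu * wl) (zu * wu))"
    using 1(2) 2(2)[of zl] 2(2)[of zu] by (auto simp: le_max_iff_disj)
qed

lemma div_le_mult: "0 \<le> p \<Longrightarrow> 0 < D \<Longrightarrow> c \<le> D * M \<Longrightarrow> 0 < c \<Longrightarrow> p / D \<le> p * M / c" for p D M c :: real
  using mult_left_mono[of c "D * M" p] by (simp add: field_simps)

locale scale =
  fixes sh :: nat and S a :: int
  assumes S: "S = 2 ^ sh" and a: "4 * a = 21 * S"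
begin

abbreviation rv :: "int \<Rightarrow> real" where "rv v \<equiv> real_of_int v / real_of_int S"

lemma Spos: "0 < S" "0 < real_of_int S" by (simp_all add: S)
lemma rS: "real_of_int S = 2 ^ sh" by (simp add: S)
lemma rva: "rv a = 21 / 4"
proof -
  have "real_of_int (4 * a) = real_of_int (21 * S)" using a by simp
  then show ?thesis using Spos by (simp add: field_simps)
qed

lemma rv_mono: "v \<le> w \<Longrightarrow> rv v \<le> rv w" using Spos by (simp add: divide_right_mono)
lemma rv_S: "rv S = 1" using Spos by simp
lemma rv_nonneg: "0 \<le> v \<Longrightarrow> 0 \<le> rv v" using Spos by simp

lemma rv_shr: "rv (shr n x) \<le> rv x / 2 ^ n" "rv x / 2 ^ n \<le> rv (shr n x + 1)"
proof -
  show "rv (shr n x) \<le> rv x / 2 ^ n"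
    using divide_right_mono[OF shr_bounds(1)[of n x], of "real_of_int S"] Spos by (simp add: mult.commute)
  have "real_of_int x / 2 ^ n \<le> real_of_int (shr n x + 1)" using shr_bounds(2)[of x n] by simp
  from divide_right_mono[OF this, of "real_of_int S"] Spos
  show "rv x / 2 ^ n \<le> rv (shr n x + 1)" by (simp add: mult.commute)
qed

lemma rv_add: "rv (v + w) = rv v + rv w" and rv_diff: "rv (v - w) = rv v - rv w" and rv_minus: "rv (- v) = - rv v"
  by (simp_all add: add_divide_distrib diff_divide_distrib)

lemma rv_one: "0 \<le> rv 1" using Spos by simp

lemma rv_mulu: "rv v * rv w \<le> rv (mulu sh v w)"
proof -
  have "rv v * rv w = rv (v * w) / 2 ^ sh" by (simp add: rS)
  also have "\<dots> \<le> rv (mulu sh v w)" unfolding mulu_def by (rule rv_shr)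
  finally show ?thesis .
qed

lemma rv_mulu_half: "rv v * rv w / 2 \<le> rv (mulu (sh + 1) v w)"
proof -
  have "rv v * rv w / 2 = rv (v * w) / 2 ^ (sh + 1)" by (simp add: rS)
  also have "\<dots> \<le> rv (mulu (sh + 1) v w)" unfolding mulu_def by (rule rv_shr)
  finally show ?thesis .
qed

lemma mulu_le:
  assumes "u \<le> rv v" "w \<le> rv w'" "0 \<le> u" "0 \<le> w"
  shows "u * w \<le> rv (mulu sh v w')"
  by (rule order_trans[OF mult_mono rv_mulu]) (use assms in auto)

lemma decay: assumes "u \<le> rv h" "rv h \<le> 0" shows "exp u \<le> rv (decay sh S h)"
proof -
  have "exp u \<le> exp (rv h)" using assms by simp
  also have "\<dots> \<le> 1 + rv h + rv h * rv h / 2"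
    using exp_le_quadratic[OF assms(2)] by (simp add: power2_eq_square)
  also have "\<dots> \<le> rv (decay sh S h)"
    unfolding decay_def rv_add rv_S using rv_mulu_half[of h h] by simp
  finally show ?thesis .
qed

lemma grow: assumes "u \<le> rv h" "0 \<le> rv h" "h \<le> S" shows "exp u \<le> rv (grow sh S h)"
proof -
  have h: "rv h \<le> 1" using rv_mono[OF assms(3)] rv_S by simp
  have "exp u \<le> exp (rv h)" using assms by simp
  also have "\<dots> \<le> 1 + rv h + rv h * rv h"
    using exp_bound[OF assms(2) h] by (simp add: power2_eq_square)
  also have "\<dots> \<le> rv (grow sh S h)"
    unfolding grow_def rv_add rv_S using rv_mulu[of h h] by simp
  finally show ?thesis .
qed

lemma rv_tenth: "1 / 10 \<le> rv (tenth S)"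
proof -
  have "1 / 10 \<le> rv (6554 * S) / 2 ^ 16" using Spos by simp
  also have "\<dots> \<le> rv (tenth S)" unfolding tenth_def by (rule rv_shr)
  finally show ?thesis .
qed

lemma cr_bound:
  assumes "cr D M l h = (c, g)" "0 < D" "2 ^ 20 \<le> D * M" "rv l \<le> v" "v \<le> rv h"
  shows "\<bar>v / D - rv c\<bar> \<le> rv g"
proof -
  let ?m = "max (h - D * c) (D * c - l)"
  have g: "g = shr 20 (?m * M) + 1" using assms(1) by (auto simp: cr_def cr'_def)
  have b: "v - D * rv c \<le> rv ?m" "D * rv c - v \<le> rv ?m"
  proof -
    have "v - D * rv c \<le> rv (h - D * c)" using assms(5) by (simp add: diff_divide_distrib)
    also have "\<dots> \<le> rv ?m" by (rule rv_mono) simp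
    finally show "v - D * rv c \<le> rv ?m" .
    have "D * rv c - v \<le> rv (D * c - l)" using assms(4) by (simp add: diff_divide_distrib)
    also have "\<dots> \<le> rv ?m" by (rule rv_mono) simp
    finally show "D * rv c - v \<le> rv ?m" .
  qed
  then have m0: "0 \<le> rv ?m" by linarith
  have D: "0 < real_of_int D" using assms(2) by simp
  have eq: "v / D - rv c = (v - D * rv c) / D" using D by (simp add: diff_divide_distrib)
  have "\<bar>v / D - rv c\<bar> = \<bar>v - D * rv c\<bar> / D" unfolding eq abs_divide using D by simp
  also have "\<dots> \<le> rv ?m / D"
    using b D by (intro divide_right_mono) auto
  also have "\<dots> \<le> rv (?m * M) / 2 ^ 20"
  proof -
    have "(2::real) ^ 20 \<le> real_of_int D * real_of_int M"
      using assms(3) by (metis of_int_le_iff of_int_mult of_int_numeral of_int_power)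
    then have "rv ?m / D \<le> rv ?m * M / 2 ^ 20" by (rule div_le_mult[OF m0 D]) simp
    also have "rv ?m * M = rv (?m * M)" by simp
    finally show ?thesis .
  qed
  also have "\<dots> \<le> rv g" unfolding g by (rule rv_shr)
  finally show ?thesis .
qed

fun inb :: "box \<Rightarrow> real \<Rightarrow> real \<Rightarrow> real \<Rightarrow> bool" where
  "inb ((xl,xu),(yl,yu),(zl,zu)) x y z \<longleftrightarrow> rv xl \<le> x \<and> x \<le> rv xu \<and> rv yl \<le> y \<and> y \<le> rv yu \<and> rv zl \<le> z \<and> z \<le> rv zu"

lemma delay_bound:
  assumes "delay sh S a d = ((cx,gx),(cy,gy),(cz,gz))" "inb d x y z"
  shows "\<bar>(- y - z) / 10000 - rv cx\<bar> \<le> rv gx" "\<bar>(x + y / 5) / 10000 - rv cy\<bar> \<le> rv gy"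
    "\<bar>(z * (x - 21 / 4) + 1 / 5) / 10000 - rv cz\<bar> \<le> rv gz"
proof -
  obtain xl xu yl yu zl zu where d: "d = ((xl,xu),(yl,yu),(zl,zu))" by (metis prod.exhaust)
  note b = assms(2)[unfolded d, simplified]
  have cx: "cr 10000 105 (- yu - zu) (- yl - zl) = (cx,gx)"
    and cy: "cr 50000 21 (5 * xl + yl) (5 * xu + yu) = (cy,gy)"
    and cz: "crz sh S (zl * (xl - a)) (zl * (xu - a)) (zu * (xl - a)) (zu * (xu - a)) = (cz,gz)"
    using assms(1) by (simp_all add: d)
  have "\<bar>(- y - z) / real_of_int 10000 - rv cx\<bar> \<le> rv gx"
    by (rule cr_bound[OF cx]) (use b in \<open>auto simp: diff_divide_distrib\<close>)
  then show "\<bar>(- y - z) / 10000 - rv cx\<bar> \<le> rv gx" by simp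
  have "\<bar>(5 * x + y) / real_of_int 50000 - rv cy\<bar> \<le> rv gy"
    by (rule cr_bound[OF cy]) (use b in \<open>auto simp: add_divide_distrib\<close>)
  moreover have "(5 * x + y) / real_of_int 50000 = (x + y / 5) / 10000" by simp
  ultimately show "\<bar>(x + y / 5) / 10000 - rv cy\<bar> \<le> rv gy" by metis
  let ?p = "zl * (xl - a)" and ?q = "zl * (xu - a)" and ?r = "zu * (xl - a)" and ?s = "zu * (xu - a)"
  let ?w = "x - 21 / 4"
  have w: "rv (xl - a) \<le> ?w" "?w \<le> rv (xu - a)" using b unfolding rv_diff rva by simp_all
  have pr: "rv v * rv w = rv (v * w) / S" for v w by simp
  have mn: "min (rv v / real_of_int S) (rv w / real_of_int S) = rv (min v w) / S" for v w using Spos by (auto simp: min_def divide_simps)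
  have mx: "max (rv v / real_of_int S) (rv w / real_of_int S) = rv (max v w) / S" for v w using Spos by (auto simp: max_def divide_simps)
  have "rv (min4 ?p ?q ?r ?s) / S \<le> z * ?w" "z * ?w \<le> rv (max4 ?p ?q ?r ?s) / S"
    using product_range[of "rv zl" z "rv zu" "rv (xl - a)" ?w "rv (xu - a)"] b w
    unfolding pr mn mx min4_def max4_def by auto
  then have 1: "rv (shr sh (min4 ?p ?q ?r ?s)) \<le> z * ?w" "z * ?w \<le> rv (shr sh (max4 ?p ?q ?r ?s) + 1)"
    using rv_shr(1)[of sh "min4 ?p ?q ?r ?s"] rv_shr(2)[of "max4 ?p ?q ?r ?s" sh] unfolding rS by linarith+
  have "\<bar>(5 * (z * ?w) + 1) / real_of_int 50000 - rv cz\<bar> \<le> rv gz"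
  proof (rule cr_bound[OF cz[unfolded crz_def]])
    show "rv (5 * shr sh (min4 ?p ?q ?r ?s) + S) \<le> 5 * (z * ?w) + 1"
      using 1(1) rv_S by (simp add: add_divide_distrib)
    have "rv (5 * shr sh (max4 ?p ?q ?r ?s) + 5 + S) = 5 * rv (shr sh (max4 ?p ?q ?r ?s) + 1) + 1"
      using Spos by (simp add: field_simps)
    then show "5 * (z * ?w) + 1 \<le> rv (5 * shr sh (max4 ?p ?q ?r ?s) + 5 + S)"
      using 1(2) by linarith
  qed simp_all
  moreover have "(5 * (z * ?w) + 1) / real_of_int 50000 = (z * ?w + 1 / 5) / 10000" by simp
  ultimately show "\<bar>(z * (x - 21 / 4) + 1 / 5) / 10000 - rv cz\<bar> \<le> rv gz" by metis
qed

lemma abs_div_S: "\<bar>v\<bar> \<le> w \<Longrightarrow> \<bar>v / S\<bar> \<le> w / S" for v w :: real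
  using Spos by (simp add: abs_divide divide_right_mono)

lemma resx_bound:
  assumes "0 \<le> t" "t \<le> 1"
  shows "\<bar>K * (pv (pder xs) t / S) + pv ys t / S + pv zs t / S - rv c\<bar> \<le> rv (resx K c xs ys zs)"
proof -
  let ?P = "cadd (- c) (padd (psm K (pder xs)) (padd ys zs))"
  have "K * (pv (pder xs) t / S) + pv ys t / S + pv zs t / S - rv c = pv ?P t / S"
    using Spos by (simp add: pv_cadd pv_padd pv_psm field_simps)
  then show ?thesis
    unfolding resx_def using asum_bound[OF assms, of ?P] Spos by (simp add: divide_right_mono)
qed

lemma fifth_up: assumes "0 \<le> A" shows "real_of_int A / 5 \<le> real_of_int (shr 10 (205 * A) + 1)"
proof -
  have "real_of_int A / 5 \<le> real_of_int (205 * A) / 2 ^ 10" using assms by simp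
  also have "\<dots> \<le> real_of_int (shr 10 (205 * A) + 1)" using shr_bounds(2)[of "205 * A" 10] by simp
  finally show ?thesis .
qed

lemma resy_bound:
  assumes "0 \<le> t" "t \<le> 1"
  shows "\<bar>K * (pv (pder ys) t / S) - pv xs t / S - pv ys t / S / 5 - rv c\<bar> \<le> rv (resy K c xs ys)"
proof -
  let ?P = "cadd (- 5 * c) (padd (psm (5 * K) (pder ys)) (padd (psm (-5) xs) (psm (-1) ys)))"
  have "K * (pv (pder ys) t / S) - pv xs t / S - pv ys t / S / 5 - rv c = pv ?P t / 5 / S"
    using Spos by (simp add: pv_cadd pv_padd pv_psm field_simps)
  moreover have "\<bar>pv ?P t / 5\<bar> \<le> real_of_int (shr 10 (205 * asum ?P) + 1)"
    using asum_bound[OF assms, of ?P] fifth_up[OF asum_nonneg, of ?P] by simp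
  ultimately show ?thesis
    unfolding resy_def by (simp only: abs_div_S)
qed

lemma resz_bound:
  assumes "0 \<le> t" "t \<le> 1"
  shows "\<bar>K * (pv (pder zs) t / S) - pv zs t / S * (pv xs t / S - 21 / 4) - 1 / 5 - rv c\<bar> \<le> rv (resz sh S a K c xs zs)"
proof -
  let ?P = "cadd (- (S * S + 5 * S * c)) (padd (psm (5 * S * K) (pder zs)) (psm (- 5) (pmul zs (cadd (- a) xs))))"
  have "K * (pv (pder zs) t / S) - pv zs t / S * (pv xs t / S - rv a) - 1 / 5 - rv c = pv ?P t / 5 / S / S"
    using Spos by (simp add: pv_cadd pv_padd pv_psm pv_pmul field_simps)
  then have 1: "K * (pv (pder zs) t / S) - pv zs t / S * (pv xs t / S - 21 / 4) - 1 / 5 - rv c = pv ?P t / 5 / S / S"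
    unfolding rva .
  have "\<bar>pv ?P t / 5\<bar> \<le> asum ?P / 5" using asum_bound[OF assms, of ?P] by simp
  also have "\<dots> \<le> real_of_int (205 * asum ?P) / 2 ^ 10" using asum_nonneg[of ?P] by simp
  finally have "\<bar>pv ?P t / 5\<bar> / S \<le> real_of_int (205 * asum ?P) / 2 ^ 10 / S" using Spos by (intro divide_right_mono) auto
  also have "\<dots> = real_of_int (205 * asum ?P) / 2 ^ (sh + 10)" by (simp add: rS power_add)
  also have "\<dots> \<le> real_of_int (resz sh S a K c xs zs)"
    unfolding resz_def using shr_bounds(2)[of "205 * asum ?P" "sh + 10"] by simp
  finally have "\<bar>pv ?P t / 5\<bar> / S / S \<le> rv (resz sh S a K c xs zs)" using Spos by (intro divide_right_mono) auto
  then show ?thesis unfolding 1 using Spos by (simp only: abs_divide abs_of_pos)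
qed

end

lemma tay_last:
  assumes "xr \<noteq> []" "yr \<noteq> []" "zr \<noteq> []" "tay sh ds c (xr,yr,zr,w) = (xr',yr',zr',w')"
  shows "xr' \<noteq> [] \<and> yr' \<noteq> [] \<and> zr' \<noteq> [] \<and> last xr' = last xr \<and> last yr' = last yr \<and> last zr' = last zr"
  using assms
proof (induction ds arbitrary: c xr yr zr w)
  case (Cons d ds)
  have "\<exists>X Y Z w2. tstep sh d c (xr,yr,zr,w) = (X#xr,Y#yr,Z#zr,w2)" by (cases d; cases c) simp
  then obtain X Y Z w2 where st: "tstep sh d c (xr,yr,zr,w) = (X#xr,Y#yr,Z#zr,w2)" by blast
  then have "tay sh ds (0,0,0) (X#xr,Y#yr,Z#zr,w2) = (xr',yr',zr',w')" using Cons.prems(4) by simp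
  from Cons.IH[OF _ _ _ this] Cons.prems show ?case by simp
qed auto

text \<open>All that soundness needs to know about the Taylor coefficients: the polynomial starts at
  the reference point. The higher coefficients could be arbitrary, since the residual is
  measured.\<close>

lemma taylor_hd:
  assumes "taylor sh S a k (x,y,z) cx cy cz = (xs,ys,zs)"
  shows "pv xs 0 = x" "pv ys 0 = y" "pv zs 0 = z"
proof -
  define st where "st = tay sh [(1,k),(1,k+1),(21845,k+16),(1,k+2)] (cx, cy, cz + shr 18 (S * 52429)) ([x], [y], [z], [x - a])"
  obtain xr yr zr w where st': "st = (xr,yr,zr,w)" by (cases st)
  have "xr \<noteq> [] \<and> yr \<noteq> [] \<and> zr \<noteq> [] \<and> last xr = x \<and> last yr = y \<and> last zr = z"
    using tay_last[OF _ _ _ st_def[unfolded st', symmetric]] by simp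
  moreover have "xs = rev xr" "ys = rev yr" "zs = rev zr"
    using assms unfolding taylor.simps st_def[symmetric] st' by simp_all
  ultimately show "pv xs 0 = x" "pv ys 0 = y" "pv zs 0 = z"
    by (simp_all add: pv_0 hd_rev)
qed

section \<open>One time step: from integer bounds to error estimates\<close>

locale step_setting = scale + error_step ex ey ez px pz dx dy dz t0 t1 "21 / 4" rx ry rz
  for ex ey ez px pz dx dy dz :: "real \<Rightarrow> real" and t0 t1 rx ry rz :: real +
  fixes k :: nat and xl xu zl zu rxy rzi :: int
  assumes k: "3 \<le> k" and h: "t1 - t0 = 1 / 2 ^ k"
    and pxb: "\<And>t. t \<in> {t0..t1} \<Longrightarrow> rv xl \<le> px t \<and> px t \<le> rv xu"
    and pzb: "\<And>t. t \<in> {t0..t1} \<Longrightarrow> rv zl \<le> pz t \<and> pz t \<le> rv zu"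
    and rxy: "rx + ry \<le> rv rxy" and rzi: "rz \<le> rv rzi"
begin

definition zm :: int where "zm = max zu (- zl)"

lemma pz_zm: "t \<in> {t0..t1} \<Longrightarrow> \<bar>pz t\<bar> \<le> rv zm"
  using pzb[of t] rv_mono[of zu zm] rv_mono[of "- zl" zm] by (auto simp: zm_def abs_le_iff)

lemma zm_nonneg: "0 \<le> rv zm" using pz_zm[of t0] t01 by fastforce

lemma hpos: "0 < t1 - t0" using t01 by simp

lemma scaled: "(t1 - t0) * rv v = rv v / 2 ^ k" unfolding h by simp

lemma scaled_le: "(t1 - t0) * rv v \<le> rv (shr k v + 1)" unfolding scaled by (rule rv_shr)

lemma bulge: "129 / 128 * rv R \<le> rv (R + shr 7 R + 1)"
proof -
  have "129 / 128 * rv R = rv R + rv R / 2 ^ 7" by simp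
  also have "\<dots> \<le> rv R + rv (shr 7 R + 1)" using rv_shr(2)[of R 7] by (intro add_left_mono)
  finally show ?thesis by (simp add: add_divide_distrib)
qed

lemma exp_tenth: "exp (1 / 10 * (t1 - t0)) \<le> 1 + 13 / 128 * (t1 - t0)"
proof -
  define D where "D = t1 - t0"
  have "(2::real) ^ 3 \<le> 2 ^ k" using k by (intro power_increasing) auto
  then have D: "0 < D" "D \<le> 1 / 8" unfolding D_def h by (simp_all add: divide_simps)
  have "exp (1 / 10 * D) \<le> 1 + 1 / 10 * D + (1 / 10 * D)\<^sup>2"
    by (rule exp_bound) (use D in auto)
  moreover have "D * D \<le> D * (1 / 8)" using D by (intro mult_left_mono) auto
  then have "(1 / 10 * D)\<^sup>2 \<le> D / 800" by (simp add: power2_eq_square)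
  ultimately show ?thesis unfolding D_def[symmetric] using D(1) by linarith
qed

lemma slow_step:
  assumes ok: "R1 < Rb"
    and init: "sqrt (quad (ex t0) (ey t0)) \<le> rv R" "\<bar>ez t0\<bar> \<le> rv Z"
    and e1: "e1 = Rb + shr 7 Rb + 1" "0 \<le> rv Rb" and q: "q = shr k (mulu sh zm e1 + rzi) + 1"
    and Zm: "(rv Z + rv q) * max 1 (exp (rv (xu + e1 - a) / 2 ^ k)) \<le> rv Zm"
    and Z1: "exp (rv (xu + e1 - a) / 2 ^ k) * rv Z + rv q * max 1 (exp (rv (xu + e1 - a) / 2 ^ k)) \<le> rv Z1"
    and v: "v = R + shr k (Zm + rxy) + 1" and R1: "R1 = v + shr (k + 7) (13 * v) + 1"
    and inn: "- 99 < rv (xl - (R1 + shr 7 R1 + 1))" "rv (xu + (R1 + shr 7 R1 + 1)) < 99"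
      "- 99 < rv (zl - max Zm Z1)" "rv (zu + max Zm Z1) < 99"
  shows "\<And>t. t \<in> {t0..t1} \<Longrightarrow> sqrt (quad (ex t) (ey t)) \<le> rv R1 \<and> \<bar>ez t\<bar> \<le> rv (max Zm Z1)"
    and "\<bar>ez t1\<bar> \<le> rv Z1"
proof -
  let ?h = "t1 - t0" and ?d = "rv (xu + e1 - a)"
  \<comment> \<open>A provisional bound strictly above \<open>R1\<close> but within 1/2 of it. Then
    the coordinates exceed their final bounds by at most 129/256, which fits between 99 and
    100.\<close>
  define E where "E = min (rv Rb) (rv R1 + 1 / 2)"
  define er where "er = 129 / 128 * E"
  have R1Rb: "rv R1 < rv Rb" using ok Spos by (simp add: divide_strict_right_mono)
  have R1E: "rv R1 < E" using R1Rb by (auto simp: E_def)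
  have er1: "er \<le> rv e1"
  proof -
    have "er \<le> 129 / 128 * rv Rb" unfolding er_def E_def by (intro mult_left_mono) auto
    also have "\<dots> \<le> rv e1" unfolding e1(1) by (rule bulge)
    finally show ?thesis .
  qed
  have er2: "er \<le> rv (R1 + shr 7 R1 + 1) + 129 / 256"
  proof -
    have "er \<le> 129 / 128 * (rv R1 + 1 / 2)" unfolding er_def E_def by (intro mult_left_mono) auto
    also have "\<dots> = 129 / 128 * rv R1 + 129 / 256" by (simp only: distrib_left)
    also have "\<dots> \<le> rv (R1 + shr 7 R1 + 1) + 129 / 256" by (rule add_right_mono[OF bulge])
    finally show ?thesis .
  qed
  have Rn: "0 \<le> rv R" using init(1) quad_nonneg[of "ex t0" "ey t0"] by (meson order_trans real_sqrt_ge_zero)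
  have Zn: "0 \<le> rv Z" using init(2) by linarith
  have dh: "?d * ?h = ?d / 2 ^ k" unfolding h by simp
  have e1n: "0 \<le> rv e1" using bulge[of Rb] e1 by simp
  have hq: "?h * (rv zm * er + rz) \<le> rv q"
  proof -
    have "rv zm * er + rz \<le> rv (mulu sh zm e1) + rv rzi"
      using rv_mulu[of zm e1] mult_left_mono[OF er1 zm_nonneg] rzi by linarith
    also have "\<dots> = rv (mulu sh zm e1 + rzi)" by (simp add: add_divide_distrib)
    finally have "?h * (rv zm * er + rz) \<le> ?h * rv (mulu sh zm e1 + rzi)" using hpos by (intro mult_left_mono) auto
    also have "\<dots> \<le> rv q" unfolding q by (rule scaled_le)
    finally show ?thesis .
  qed
  have inn': "- 99 < rv xl - rv (R1 + shr 7 R1 + 1)" "rv xu + rv (R1 + shr 7 R1 + 1) < 99"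
     "- 99 < rv zl - rv (max Zm Z1)" "rv zu + rv (max Zm Z1) < 99"
    using inn unfolding rv_add rv_diff by simp_all
  have m1: "rv Zm \<le> rv (max Zm Z1)" "rv Z1 \<le> rv (max Zm Z1)" by (simp_all add: rv_mono)
  have mx: "0 < max 1 (exp (?d / 2 ^ k))" by simp
  have q0: "0 \<le> rv q"
  proof -
    have "0 \<le> rv (mulu sh zm e1) + rv rzi"
      using rv_mulu[of zm e1] mult_nonneg_nonneg[OF zm_nonneg e1n] rzi r_nonneg(3) by linarith
    then have "0 \<le> (t1 - t0) * rv (mulu sh zm e1 + rzi)" using hpos by (simp add: add_divide_distrib)
    then show ?thesis unfolding q using scaled_le[of "mulu sh zm e1 + rzi"] by linarith
  qed
  have Zm0: "0 \<le> rv Zm"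
  proof -
    have "0 \<le> (rv Z + rv q) * max 1 (exp (?d / 2 ^ k))" using Zn q0 mx by (intro mult_nonneg_nonneg) auto
    then show ?thesis using Zm by linarith
  qed
  have vle: "rv R + ?h * (rv Zm + rx + ry) \<le> rv v"
  proof -
    have "rv Zm + rx + ry \<le> rv (Zm + rxy)" using rxy by (simp add: add_divide_distrib)
    then have "?h * (rv Zm + rx + ry) \<le> ?h * rv (Zm + rxy)" using hpos by (intro mult_left_mono) auto
    also have "\<dots> \<le> rv (shr k (Zm + rxy) + 1)" by (rule scaled_le)
    finally show ?thesis unfolding v by (simp add: add_divide_distrib)
  qed
  have v0: "0 \<le> rv R + ?h * (rv Zm + rx + ry)" using Rn Zm0 r_nonneg hpos by simp
  have R1': "exp (1 / 10 * ?h) * (rv R + ?h * (rv Zm + rx + ry)) \<le> rv R1"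
  proof -
    have "exp (1 / 10 * ?h) * (rv R + ?h * (rv Zm + rx + ry)) \<le> (1 + 13 / 128 * ?h) * rv v"
      using exp_tenth vle v0 hpos by (intro mult_mono) auto
    also have "\<dots> = rv v + rv (13 * v) / 2 ^ (k + 7)" unfolding h by (simp add: power_add algebra_simps)
    also have "\<dots> \<le> rv v + rv (shr (k + 7) (13 * v) + 1)" by (intro add_left_mono rv_shr)
    finally show ?thesis unfolding R1 by (simp add: add_divide_distrib)
  qed
  have R10: "0 \<le> rv R1" by (rule order_trans[OF _ R1']) (use v0 in simp)
  have er0: "0 \<le> er" using R10 R1E by (simp add: er_def)
  have Zm': "(rv Z + ?h * (rv zm * er + rz)) * max 1 (exp (?d * ?h)) \<le> rv Zm"
    unfolding dh by (rule order_trans[OF mult_right_mono Zm]) (use hq in auto)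
  have pzm: "rv zm + (rv Zm + 1 / 2) \<le> 100"
    using inn'(3,4) m1 by (auto simp: zm_def max_def)
  have c1: "\<bar>px t\<bar> + er \<le> 100" if "t \<in> {t0..t1}" for t
    using pxb[OF that] inn'(1,2) er2 by linarith
  have c2: "px t + er - 21 / 4 \<le> ?d" if "t \<in> {t0..t1}" for t
    using pxb[OF that] er1 rva unfolding rv_add rv_diff by linarith
  show "sqrt (quad (ex t) (ey t)) \<le> rv R1 \<and> \<bar>ez t\<bar> \<le> rv (max Zm Z1)" if "t \<in> {t0..t1}" for t
    using slow_mode(1)[where ?e1.0 = er and zm = "rv zm" and Ez = "rv Zm + 1 / 2" and d = ?d and ?R0.0 = "rv R" and ?Z0.0 = "rv Z"
      and q = "rv zm * er + rz" and Zm = "rv Zm" and ?R1.0 = "rv R1" and Rb = E, OF c1 pz_zm pzm c2 init order_refl Zm' _ R1' R1E _ er0 that]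
      m1 by (auto simp: er_def)
  have "\<bar>ez t1\<bar> \<le> exp (?d * ?h) * rv Z + ?h * (rv zm * er + rz) * max 1 (exp (?d * ?h))"
    using slow_mode(2)[where ?e1.0 = er and zm = "rv zm" and Ez = "rv Zm + 1 / 2" and d = ?d and ?R0.0 = "rv R" and ?Z0.0 = "rv Z"
      and q = "rv zm * er + rz" and Zm = "rv Zm" and ?R1.0 = "rv R1" and Rb = E, OF c1 pz_zm pzm c2 init order_refl Zm' _ R1' R1E _ er0]
    by (simp add: er_def)
  also have "\<dots> \<le> exp (?d / 2 ^ k) * rv Z + rv q * max 1 (exp (?d / 2 ^ k))"
    unfolding dh by (intro add_mono order_refl mult_right_mono hq) simp
  finally show "\<bar>ez t1\<bar> \<le> rv Z1" using Z1 by linarith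
qed

lemma fast_step:
  fixes s g :: int
  defines "s1 \<equiv> s - mulu sh s g" and "s2 \<equiv> mulu sh s s" and "sx \<equiv> (if 0 \<le> g then s else s + mulu sh s (mulu sh g g - g))"
    and "b2 \<equiv> shr (sh + 1) (4 * g * g)"
  defines "sm \<equiv> min s s1" and "dp \<equiv> xu - a - g * 2 ^ k"
  assumes pz: "\<And>t. t \<in> {t0..t1} \<Longrightarrow> pz t = pv zs ((t - t0) * 2 ^ k) / S"
    and ok: "0 < s" "0 < s1" "\<bar>2 * g\<bar> \<le> S" "0 < r" "S * S \<le> r * sm" "W1 < Wb" "0 \<le> lam" "lh \<le> S"
    and init: "quad (ex t0) (ey t0) + (rv s * ez t0)\<^sup>2 \<le> (rv W)\<^sup>2" "0 \<le> rv W"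
    and M: "M0 = defect sh S s2 (pmul zs [S, - 2 * g, b2]) + mulu sh (mulu sh s2 zm) (mulu sh \<bar>2 * g\<bar> (b2 + 1) + 1)
        + tenth S + mulu sh sx Wb" "M = M0 + shr 7 M0 + 1"
    and lam: "tenth S \<le> lam" "dp \<le> lam" "M * M \<le> 4 * shr sh ((lam - tenth S) * (lam - dp)) * shr sh (sm * sm)"
    and lh: "lh = shr k lam + 1"
    and W1: "W1 = mulu sh (grow sh S lh) (W + (shr k (rxy + mulu sh sx rzi) + 1))"
    and ez: "ezi = mulu sh W1 r"
    and inn: "- 99 < rv (xl - (W1 + shr 7 W1 + 1))" "rv (xu + (W1 + shr 7 W1 + 1)) < 99"
      "- 99 < rv (zl - ezi)" "rv (zu + ezi) < 99"
  shows "\<And>t. t \<in> {t0..t1} \<Longrightarrow> sqrt (quad (ex t) (ey t)) \<le> rv W1 \<and> \<bar>ez t\<bar> \<le> rv ezi"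
    and "quad (ex t1) (ey t1) + (rv s1 * ez t1)\<^sup>2 \<le> (rv W1)\<^sup>2" "0 \<le> rv W1"
proof -
  let ?h = "t1 - t0"
  \<comment> \<open>\<open>g\<close> is the exponent for the whole step, \<open>G\<close> the rate
    per unit of time.\<close>
  define G where "G = rv g * 2 ^ k"
  define st where "st t = rv s * exp (- G * (t - t0))" for t
  have Gh: "G * ?h = rv g" unfolding G_def h by simp
  have s0: "0 < rv s" using ok(1) Spos by simp
  have th: "0 \<le> (t - t0) * 2 ^ k \<and> (t - t0) * 2 ^ k \<le> 1" if "t \<in> {t0..t1}" for t
  proof -
    have "(t - t0) * 2 ^ k \<le> (t1 - t0) * 2 ^ k" using that by (intro mult_right_mono) auto
    then show ?thesis using that h by simp
  qed
  have Gt: "G * (t - t0) = rv g * ((t - t0) * 2 ^ k)" for t by (simp add: G_def)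
  have s1le: "rv s1 \<le> rv s * (1 - rv g)"
    unfolding s1_def rv_diff using rv_mulu[of s g] by (simp add: algebra_simps)
  have expge: "1 - rv g \<le> exp (- rv g)" using exp_ge_add_one_self[of "- rv g"] by simp
  have s1exp: "rv s1 \<le> rv s * exp (- rv g)"
    using s1le mult_left_mono[OF expge, of "rv s"] s0 by linarith
  have smst: "rv sm \<le> st t" if t: "t \<in> {t0..t1}" for t
  proof (cases "0 \<le> g")
    case True
    have "rv g * ((t - t0) * 2 ^ k) \<le> rv g * 1"
      by (rule mult_left_mono[OF conjunct2[OF th[OF t]] rv_nonneg[OF True]])
    then have "exp (- rv g) \<le> exp (- G * (t - t0))" using Gt[of t] by simp
    then have "rv s * exp (- rv g) \<le> st t" unfolding st_def using s0 by (intro mult_left_mono) auto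
    moreover have "rv sm \<le> rv s1" unfolding sm_def by (rule rv_mono) simp
    ultimately show ?thesis using s1exp by linarith
  next
    case False
    then have "rv g * ((t - t0) * 2 ^ k) \<le> 0"
      using Spos by (intro mult_nonpos_nonneg[OF _ conjunct1[OF th[OF t]]]) (auto simp: divide_nonpos_pos)
    then have "1 \<le> exp (- G * (t - t0))" using Gt[of t] by simp
    then have "rv s * 1 \<le> st t" unfolding st_def using s0 by (intro mult_left_mono) auto
    moreover have "rv sm \<le> rv s" unfolding sm_def by (rule rv_mono) simp
    ultimately show ?thesis by linarith
  qed
  have g1: "\<bar>rv g\<bar> \<le> 1 / 2" using ok(3) Spos by (simp add: abs_divide divide_le_eq)
  have stsx: "st t \<le> rv sx" if t: "t \<in> {t0..t1}" for t
  proof (cases "0 \<le> g")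
    case True
    have "0 \<le> rv g * ((t - t0) * 2 ^ k)"
      by (rule mult_nonneg_nonneg[OF rv_nonneg[OF True] conjunct1[OF th[OF t]]])
    then have "exp (- G * (t - t0)) \<le> 1" using Gt[of t] by simp
    then have "st t \<le> rv s * 1" unfolding st_def using s0 by (intro mult_left_mono) auto
    then show ?thesis using True by (simp add: sx_def)
  next
    case False
    then have gn: "rv g \<le> 0" using Spos by (simp add: divide_nonpos_pos)
    have "rv g * 1 \<le> rv g * ((t - t0) * 2 ^ k)" by (rule mult_left_mono_neg[OF conjunct2[OF th[OF t]] gn])
    then have "exp (- G * (t - t0)) \<le> exp (- rv g)" using Gt[of t] by simp
    also have "\<dots> \<le> 1 + - rv g + (- rv g)\<^sup>2" by (rule exp_bound) (use gn g1 in linarith)+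
    also have "\<dots> \<le> 1 + rv (mulu sh g g - g)"
      unfolding rv_diff using rv_mulu[of g g] by (simp add: power2_eq_square)
    finally have "st t \<le> rv s * (1 + rv (mulu sh g g - g))" unfolding st_def using s0 by (intro mult_left_mono) auto
    also have "\<dots> = rv s + rv s * rv (mulu sh g g - g)" by (simp only: distrib_left mult_1_right)
    also have "\<dots> \<le> rv s + rv (mulu sh s (mulu sh g g - g))" by (intro add_left_mono rv_mulu)
    finally show ?thesis using False by (simp add: sx_def add_divide_distrib)
  qed
  have smpos: "0 < sm" using ok(1,2) by (simp add: sm_def)
  then have smr: "0 < rv sm" using Spos by simp
  have sxn: "0 \<le> rv sx" using smst[of t0] stsx[of t0] smr t01 by auto
  have rr: "1 / rv sm \<le> rv r"
  proof -
    have "real_of_int (S * S) \<le> real_of_int (r * sm)" using ok(5) by linarith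
    then have "1 \<le> rv r * rv sm" using Spos by (simp add: le_divide_eq)
    then show ?thesis using smr by (simp only: pos_divide_le_eq)
  qed
  \<comment> \<open>The bound for \<open>ez\<close> is obtained by dividing by the smallest weight,
    so the excess over \<open>W1\<close> is limited to half of that weight as well.\<close>
  define E where "E = min (rv Wb) (rv W1 + min (1 / 2) (rv sm / 2))"
  have W1E: "rv W1 < E" using ok(6) smr Spos by (simp add: E_def divide_strict_right_mono)
  have lam1: "1 / 10 \<le> rv lam" using rv_tenth rv_mono[OF lam(1)] by linarith
  have eg: "exp (rv lam * ?h) \<le> rv (grow sh S lh)"
  proof (rule grow)
    show "rv lam * ?h \<le> rv lh" unfolding lh using scaled_le[of lam] by (simp add: mult.commute)
    moreover have "0 \<le> rv lam * ?h" by (rule mult_nonneg_nonneg) (use lam1 hpos in linarith)+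
    ultimately show "0 \<le> rv lh" by (rule order_trans[rotated])
  qed (rule ok(8))
  have rw: "?h * (rx + ry + rv sx * rz) \<le> rv (shr k (rxy + mulu sh sx rzi) + 1)"
  proof -
    have "rx + ry + rv sx * rz \<le> rv (rxy + mulu sh sx rzi)"
      unfolding rv_add using rxy rv_mulu[of sx rzi] mult_left_mono[OF rzi sxn] by linarith
    then have "?h * (rx + ry + rv sx * rz) \<le> ?h * rv (rxy + mulu sh sx rzi)" using hpos by (intro mult_left_mono) auto
    also note scaled_le
    finally show ?thesis .
  qed
  have rwn: "0 \<le> ?h * (rx + ry + rv sx * rz)"
    using hpos r_nonneg sxn by (intro mult_nonneg_nonneg add_nonneg_nonneg) auto
  have W1': "exp (rv lam * ?h) * (rv W + ?h * (rx + ry + rv sx * rz)) \<le> rv W1"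
    unfolding W1 by (rule mulu_le[OF eg]) (use rw rwn init(2) in \<open>auto simp: add_divide_distrib\<close>)
  have W1n: "0 \<le> rv W1" by (rule order_trans[OF _ W1']) (use rwn init(2) in auto)
  have ezge: "rv W1 / rv sm \<le> rv ezi"
  proof -
    have "rv W1 * (1 / rv sm) \<le> rv W1 * rv r" by (intro mult_left_mono rr W1n)
    also have "\<dots> \<le> rv ezi" unfolding ez by (rule rv_mulu)
    finally show ?thesis by simp
  qed
  have inn': "- 99 < rv xl - rv (W1 + shr 7 W1 + 1)" "rv xu + rv (W1 + shr 7 W1 + 1) < 99"
     "- 99 < rv zl - rv ezi" "rv zu + rv ezi < 99"
    using inn unfolding rv_add rv_diff by simp_all
  have s2ge: "(rv s)\<^sup>2 \<le> rv s2" unfolding s2_def power2_eq_square by (rule rv_mulu)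
  have s2le: "rv (s2 - 1) \<le> (rv s)\<^sup>2"
  proof -
    have "rv (s2 - 1) \<le> rv (s * s) / 2 ^ sh" unfolding s2_def mulu_def using rv_shr(1)[of sh "s * s"] by simp
    also have "\<dots> = (rv s)\<^sup>2" by (simp add: power2_eq_square rS)
    finally show ?thesis .
  qed
  let ?T = "pmul zs [S, - 2 * g, b2]"
  have M0': "\<bar>(st t)\<^sup>2 * pz t - 1\<bar> \<le> rv (defect sh S s2 ?T) + rv (mulu sh (mulu sh s2 zm) (mulu sh \<bar>2 * g\<bar> (b2 + 1) + 1))"
    if t: "t \<in> {t0..t1}" for t
  proof -
    define u where "u = (t - t0) * 2 ^ k"
    have u: "0 \<le> u" "u \<le> 1" using th[OF t] by (auto simp: u_def)
    define B where "B = 2 * rv g"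
    have B1: "\<bar>B\<bar> \<le> 1" using g1 unfolding B_def by linarith
    have pzu: "pz t = pv zs u / S" using pz[OF t] by (simp add: u_def)
    have st2: "(st t)\<^sup>2 = (rv s)\<^sup>2 * exp (- B * u)"
    proof -
      have "(exp (- G * (t - t0)))\<^sup>2 = exp (- B * u)"
        unfolding exp_double[symmetric] using Gt[of t] by (simp add: B_def u_def)
      then show ?thesis unfolding st_def power_mult_distrib by (rule arg_cong)
    qed
    have b2: "rv b2 \<le> B\<^sup>2 / 2" "B\<^sup>2 / 2 \<le> rv b2 + rv 1"
    proof -
      have e: "rv (4 * g * g) / 2 ^ (sh + 1) = B\<^sup>2 / 2" by (simp add: B_def power2_eq_square rS)
      show "rv b2 \<le> B\<^sup>2 / 2" using rv_shr(1)[of "sh + 1" "4 * g * g"] unfolding e b2_def .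
      show "B\<^sup>2 / 2 \<le> rv b2 + rv 1" using rv_shr(2)[of "4 * g * g" "sh + 1"] unfolding e b2_def rv_add .
    qed
    \<comment> \<open>The exponential is replaced by a quadratic polynomial in order to multiply it
      with the polynomial for z and read off a range; \<open>err\<close> is the price.\<close>
    define Q where "Q = 1 - B * u + rv b2 * u\<^sup>2"
    have err: "\<bar>exp (- B * u) - Q\<bar> \<le> rv (mulu sh \<bar>2 * g\<bar> (b2 + 1) + 1)"
    proof -
      have Bu: "\<bar>B * u\<bar> \<le> \<bar>B\<bar>" using u by (simp add: abs_mult mult_left_le)
      have "\<bar>exp (- (B * u)) - (1 + - (B * u) + (- (B * u))\<^sup>2 / 2)\<bar> \<le> \<bar>- (B * u)\<bar> ^ 3 / 2"
        by (rule exp_cubic_error) (use Bu B1 in linarith)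
      also have "\<dots> \<le> \<bar>B\<bar> ^ 3 / 2" using Bu by (auto intro!: divide_right_mono power_mono)
      also have "\<dots> = \<bar>B\<bar> * (B\<^sup>2 / 2)" by (simp add: power3_eq_cube power2_eq_square)
      also have "\<dots> \<le> rv \<bar>2 * g\<bar> * rv (b2 + 1)"
      proof (rule mult_mono)
        have "\<bar>B\<bar> = \<bar>rv (2 * g)\<bar>" by (simp add: B_def)
        then show "\<bar>B\<bar> \<le> rv \<bar>2 * g\<bar>" using Spos by (simp add: abs_divide)
        show "B\<^sup>2 / 2 \<le> rv (b2 + 1)" using b2(2) unfolding rv_add .
        then show "0 \<le> B\<^sup>2 / 2" by simp
        show "0 \<le> rv \<bar>2 * g\<bar>" using Spos by simp
      qed
      also have "\<dots> \<le> rv (mulu sh \<bar>2 * g\<bar> (b2 + 1))" by (rule rv_mulu)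
      finally have 1: "\<bar>exp (- B * u) - (1 - B * u + B\<^sup>2 / 2 * u\<^sup>2)\<bar> \<le> rv (mulu sh \<bar>2 * g\<bar> (b2 + 1))"
        by (simp add: power_mult_distrib)
      have "\<bar>(B\<^sup>2 / 2 - rv b2) * u\<^sup>2\<bar> \<le> rv 1 * 1"
        unfolding abs_mult using b2 u Spos by (intro mult_mono) (auto simp: power_le_one)
      then have 2: "\<bar>(1 - B * u + B\<^sup>2 / 2 * u\<^sup>2) - Q\<bar> \<le> rv 1" by (simp add: Q_def algebra_simps)
      show ?thesis unfolding rv_add using 1 2 by linarith
    qed
    have Tv: "Q * pz t = pv ?T u / S / S"
      unfolding pzu Q_def pv_pmul B_def using Spos by (simp add: field_simps power2_eq_square)
    let ?tl = "shr sh (lo ?T)" and ?th = "shr sh (hi ?T) + 1"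
    have tl: "rv ?tl \<le> Q * pz t" "Q * pz t \<le> rv ?th"
    proof -
      have "rv ?tl \<le> rv (lo ?T) / S" using rv_shr(1)[of sh "lo ?T"] rS by simp
      also have "\<dots> \<le> Q * pz t" unfolding Tv using lo_hi(1)[OF u, of ?T] Spos by (intro divide_right_mono) auto
      finally show "rv ?tl \<le> Q * pz t" .
      have "Q * pz t \<le> rv (hi ?T) / S" unfolding Tv using lo_hi(2)[OF u, of ?T] Spos by (intro divide_right_mono) auto
      also have "\<dots> \<le> rv ?th" using rv_shr(2)[of "hi ?T" sh] rS by simp
      finally show "Q * pz t \<le> rv ?th" .
    qed
    have ss: "0 \<le> (rv s)\<^sup>2" by simp
    have def: "defect sh S s2 ?T = max 0 (max (mulu sh s2 ?th - S) (S - shr sh (min ((s2 - 1) * ?tl) (s2 * ?tl))))"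
      by (simp add: defect_def defect'_def)
    have d0: "0 \<le> rv (defect sh S s2 ?T)" "rv (mulu sh s2 ?th - S) \<le> rv (defect sh S s2 ?T)"
      "rv (S - shr sh (min ((s2 - 1) * ?tl) (s2 * ?tl))) \<le> rv (defect sh S s2 ?T)"
      unfolding def by (rule rv_nonneg, simp) (rule rv_mono, simp)+
    have up: "(rv s)\<^sup>2 * (Q * pz t) - 1 \<le> rv (defect sh S s2 ?T)"
    proof (cases "0 \<le> rv ?th")
      case True
      have "(rv s)\<^sup>2 * (Q * pz t) \<le> (rv s)\<^sup>2 * rv ?th" using tl(2) by (intro mult_left_mono) auto
      also have "\<dots> \<le> rv s2 * rv ?th" using True s2ge by (intro mult_right_mono)
      also have "\<dots> \<le> rv (mulu sh s2 ?th)" by (rule rv_mulu)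
      finally show ?thesis using d0(2) rv_S unfolding rv_diff by linarith
    next
      case False
      then have "Q * pz t \<le> 0" using tl(2) by linarith
      then have "(rv s)\<^sup>2 * (Q * pz t) \<le> 0" by (rule mult_nonneg_nonpos[OF ss])
      then show ?thesis using d0(1) by linarith
    qed
    have dn: "1 - (rv s)\<^sup>2 * (Q * pz t) \<le> rv (defect sh S s2 ?T)"
    proof -
      have pr: "rv (v * w) / 2 ^ sh = rv v * rv w" for v w by (simp add: rS)
      have "rv (shr sh (min ((s2 - 1) * ?tl) (s2 * ?tl))) \<le> rv (min ((s2 - 1) * ?tl) (s2 * ?tl)) / 2 ^ sh" by (rule rv_shr)
      also have "\<dots> \<le> (rv s)\<^sup>2 * rv ?tl"
      proof (cases "0 \<le> ?tl")
        case True
        have "rv (min ((s2 - 1) * ?tl) (s2 * ?tl)) / 2 ^ sh \<le> rv ((s2 - 1) * ?tl) / 2 ^ sh"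
          by (intro divide_right_mono rv_mono) auto
        also have "\<dots> \<le> (rv s)\<^sup>2 * rv ?tl" unfolding pr using s2le rv_nonneg[OF True] by (intro mult_right_mono)
        finally show ?thesis .
      next
        case False
        have "rv (min ((s2 - 1) * ?tl) (s2 * ?tl)) / 2 ^ sh \<le> rv (s2 * ?tl) / 2 ^ sh"
          by (intro divide_right_mono rv_mono) auto
        also have "\<dots> \<le> (rv s)\<^sup>2 * rv ?tl" unfolding pr using s2ge False Spos
          by (intro mult_right_mono_neg) (auto simp: divide_nonpos_pos)
        finally show ?thesis .
      qed
      also have "\<dots> \<le> (rv s)\<^sup>2 * (Q * pz t)" using tl(1) by (intro mult_left_mono) auto
      finally show ?thesis using d0(3) rv_S unfolding rv_diff by linarith
    qed
    have e3: "\<bar>(rv s)\<^sup>2 * ((exp (- B * u) - Q) * pz t)\<bar> \<le> rv (mulu sh (mulu sh s2 zm) (mulu sh \<bar>2 * g\<bar> (b2 + 1) + 1))"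
    proof -
      have "\<bar>(rv s)\<^sup>2 * ((exp (- B * u) - Q) * pz t)\<bar> = ((rv s)\<^sup>2 * \<bar>pz t\<bar>) * \<bar>exp (- B * u) - Q\<bar>"
        by (simp add: abs_mult ac_simps)
      also have "\<dots> \<le> rv (mulu sh (mulu sh s2 zm) (mulu sh \<bar>2 * g\<bar> (b2 + 1) + 1))"
        by (intro mulu_le s2ge pz_zm[OF t] err) auto
      finally show ?thesis .
    qed
    have "(st t)\<^sup>2 * pz t = (rv s)\<^sup>2 * (Q * pz t) + (rv s)\<^sup>2 * ((exp (- B * u) - Q) * pz t)"
      unfolding st2 by (simp add: algebra_simps)
    then show ?thesis using up dn e3 by linarith
  qed
  let ?M0 = "rv (defect sh S s2 ?T) + rv (mulu sh (mulu sh s2 zm) (mulu sh \<bar>2 * g\<bar> (b2 + 1) + 1))"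
  have En: "0 \<le> E" using W1E W1n by linarith
  have M': "129 / 128 * (?M0 + 1 / 10 + rv sx * E) \<le> rv M"
  proof -
    have "rv sx * E \<le> rv (mulu sh sx Wb)"
      by (rule order_trans[OF mult_left_mono rv_mulu]) (use sxn in \<open>auto simp: E_def\<close>)
    then have "?M0 + 1 / 10 + rv sx * E \<le> rv M0" unfolding M(1) rv_add using rv_tenth by linarith
    then have "129 / 128 * (?M0 + 1 / 10 + rv sx * E) \<le> 129 / 128 * rv M0" by (intro mult_left_mono) auto
    also have "\<dots> \<le> rv M" unfolding M(2) by (rule bulge)
    finally show ?thesis .
  qed
  have lam3: "(rv M)\<^sup>2 \<le> 4 * ((rv lam - 1 / 10) * (rv lam - rv dp)) * (rv sm)\<^sup>2"
  proof -
    let ?p = "shr sh ((lam - tenth S) * (lam - dp))" and ?q = "shr sh (sm * sm)"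
    have "rv ?p \<le> rv ((lam - tenth S) * (lam - dp)) / 2 ^ sh" by (rule rv_shr)
    also have "rv ((lam - tenth S) * (lam - dp)) / 2 ^ sh = rv (lam - tenth S) * rv (lam - dp)" by (simp add: rS)
    also have "\<dots> = (rv lam - rv (tenth S)) * (rv lam - rv dp)" unfolding rv_diff ..
    also have "\<dots> \<le> (rv lam - 1 / 10) * (rv lam - rv dp)"
      using rv_tenth rv_mono[OF lam(2)] by (intro mult_right_mono) auto
    finally have p: "rv ?p \<le> (rv lam - 1 / 10) * (rv lam - rv dp)" .
    have q: "rv ?q \<le> (rv sm)\<^sup>2" using rv_shr(1)[of sh "sm * sm"] by (simp add: power2_eq_square rS)
    have q0: "0 \<le> rv ?q" by (rule rv_nonneg, rule shr_nonneg) simp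
    have pp: "0 \<le> rv ?p" by (rule rv_nonneg, rule shr_nonneg) (use lam(1,2) in simp)
    have p0: "0 \<le> (rv lam - 1 / 10) * (rv lam - rv dp)" using lam1 rv_mono[OF lam(2)] by simp
    have "real_of_int (M * M) \<le> real_of_int (4 * ?p * ?q)" using lam(3) by linarith
    then have "real_of_int (M * M) / S / S \<le> real_of_int (4 * ?p * ?q) / S / S" using Spos by (intro divide_right_mono) auto
    moreover have "(rv M)\<^sup>2 = real_of_int (M * M) / S / S" by (simp add: power2_eq_square)
    moreover have "real_of_int (4 * ?p * ?q) / S / S = 4 * rv ?p * rv ?q" by simp
    ultimately have "(rv M)\<^sup>2 \<le> 4 * rv ?p * rv ?q" by linarith
    also have "\<dots> \<le> 4 * ((rv lam - 1 / 10) * (rv lam - rv dp)) * (rv sm)\<^sup>2"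
      using p q q0 p0 pp by (intro mult_mono) auto
    finally show ?thesis .
  qed
  have c1: "\<bar>px t\<bar> + 129 / 128 * E \<le> 100" if "t \<in> {t0..t1}" for t
  proof -
    have "129 / 128 * E \<le> 129 / 128 * (rv W1 + 1 / 2)" unfolding E_def by (intro mult_left_mono) auto
    moreover have "\<bar>p\<bar> + e \<le> 100" if "e \<le> 129 / 128 * (w + 1 / 2)" "l \<le> p \<and> p \<le> u" "- 99 < l - b" "u + b < 99" "129 / 128 * w \<le> b"
      for p e w l u b :: real using that by argo
    ultimately show ?thesis using pxb[OF that] inn'(1,2) bulge[of W1] by blast
  qed
  have c2: "rv zm + E / rv sm \<le> 100"
  proof -
    have "E / rv sm \<le> (rv W1 + rv sm / 2) / rv sm" using smr unfolding E_def by (intro divide_right_mono) auto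
    also have "\<dots> = rv W1 / rv sm + 1 / 2"
    proof -
      have "(w + c / 2) / c = w / c + 1 / 2" if "0 < c" for w c :: real using that by (simp add: add_divide_distrib)
      from this[OF smr] show ?thesis .
    qed
    finally show ?thesis using ezge inn'(3,4) by (auto simp: zm_def max_def)
  qed
  have c3: "px t - 21 / 4 - G \<le> rv dp" if "t \<in> {t0..t1}" for t
  proof -
    have "rv dp = rv xu - 21 / 4 - G" unfolding dp_def rv_diff rva G_def by simp
    then show ?thesis using pxb[OF that] by linarith
  qed
  have lam2: "rv dp \<le> rv lam" by (rule rv_mono[OF lam(2)])
  have fm: "\<And>t. t \<in> {t0..t1} \<Longrightarrow> quad (ex t) (ey t) + (st t * ez t)\<^sup>2 \<le> (rv W1)\<^sup>2"
    unfolding st_def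
    by (rule fast_mode(1)[OF s0 c1 pz_zm c2 smst[unfolded st_def] stsx[unfolded st_def] smr c3 M0'[unfolded st_def] M' lam1 lam2 lam3 _ init(2) W1' W1E])
       (use init(1) in auto)
  show "0 \<le> rv W1" by (rule W1n)
  show "sqrt (quad (ex t) (ey t)) \<le> rv W1 \<and> \<bar>ez t\<bar> \<le> rv ezi" if t: "t \<in> {t0..t1}" for t
  proof
    have "quad (ex t) (ey t) \<le> (rv W1)\<^sup>2" using fm[OF t] by (smt (verit) zero_le_power2)
    then show "sqrt (quad (ex t) (ey t)) \<le> rv W1" by (rule real_le_lsqrt[OF W1n])
    have "(st t * ez t)\<^sup>2 \<le> (rv W1)\<^sup>2" using fm[OF t] quad_nonneg[of "ex t" "ey t"] by linarith
    then have "\<bar>st t * ez t\<bar> \<le> rv W1" using W1n by (simp add: abs_le_square_iff[symmetric])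
    then have "rv sm * \<bar>ez t\<bar> \<le> rv W1"
      using mult_right_mono[OF smst[OF t], of "\<bar>ez t\<bar>"] smst[OF t] smr by (simp only: abs_mult) linarith
    then have "\<bar>ez t\<bar> \<le> rv W1 / rv sm" using smr by (simp only: pos_le_divide_eq mult.commute)
    then show "\<bar>ez t\<bar> \<le> rv ezi" using ezge by linarith
  qed
  have "(rv s1 * ez t1)\<^sup>2 \<le> (st t1 * ez t1)\<^sup>2"
  proof -
    have "rv s1 \<le> st t1" using s1exp Gh by (simp add: st_def)
    moreover have "0 \<le> rv s1" using ok(2) by (intro rv_nonneg) auto
    ultimately show ?thesis unfolding power_mult_distrib by (intro mult_right_mono power_mono) auto
  qed
  then show "quad (ex t1) (ey t1) + (rv s1 * ez t1)\<^sup>2 \<le> (rv W1)\<^sup>2" using fm[of t1] t01 by auto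
qed

end

lemma find_lam:
  "0 \<le> find_lam te dp M2 sh s2 ls \<Longrightarrow> te \<le> find_lam te dp M2 sh s2 ls \<and> dp \<le> find_lam te dp M2 sh s2 ls \<and>
     M2 \<le> 4 * shr sh ((find_lam te dp M2 sh s2 ls - te) * (find_lam te dp M2 sh s2 ls - dp)) * s2"
  by (induction ls) auto

lemma find_r: "0 < find_r SS s rs \<Longrightarrow> SS \<le> find_r SS s rs * s"
  by (induction rs) auto

section \<open>Trajectories of the truncated delay equation\<close>

locale clamped_dde =
  fixes x y z :: "real \<Rightarrow> real"
  assumes x': "\<And>t. 0 \<le> t \<Longrightarrow> (x has_real_derivative (- y t - z t + (- y (t - 1/2) - z (t - 1/2)) / 10000)) (at t within {0..})"
    and y': "\<And>t. 0 \<le> t \<Longrightarrow> (y has_real_derivative (x t + y t / 5 + (x (t - 1/2) + y (t - 1/2) / 5) / 10000)) (at t within {0..})"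
    and z': "\<And>t. 0 \<le> t \<Longrightarrow> (z has_real_derivative (clamp 100 (z t) * (clamp 100 (x t) - 21 / 4) + 1 / 5
        + (clamp 100 (z (t - 1/2)) * (clamp 100 (x (t - 1/2)) - 21 / 4) + 1 / 5) / 10000)) (at t within {0..})"

locale traj = clamped_dde + scale
begin

definition tame :: "box \<Rightarrow> real \<Rightarrow> bool" where
  "tame b t \<longleftrightarrow> inb b (x t) (y t) (z t) \<and> \<bar>x t\<bar> \<le> 100 \<and> \<bar>y t\<bar> \<le> 100 \<and> \<bar>z t\<bar> \<le> 100"

fun est_ok :: "real \<Rightarrow> int \<times> int \<times> int \<Rightarrow> est \<Rightarrow> bool" where
  "est_ok t (u,v,w) (MA R Z) \<longleftrightarrow> sqrt (quad (x t - rv u) (y t - rv v)) \<le> rv R \<and> \<bar>z t - rv w\<bar> \<le> rv Z"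
| "est_ok t (u,v,w) (MV W s Z lam) \<longleftrightarrow> 0 < s \<and> 0 \<le> rv W \<and>
     quad (x t - rv u) (y t - rv v) + (rv s * (z t - rv w))\<^sup>2 \<le> (rv W)\<^sup>2 \<and> \<bar>z t - rv w\<bar> \<le> rv Z"

text \<open>The solution minus the Taylor polynomial satisfies the error equations. The disturbance
  is the residual together with the deviation of the delayed term from its centre; as the history is
  tame, the truncation does not affect that term.\<close>

lemma enc_sound:
  assumes enc: "enc sh S a k d u e = (True, b, u', e')"
    and k: "3 \<le> k" and t0: "0 \<le> t0" and est: "est_ok t0 u e"
    and d: "\<And>t. t \<in> {t0 - 1/2..t0 - 1/2 + 1 / 2 ^ k} \<Longrightarrow> tame d t"
  shows "\<And>t. t \<in> {t0..t0 + 1 / 2 ^ k} \<Longrightarrow> tame b t" "est_ok (t0 + 1 / 2 ^ k) u' e'"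
proof -
  obtain cx gx cy gy cz gz where del: "delay sh S a d = ((cx,gx),(cy,gy),(cz,gz))" by (metis prod.exhaust)
  obtain ux uy uz where u: "u = (ux,uy,uz)" by (metis prod.exhaust)
  obtain xs ys zs where tay: "taylor sh S a k (ux,uy,uz) cx cy cz = (xs,ys,zs)" by (metis prod.exhaust)
  define rxy where "rxy = resx (2^k) cx xs ys zs + gx + resy (2^k) cy xs ys + gy"
  define rzi where "rzi = resz sh S a (2^k) cz xs zs + gz"
  define xl xu zl zu where "xl = lo xs" "xu = hi xs" "zl = lo zs" "zu = hi zs"
  obtain ok exi ezi e1 where st: "step sh S a k xu zs (max zu (- zl)) rxy rzi (psum zs) e = (ok, exi, ezi, e1)"
    by (metis prod.exhaust)
  have res: "ok" "b = ((xl - exi, xu + exi),(lo ys - exi, hi ys + exi),(zl - ezi, zu + ezi))"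
    "u' = (psum xs, psum ys, psum zs)" "e' = e1" "inner S b"
  proof -
    have "enc4 S ((xl,xu),(lo ys,hi ys),(zl,zu)) (psum xs,psum ys,psum zs) (ok, exi, ezi, e1) = (True, b, u', e')"
      using enc by (simp only: enc_def u del enc1.simps fst_conv tay enc2.simps enc3.simps st[symmetric] rxy_def rzi_def xl_xu_zl_zu_def)
    then show "ok" "b = ((xl - exi, xu + exi),(lo ys - exi, hi ys + exi),(zl - ezi, zu + ezi))"
      "u' = (psum xs, psum ys, psum zs)" "e' = e1" "inner S b" by auto
  qed
  define t1 where "t1 = t0 + 1 / 2 ^ k"
  have t01: "t0 < t1" by (simp add: t1_def)
  define th where "th t = (t - t0) * 2 ^ k" for t
  have th: "0 \<le> th t" "th t \<le> 1" if "t \<in> {t0..t1}" for t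
  proof -
    have "(t - t0) * 2 ^ k \<le> (t1 - t0) * 2 ^ k" using that by (intro mult_right_mono) auto
    then show "0 \<le> th t" "th t \<le> 1" using that by (simp_all add: th_def t1_def)
  qed
  define px py pz where "px t = pv xs (th t) / S" "py t = pv ys (th t) / S" "pz t = pv zs (th t) / S" for t
  define dpx dpy dpz where "dpx t = 2 ^ k * (pv (pder xs) (th t) / S)" "dpy t = 2 ^ k * (pv (pder ys) (th t) / S)"
    "dpz t = 2 ^ k * (pv (pder zs) (th t) / S)" for t
  have dth: "(th has_real_derivative 2 ^ k) (at t within A)" for t A
    unfolding th_def by (auto intro!: derivative_eq_intros)
  have dp: "((\<lambda>t. pv p (th t) / S) has_real_derivative (2 ^ k * (pv (pder p) (th t) / S))) (at t within A)" for p t A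
    using DERIV_cdivide[OF DERIV_chain2[OF pv_pder[of p "th t" UNIV] dth[of t A]], of "real_of_int S"]
    by (simp add: mult.commute)
  define gx' gy' gz' where "gx' t = (- y (t - 1/2) - z (t - 1/2)) / 10000" "gy' t = (x (t - 1/2) + y (t - 1/2) / 5) / 10000"
     "gz' t = (z (t - 1/2) * (x (t - 1/2) - 21 / 4) + 1 / 5) / 10000" for t
  have dt: "tame d (t - 1/2)" if "t \<in> {t0..t1}" for t using that by (intro d) (auto simp: t1_def)
  have gb: "\<bar>gx' t - rv cx\<bar> \<le> rv gx" "\<bar>gy' t - rv cy\<bar> \<le> rv gy" "\<bar>gz' t - rv cz\<bar> \<le> rv gz" if "t \<in> {t0..t1}" for t
    using delay_bound[OF del, of "x (t - 1/2)" "y (t - 1/2)" "z (t - 1/2)"] dt[OF that]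
    by (auto simp: tame_def gx'_gy'_gz'_def)
  have sub: "{t0..t1} \<subseteq> {0..}" using t0 by auto
  define dx dy dz where "dx t = gx' t - (dpx t + py t + pz t)" "dy t = gy' t - (dpy t - px t - py t / 5)"
    "dz t = gz' t - (dpz t - pz t * (px t - 21 / 4) - 1 / 5)" for t
  have ex': "((\<lambda>t. x t - px t) has_real_derivative (- (y t - py t) - (z t - pz t) + dx t)) (at t within {t0..t1})" if "t \<in> {t0..t1}" for t
  proof -
    have "((\<lambda>t. x t - px t) has_real_derivative ((- y t - z t + gx' t) - dpx t)) (at t within {t0..t1})"
      unfolding gx'_gy'_gz'_def dpx_dpy_dpz_def px_py_pz_def
      by (intro DERIV_diff dp has_field_derivative_subset[OF x' sub]) (use that t0 in auto)
    then show ?thesis by (rule back_subst[where P = "\<lambda>D. (_ has_real_derivative D) _"]) (simp add: dx_dy_dz_def)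
  qed
  have ey': "((\<lambda>t. y t - py t) has_real_derivative ((x t - px t) + (y t - py t) / 5 + dy t)) (at t within {t0..t1})" if "t \<in> {t0..t1}" for t
  proof -
    have "((\<lambda>t. y t - py t) has_real_derivative ((x t + y t / 5 + gy' t) - dpy t)) (at t within {t0..t1})"
      unfolding gx'_gy'_gz'_def dpx_dpy_dpz_def px_py_pz_def
      by (intro DERIV_diff dp has_field_derivative_subset[OF y' sub]) (use that t0 in auto)
    then show ?thesis by (rule back_subst[where P = "\<lambda>D. (_ has_real_derivative D) _"]) (simp add: dx_dy_dz_def diff_divide_distrib)
  qed
  have cez: "continuous_on {t0..t1} (\<lambda>t. z t - pz t)"
  proof (rule continuous_on_diff)
    show "continuous_on {t0..t1} z"
      by (rule continuous_on_subset[OF DERIV_continuous_on[OF z'] sub]) simp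
    show "continuous_on {t0..t1} pz" unfolding px_py_pz_def by (rule DERIV_continuous_on[OF dp])
  qed
  have ez': "((\<lambda>t. z t - pz t) has_real_derivative ((px t - 21/4) * (z t - pz t) + (pz t + (z t - pz t)) * (x t - px t) + dz t)) (at t within {t0..t1})"
    if t: "t \<in> {t0..t1}" and b: "\<bar>px t + (x t - px t)\<bar> \<le> 100" "\<bar>pz t + (z t - pz t)\<bar> \<le> 100" for t
  proof -
    have cl: "clamp 100 (x t) = x t" "clamp 100 (z t) = z t" "clamp 100 (x (t - 1/2)) = x (t - 1/2)" "clamp 100 (z (t - 1/2)) = z (t - 1/2)"
      using b dt[OF t] by (auto simp: clamp_id tame_def)
    have "(z has_real_derivative (z t * (x t - 21 / 4) + 1 / 5 + gz' t)) (at t within {t0..t1})"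
      using has_field_derivative_subset[OF z' sub, of t] t t0 unfolding cl gx'_gy'_gz'_def by auto
    then have "((\<lambda>t. z t - pz t) has_real_derivative ((z t * (x t - 21 / 4) + 1 / 5 + gz' t) - dpz t)) (at t within {t0..t1})"
      unfolding dpx_dpy_dpz_def px_py_pz_def by (intro DERIV_diff dp)
    then show ?thesis by (rule back_subst[where P = "\<lambda>D. (_ has_real_derivative D) _"]) (simp add: dx_dy_dz_def algebra_simps diff_divide_distrib)
  qed
  have rb: "\<bar>dx t\<bar> \<le> rv (resx (2^k) cx xs ys zs + gx)" "\<bar>dy t\<bar> \<le> rv (resy (2^k) cy xs ys + gy)" "\<bar>dz t\<bar> \<le> rv rzi"
    if "t \<in> {t0..t1}" for t
    using gb[OF that] resx_bound[OF th[OF that], of "2^k" xs ys zs cx] resy_bound[OF th[OF that], of "2^k" ys xs cy]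
      resz_bound[OF th[OF that], of "2^k" zs xs cz]
    unfolding dx_dy_dz_def dpx_dpy_dpz_def px_py_pz_def rzi_def rv_add by (simp_all only: of_int_power of_int_numeral)
  have lh: "rv (lo p) \<le> pv p (th t) / S \<and> pv p (th t) / S \<le> rv (hi p)" if "t \<in> {t0..t1}" for p t
    using lo_hi[OF th[OF that], of p] Spos by (simp add: divide_right_mono)
  interpret I: step_setting sh S a "\<lambda>t. x t - px t" "\<lambda>t. y t - py t" "\<lambda>t. z t - pz t" px pz dx dy dz t0 t1
      "rv (resx (2^k) cx xs ys zs + gx)" "rv (resy (2^k) cy xs ys + gy)" "rv rzi" k xl xu zl zu rxy rzi
  proof unfold_locales
    show "rv (resx (2^k) cx xs ys zs + gx) + rv (resy (2^k) cy xs ys + gy) \<le> rv rxy"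
      unfolding rxy_def rv_add by simp
  qed (use t01 k ex' ey' cez ez' rb lh in \<open>auto simp: t1_def xl_xu_zl_zu_def px_py_pz_def(1,3)\<close>)
  have p0: "px t0 = rv ux" "py t0 = rv uy" "pz t0 = rv uz"
    unfolding px_py_pz_def th_def using taylor_hd[OF tay] by simp_all
  have th1: "th t1 = 1" by (simp add: th_def t1_def)
  have p1: "px t1 = rv (psum xs)" "py t1 = rv (psum ys)" "pz t1 = rv (psum zs)"
    unfolding px_py_pz_def th1 pv_1 by simp_all
  have inn: "- 99 < rv (xl - exi)" "rv (xu + exi) < 99" "- 99 < rv (zl - ezi)" "rv (zu + ezi) < 99"
    "- 99 < rv (lo ys - exi)" "rv (hi ys + exi) < 99"
  proof -
    have i: "-99 * S < xl - exi" "xu + exi < 99 * S" "-99 * S < zl - ezi" "zu + ezi < 99 * S"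
      "-99 * S < lo ys - exi" "hi ys + exi < 99 * S"
      using res(5) by (simp_all add: inner_def res(2))
    have *: "v < w \<Longrightarrow> rv v < rv w" for v w using Spos by (simp add: divide_strict_right_mono)
    have e: "rv (-99 * S) = -99" "rv (99 * S) = 99" using Spos by simp_all
    show "- 99 < rv (xl - exi)" "rv (xu + exi) < 99" "- 99 < rv (zl - ezi)" "rv (zu + ezi) < 99"
      "- 99 < rv (lo ys - exi)" "rv (hi ys + exi) < 99"
      using i[THEN *] unfolding e .
  qed
  have key: "(\<forall>t\<in>{t0..t1}. \<bar>x t - px t\<bar> \<le> rv exi \<and> \<bar>y t - py t\<bar> \<le> rv exi \<and> \<bar>z t - pz t\<bar> \<le> rv ezi) \<and> est_ok t1 u' e1"
  proof (cases e)
    case (MA R Z)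
    have init: "sqrt (quad (x t0 - px t0) (y t0 - py t0)) \<le> rv R" "\<bar>z t0 - pz t0\<bar> \<le> rv Z"
      using est by (simp_all add: MA u p0)
    define Rb where "Rb = R + shr 4 R + shr k (2 * (Z + rxy)) + shr 14 S + 1"
    define f where "f = Rb + shr 7 Rb + 1"
    define q where "q = shr k (mulu sh (max zu (- zl)) f + rzi) + 1"
    define dd where "dd = xu + f - a"
    have Rn: "0 \<le> rv R" using init(1) quad_nonneg[of "x t0 - px t0" "y t0 - py t0"] by (meson order_trans real_sqrt_ge_zero)
    have Zn: "0 \<le> rv Z" using init(2) by linarith
    have nn: "0 \<le> v" if "0 \<le> rv v" for v using that Spos by (simp add: zero_le_divide_iff)
    have rxy0: "0 \<le> rxy" and rzi0: "0 \<le> rzi"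
      using nn[OF I.r_nonneg(3)] nn[OF order_trans[OF add_nonneg_nonneg[OF I.r_nonneg(1,2)] I.rxy]] by auto
    have Rb0: "0 \<le> Rb" unfolding Rb_def using nn[OF Rn] nn[OF Zn] rxy0 Spos by (auto intro!: add_nonneg_nonneg shr_nonneg)
    have f0: "0 \<le> f" unfolding f_def using Rb0 by (auto intro!: add_nonneg_nonneg shr_nonneg)
    have q0: "0 \<le> rv q"
    proof (rule rv_nonneg)
      have "0 \<le> mulu sh (max zu (- zl)) f" unfolding mulu_def using nn[OF I.zm_nonneg] f0
        by (auto intro!: add_nonneg_nonneg shr_nonneg mult_nonneg_nonneg simp: I.zm_def)
      then show "0 \<le> q" unfolding q_def using rzi0 by (auto intro!: add_nonneg_nonneg shr_nonneg)
    qed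
    have s: "stA2 sh S k rxy R Z Rb dd q = (True, exi, ezi, e1)"
      using st res(1) unfolding MA step.simps stepA_def stA0_def stA1_def Rb_def f_def q_def dd_def by simp
    have "\<exists>Zm Z1. stA3 k rxy R Rb True Zm Z1 = (True, exi, ezi, e1) \<and>
        (rv Z + rv q) * max 1 (exp (rv dd / 2 ^ k)) \<le> rv Zm \<and>
        exp (rv dd / 2 ^ k) * rv Z + rv q * max 1 (exp (rv dd / 2 ^ k)) \<le> rv Z1"
    proof (cases "dd \<le> 0")
      case True
      \<comment> \<open>Rounding up may turn the exponent positive; the minimum with 0 is still an
        upper bound because \<open>dd\<close> is not positive.\<close>
      let ?h = "min 0 (shr k dd + 1)"
      have h: "rv dd / 2 ^ k \<le> rv ?h" "rv ?h \<le> 0"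
      proof -
        have "rv dd / 2 ^ k \<le> 0" using True Spos by (simp add: divide_nonpos_pos)
        then show "rv dd / 2 ^ k \<le> rv ?h" using rv_shr(2)[of dd k] by (simp add: min_def)
        show "rv ?h \<le> 0" using Spos by (simp add: divide_nonpos_pos)
      qed
      have e: "exp (rv dd / 2 ^ k) \<le> rv (decay sh S ?h)" by (rule decay[OF h])
      have "exp (rv dd / 2 ^ k) \<le> 1" using h by simp
      then have mx: "max 1 (exp (rv dd / 2 ^ k)) = 1" by simp
      have "rv Z * exp (rv dd / 2 ^ k) \<le> rv (mulu sh Z (decay sh S ?h))"
        using Zn by (intro mulu_le[OF order_refl e]) auto
      then have "exp (rv dd / 2 ^ k) * rv Z + rv q * 1 \<le> rv (mulu sh Z (decay sh S ?h) + q)"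
        unfolding rv_add by (simp only: mult.commute mult_1_right mult_1_left add_right_mono)
      moreover have "(rv Z + rv q) * 1 \<le> rv (Z + q)" unfolding rv_add by simp
      moreover have "stA3 k rxy R Rb True (Z + q) (mulu sh Z (decay sh S ?h) + q) = (True, exi, ezi, e1)"
        using s by (simp only: stA2_def True if_True)
      ultimately show ?thesis unfolding mx by blast
    next
      case False
      let ?c = "shr k dd + 1"
      have s': "stA3 k rxy R Rb (?c \<le> S) (mulu sh (grow sh S ?c) (Z + q)) (mulu sh (grow sh S ?c) (Z + q)) = (True, exi, ezi, e1)"
        using s False by (simp add: stA2_def stA3'_def)
      then have c: "?c \<le> S" by (simp add: stA3_def stA4_def stA5_def)
      have d0: "0 \<le> rv dd / 2 ^ k" using False Spos by simp
      have e: "exp (rv dd / 2 ^ k) \<le> rv (grow sh S ?c)"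
        by (rule grow[OF rv_shr(2) _ c]) (use rv_shr(2)[of dd k] d0 in linarith)
      have mx: "max 1 (exp (rv dd / 2 ^ k)) = exp (rv dd / 2 ^ k)" using d0 by simp
      have "0 \<le> rv (Z + q)" unfolding rv_add using Zn q0 by (rule add_nonneg_nonneg)
      then have *: "exp (rv dd / 2 ^ k) * rv (Z + q) \<le> rv (mulu sh (grow sh S ?c) (Z + q))"
        by (rule mulu_le[OF e order_refl exp_ge_zero])
      have "exp (rv dd / 2 ^ k) * rv (Z + q) = (rv Z + rv q) * exp (rv dd / 2 ^ k)"
        "exp (rv dd / 2 ^ k) * rv (Z + q) = exp (rv dd / 2 ^ k) * rv Z + rv q * exp (rv dd / 2 ^ k)"
        unfolding rv_add by (simp_all only: algebra_simps)
      then show ?thesis using s' * unfolding mx eqTrueI[OF c] by metis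
    qed
    then obtain Zm Z1 where s3: "stA3 k rxy R Rb True Zm Z1 = (True, exi, ezi, e1)"
      and Zm: "(rv Z + rv q) * max 1 (exp (rv dd / 2 ^ k)) \<le> rv Zm"
      and Z1: "exp (rv dd / 2 ^ k) * rv Z + rv q * max 1 (exp (rv dd / 2 ^ k)) \<le> rv Z1" by blast
    define v where "v = R + shr k (Zm + rxy) + 1"
    define R1 where "R1 = v + shr (k + 7) (13 * v) + 1"
    have r: "R1 < Rb" "exi = R1 + shr 7 R1 + 1" "ezi = max Zm Z1" "e1 = MA R1 Z1"
      using s3 unfolding stA3_def stA4_def v_def[symmetric] R1_def[symmetric] stA5_def by auto
    have sl: "sqrt (quad (x t - px t) (y t - py t)) \<le> rv R1 \<and> \<bar>z t - pz t\<bar> \<le> rv (max Zm Z1)" if "t \<in> {t0..t1}" for t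
      by (rule I.slow_step(1)[OF r(1) init f_def rv_nonneg[OF Rb0] _ Zm[unfolded dd_def] Z1[unfolded dd_def] v_def R1_def _ _ _ _ that])
         (use inn in \<open>simp_all only: r(2,3) q_def I.zm_def\<close>)
    have sl1: "\<bar>z t1 - pz t1\<bar> \<le> rv Z1"
      by (rule I.slow_step(2)[OF r(1) init f_def rv_nonneg[OF Rb0] _ Zm[unfolded dd_def] Z1[unfolded dd_def] v_def R1_def])
         (use inn in \<open>simp_all only: r(2,3) q_def I.zm_def\<close>)
    have "\<bar>x t - px t\<bar> \<le> rv exi \<and> \<bar>y t - py t\<bar> \<le> rv exi \<and> \<bar>z t - pz t\<bar> \<le> rv ezi" if "t \<in> {t0..t1}" for t
      using quad_bounds(3,4)[where x = "x t - px t" and y = "y t - py t"] sl[OF that] I.bulge[of R1]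
      unfolding r(2,3) by linarith
    moreover have "est_ok t1 u' e1"
      using sl[of t1] sl1 t01 unfolding r(4) res(3) est_ok.simps p1[symmetric] by simp
    ultimately show ?thesis by blast
  next
    case (MV W s Z lam0)
    have s0: "0 < s" and init: "quad (x t0 - px t0) (y t0 - py t0) + (rv s * (z t0 - pz t0))\<^sup>2 \<le> (rv W)\<^sup>2" "0 \<le> rv W"
      using est by (simp_all add: MV u p0)
    define zm where "zm = max zu (- zl)"
    define Wb where "Wb = W + mulu sh W (shr (k + 2) (5 * lam0)) + shr 4 W + shr k (4 * rxy) + shr 14 S + 1"
    define s2 where "s2 = mulu sh s s"
    define g where "g = half (mulu sh s2 (psum zs) - S)"
    define s1 where "s1 = s - mulu sh s g"
    define sx where "sx = (if 0 \<le> g then s else s + mulu sh s (mulu sh g g - g))"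
    define b2 where "b2 = shr (sh + 1) (4 * g * g)"
    define sm where "sm = min s s1"
    define dp where "dp = xu - a - g * 2 ^ k"
    define M0 where "M0 = defect sh S s2 (pmul zs [S, - 2 * g, b2]) + mulu sh (mulu sh s2 zm) (mulu sh \<bar>2 * g\<bar> (b2 + 1) + 1)
        + tenth S + mulu sh sx Wb"
    define M where "M = M0 + shr 7 M0 + 1"
    define lam where "lam = find_lam (tenth S) dp (M * M) sh (shr sh (sm * sm)) (lcands S dp (max 0 dp) (mulu sh M (mulu sh sm (psum zs))))"
    define lh where "lh = shr k lam + 1"
    define W1 where "W1 = mulu sh (grow sh S lh) (W + (shr k (rxy + mulu sh sx rzi) + 1))"
    define r where "r = find_r (S * S) sm (rcands (mulu sh sm (psum zs)))"
    have "stV2 sh S a k xu zs zm rxy rzi W s (psum zs) Wb s2 g = (ok, exi, ezi, e1)"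
      using st by (simp only: MV step.simps stepV_def stV1_def Wb_def s2_def g_def zm_def)
    then have "stV4 sh S k (0 < s1 \<and> \<bar>g\<bar> \<le> half S) W Wb s1 sm (psum zs) (shr k (rxy + mulu sh sx rzi) + 1) dp M0 = (ok, exi, ezi, e1)"
      by (simp only: stV2_def stV3_def s1_def sx_def b2_def sm_def dp_def M0_def)
    then have "stV8 sh ((0 < s1 \<and> \<bar>g\<bar> \<le> half S) \<and> 0 \<le> lam \<and> lh \<le> S) Wb s1 lam r W1 = (ok, exi, ezi, e1)"
      by (simp only: stV4_def stV5_def stV6_def stV7_def M_def lam_def lh_def r_def W1_def)
    then have ok: "0 < s1" "\<bar>g\<bar> \<le> half S" "0 \<le> lam" "lh \<le> S" "0 < r" "W1 < Wb"
      and ex: "exi = W1 + shr 7 W1 + 1" and ez: "ezi = mulu sh W1 r" and e1: "e1 = MV W1 s1 (mulu sh W1 r) lam"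
      using res(1) by (auto simp: stV8_def stV9_def)
    have g2: "\<bar>2 * g\<bar> \<le> S" using ok(2) unfolding half_def by linarith
    note fl = find_lam[of "tenth S" dp "M * M" sh "shr sh (sm * sm)", folded lam_def, OF ok(3)[unfolded lam_def]]
    have fl': "tenth S \<le> lam" "dp \<le> lam" "M * M \<le> 4 * shr sh ((lam - tenth S) * (lam - dp)) * shr sh (sm * sm)"
      using fl unfolding lam_def by blast+
    have fr: "S * S \<le> r * sm" unfolding r_def by (rule find_r) (use ok(5) r_def in simp)
    have pzz: "pz t = pv zs ((t - t0) * 2 ^ k) / S" for t by (simp add: px_py_pz_def th_def)
    note F = I.fast_step[where s = s and g = g, folded s1_def s2_def sx_def b2_def sm_def dp_def, unfolded I.zm_def, folded zm_def,
        OF pzz s0 ok(1) g2 ok(5) fr ok(6) ok(3) ok(4) init M0_def M_def fl' lh_def W1_def ez _ _ _ _]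
    have inn': "- 99 < rv (xl - (W1 + shr 7 W1 + 1))" "rv (xu + (W1 + shr 7 W1 + 1)) < 99"
      "- 99 < rv (zl - ezi)" "rv (zu + ezi) < 99" using inn unfolding ex by auto
    note F1 = F(1)[OF inn'] and F2 = F(2,3)[OF inn']
    have "\<bar>x t - px t\<bar> \<le> rv exi \<and> \<bar>y t - py t\<bar> \<le> rv exi \<and> \<bar>z t - pz t\<bar> \<le> rv ezi" if "t \<in> {t0..t1}" for t
      using quad_bounds(3,4)[where x = "x t - px t" and y = "y t - py t"] F1[OF that] I.bulge[of W1]
      unfolding ex by linarith
    moreover have "est_ok t1 u' e1"
      using F1[of t1] F2 t01 ok(1) unfolding e1 res(3) est_ok.simps p1[symmetric] ez by simp
    ultimately show ?thesis by blast
  qed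
  have "tame b t" if "t \<in> {t0..t1}" for t
  proof -
    have k1: "\<bar>x t - px t\<bar> \<le> rv exi" "\<bar>y t - py t\<bar> \<le> rv exi" "\<bar>z t - pz t\<bar> \<le> rv ezi" using key that by auto
    have r: "rv xl \<le> px t \<and> px t \<le> rv xu" "rv (lo ys) \<le> py t \<and> py t \<le> rv (hi ys)" "rv zl \<le> pz t \<and> pz t \<le> rv zu"
      unfolding xl_xu_zl_zu_def px_py_pz_def using lh[OF that] by auto
    show ?thesis unfolding tame_def res(2) inb.simps rv_diff rv_add
      using k1 r inn unfolding rv_diff rv_add by linarith
  qed
  then show "\<And>t. t \<in> {t0..t0 + 1 / 2 ^ k} \<Longrightarrow> tame b t" by (simp add: t1_def)
  show "est_ok (t0 + 1 / 2 ^ k) u' e'" using key res(4) by (simp add: t1_def)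
qed

end

lemma decreasing_of_negative_rate:
  fixes f :: "real \<Rightarrow> real"
  assumes "a < b" and d: "\<And>t. t \<in> {a..b} \<Longrightarrow> (f has_real_derivative f' t) (at t within {a..b})"
    and n: "\<And>t. t \<in> {a..b} \<Longrightarrow> f' t < 0"
  shows "f b < f a"
proof -
  obtain t where t: "t \<in> {a<..<b}" "f b - f a = f' t * (b - a)"
    using mvt_simple[OF assms(1), of f "\<lambda>t. (*) (f' t)"] d unfolding has_field_derivative_def by auto
  then show ?thesis using n[of t] assms(1) mult_neg_pos[of "f' t" "b - a"] by auto
qed

text \<open>The margin 1/16 outweighs the delayed term: at most 200/10000 in the first two cases,
  and 120/10000 against 1/80 in the last.\<close>

lemma rate_margin:
  fixes y z p q :: real
  assumes "\<bar>p\<bar> \<le> 100" "\<bar>q\<bar> \<le> 100"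
  shows "y + z < - 1/16 \<Longrightarrow> 0 < - y - z + (- p - q) / 10000"
    and "1/16 < y + z \<Longrightarrow> - y - z + (- p - q) / 10000 < 0"
    and "5 * y + z < - 1/16 \<Longrightarrow> y + z / 5 + (p + q / 5) / 10000 < 0"
  using assms unfolding abs_le_iff add_divide_distrib diff_divide_distrib by linarith+

lemma slot_exists:
  assumes "0 < n" "0 \<le> s" "s \<le> real n / 64"
  shows "\<exists>i<n. real i / 64 \<le> s \<and> s \<le> (real i + 1) / 64"
  using assms
proof (induction n)
  case (Suc n)
  show ?case
  proof (cases "n > 0 \<and> s \<le> real n / 64")
    case True
    then show ?thesis using Suc less_Suc_eq by blast
  next
    case False
    then show ?thesis using Suc.prems by (intro exI[of _ n]) (auto simp: add.commute)
  qed
qed simp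

text \<open>32 slots make up the delay 1/2: with so long a phase \<open>PG\<close>, the whole
  history at the return in \<open>PE\<close> has been compared with the box of admissible
  histories.\<close>

definition cert :: "par \<Rightarrow> state \<Rightarrow> cmd list \<Rightarrow> cmd list \<Rightarrow> cmd list \<Rightarrow> cmd list \<Rightarrow> cmd list \<Rightarrow> cmd list \<Rightarrow> cmd list \<Rightarrow> bool" where
  "cert P st A B C D G E F \<longleftrightarrow> run P (A @ B @ C @ D @ G @ E @ F) (Some st) \<and>
     only PA A \<and> only PB B \<and> only PC C \<and> only PD D \<and> only PG G \<and> only PE E \<and> only PF F \<and>
     0 < slots A \<and> 0 < slots B \<and> 0 < slots C \<and> 0 < slots D \<and> 32 \<le> slots G \<and> 0 < slots E \<and> 0 < slots F"

context clamped_dde begin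

definition xd where "xd t = - y t - z t + (- y (t - 1/2) - z (t - 1/2)) / 10000" for t
definition yd where "yd t = x t + y t / 5 + (x (t - 1/2) + y (t - 1/2) / 5) / 10000" for t

lemma dx: "0 \<le> a \<Longrightarrow> t \<in> {a..b} \<Longrightarrow> (x has_real_derivative xd t) (at t within {a..b})"
  unfolding xd_def by (rule has_field_derivative_subset[OF x']) auto

lemma dy: "0 \<le> a \<Longrightarrow> t \<in> {a..b} \<Longrightarrow> (y has_real_derivative yd t) (at t within {a..b})"
  unfolding yd_def by (rule has_field_derivative_subset[OF y']) auto

end

context traj begin

definition inv :: "real \<Rightarrow> state \<Rightarrow> bool" where
  "inv t0 st \<longleftrightarrow> (case st of (bs, u, e) \<Rightarrow> length bs = 32 \<and> est_ok t0 u e \<and>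
     (\<forall>i<32. \<forall>t\<in>{t0 - 1/2 + real i / 64..t0 - 1/2 + (real i + 1) / 64}. tame (bs ! i) t))"

lemma tame_bhull: "tame b t \<or> tame c t \<Longrightarrow> tame (bhull b c) t"
proof -
  obtain a1 a2 a3 a4 a5 a6 where b: "b = ((a1,a2),(a3,a4),(a5,a6))" by (metis prod.exhaust)
  obtain c1 c2 c3 c4 c5 c6 where c: "c = ((c1,c2),(c3,c4),(c5,c6))" by (metis prod.exhaust)
  have mm: "rv p \<le> v \<or> rv q \<le> v \<Longrightarrow> rv (min p q) \<le> v" "v \<le> rv p \<or> v \<le> rv q \<Longrightarrow> v \<le> rv (max p q)" for p q v
    by (metis min.cobounded1 min.cobounded2 rv_mono order_trans, metis max.cobounded1 max.cobounded2 rv_mono order_trans)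
  assume "tame b t \<or> tame c t"
  then show ?thesis unfolding b c tame_def bhull.simps inb.simps by (blast intro: mm)
qed

lemma takeh_sound:
  "takeh m h bs = (d, bs') \<Longrightarrow> m \<le> length bs \<Longrightarrow>
    bs' = drop m bs \<and> (\<forall>t. tame h t \<or> (\<exists>i<m. tame (bs ! i) t) \<longrightarrow> tame d t)"
proof (induction m arbitrary: h bs)
  case (Suc m)
  then obtain b bs1 where bs: "bs = b # bs1" by (cases bs) auto
  have IH: "bs' = drop m bs1 \<and> (\<forall>t. tame (bhull h b) t \<or> (\<exists>i<m. tame (bs1 ! i) t) \<longrightarrow> tame d t)"
    by (rule Suc.IH) (use Suc.prems bs in auto)
  have "tame d t" if "tame h t \<or> (\<exists>i<Suc m. tame (bs ! i) t)" for t
  proof -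
    have "tame h t \<or> tame b t \<or> (\<exists>i<m. tame (bs1 ! i) t)"
      using that unfolding bs by (metis less_Suc_eq_0_disj nth_Cons_0 nth_Cons_Suc)
    then show ?thesis using IH tame_bhull by blast
  qed
  then show ?case using IH bs by simp
qed simp

text \<open>The hull of the \<open>m + 1\<close> oldest slots encloses the delayed values during the
  step. These slots then leave the window, and \<open>m + 1\<close> copies of the new enclosure join
  it.\<close>

lemma step_sound:
  assumes I: "inv t0 (bs, u, e)" and t0: "0 \<le> t0" and ex: "exec (Par sh S a sp) (Step k m p) (bs, u, e) = Some st"
  shows "inv (t0 + real (Suc m) / 64) st" "\<And>t. t \<in> {t0..t0 + real (Suc m) / 64} \<Longrightarrow> \<exists>b. phase_ok sp p b \<and> tame b t"
proof -
  have ok: "okstep k m" using ex by (auto split: if_splits)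
  then have k: "3 \<le> k" "1 / 2 ^ k = real (Suc m) / 64" "Suc m \<le> 32" by (auto simp: okstep_def)
  have len: "length bs = 32" and est: "est_ok t0 u e"
    and sl: "\<And>i t. i < 32 \<Longrightarrow> t \<in> {t0 - 1/2 + real i / 64..t0 - 1/2 + (real i + 1) / 64} \<Longrightarrow> tame (bs ! i) t"
    using I by (auto simp: inv_def)
  obtain b0 bs0 where bs: "bs = b0 # bs0" using len by (cases bs) auto
  obtain d bs1 where tk: "takeh m (hd bs) (tl bs) = (d, bs1)" by (metis prod.exhaust)
  have tk': "bs1 = drop (Suc m) bs" "\<And>t. \<exists>i<Suc m. tame (bs ! i) t \<Longrightarrow> tame d t"
  proof -
    have *: "bs1 = drop m bs0 \<and> (\<forall>t. tame b0 t \<or> (\<exists>i<m. tame (bs0 ! i) t) \<longrightarrow> tame d t)"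
      by (rule takeh_sound) (use tk bs len k in auto)
    then show "bs1 = drop (Suc m) bs" by (simp add: bs)
    show "\<exists>i<Suc m. tame (bs ! i) t \<Longrightarrow> tame d t" for t
      using * unfolding bs by (metis less_Suc_eq_0_disj nth_Cons_0 nth_Cons_Suc)
  qed
  obtain okf b u' e' where en: "enc sh S a k d u e = (okf, b, u', e')" by (metis prod.exhaust)
  have r: "okf" "phase_ok sp p b" "st = (bs1 @ replicate (Suc m) b, u', e')"
  proof -
    have c: "q \<and> w = v" if "chk q v = Some w" for q and v w :: state using that by (cases q) auto
    have "chk (okf \<and> phase_ok sp p b) (bs1 @ replicate (Suc m) b, u', e') = Some st"
      using ex by (simp only: exec.simps ok if_True tk exec1.simps exec2.simps en)
    from c[OF this] show "okf" "phase_ok sp p b" "st = (bs1 @ replicate (Suc m) b, u', e')" by auto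
  qed
  have dt: "tame d t" if tt: "t \<in> {t0 - 1/2..t0 - 1/2 + 1 / 2 ^ k}" for t
  proof (rule tk'(2))
    obtain i where i: "i < Suc m" "real i / 64 \<le> t - t0 + 1/2" "t - t0 + 1/2 \<le> (real i + 1) / 64"
    proof -
      have "0 \<le> t - t0 + 1/2" "t - t0 + 1/2 \<le> real (Suc m) / 64" using tt unfolding k(2) atLeastAtMost_iff by linarith+
      from slot_exists[OF zero_less_Suc this] show thesis using that by blast
    qed
    have "t \<in> {t0 - 1/2 + real i / 64..t0 - 1/2 + (real i + 1) / 64}"
      unfolding atLeastAtMost_iff using i(2,3) by (intro conjI) linarith+
    then have "tame (bs ! i) t" using k(3) i(1) by (intro sl) linarith+
    then show "\<exists>i<Suc m. tame (bs ! i) t" using i by blast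
  qed
  note en' = en[unfolded eqTrueI[OF r(1)]]
  have bt: "tame b t" if "t \<in> {t0..t0 + real (Suc m) / 64}" for t
    by (rule enc_sound(1)[OF en' k(1) t0 est dt, unfolded k(2)]) (use that in auto)
  have "est_ok (t0 + real (Suc m) / 64) u' e'"
    by (rule enc_sound(2)[OF en' k(1) t0 est dt, unfolded k(2)])
  moreover have "tame ((bs1 @ replicate (Suc m) b) ! i) t"
    if i: "i < 32" and t: "t \<in> {t0 + real (Suc m) / 64 - 1/2 + real i / 64..t0 + real (Suc m) / 64 - 1/2 + (real i + 1) / 64}" for i t
  proof (cases "i < 32 - Suc m")
    case True
    then have "(bs1 @ replicate (Suc m) b) ! i = bs ! (Suc m + i)" using len k(3) by (simp add: tk'(1) nth_append)
    moreover have "tame (bs ! (Suc m + i)) t" using True t by (intro sl) (auto simp: field_simps)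
    ultimately show ?thesis by simp
  next
    case False
    then have "(bs1 @ replicate (Suc m) b) ! i = b" using len k(3) i by (simp add: tk'(1) nth_append del: replicate_Suc)
    moreover have "tame b t"
    proof (rule bt)
      have "32 - real (Suc m) \<le> real i" "real i + 1 \<le> 32" using False i k(3) by linarith+
      then show "t \<in> {t0..t0 + real (Suc m) / 64}" using t by (auto simp: field_simps)
    qed
    ultimately show ?thesis by simp
  qed
  ultimately show "inv (t0 + real (Suc m) / 64) st" using len k(3) by (simp add: inv_def r(3) tk'(1))
  show "\<And>t. t \<in> {t0..t0 + real (Suc m) / 64} \<Longrightarrow> \<exists>b. phase_ok sp p b \<and> tame b t" using bt r(2) by blast
qed

text \<open>The squares of the two old bounds are added; the test in \<open>exec\<close> is this sum
  against W^2, multiplied by S^4 to remain among the integers.\<close>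

lemma ToV_sound:
  assumes I: "inv t0 st0" and ex: "exec (Par sh S a sp) (ToV W s) st0 = Some st"
  shows "inv t0 st"
proof -
  obtain bs u1 u2 u3 e where st0: "st0 = (bs, (u1, u2, u3), e)" by (metis prod.exhaust)
  show ?thesis
  proof (cases e)
    case (MA R Z)
    let ?c = "0 \<le> W \<and> 0 < s \<and> S * S * R * R + s * s * Z * Z \<le> S * S * W * W"
    have c: ?c using ex unfolding st0 MA by (cases ?c) (auto simp del: of_int_mult)
    then have st: "st = (bs, (u1, u2, u3), MV W s Z (2 * S))" using ex unfolding st0 MA by simp
    let ?q = "quad (x t0 - rv u1) (y t0 - rv u2)"
    have est: "sqrt ?q \<le> rv R" "\<bar>z t0 - rv u3\<bar> \<le> rv Z" using I by (auto simp: inv_def st0 MA)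
    have "0 \<le> sqrt ?q" by (simp add: quad_nonneg)
    then have q: "?q \<le> (rv R)\<^sup>2" using est(1) quad_nonneg[of "x t0 - rv u1" "y t0 - rv u2"]
      by (metis power_mono real_sqrt_pow2)
    have zz: "(z t0 - rv u3)\<^sup>2 \<le> (rv Z)\<^sup>2" using est(2) by (metis abs_ge_zero power2_abs power_mono)
    have "?q + (rv s * (z t0 - rv u3))\<^sup>2 \<le> (rv R)\<^sup>2 + (rv s)\<^sup>2 * (rv Z)\<^sup>2"
      unfolding power_mult_distrib by (intro add_mono q mult_left_mono zz) simp
    also have "\<dots> = real_of_int (S * S * R * R + s * s * Z * Z) / (S * S * S * S)"
      using Spos by (simp add: power2_eq_square field_simps)
    also have "\<dots> \<le> real_of_int (S * S * W * W) / (S * S * S * S)"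
      by (rule divide_right_mono) (use c Spos in \<open>simp_all only: of_int_le_iff zero_le_mult_iff, auto\<close>)
    also have "\<dots> = (rv W)\<^sup>2" using Spos by (simp add: power2_eq_square field_simps)
    finally show ?thesis using I c Spos unfolding st st0 MA by (auto simp: inv_def)
  qed (use ex st0 in simp)
qed

lemma ToA_sound:
  assumes I: "inv t0 st0" and ex: "exec (Par sh S a sp) ToA st0 = Some st"
  shows "inv t0 st"
proof -
  obtain bs u1 u2 u3 e where st0: "st0 = (bs, (u1, u2, u3), e)" by (metis prod.exhaust)
  show ?thesis
  proof (cases e)
    case (MV W s Z lam)
    have st: "st = (bs, (u1, u2, u3), MA W Z)" using ex unfolding st0 MV by simp
    let ?q = "quad (x t0 - rv u1) (y t0 - rv u2)"
    have est: "?q + (rv s * (z t0 - rv u3))\<^sup>2 \<le> (rv W)\<^sup>2" "0 \<le> rv W" using I by (auto simp: inv_def st0 MV)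
    have "?q \<le> (rv W)\<^sup>2" using est(1) zero_le_power2[of "rv s * (z t0 - rv u3)"] by linarith
    then have "sqrt ?q \<le> rv W" by (rule real_le_lsqrt[OF est(2)])
    then show ?thesis using I unfolding st st0 MV by (auto simp: inv_def)
  qed (use ex st0 in simp)
qed

lemma run_sound:
  assumes "run (Par sh S a sp) (cs @ cs') (Some st)" "only p cs" "inv t0 st" "0 \<le> t0"
  shows "\<exists>st'. run (Par sh S a sp) cs' (Some st') \<and> inv (t0 + real (slots cs) / 64) st' \<and>
    (0 < slots cs \<longrightarrow> (\<forall>t\<in>{t0..t0 + real (slots cs) / 64}. \<exists>b. phase_ok sp p b \<and> tame b t))"
  using assms
proof (induction cs arbitrary: st t0)
  case (Cons c cs)
  obtain st1 where st1: "exec (Par sh S a sp) c st = Some st1" "run (Par sh S a sp) (cs @ cs') (Some st1)"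
    using Cons.prems(1) by (cases "exec (Par sh S a sp) c st") auto
  obtain bs u e where st: "st = (bs, u, e)" by (metis prod.exhaust)
  show ?case
  proof (cases c)
    case (Step k m q)
    have q: "q = p" "only p cs" using Cons.prems(2) Step by auto
    note s = step_sound[OF Cons.prems(3)[unfolded st] Cons.prems(4) st1(1)[unfolded st Step q(1)]]
    obtain st' where st': "run (Par sh S a sp) cs' (Some st')" "inv (t0 + real (Suc m) / 64 + real (slots cs) / 64) st'"
        "0 < slots cs \<longrightarrow> (\<forall>t\<in>{t0 + real (Suc m) / 64..t0 + real (Suc m) / 64 + real (slots cs) / 64}. \<exists>b. phase_ok sp p b \<and> tame b t)"
      using Cons.IH[OF st1(2) q(2) s(1)] Cons.prems(4) by auto
    have slc: "slots (c # cs) = Suc m + slots cs" by (simp add: Step)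
    have e: "t0 + real (Suc m) / 64 + real (slots cs) / 64 = t0 + real (slots (c # cs)) / 64" unfolding slc by (simp add: field_simps)
    have "\<exists>b. phase_ok sp p b \<and> tame b t" if "t \<in> {t0..t0 + real (slots (c # cs)) / 64}" for t
    proof (cases "t \<le> t0 + real (Suc m) / 64")
      case True then show ?thesis using s(2) that by auto
    next
      case False
      then have "0 < slots cs" using that slc by (cases "slots cs = 0") auto
      then show ?thesis using st'(3) that False unfolding e by auto
    qed
    then show ?thesis using st' unfolding e by blast
  next
    case (ToV W s)
    then show ?thesis using Cons.IH[OF st1(2) _ ToV_sound[OF Cons.prems(3) st1(1)[unfolded ToV]] Cons.prems(4)] Cons.prems(2) by simp
  next
    case ToA
    then show ?thesis using Cons.IH[OF st1(2) _ ToA_sound[OF Cons.prems(3) st1(1)[unfolded ToA]] Cons.prems(4)] Cons.prems(2) by simp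
  qed
next
  case Nil
  then show ?case by (intro exI[of _ st]) auto
qed

definition zband :: "ivl \<Rightarrow> real \<Rightarrow> bool" where "zband b v \<longleftrightarrow> rv (fst b) \<le> v \<and> v \<le> rv (snd b)"

lemma tube:
  assumes ce: "cert (Par sh S a (Spec T h zb1 zb2 l2 xr)) (replicate 32 h, u, e) A B C D G E F"
    and T: "16 * T = S" and h: "\<And>t. t \<in> {-1/2..0} \<Longrightarrow> tame h t" and est: "est_ok 0 u e" and y0: "y 0 = 0"
  obtains tE tF c where "1/2 \<le> tE" "tE < tF" "tF \<le> real (slots (A @ B @ C @ D @ G @ E @ F)) / 64" "0 < c" "c < tE" "x c = 0" "0 < xd c"
    and "\<And>s. s \<in> {0..tF} \<Longrightarrow> x s = 0 \<Longrightarrow> 0 < xd s \<Longrightarrow> s = c"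
    and "0 < y tE" "y tF < 0" "\<And>s. s \<in> {tE..tF} \<Longrightarrow> yd s < 0" "\<And>s. s \<in> {tE..tF} \<Longrightarrow> x s < 0"
    and "\<And>s. s \<in> {0<..tE} \<Longrightarrow> x s < 0 \<Longrightarrow> y s \<noteq> 0"
    and "\<And>s. s \<in> {tE - 1/2..tF} \<Longrightarrow> inb h (x s) (y s) (z s)"
    and "\<And>s. s \<in> {tE..tF} \<Longrightarrow> zband xr (x s)" "\<And>s. s \<in> {tE..tF} \<Longrightarrow> zband zb1 (z s)"
    and "\<And>s. s \<in> {tE..tF} \<Longrightarrow> x s \<le> - rv l2 \<Longrightarrow> zband zb2 (z s)"
    and "\<And>s. s \<in> {-1/2..tF} \<Longrightarrow> \<bar>x s\<bar> \<le> 100 \<and> \<bar>y s\<bar> \<le> 100 \<and> \<bar>z s\<bar> \<le> 100"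
proof -
  let ?sp = "Spec T h zb1 zb2 l2 xr"
  let ?P = "Par sh S a ?sp"
  have ru: "run ?P (A @ B @ C @ D @ G @ E @ F) (Some (replicate 32 h, u, e))"
    and on: "only PA A" "only PB B" "only PC C" "only PD D" "only PG G" "only PE E" "only PF F"
    and sl: "0 < slots A" "0 < slots B" "0 < slots C" "0 < slots D" "32 \<le> slots G" "0 < slots E" "0 < slots F"
    using ce by (auto simp: cert_def)
  have iv: "inv 0 (replicate 32 h, u, e)"
    unfolding inv_def prod.case
  proof (intro conjI allI impI ballI)
    fix i :: nat and t assume i: "i < 32" and t: "t \<in> {0 - 1/2 + real i / 64..0 - 1/2 + (real i + 1) / 64}"
    have i32: "real i + 1 \<le> 32" using i by linarith
    have h64: "0 \<le> real i / 64" "(real i + 1) / 64 \<le> 1/2" using i32 by simp_all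
    have "- 1/2 \<le> t" "t \<le> 0"
      using h64 t[unfolded atLeastAtMost_iff, THEN conjunct1] t[unfolded atLeastAtMost_iff, THEN conjunct2] by linarith+
    then have "t \<in> {-1/2..0}" by simp
    then show "tame (replicate 32 h ! i) t" using i by (simp add: h)
  qed (use est in auto)
  define tA where "tA = real (slots A) / 64"
  define tB where "tB = tA + real (slots B) / 64"
  define tC where "tC = tB + real (slots C) / 64"
  define tD where "tD = tC + real (slots D) / 64"
  define tG where "tG = tD + real (slots G) / 64"
  define tE where "tE = tG + real (slots E) / 64"
  define tF where "tF = tE + real (slots F) / 64"
  have tm: "0 < tA" "tA < tB" "tB < tC" "tC < tD" "tD + 1/2 \<le> tG" "tG < tE" "tE < tF"
    using sl by (auto simp: tA_def tB_def tC_def tD_def tG_def tE_def tF_def)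
  obtain sA where sA: "run ?P (B @ C @ D @ G @ E @ F) (Some sA)" "inv tA sA" "\<forall>t\<in>{0..tA}. \<exists>b. phase_ok ?sp PA b \<and> tame b t"
    using run_sound[OF ru on(1) iv] sl(1) by (auto simp: tA_def)
  obtain sB where sB: "run ?P (C @ D @ G @ E @ F) (Some sB)" "inv tB sB" "\<forall>t\<in>{tA..tB}. \<exists>b. phase_ok ?sp PB b \<and> tame b t"
    using run_sound[OF sA(1) on(2) sA(2)] sl(2) tm by (auto simp: tB_def)
  obtain sC where sC: "run ?P (D @ G @ E @ F) (Some sC)" "inv tC sC" "\<forall>t\<in>{tB..tC}. \<exists>b. phase_ok ?sp PC b \<and> tame b t"
    using run_sound[OF sB(1) on(3) sB(2)] sl(3) tm by (auto simp: tC_def)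
  obtain sD where sD: "run ?P (G @ E @ F) (Some sD)" "inv tD sD" "\<forall>t\<in>{tC..tD}. \<exists>b. phase_ok ?sp PD b \<and> tame b t"
    using run_sound[OF sC(1) on(4) sC(2)] sl(4) tm by (auto simp: tD_def)
  obtain sG where sG: "run ?P (E @ F) (Some sG)" "inv tG sG" "\<forall>t\<in>{tD..tG}. \<exists>b. phase_ok ?sp PG b \<and> tame b t"
    using run_sound[OF sD(1) on(5) sD(2)] sl(5) tm by (auto simp: tG_def)
  obtain sE where sE: "run ?P F (Some sE)" "inv tE sE" "\<forall>t\<in>{tG..tE}. \<exists>b. phase_ok ?sp PE b \<and> tame b t"
    using run_sound[OF sG(1) on(6) sG(2)] sl(6) tm by (auto simp: tE_def)
  have sF: "\<forall>t\<in>{tE..tF}. \<exists>b. phase_ok ?sp PF b \<and> tame b t"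
    using run_sound[of ?sp F "[]", OF _ on(7) sE(2)] sE(1) sl(7) tm by (auto simp: tF_def)
  have Tr: "rv T = 1 / 16"
  proof -
    have "16 * real_of_int T = real_of_int S" using T by linarith
    then show ?thesis using Spos by (simp add: field_simps)
  qed
  have rvT: "rv (- T) = - (1 / 16)" using Tr by simp
  have r5: "rv (5 * p + q) = 5 * rv p + rv q" for p q by (simp add: add_divide_distrib)
  have lt: "rv v < rv w" if "v < w" for v w using that Spos by (simp add: divide_strict_right_mono)
  have pA: "x t < - 1/16 \<and> 5 * x t + y t < - 1/16" if "t \<in> {0..tA}" for t
  proof -
    obtain b where b: "phase_ok ?sp PA b" "tame b t" using sA(3) \<open>t \<in> {0..tA}\<close> by blast
    obtain xl xu yl yu zl zu where e: "b = ((xl,xu),(yl,yu),(zl,zu))" by (metis prod.exhaust)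
    have "xu < - T" "5 * xu + yu < - T" using b(1) e by auto
    from this[THEN lt] b(2) show ?thesis unfolding e tame_def inb.simps rvT r5 by (intro conjI) linarith+
  qed
  have pB: "y t < 0 \<and> y t + z t < - 1/16" if "t \<in> {tA..tB}" for t
  proof -
    obtain b where b: "phase_ok ?sp PB b" "tame b t" using sB(3) \<open>t \<in> {tA..tB}\<close> by blast
    obtain xl xu yl yu zl zu where e: "b = ((xl,xu),(yl,yu),(zl,zu))" by (metis prod.exhaust)
    have "yu < - T" "yu + zu < - T" using b(1) e by auto
    from this[THEN lt] b(2) show ?thesis unfolding e tame_def inb.simps rvT rv_add by (intro conjI) linarith+
  qed
  have pC: "0 < x t" if "t \<in> {tB..tC}" for t
  proof -
    obtain b where b: "phase_ok ?sp PC b" "tame b t" using sC(3) \<open>t \<in> {tB..tC}\<close> by blast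
    obtain xl xu yl yu zl zu where e: "b = ((xl,xu),(yl,yu),(zl,zu))" by (metis prod.exhaust)
    have "0 < xl" using b(1) e by auto
    from this[THEN lt] b(2) show ?thesis unfolding e tame_def by simp
  qed
  have pD: "0 < y t \<and> 1/16 < y t + z t" if tt: "t \<in> {tC..tG}" for t
  proof -
    obtain b where b: "phase_ok ?sp PD b \<or> phase_ok ?sp PG b" "tame b t"
    proof (cases "t \<le> tD")
      case True
      then have "t \<in> {tC..tD}" using tt by simp
      then show thesis using sD(3) that by blast
    next
      case False
      then have "t \<in> {tD..tG}" using tt by simp
      then show thesis using sG(3) that by blast
    qed
    obtain xl xu yl yu zl zu where e: "b = ((xl,xu),(yl,yu),(zl,zu))" by (metis prod.exhaust)
    have "T < yl" "T < yl + zl" using b(1) e by auto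
    from this[THEN lt] b(2) show ?thesis unfolding e tame_def inb.simps Tr rv_add by (intro conjI) linarith+
  qed
  have sub: "rv c \<le> rv p \<and> rv q \<le> rv d" if "sub (p, q) (c, d)" for p q c d using that by (simp add: rv_mono)
  have hin: "inb h (x t) (y t) (z t)" if "in_hist h b" "tame b t" for b t
  proof -
    obtain xl xu yl yu zl zu where e: "b = ((xl,xu),(yl,yu),(zl,zu))" by (metis prod.exhaust)
    obtain h1 h2 h3 h4 h5 h6 where h': "h = ((h1,h2),(h3,h4),(h5,h6))" by (metis prod.exhaust)
    have "sub (xl,xu) (h1,h2)" "sub (yl,yu) (h3,h4)" "sub (zl,zu) (h5,h6)" using that(1) unfolding e h' by auto
    from this[THEN sub] that(2) show ?thesis unfolding e h' tame_def by simp
  qed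
  have pG: "inb h (x t) (y t) (z t)" if "t \<in> {tD..tG}" for t
  proof -
    obtain b where b: "phase_ok ?sp PG b" "tame b t" using sG(3) \<open>t \<in> {tD..tG}\<close> by blast
    then show ?thesis by (intro hin[OF _ b(2)]) (cases b rule: prod_cases3, auto elim!: phase_ok.elims)
  qed
  have pE: "x t < 0" "5 * x t + y t < - 1/16" "inb h (x t) (y t) (z t)" "zband xr (x t)" "zband zb1 (z t)"
      "x t \<le> - rv l2 \<Longrightarrow> zband zb2 (z t)" if "t \<in> {tG..tE}" for t
  proof -
    obtain b where b: "phase_ok ?sp PE b" "tame b t" using sE(3) \<open>t \<in> {tG..tE}\<close> by blast
    obtain xl xu yl yu zl zu where e: "b = ((xl,xu),(yl,yu),(zl,zu))" by (metis prod.exhaust)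
    have p: "xu < - T" "5 * xu + yu < - T" using b(1) e by auto
    have q: "sub (xl,xu) (fst xr, snd xr)" "sub (zl,zu) (fst zb1, snd zb1)" using b(1) e by auto
    note t = b(2)[unfolded e tame_def, simplified]
    show "x t < 0" "5 * x t + y t < - 1/16" using p[THEN lt] b(2) unfolding e tame_def inb.simps rvT r5 by linarith+
    show "inb h (x t) (y t) (z t)" using b e by (intro hin[OF _ b(2)]) auto
    show "zband xr (x t)" "zband zb1 (z t)" using q[THEN sub] t unfolding zband_def by auto
    assume "x t \<le> - rv l2"
    have "\<not> - l2 < xl"
    proof
      assume "- l2 < xl"
      from lt[OF this] t \<open>x t \<le> - rv l2\<close> show False by simp
    qed
    then have "sub (zl,zu) (fst zb2, snd zb2)" using b(1) e by auto
    from sub[OF this] t show "zband zb2 (z t)" unfolding zband_def by auto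
  qed
  have yF: "y tE < 0"
  proof -
    obtain b where b: "phase_ok ?sp PF b" "tame b tE" using sF tm by fastforce
    obtain xl xu yl yu zl zu where e: "b = ((xl,xu),(yl,yu),(zl,zu))" by (metis prod.exhaust)
    have "yu < 0" using b(1) e by auto
    from this[THEN lt] b(2) show ?thesis unfolding e tame_def by simp
  qed
  have bd: "\<bar>x t\<bar> \<le> 100 \<and> \<bar>y t\<bar> \<le> 100 \<and> \<bar>z t\<bar> \<le> 100" if tt: "t \<in> {-1/2..tE}" for t
  proof -
    have "t \<in> {-1/2..0} \<or> t \<in> {0..tA} \<or> t \<in> {tA..tB} \<or> t \<in> {tB..tC} \<or> t \<in> {tC..tD} \<or> t \<in> {tD..tG} \<or> t \<in> {tG..tE}"
      using tt unfolding atLeastAtMost_iff by linarith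
    then have "\<exists>b. tame b t" using h sA(3) sB(3) sC(3) sD(3) sG(3) sE(3) by (elim disjE) blast+
    then show ?thesis by (auto simp: tame_def)
  qed
  have bd': "\<bar>x (t - 1/2)\<bar> \<le> 100 \<and> \<bar>y (t - 1/2)\<bar> \<le> 100 \<and> \<bar>z (t - 1/2)\<bar> \<le> 100" if "t \<in> {0..tE}" for t
    using that by (intro bd) auto
  have ydA: "yd t < 0" if "t \<in> {0..tA} \<or> t \<in> {tG..tE}" for t
  proof -
    have t: "t \<in> {0..tE}" using that tm by auto
    have "5 * x t + y t < - 1/16" using pA[of t] pE(2)[of t] that by blast
    moreover have "\<bar>x (t - 1/2)\<bar> \<le> 100" "\<bar>y (t - 1/2)\<bar> \<le> 100" using bd'[OF t] by blast+
    ultimately show ?thesis unfolding yd_def by (intro rate_margin(3))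
  qed
  have xdB: "0 < xd t" if "t \<in> {tA..tB}" for t
  proof -
    have t: "t \<in> {0..tE}" using that tm by auto
    moreover have "\<bar>y (t - 1/2)\<bar> \<le> 100" "\<bar>z (t - 1/2)\<bar> \<le> 100" using bd'[OF t] by blast+
    ultimately show ?thesis using pB[OF that, THEN conjunct2] unfolding xd_def by (intro rate_margin(1))
  qed
  have xdD: "xd t < 0" if "t \<in> {tC..tG}" for t
  proof -
    have t: "t \<in> {0..tE}" using that tm by auto
    moreover have "\<bar>y (t - 1/2)\<bar> \<le> 100" "\<bar>z (t - 1/2)\<bar> \<le> 100" using bd'[OF t] by blast+
    ultimately show ?thesis using pD[OF that, THEN conjunct2] unfolding xd_def by (intro rate_margin(2))
  qed
  have cx: "continuous_on {tA..tB} x"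
    by (rule DERIV_continuous_on[OF dx]) (use tm in auto)
  \<comment> \<open>x is negative at the end of \<open>PA\<close>, positive at the beginning of
    \<open>PC\<close> and increasing in between.\<close>
  obtain c where c: "tA \<le> c" "c \<le> tB" "x c = 0"
    using IVT'[of x tA 0 tB] cx pA[of tA] pC[of tB] tm by auto
  have incr: "x r < x s" if "tA \<le> r" "r < s" "s \<le> tB" for r s
  proof -
    have r0: "0 \<le> r" using that tm by linarith
    have "- x s < - x r"
      by (rule decreasing_of_negative_rate[where f = "\<lambda>t. - x t" and f' = "\<lambda>t. - xd t"])
         (use that xdB in \<open>auto intro!: DERIV_minus dx[OF r0]\<close>)
    then show ?thesis by simp
  qed
  show thesis
  \<comment> \<open>The times called \<open>tE\<close> and \<open>tF\<close> in the statement are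
    the two ends of phase \<open>PE\<close>, which are named \<open>tG\<close> and \<open>tE\<close>
    inside this proof.\<close>
  proof (rule that)
    show "1/2 \<le> tG" using tm by simp
    show "tG < tE" by (rule tm)
    show "tE \<le> real (slots (A @ B @ C @ D @ G @ E @ F)) / 64"
    proof -
      have "slots (cs @ ds) = slots cs + slots ds" for cs ds by (induction cs rule: slots.induct) auto
      then show ?thesis by (simp add: tA_def tB_def tC_def tD_def tG_def tE_def add_divide_distrib)
    qed
    show "0 < c" "c < tG" "x c = 0" using c tm by auto
    show "0 < xd c" using xdB c by simp
    show "s = c" if "s \<in> {0..tE}" "x s = 0" "0 < xd s" for s
    proof -
      \<comment> \<open>In all other phases x has a strict sign or decreases.\<close>
      have "s \<in> {tA..tB}"
      proof (rule ccontr)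
        assume "s \<notin> {tA..tB}"
        then consider "s \<in> {0..tA}" | "s \<in> {tB..tC}" | "s \<in> {tC..tG}" | "s \<in> {tG..tE}" using \<open>s \<in> {0..tE}\<close> by fastforce
        then show False using pA[of s] pC[of s] xdD[of s] pE(1)[of s] that(2,3) by cases auto
      qed
      then show ?thesis using incr[of s c] incr[of c s] c that(2) by (cases s c rule: linorder_cases) auto
    qed
    show "0 < y tG" using pD[of tG] tm by auto
    show "y tE < 0" by (rule yF)
    show "yd s < 0" if "s \<in> {tG..tE}" for s using ydA that by blast
    show "x s < 0" if "s \<in> {tG..tE}" for s using pE(1) that by blast
    show "y s \<noteq> 0" if s: "s \<in> {0<..tG}" "x s < 0" for s
    proof -
      \<comment> \<open>In turn: y has decreased from 0, y is negative, x is positive, y is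
        positive.\<close>
      consider "s \<in> {0<..tA}" | "s \<in> {tA..tB}" | "s \<in> {tB..tC}" | "s \<in> {tC..tG}" using s by fastforce
      then show ?thesis
      proof cases
        case 1
        have "y s < y 0" by (rule decreasing_of_negative_rate[where f' = yd]) (use 1 ydA in \<open>auto intro!: dy\<close>)
        then show ?thesis using y0 by simp
      qed (use pB[of s] pC[of s] pD[of s] s in auto)
    qed
    show "inb h (x s) (y s) (z s)" if "s \<in> {tG - 1/2..tE}" for s
    proof -
      have "s \<in> {tD..tG} \<or> s \<in> {tG..tE}" using that tm by auto
      then show ?thesis using pG pE(3) by blast
    qed
    show "zband xr (x s)" "zband zb1 (z s)" if "s \<in> {tG..tE}" for s using pE(4,5)[OF that] by auto
    show "zband zb2 (z s)" if "s \<in> {tG..tE}" "x s \<le> - rv l2" for s by (rule pE(6)[OF that])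
    show "\<bar>x s\<bar> \<le> 100 \<and> \<bar>y s\<bar> \<le> 100 \<and> \<bar>z s\<bar> \<le> 100" if "s \<in> {-1/2..tE}" for s by (rule bd[OF that])
  qed
qed

end

section \<open>Existence and continuous dependence for delay equations\<close>

text \<open>Integrating something of size c exp (M s) gains the factor 1 / M. This is the mechanism
  of exponentially weighted norms, used below for continuous dependence and for existence.\<close>

lemma exp_weight_bound:
  fixes f :: "real \<Rightarrow> 'a::real_normed_vector"
  assumes t: "0 \<le> t" and M: "0 < M"
    and f: "\<And>s. s \<in> {0..t} \<Longrightarrow> (f has_vector_derivative f' s) (at s within {0..t})"
    and b: "\<And>s. s \<in> {0..t} \<Longrightarrow> norm (f' s) \<le> c * exp (M * s) + r"
  shows "norm (f t - f 0) \<le> c / M * (exp (M * t) - 1) + r * t"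
proof (cases "t = 0")
  case False
  define g where "g s = c / M * exp (M * s) + r * s" for s
  have g: "(g has_vector_derivative (c * exp (M * s) + r)) (at s within A)" for s A
    unfolding g_def has_real_derivative_iff_has_vector_derivative[symmetric]
    using M by (auto intro!: derivative_eq_intros)
  have "norm (f t - f 0) \<le> g t - g 0"
  proof (rule differentiable_bound_general)
    show "0 < t" using False t by simp
    show "continuous_on {0..t} f" by (rule continuous_on_vector_derivative) (rule f)
    show "continuous_on {0..t} g" by (rule continuous_on_vector_derivative) (rule g)
    fix s assume s: "0 < s" "s < t"
    show "(f has_vector_derivative f' s) (at s)"
      using f[of s] s by (simp add: at_within_Icc_at)
    show "(g has_vector_derivative (c * exp (M * s) + r)) (at s)" by (rule g)
    show "norm (f' s) \<le> c * exp (M * s) + r" using b s by simp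
  qed
  then show ?thesis by (simp add: g_def algebra_simps diff_divide_distrib)
qed simp

text \<open>Let \<open>D\<close> be the maximum of the distance weighted by exp (-4 K t). A delayed
  value is bounded by the same weight, or by \<delta> on the initial segment, so present and past
  contribute at most 2 K D / (4 K) = D / 2, which the left side absorbs.\<close>

lemma dde_dependence:
  fixes F :: "'a::real_normed_vector \<Rightarrow> 'a \<Rightarrow> 'a"
  assumes K: "0 < K" and tau: "0 \<le> \<tau>" and T: "0 \<le> T" and del: "0 \<le> \<delta>"
    and lip: "\<And>a b a' b'. norm (F a b - F a' b') \<le> K * (norm (a - a') + norm (b - b'))"
    and u: "\<And>t. t \<in> {0..T} \<Longrightarrow> (u has_vector_derivative F (u t) (u (t - \<tau>))) (at t within {0..T})"
    and v: "\<And>t. t \<in> {0..T} \<Longrightarrow> (v has_vector_derivative F (v t) (v (t - \<tau>))) (at t within {0..T})"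
    and h: "\<And>t. t \<in> {-\<tau>..0} \<Longrightarrow> norm (u t - v t) \<le> \<delta>"
    and t: "t \<in> {0..T}"
  shows "norm (u t - v t) \<le> 2 * (1 + K * T) * exp (4 * K * T) * \<delta>"
proof -
  define d where "d t = u t - v t" for t
  define d' where "d' t = F (u t) (u (t - \<tau>)) - F (v t) (v (t - \<tau>))" for t
  have d: "(d has_vector_derivative d' s) (at s within {0..r})" if "s \<in> {0..r}" "r \<le> T" for s r
  proof -
    have "s \<in> {0..T}" "{0..r} \<subseteq> {0..T}" using that by auto
    then show ?thesis unfolding d_def d'_def
      by (intro has_vector_derivative_diff has_vector_derivative_within_subset[OF u] has_vector_derivative_within_subset[OF v]) auto
  qed
  define w where "w t = exp (- (4 * K) * t) * norm (d t)" for t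
  have "continuous_on {0..T} d" by (rule continuous_on_vector_derivative) (use d in blast)
  then have "continuous_on {0..T} w" unfolding w_def by (intro continuous_intros)
  then obtain m where m: "m \<in> {0..T}" "\<And>s. s \<in> {0..T} \<Longrightarrow> w s \<le> w m"
    using continuous_attains_sup[of "{0..T}" w] T by auto
  define D where "D = w m"
  have D0: "0 \<le> D" by (simp add: D_def w_def)
  have wd: "norm (d s) = exp (4 * K * s) * w s" for s by (simp add: w_def mult.assoc[symmetric] exp_add[symmetric])
  have dD: "norm (d s) \<le> exp (4 * K * s) * D" if "s \<in> {0..T}" for s
    unfolding wd D_def using m(2)[OF that] by simp
  have del': "norm (d (s - \<tau>)) \<le> exp (4 * K * s) * D + \<delta>" if s: "s \<in> {0..T}" for s
  proof (cases "s - \<tau> \<le> 0")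
    case True
    then have "norm (d (s - \<tau>)) \<le> \<delta>" unfolding d_def using s by (intro h) auto
    then show ?thesis using D0 by (simp add: add_increasing)
  next
    case False
    then have "norm (d (s - \<tau>)) \<le> exp (4 * K * (s - \<tau>)) * D" using s tau by (intro dD) auto
    also have "\<dots> \<le> exp (4 * K * s) * D" using K tau D0 by (intro mult_right_mono) auto
    finally show ?thesis using del by simp
  qed
  have "norm (d m - d 0) \<le> (2 * K * D) / (4 * K) * (exp (4 * K * m) - 1) + K * \<delta> * m"
  proof (rule exp_weight_bound)
    fix s assume s: "s \<in> {0..m}"
    then have sT: "s \<in> {0..T}" using m by auto
    show "(d has_vector_derivative d' s) (at s within {0..m})" using d[OF s] m by auto
    have "norm (d' s) \<le> K * (norm (d s) + norm (d (s - \<tau>)))" unfolding d'_def d_def by (rule lip)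
    also have "\<dots> \<le> K * (exp (4 * K * s) * D + (exp (4 * K * s) * D + \<delta>))"
      using K dD[OF sT] del'[OF sT] by (intro mult_left_mono add_mono) auto
    finally show "norm (d' s) \<le> 2 * K * D * exp (4 * K * s) + K * \<delta>" by (simp add: algebra_simps)
  qed (use m K in auto)
  also have "(2 * K * D) / (4 * K) * (exp (4 * K * m) - 1) \<le> D / 2 * exp (4 * K * m)"
    using K D0 by (simp add: field_simps)
  also have "K * \<delta> * m \<le> K * \<delta> * T" using K del m by (intro mult_left_mono) auto
  finally have "norm (d m - d 0) \<le> D / 2 * exp (4 * K * m) + K * \<delta> * T" by simp
  moreover have "norm (d m) \<le> norm (d m - d 0) + norm (d 0)" by (metis diff_add_cancel norm_triangle_ineq)
  moreover have "norm (d 0) \<le> \<delta>" unfolding d_def using tau by (intro h) auto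
  ultimately have 1: "exp (4 * K * m) * D \<le> D / 2 * exp (4 * K * m) + (1 + K * T) * \<delta>"
    unfolding wd D_def by (simp add: algebra_simps)
  have "D / 2 \<le> exp (4 * K * m) * (D / 2)" using D0 K m by (simp add: mult_le_cancel_right1)
  then have "D \<le> 2 * ((1 + K * T) * \<delta>)" using 1 by (simp add: algebra_simps)
  have "norm (d t) \<le> exp (4 * K * t) * D" by (rule dD[OF t])
  also have "\<dots> \<le> exp (4 * K * T) * (2 * ((1 + K * T) * \<delta>))"
    using \<open>D \<le> _\<close> t K D0 by (intro mult_mono) auto
  finally show ?thesis by (simp add: d_def algebra_simps)
qed

text \<open>The integral equation is solved for all times at once by a contraction in an
  exponentially weighted norm.\<close>

lemma dde_exists:
  fixes F :: "'a::euclidean_space \<Rightarrow> 'a \<Rightarrow> 'a"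
  assumes K: "0 < K" and tau: "0 \<le> \<tau>"
    and lip: "\<And>a b a' b'. norm (F a b - F a' b') \<le> K * (norm (a - a') + norm (b - b'))"
    and \<phi>: "continuous_on {-\<tau>..0} \<phi>"
  obtains u where "continuous_on UNIV u" "\<And>t. t \<in> {-\<tau>..0} \<Longrightarrow> u t = \<phi> t"
    "\<And>t. 0 \<le> t \<Longrightarrow> (u has_vector_derivative F (u t) (u (t - \<tau>))) (at t within {0..})"
proof -
  \<comment> \<open>The history continued by constants, so that it is continuous and bounded on the
    whole line.\<close>
  define p where "p t = \<phi> (max (-\<tau>) (min t 0))" for t
  have cp: "continuous_on UNIV p" unfolding p_def
    by (rule continuous_on_compose2[OF \<phi>]) (use tau in \<open>auto intro!: continuous_intros\<close>)
  have cF: "continuous_on UNIV (\<lambda>s. F (f s) (g s))" if f: "continuous_on UNIV f" and g: "continuous_on UNIV g" for f g :: "real \<Rightarrow> 'a"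
    unfolding continuous_on_def
  proof
    fix s :: real
    have "((\<lambda>r. K * (norm (f r - f s) + norm (g r - g s))) \<longlongrightarrow> K * (norm (f s - f s) + norm (g s - g s))) (at s)"
      using f g by (intro tendsto_intros) (auto simp: continuous_on_def)
    then have "((\<lambda>r. K * (norm (f r - f s) + norm (g r - g s))) \<longlongrightarrow> 0) (at s)" by simp
    then have "((\<lambda>r. F (f r) (g r) - F (f s) (g s)) \<longlongrightarrow> 0) (at s)"
      by (rule Lim_null_comparison[rotated]) (auto intro!: always_eventually lip)
    then show "((\<lambda>s. F (f s) (g s)) \<longlongrightarrow> F (f s) (g s)) (at s)" by (rule LIM_zero_cancel)
  qed
  obtain b where b: "\<And>t. norm (p t) \<le> b"
  proof -
    have "bounded (\<phi> ` {-\<tau>..0})" by (intro compact_imp_bounded compact_continuous_image \<phi>) simp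
    then obtain b where "\<forall>x\<in>\<phi> ` {-\<tau>..0}. norm x \<le> b" unfolding bounded_iff by blast
    then have "norm (p t) \<le> b" for t unfolding p_def using tau by auto
    then show thesis by (rule that)
  qed
  \<comment> \<open>The Lipschitz estimates below cost 4 K / M, hence the contraction factor
    1/2.\<close>
  define M where "M = 8 * K"
  have M: "0 < M" using K by (simp add: M_def)
  \<comment> \<open>The unknown \<open>v\<close> is a bounded continuous function, rescaled by the
    exponential. Subtracting its value at 0 makes \<open>E v\<close> agree with the history for
    every \<open>v\<close>, so that the fixed point is sought in the full space; at the fixed point
    this value is 0.\<close>
  define E where "E v t = p t + exp (M * max t 0) *\<^sub>R apply_bcontfun v (max t 0) - apply_bcontfun v 0" for v and t :: real
  define G where "G v t = F (E v t) (E v (t - \<tau>))" for v and t :: real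
  define I where "I v t = exp (- M * max t 0) *\<^sub>R integral {0..max t 0} (G v)" for v and t :: real
  have cE: "continuous_on UNIV (E v)" for v
    unfolding E_def by (intro continuous_intros cp continuous_on_compose2[OF continuous_on_apply_bcontfun[of UNIV v]]) auto
  have cE': "continuous_on UNIV (\<lambda>t. E v (t - \<tau>))" for v
    by (rule continuous_on_compose2[OF cE]) (auto intro!: continuous_intros)
  have cG: "continuous_on UNIV (G v)" for v unfolding G_def by (rule cF[OF cE cE'])
  have dI: "((\<lambda>t. integral {0..t} (G v)) has_vector_derivative G v t) (at t within {0..T})" if "t \<in> {0..T}" for v t T
    by (rule integral_has_vector_derivative[OF continuous_on_subset[OF cG] that]) simp
  have e1: "1 \<le> exp (M * max t 0)" for t using M by simp
  have Eb: "norm (E v t) \<le> (b + 2 * norm v) * exp (M * max t 0)" for v t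
  proof -
    have b0: "0 \<le> b" using b[of 0] norm_ge_zero order_trans by blast
    have "norm (E v t) \<le> norm (p t) + norm (exp (M * max t 0) *\<^sub>R apply_bcontfun v (max t 0)) + norm (apply_bcontfun v 0)"
      unfolding E_def by (rule order_trans[OF norm_triangle_ineq4]) (intro add_right_mono norm_triangle_ineq)
    also have "\<dots> \<le> b * exp (M * max t 0) + exp (M * max t 0) * norm v + norm v * exp (M * max t 0)"
    proof (intro add_mono)
      have "b * 1 \<le> b * exp (M * max t 0)" by (rule mult_left_mono[OF e1 b0])
      then show "norm (p t) \<le> b * exp (M * max t 0)" using b[of t] by linarith
      show "norm (exp (M * max t 0) *\<^sub>R apply_bcontfun v (max t 0)) \<le> exp (M * max t 0) * norm v"
        using norm_bounded[of v "max t 0"] by (simp add: mult_left_mono)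
      have "norm v * 1 \<le> norm v * exp (M * max t 0)" by (rule mult_left_mono[OF e1 norm_ge_zero])
      then show "norm (apply_bcontfun v 0) \<le> norm v * exp (M * max t 0)" using norm_bounded[of v 0] by linarith
    qed
    finally show ?thesis by (simp add: algebra_simps)
  qed
  have em: "exp (M * max (s - \<tau>) 0) \<le> exp (M * s)" if "0 \<le> s" for s using M tau that by auto
  have Gb: "norm (G v s) \<le> (norm (F 0 0) + K * (2 * (b + 2 * norm v))) * exp (M * s)" if s: "0 \<le> s" for v s
  proof -
    have b0: "0 \<le> b + 2 * norm v" using b[of 0] norm_ge_zero[of "p 0"] norm_ge_zero[of v] by linarith
    have "norm (G v s) \<le> norm (F 0 0) + norm (G v s - F 0 0)" by (metis add.commute diff_add_cancel norm_triangle_ineq)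
    also have "norm (G v s - F 0 0) \<le> K * (norm (E v s) + norm (E v (s - \<tau>)))"
      unfolding G_def using lip[of "E v s" "E v (s - \<tau>)" 0 0] by simp
    also have "\<dots> \<le> K * ((b + 2 * norm v) * exp (M * s) + (b + 2 * norm v) * exp (M * s))"
    proof (intro mult_left_mono add_mono)
      show "norm (E v s) \<le> (b + 2 * norm v) * exp (M * s)" using Eb[of v s] s by simp
      show "norm (E v (s - \<tau>)) \<le> (b + 2 * norm v) * exp (M * s)"
        by (rule order_trans[OF Eb mult_left_mono[OF em[OF s] b0]])
    qed (use K in simp)
    also have "norm (F 0 0) \<le> norm (F 0 0) * exp (M * s)" using s M by (simp add: mult_le_cancel_left1)
    finally show ?thesis by (simp add: algebra_simps)
  qed
  have wb: "norm (I v t) \<le> c / M" if "\<And>s. 0 \<le> s \<Longrightarrow> norm (G v s) \<le> c * exp (M * s)" for v t c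
  proof -
    have c0: "0 \<le> c" using order_trans[OF norm_ge_zero that[of 0]] by simp
    have "norm (integral {0..max t 0} (G v) - integral {0..0} (G v)) \<le> c / M * (exp (M * max t 0) - 1) + 0 * max t 0"
      by (rule exp_weight_bound) (use M dI that in auto)
    also have "\<dots> \<le> c / M * exp (M * max t 0)" using divide_nonneg_pos[OF c0 M] by (simp add: right_diff_distrib)
    finally have n: "norm (integral {0..max t 0} (G v)) \<le> c / M * exp (M * max t 0)" by simp
    have "norm (I v t) = exp (- M * max t 0) * norm (integral {0..max t 0} (G v))" by (simp add: I_def)
    also have "\<dots> \<le> exp (- M * max t 0) * (c / M * exp (M * max t 0))" by (rule mult_left_mono[OF n]) simp
    also have "\<dots> = c / M" by (simp add: exp_minus field_simps)
    finally show ?thesis .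
  qed
  have cI: "continuous_on UNIV (I v)" for v
  proof -
    have *: "continuous_on {0..} (\<lambda>t. integral {0..t} (G v))"
      unfolding continuous_on_eq_continuous_within
    proof
      fix t :: real assume t: "t \<in> {0..}"
      have "continuous (at t within {0..t+1}) (\<lambda>t. integral {0..t} (G v))"
        by (rule has_vector_derivative_continuous[OF dI]) (use t in auto)
      moreover have "at t within {0..t+1} = at t within {0..}"
        by (rule at_within_nhd[of t "{..<t+1}"]) auto
      ultimately show "continuous (at t within {0..}) (\<lambda>t. integral {0..t} (G v))" by simp
    qed
    show ?thesis unfolding I_def
      by (intro continuous_intros continuous_on_compose2[OF *]) auto
  qed
  have Ib: "I v \<in> bcontfun" for v by (rule bcontfun_normI[OF cI wb[OF Gb]])
  define P where "P v = Bcontfun (I v)" for v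
  have aP: "apply_bcontfun (P v) = I v" for v unfolding P_def by (rule Bcontfun_inverse[OF Ib])
  have con: "dist (P v) (P w) \<le> 1/2 * dist v w" for v w
  proof (rule dist_bound)
    fix t :: real
    let ?d = "dist v w"
    have dvw: "norm (apply_bcontfun v s - apply_bcontfun w s) \<le> ?d" for s using dist_bounded[of v s w] by (simp add: dist_norm)
    have Ed: "norm (E v s - E w s) \<le> 2 * ?d * exp (M * max s 0)" for s
    proof -
      have "E v s - E w s = exp (M * max s 0) *\<^sub>R (apply_bcontfun v (max s 0) - apply_bcontfun w (max s 0)) - (apply_bcontfun v 0 - apply_bcontfun w 0)"
        unfolding E_def by (simp add: algebra_simps)
      also have "norm \<dots> \<le> exp (M * max s 0) * ?d + ?d"
        by (rule order_trans[OF norm_triangle_ineq4]) (auto intro!: add_mono dvw mult_left_mono)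
      also have "\<dots> \<le> 2 * ?d * exp (M * max s 0)"
        using mult_left_mono[OF e1[of s], of ?d] by (simp add: algebra_simps)
      finally show ?thesis .
    qed
    have Gd: "norm (G v s - G w s) \<le> 4 * K * ?d * exp (M * s)" if s: "0 \<le> s" for s
    proof -
      have "norm (G v s - G w s) \<le> K * (norm (E v s - E w s) + norm (E v (s - \<tau>) - E w (s - \<tau>)))"
        unfolding G_def by (rule lip)
      also have "\<dots> \<le> K * (2 * ?d * exp (M * s) + 2 * ?d * exp (M * s))"
      proof (intro mult_left_mono add_mono)
        show "norm (E v s - E w s) \<le> 2 * ?d * exp (M * s)" using Ed[of s] s by simp
        show "norm (E v (s - \<tau>) - E w (s - \<tau>)) \<le> 2 * ?d * exp (M * s)"
          by (rule order_trans[OF Ed mult_left_mono[OF em[OF s]]]) simp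
      qed (use K in simp)
      finally show ?thesis by (simp add: algebra_simps)
    qed
    define r where "r = max t 0"
    have r: "0 \<le> r" by (simp add: r_def)
    have "norm ((integral {0..r} (G v) - integral {0..r} (G w)) - (integral {0..0} (G v) - integral {0..0} (G w)))
        \<le> 4 * K * ?d / M * (exp (M * r) - 1) + 0 * r"
      by (rule exp_weight_bound[where f = "\<lambda>r. integral {0..r} (G v) - integral {0..r} (G w)" and f' = "\<lambda>s. G v s - G w s"])
         (use M r Gd in \<open>auto intro!: has_vector_derivative_diff dI\<close>)
    also have "\<dots> \<le> 1 / 2 * ?d * exp (M * r)" using K by (simp add: M_def mult_left_mono)
    finally have n: "norm (integral {0..r} (G v) - integral {0..r} (G w)) \<le> 1 / 2 * ?d * exp (M * r)" by simp
    have "dist (apply_bcontfun (P v) t) (apply_bcontfun (P w) t) = exp (- M * r) * norm (integral {0..r} (G v) - integral {0..r} (G w))"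
      unfolding aP I_def r_def[symmetric] dist_norm by (simp add: scaleR_diff_right[symmetric])
    also have "\<dots> \<le> exp (- M * r) * (1 / 2 * ?d * exp (M * r))" by (intro mult_left_mono n) simp
    also have "\<dots> = 1 / 2 * ?d" by (simp add: exp_minus field_simps)
    finally show "dist (apply_bcontfun (P v) t) (apply_bcontfun (P w) t) \<le> 1 / 2 * ?d" .
  qed
  obtain v where v: "P v = v" using banach_fix_type[of "1/2" P] con by auto
  have vI: "apply_bcontfun v = I v" using aP[of v] v by simp
  have v0: "apply_bcontfun v 0 = 0" unfolding vI I_def by simp
  have hist: "E v t = \<phi> t" if "t \<in> {-\<tau>..0}" for t
    using that unfolding E_def p_def v0 by (simp add: v0 max_def min_def)
  have pos: "E v t = p 0 + integral {0..t} (G v)" if "0 \<le> t" for t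
    using that unfolding E_def v0 unfolding vI I_def p_def by (simp add: exp_minus max_def min_def)
  have "(E v has_vector_derivative F (E v t) (E v (t - \<tau>))) (at t within {0..})" if t: "0 \<le> t" for t
  proof -
    have "((\<lambda>t. p 0 + integral {0..t} (G v)) has_vector_derivative (0 + G v t)) (at t within {0..t+1})"
      by (intro has_vector_derivative_add has_vector_derivative_const dI) (use t in auto)
    moreover have "at t within {0..t+1} = at t within {0..}"
      by (rule at_within_nhd[of t "{..<t+1}"]) auto
    ultimately have "((\<lambda>t. p 0 + integral {0..t} (G v)) has_vector_derivative G v t) (at t within {0..})" by simp
    then have "(E v has_vector_derivative G v t) (at t within {0..})"
      by (rule has_vector_derivative_transform[rotated 2]) (use t pos in auto)
    then show ?thesis by (simp add: G_def)
  qed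
  then show thesis using that cE hist by blast
qed

section \<open>The Poincare--Miranda theorem\<close>

lemma bounded_coordinates_convergent_subseq:
  fixes u :: "nat \<Rightarrow> nat \<Rightarrow> real"
  assumes "\<And>p j. j < n \<Longrightarrow> u p j \<in> {a..b}"
  shows "\<exists>r l. strict_mono (r :: nat \<Rightarrow> nat) \<and> (\<forall>j<n. (\<lambda>p. u (r p) j) \<longlonglongrightarrow> l j)"
  using assms
proof (induction n)
  case 0
  show ?case by (auto intro: exI[of _ id] simp: strict_mono_def)
next
  case (Suc n)
  obtain r l where r: "strict_mono r" "\<forall>j<n. (\<lambda>p. u (r p) j) \<longlonglongrightarrow> l j" using Suc by fastforce
  have "\<forall>p. u (r p) n \<in> {a..b}" using Suc.prems by simp
  then obtain c q where q: "strict_mono q" "((\<lambda>p. u (r p) n) \<circ> q) \<longlonglongrightarrow> c"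
    using compact_Icc[of a b] unfolding compact_def by (metis (no_types, lifting))
  have "(\<lambda>p. u (r (q p)) j) \<longlonglongrightarrow> (l(n := c)) j" if "j < Suc n" for j
  proof (cases "j = n")
    case True
    then show ?thesis using q(2) by (simp add: o_def)
  next
    case False
    then have "(\<lambda>p. u (r p) j) \<longlonglongrightarrow> l j" using r(2) that by simp
    from LIMSEQ_subseq_LIMSEQ[OF this q(1)] False show ?thesis by (simp add: o_def)
  qed
  then show ?case using strict_mono_o[OF r(1) q(1)] by (auto simp: o_def intro!: exI[of _ "r \<circ> q"] exI[of _ "l(n := c)"])
qed

text \<open>Kuhn's labelling lemma on ever finer grids, labelled by the signs of the
  \<open>f i\<close>: in some grid cube every \<open>f i\<close> takes both signs, and a limit point
  of such cubes is a common zero. Continuity is required along sequences converging in the first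
  \<open>n\<close> coordinates, which are the only ones that count.\<close>

lemma poincare_miranda_unit_cube:
  fixes n :: nat and f :: "nat \<Rightarrow> (nat \<Rightarrow> real) \<Rightarrow> real"
  assumes cont: "\<And>i u v. i < n \<Longrightarrow> (\<And>p j. j < n \<Longrightarrow> u p j \<in> {0..1}) \<Longrightarrow> (\<And>j. j < n \<Longrightarrow> (\<lambda>p. u p j) \<longlonglongrightarrow> v j)
      \<Longrightarrow> (\<lambda>p. f i (u p)) \<longlonglongrightarrow> f i v"
    and lo: "\<And>i u. i < n \<Longrightarrow> (\<And>j. j < n \<Longrightarrow> u j \<in> {0..1}) \<Longrightarrow> u i = 0 \<Longrightarrow> 0 \<le> f i u"
    and hi: "\<And>i u. i < n \<Longrightarrow> (\<And>j. j < n \<Longrightarrow> u j \<in> {0..1}) \<Longrightarrow> u i = 1 \<Longrightarrow> f i u \<le> 0"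
  obtains u where "\<And>j. j < n \<Longrightarrow> u j \<in> {0..1}" "\<And>i. i < n \<Longrightarrow> f i u = 0"
proof -
  define sc where "sc P x j = real (x j) / real P" for P :: nat and x :: "nat \<Rightarrow> nat" and j :: nat
  have "\<exists>q a b. (\<forall>j<n. q j < Suc p) \<and> (\<forall>i<n. (\<forall>j<n. q j \<le> a i j \<and> a i j \<le> q j + 1 \<and> q j \<le> b i j \<and> b i j \<le> q j + 1)
      \<and> 0 \<le> f i (sc (Suc p) (a i)) \<and> f i (sc (Suc p) (b i)) \<le> 0)" for p
  proof -
    let ?P = "Suc p"
    \<comment> \<open>On the faces the label is prescribed by the labelling lemma; \<open>lo\<close>
      and \<open>hi\<close> ensure that it agrees with the sign of \<open>f i\<close> there
      too.\<close>
    define label where "label x i = (if x i = 0 then 0 else if x i = ?P then 1 else if 0 \<le> f i (sc ?P x) then 0 else (1::nat))" for x i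
    have cube: "sc ?P x j \<in> {0..1}" if "x j \<le> ?P" for x j using that by (simp add: sc_def divide_le_eq)
    have l0: "0 \<le> f i (sc ?P x)" if "label x i = 0" "i < n" "\<forall>j<n. x j \<le> ?P" for x i
    proof (cases "x i = 0")
      case True
      then show ?thesis by (intro lo[OF that(2)] cube) (use that(3) in \<open>auto simp: sc_def\<close>)
    qed (use that(1) in \<open>auto simp: label_def split: if_splits\<close>)
    have l1: "f i (sc ?P x) \<le> 0" if "label x i \<noteq> 0" "i < n" "\<forall>j<n. x j \<le> ?P" for x i
    proof (cases "x i = ?P")
      case True
      then show ?thesis by (intro hi[OF that(2)] cube) (use that(3) in \<open>auto simp: sc_def\<close>)
    qed (use that(1) in \<open>auto simp: label_def split: if_splits\<close>)
    obtain q where q: "\<forall>i<n. q i < ?P" and rs: "\<forall>i<n. \<exists>r s. (\<forall>j<n. q j \<le> r j \<and> r j \<le> q j + 1) \<and>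
        (\<forall>j<n. q j \<le> s j \<and> s j \<le> q j + 1) \<and> label r i \<noteq> label s i"
      by (rule kuhn_lemma[of ?P n label]) (auto simp: label_def)
    have "\<exists>a b. (\<forall>j<n. q j \<le> a j \<and> a j \<le> q j + 1 \<and> q j \<le> b j \<and> b j \<le> q j + 1) \<and> 0 \<le> f i (sc ?P a) \<and> f i (sc ?P b) \<le> 0"
      if i: "i < n" for i
    proof -
      obtain r s where r: "\<forall>j<n. q j \<le> r j \<and> r j \<le> q j + 1" and s: "\<forall>j<n. q j \<le> s j \<and> s j \<le> q j + 1" and ne: "label r i \<noteq> label s i"
        using rs i by blast
      have le: "\<forall>j<n. r j \<le> ?P" "\<forall>j<n. s j \<le> ?P" using q r s by fastforce+
      consider "label r i = 0" "label s i \<noteq> 0" | "label s i = 0" "label r i \<noteq> 0"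
        using ne by (auto simp: label_def split: if_splits)
      then show ?thesis
      proof cases
        case 1 then show ?thesis using l0[OF _ i le(1)] l1[OF _ i le(2)] r s by blast
      next
        case 2 then show ?thesis using l0[OF _ i le(2)] l1[OF _ i le(1)] r s by blast
      qed
    qed
    then obtain a b where "\<And>i. i < n \<Longrightarrow> (\<forall>j<n. q j \<le> a i j \<and> a i j \<le> q j + 1 \<and> q j \<le> b i j \<and> b i j \<le> q j + 1) \<and> 0 \<le> f i (sc ?P (a i)) \<and> f i (sc ?P (b i)) \<le> 0"
      by metis
    then show ?thesis using q by blast
  qed
  then obtain q a b where q: "\<And>p j. j < n \<Longrightarrow> q p j < Suc p"
    and ab: "\<And>p i j. i < n \<Longrightarrow> j < n \<Longrightarrow> q p j \<le> a p i j \<and> a p i j \<le> q p j + 1 \<and> q p j \<le> b p i j \<and> b p i j \<le> q p j + 1"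
    and f: "\<And>p i. i < n \<Longrightarrow> 0 \<le> f i (sc (Suc p) (a p i)) \<and> f i (sc (Suc p) (b p i)) \<le> 0"
    by metis
  have cube: "sc (Suc p) x j \<in> {0..1}" if "x j \<le> Suc p" for p x j using that by (simp add: sc_def divide_le_eq)
  have "sc (Suc p) (q p) j \<in> {0..1}" if "j < n" for p j using q[OF that, of p] by (intro cube) simp
  from bounded_coordinates_convergent_subseq[where u = "\<lambda>p. sc (Suc p) (q p)", OF this]
  obtain r l where r: "strict_mono r" and l: "\<And>j. j < n \<Longrightarrow> (\<lambda>p. sc (Suc (r p)) (q (r p)) j) \<longlonglongrightarrow> l j" by blast
  have near: "(\<lambda>p. sc (Suc (r p)) (c (r p)) j) \<longlonglongrightarrow> l j"
    if j: "j < n" and c: "\<And>p. q p j \<le> c p j \<and> c p j \<le> q p j + 1" for c j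
  proof -
    have "(\<lambda>p. sc (Suc (r p)) (c (r p)) j - sc (Suc (r p)) (q (r p)) j) \<longlonglongrightarrow> 0"
    proof (rule Lim_null_comparison)
      show "(\<lambda>p. 1 / real (Suc (r p))) \<longlonglongrightarrow> 0"
        using LIMSEQ_subseq_LIMSEQ[OF LIMSEQ_inverse_real_of_nat r] by (simp add: o_def inverse_eq_divide)
      have "norm (sc (Suc (r p)) (c (r p)) j - sc (Suc (r p)) (q (r p)) j) \<le> 1 / real (Suc (r p))" for p
      proof -
        have "sc (Suc (r p)) (c (r p)) j - sc (Suc (r p)) (q (r p)) j = (real (c (r p) j) - real (q (r p) j)) / real (Suc (r p))"
          by (simp add: sc_def diff_divide_distrib)
        then show ?thesis using c[of "r p"] by (auto simp: abs_divide intro!: divide_right_mono)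
      qed
      then show "\<forall>\<^sub>F p in sequentially. norm (sc (Suc (r p)) (c (r p)) j - sc (Suc (r p)) (q (r p)) j) \<le> 1 / real (Suc (r p))" by simp
    qed
    from tendsto_add[OF this l[OF j]] show ?thesis by simp
  qed
  have "f i l = 0" if i: "i < n" for i
  proof (rule antisym)
    have ub: "a p i j \<le> Suc p" "b p i j \<le> Suc p" if "j < n" for p j using ab[OF i that, of p] q[OF that, of p] by linarith+
    have "(\<lambda>p. f i (sc (Suc (r p)) (b (r p) i))) \<longlonglongrightarrow> f i l"
      by (rule cont[OF i cube near[where c = "\<lambda>p. b p i"]]) (use ub ab[OF i] in auto)
    then show "f i l \<le> 0" by (rule LIMSEQ_le_const2) (use f[OF i] in auto)
    have "(\<lambda>p. f i (sc (Suc (r p)) (a (r p) i))) \<longlonglongrightarrow> f i l"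
      by (rule cont[OF i cube near[where c = "\<lambda>p. a p i"]]) (use ub ab[OF i] in auto)
    then show "0 \<le> f i l" by (rule LIMSEQ_le_const) (use f[OF i] in auto)
  qed
  moreover have "l j \<in> {0..1}" if j: "j < n" for j
  proof -
    have "0 \<le> l j" "l j \<le> 1"
      by (rule LIMSEQ_le_const[OF l[OF j]] LIMSEQ_le_const2[OF l[OF j]]; use cube[of "q (r _)" j "r _"] q[OF j] in \<open>auto simp: less_imp_le\<close>)+
    then show ?thesis by simp
  qed
  ultimately show thesis using that by blast
qed

lemma poincare_miranda:
  fixes I :: "'i set" and l h :: "'i \<Rightarrow> real" and f :: "'i \<Rightarrow> ('i \<Rightarrow> real) \<Rightarrow> real"
  assumes I: "finite I" and lh: "\<And>i. i \<in> I \<Longrightarrow> l i < h i"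
    and cont: "\<And>i u v. i \<in> I \<Longrightarrow> (\<And>p j. j \<in> I \<Longrightarrow> u p j \<in> {l j..h j}) \<Longrightarrow> (\<And>j. j \<in> I \<Longrightarrow> (\<lambda>p. u p j) \<longlonglongrightarrow> v j)
      \<Longrightarrow> (\<lambda>p. f i (u p)) \<longlonglongrightarrow> f i v"
    and lo: "\<And>i u. i \<in> I \<Longrightarrow> (\<And>j. j \<in> I \<Longrightarrow> u j \<in> {l j..h j}) \<Longrightarrow> u i = l i \<Longrightarrow> 0 \<le> f i u"
    and hi: "\<And>i u. i \<in> I \<Longrightarrow> (\<And>j. j \<in> I \<Longrightarrow> u j \<in> {l j..h j}) \<Longrightarrow> u i = h i \<Longrightarrow> f i u \<le> 0"
  obtains u where "\<And>j. j \<in> I \<Longrightarrow> u j \<in> {l j..h j}" "\<And>i. i \<in> I \<Longrightarrow> f i u = 0"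
proof -
  obtain e where e: "bij_betw e {0..<card I} I" using ex_bij_betw_nat_finite[OF I] by blast
  define d where "d = inv_into {0..<card I} e"
  have eI: "e j \<in> I" if "j < card I" for j using e that by (auto simp: bij_betw_def)
  have ed: "e (d i) = i" "d i < card I" if "i \<in> I" for i
    using that e f_inv_into_f[of i e "{0..<card I}"] inv_into_into[of i e "{0..<card I}"] by (auto simp: d_def bij_betw_def)
  have de: "d (e j) = j" if "j < card I" for j using e that by (auto simp: d_def bij_betw_def)
  define w where "w u i = l i + (h i - l i) * u (d i)" for u :: "nat \<Rightarrow> real" and i
  have wb: "w u i \<in> {l i..h i}" if "i \<in> I" "\<And>j. j < card I \<Longrightarrow> u j \<in> {0..1}" for u i
  proof -
    have "0 \<le> (h i - l i) * u (d i)" "(h i - l i) * u (d i) \<le> (h i - l i) * 1"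
      using lh[OF that(1)] that(2)[OF ed(2)[OF that(1)]] by (auto intro!: mult_left_mono)
    then show ?thesis unfolding w_def by simp
  qed
  obtain u where "\<And>j. j < card I \<Longrightarrow> u j \<in> {0..1}" "\<And>j. j < card I \<Longrightarrow> f (e j) (w u) = 0"
  proof (rule poincare_miranda_unit_cube[where n = "card I" and f = "\<lambda>j u. f (e j) (w u)"])
    fix i u v assume i: "i < card I" and u: "\<And>p j. j < card I \<Longrightarrow> u p j \<in> {0..1::real}"
      and c: "\<And>j. j < card I \<Longrightarrow> (\<lambda>p. u p j) \<longlonglongrightarrow> v j"
    show "(\<lambda>p. f (e i) (w (u p))) \<longlonglongrightarrow> f (e i) (w v)"
    proof (rule cont[OF eI[OF i] wb[OF _ u]])
      fix j assume "j \<in> I"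
      then show "(\<lambda>p. w (u p) j) \<longlonglongrightarrow> w v j" unfolding w_def by (intro tendsto_intros c ed)
    qed
  next
    fix i and u :: "nat \<Rightarrow> real" assume i: "i < card I" and u: "\<And>j. j < card I \<Longrightarrow> u j \<in> {0..1}"
    show "u i = 0 \<Longrightarrow> 0 \<le> f (e i) (w u)" by (rule lo[OF eI[OF i] wb[OF _ u]]) (use de[OF i] in \<open>auto simp: w_def\<close>)
    show "u i = 1 \<Longrightarrow> f (e i) (w u) \<le> 0" by (rule hi[OF eI[OF i] wb[OF _ u]]) (use de[OF i] in \<open>auto simp: w_def\<close>)
  qed (blast intro: that)
  then show thesis using that[of "w u"] wb ed by metis
qed

section \<open>One return\<close>

text \<open>The threshold is a parameter: 100 in the construction, and a common bound of two given
  solutions in the proof of uniqueness.\<close>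

definition field :: "real \<Rightarrow> real^3 \<Rightarrow> real^3" where
  "field R v = vector [- (v$2) - v$3, v$1 + v$2 / 5, clamp R (v$3) * (clamp R (v$1) - 21/4) + 1/5]"

definition rate :: "real \<Rightarrow> real^3 \<Rightarrow> real^3 \<Rightarrow> real^3" where
  "rate R v w = field R v + (1/10000) *\<^sub>R field R w"

lemma norm_le_sum3: "norm (v :: real^3) \<le> \<bar>v$1\<bar> + \<bar>v$2\<bar> + \<bar>v$3\<bar>"
  using norm_le_l1_cart[of v] by (simp add: sum_3)

lemma field_lipschitz:
  assumes R: "0 \<le> R"
  shows "norm (field R v - field R w) \<le> (2 * R + 10) * norm (v - w)"
proof -
  let ?n = "norm (v - w)"
  have c: "\<bar>v$i - w$i\<bar> \<le> ?n" for i using component_le_norm_cart[of "v - w" i] by simp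
  have cl: "\<bar>clamp R p - clamp R q\<bar> \<le> \<bar>p - q\<bar>" "\<bar>clamp R p\<bar> \<le> R" for p q using R by (auto simp: clamp_def)
  have "\<bar>clamp R (v$3) * (clamp R (v$1) - 21/4) - clamp R (w$3) * (clamp R (w$1) - 21/4)\<bar>
     = \<bar>clamp R (v$3) * (clamp R (v$1) - clamp R (w$1)) + (clamp R (v$3) - clamp R (w$3)) * (clamp R (w$1) - 21/4)\<bar>"
    by (simp add: algebra_simps)
  also have "\<dots> \<le> \<bar>clamp R (v$3)\<bar> * \<bar>clamp R (v$1) - clamp R (w$1)\<bar> + \<bar>clamp R (v$3) - clamp R (w$3)\<bar> * \<bar>clamp R (w$1) - 21/4\<bar>"
    by (simp only: abs_mult[symmetric] abs_triangle_ineq)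
  also have "\<dots> \<le> R * ?n + ?n * (R + 6)"
  proof (intro add_mono mult_mono)
    show "\<bar>clamp R (w$1) - 21/4\<bar> \<le> R + 6" using cl(2)[of "w$1"] by linarith
  qed (use cl R c order_trans[OF cl(1) c] in auto)
  finally have 3: "\<bar>clamp R (v$3) * (clamp R (v$1) - 21/4) - clamp R (w$3) * (clamp R (w$1) - 21/4)\<bar> \<le> R * ?n + ?n * (R + 6)" .
  \<comment> \<open>The three components contribute 2, 2 and 2 R + 6.\<close>
  have "norm (field R v - field R w) \<le> 2 * ?n + 2 * ?n + (R * ?n + ?n * (R + 6))"
    by (rule order_trans[OF norm_le_sum3]) (use 3 c[of 1] c[of 2] c[of 3] in \<open>simp add: field_def\<close>)
  then show ?thesis by (simp add: algebra_simps)
qed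

lemma rate_lipschitz:
  assumes R: "0 \<le> R"
  shows "norm (rate R a b - rate R a' b') \<le> (2 * R + 10) * (norm (a - a') + norm (b - b'))"
proof -
  have "rate R a b - rate R a' b' = (field R a - field R a') + (1/10000) *\<^sub>R (field R b - field R b')"
    by (simp add: rate_def algebra_simps)
  also have "norm \<dots> \<le> norm (field R a - field R a') + 1/10000 * norm (field R b - field R b')"
    by (rule order_trans[OF norm_triangle_ineq]) simp
  also have "\<dots> \<le> (2 * R + 10) * norm (a - a') + 1 * ((2 * R + 10) * norm (b - b'))"
    by (intro add_mono mult_mono field_lipschitz R) auto
  finally show ?thesis by (simp add: algebra_simps)
qed

lemma rate_lipschitz_100: "norm (rate 100 a b - rate 100 a' b') \<le> 210 * (norm (a - a') + norm (b - b'))"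
  using rate_lipschitz[of 100 a b a' b'] by simp

definition solves :: "(real \<Rightarrow> real^3) \<Rightarrow> bool" where
  "solves u \<longleftrightarrow> continuous_on UNIV u \<and>
     (\<forall>t\<ge>0. (u has_vector_derivative rate 100 (u t) (u (t - 1/2))) (at t within {0..}))"

lemma solves_exists:
  assumes "continuous_on {-1/2..0} \<phi>"
  obtains u where "solves u" "\<And>t. t \<in> {-1/2..0} \<Longrightarrow> u t = \<phi> t"
proof -
  have c: "continuous_on {-(1/2)..0} \<phi>" using assms by simp
  obtain u where "continuous_on UNIV u" "\<And>t. t \<in> {-(1/2)..0} \<Longrightarrow> u t = \<phi> t"
    "\<And>t. 0 \<le> t \<Longrightarrow> (u has_vector_derivative rate 100 (u t) (u (t - 1/2))) (at t within {0..})"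
    by (rule dde_exists[where F = "rate 100", OF _ _ rate_lipschitz_100 c]) auto
  then show thesis by (intro that[of u]) (auto simp: solves_def)
qed

lemma solves_derivative: "solves u \<Longrightarrow> 0 \<le> a \<Longrightarrow> t \<in> {a..b} \<Longrightarrow>
    (u has_vector_derivative rate 100 (u t) (u (t - 1/2))) (at t within {a..b})"
  unfolding solves_def by (rule has_vector_derivative_within_subset[of _ _ _ "{0..}"]) auto

lemma solves_dependence:
  assumes "solves u" "solves v" "0 \<le> \<delta>" "\<And>t. t \<in> {-1/2..0} \<Longrightarrow> norm (u t - v t) \<le> \<delta>" "t \<in> {-1/2..T}" "0 \<le> T"
  shows "norm (u t - v t) \<le> 2 * (1 + 210 * T) * exp (840 * T) * \<delta>"
proof (cases "0 \<le> t")
  case True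
  have "norm (u t - v t) \<le> 2 * (1 + 210 * T) * exp (4 * 210 * T) * \<delta>"
    by (rule dde_dependence[where F = "rate 100" and \<tau> = "1/2", OF _ _ _ assms(3) rate_lipschitz_100])
       (use assms True in \<open>auto intro: solves_derivative\<close>)
  then show ?thesis by simp
next
  case False
  define X where "X = (1 + 210 * T) * exp (840 * T)"
  have "1 * 1 \<le> X" unfolding X_def using assms(6) by (intro mult_mono) auto
  then have "1 * \<delta> \<le> X * \<delta>" using assms(3) by (intro mult_right_mono) auto
  moreover have "norm (u t - v t) \<le> \<delta>" using False assms(5) by (intro assms(4)) auto
  moreover have "2 * (1 + 210 * T) * exp (840 * T) * \<delta> = 2 * (X * \<delta>)" by (simp add: X_def)
  ultimately show ?thesis using assms(3) by linarith
qed

lemma solves_unique: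
  assumes "solves u" "solves v" "\<And>t. t \<in> {-1/2..0} \<Longrightarrow> u t = v t" "-1/2 \<le> t"
  shows "u t = v t"
  using solves_dependence[OF assms(1,2), of 0 t "max t 0"] assms(3,4) by auto

text \<open>Where the half unit of time before a return is spent. The box can be coarse because the
  history acts only through the factor 1/10000; the denominator 1024 makes all bounds integers at
  the scales used.\<close>

definition hbox :: "real^3 \<Rightarrow> bool" where
  "hbox v \<longleftrightarrow> -9830/1024 \<le> v$1 \<and> v$1 \<le> -717/1024 \<and> -2662/1024 \<le> v$2 \<and> v$2 \<le> 5529/1024 \<and> -1 \<le> v$3 \<and> v$3 \<le> 3"

text \<open>The two disjoint intervals for -x at a return, about [3.08, 5.45] for
  \<open>True\<close> and [5.61, 8.34] for \<open>False\<close>.\<close>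

definition xlo :: "bool \<Rightarrow> real" where "xlo b = (if b then 3157/1024 else 5740/1024)"
definition xhi :: "bool \<Rightarrow> real" where "xhi b = (if b then 5581/1024 else 8540/1024)"
definition zhi :: "bool \<Rightarrow> real" where "zhi b = (if b then 46/1024 else 26/1024)"

definition starts :: "bool \<Rightarrow> real^3 \<Rightarrow> bool" where
  "starts b v \<longleftrightarrow> - xhi b \<le> v$1 \<and> v$1 \<le> - xlo b \<and> v$2 = 0 \<and> 9/1024 \<le> v$3 \<and> v$3 \<le> zhi b"

definition adm :: "bool \<Rightarrow> (real \<Rightarrow> real^3) \<Rightarrow> bool" where
  "adm b u \<longleftrightarrow> (\<forall>t\<in>{-1/2..0}. hbox (u t)) \<and> starts b (u 0)"

text \<open>Phrased by values alone, so that functions agreeing at nonnegative times have the same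
  first return; the least period is decided by this.\<close>

definition first_down :: "(real \<Rightarrow> real^3) \<Rightarrow> real \<Rightarrow> bool" where
  "first_down u T \<longleftrightarrow> 0 < T \<and> u T $ 2 = 0 \<and> u T $ 1 < 0 \<and> (\<forall>s\<in>{0<..<T}. u s $ 1 < 0 \<longrightarrow> u s $ 2 \<noteq> 0)"

lemma first_down_unique: "first_down u T \<Longrightarrow> first_down u T' \<Longrightarrow> T = T'"
  unfolding first_down_def by (metis greaterThanLessThan_iff linorder_neqE_linordered_idom)

text \<open>\<open>T\<close> is the return time, \<open>c\<close> the only upward crossing of x = 0
  before it. The last four conjuncts are the covering: the ends of the first interval land on either
  side of the second, those of the second beyond the outer ends of both. The bound 13/2 is 416
  slots.\<close>

definition returns :: "bool \<Rightarrow> (real \<Rightarrow> real^3) \<Rightarrow> real \<Rightarrow> real \<Rightarrow> bool" where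
  "returns b u T c \<longleftrightarrow> first_down u T \<and> 1/2 \<le> T \<and> T \<le> 13/2 \<and> rate 100 (u T) (u (T - 1/2)) $ 2 < 0 \<and>
     0 < c \<and> c < T \<and> u c $ 1 = 0 \<and> 0 < rate 100 (u c) (u (c - 1/2)) $ 1 \<and>
     (\<forall>s\<in>{0..T}. u s $ 1 = 0 \<longrightarrow> 0 < rate 100 (u s) (u (s - 1/2)) $ 1 \<longrightarrow> s = c) \<and>
     (\<forall>s\<in>{T - 1/2..T}. hbox (u s)) \<and> 9/1024 \<le> u T $ 3 \<and> u T $ 3 \<le> zhi True \<and> (u T $ 1 \<le> - xlo False \<longrightarrow> u T $ 3 \<le> zhi False) \<and>
     (\<forall>s\<in>{-1/2..T}. \<forall>i. \<bar>u s $ i\<bar> \<le> 100) \<and>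
     (b \<longrightarrow> u 0 $ 1 = - xlo True \<longrightarrow> - xlo False < u T $ 1) \<and> (b \<longrightarrow> u 0 $ 1 = - xhi True \<longrightarrow> u T $ 1 < - xhi False) \<and>
     (\<not> b \<longrightarrow> u 0 $ 1 = - xlo False \<longrightarrow> u T $ 1 < - xhi False) \<and> (\<not> b \<longrightarrow> u 0 $ 1 = - xhi False \<longrightarrow> - xlo True < u T $ 1)"

definition hist_box :: "int \<Rightarrow> box" where
  "hist_box H = ((-19660 * H, -1434 * H), (-5324 * H, 11058 * H), (-2048 * H, 6144 * H))"

text \<open>The initial value of \<open>- x\<close> lies within \<open>w / 1024\<close> of \<open>X / 1024\<close>, and that of \<open>z\<close> in \<open>[9 / 1024, zu / 1024]\<close>; the
  final \<open>x\<close> must lie in \<open>[xl / 1024, xu / 1024]\<close>. The scale is \<open>S = 2048 * H\<close>.\<close>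

definition tube_cert :: "nat \<Rightarrow> int \<Rightarrow> int \<Rightarrow> int \<Rightarrow> int \<Rightarrow> int \<Rightarrow> int \<Rightarrow>
    cmd list \<Rightarrow> cmd list \<Rightarrow> cmd list \<Rightarrow> cmd list \<Rightarrow> cmd list \<Rightarrow> cmd list \<Rightarrow> cmd list \<Rightarrow> bool" where
  "tube_cert sh H zu X w xl xu A B C D G E F \<longleftrightarrow>
     cert (Par sh (2048 * H) (10752 * H) (Spec (128 * H) (hist_box H) (18 * H, 92 * H) (18 * H, 52 * H) (11480 * H) (2 * H * xl, 2 * H * xu)))
       (replicate 32 (hist_box H), (-2 * H * X, 0, H * (9 + zu)), MA (2 * H * w) (H * (zu - 9) + 1)) A B C D G E F \<and>
     slots (A @ B @ C @ D @ G @ E @ F) \<le> 416"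

lemma tube_returns:
  assumes u: "solves u" and adm: "adm b u" and H: "2048 * H = 2 ^ sh" and zu: "zu = (if b then 46 else 26)"
    and ce: "tube_cert sh H zu X w xl xu A B C D G E F"
    and X: "\<bar>u 0 $ 1 + real_of_int X / 1024\<bar> \<le> real_of_int w / 1024"
    and ends: "b \<Longrightarrow> u 0 $ 1 = - xlo True \<Longrightarrow> -5740 < xl" "b \<Longrightarrow> u 0 $ 1 = - xhi True \<Longrightarrow> xu < -8540"
      "\<not> b \<Longrightarrow> u 0 $ 1 = - xlo False \<Longrightarrow> xu < -8540" "\<not> b \<Longrightarrow> u 0 $ 1 = - xhi False \<Longrightarrow> -3157 < xl"
  shows "\<exists>T c. returns b u T c"
proof -
  define x y z where "x = (\<lambda>t. u t $ 1)" "y = (\<lambda>t. u t $ 2)" "z = (\<lambda>t. u t $ 3)"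
  have du: "((\<lambda>t. u t $ i) has_real_derivative rate 100 (u t) (u (t - 1/2)) $ i) (at t within {0..})" if "0 \<le> t" for t i
    using u that unfolding solves_def has_real_derivative_iff_has_vector_derivative
    by (auto intro: bounded_linear.has_vector_derivative[OF bounded_linear_vec_nth])
  interpret traj x y z sh "2048 * H" "10752 * H"
  proof
    show "2048 * H = 2 ^ sh" "4 * (10752 * H) = 21 * (2048 * H)" using H by simp_all
  qed (use du[of _ 1] du[of _ 2] du[of _ 3] in \<open>simp_all add: x_y_z_def rate_def field_def add_divide_distrib diff_divide_distrib\<close>)
  have Hp: "0 < real_of_int H" using Spos by simp
  have rvH: "rv (n * H) = real_of_int n / 2048" "rv (H * n) = real_of_int n / 2048" for n using Hp by simp_all
  have rates: "xd t = rate 100 (u t) (u (t - 1/2)) $ 1" "yd t = rate 100 (u t) (u (t - 1/2)) $ 2" for t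
    unfolding xd_def yd_def by (simp_all add: x_y_z_def rate_def field_def add_divide_distrib diff_divide_distrib)
  have hb: "inb (hist_box H) (x t) (y t) (z t) \<longleftrightarrow> hbox (u t)" for t
    unfolding hist_box_def inb.simps rvH hbox_def x_y_z_def by simp
  have hist: "tame (hist_box H) t" if "t \<in> {-1/2..0}" for t
  proof -
    have "hbox (u t)" using adm that by (simp add: adm_def)
    then show ?thesis unfolding tame_def hb by (simp add: hbox_def x_y_z_def abs_le_iff)
  qed
  have st: "starts b (u 0)" using adm by (simp add: adm_def)
  have y0: "y 0 = 0" using st by (simp add: starts_def x_y_z_def)
  have est: "est_ok 0 (-2 * H * X, 0, H * (9 + zu)) (MA (2 * H * w) (H * (zu - 9) + 1))"
  proof -
    have r1: "rv (-2 * H * X) = - (real_of_int X / 1024)" "rv (2 * H * w) = real_of_int w / 1024"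
      using Hp by (simp_all add: field_simps)
    have "sqrt (quad (x 0 - rv (-2 * H * X)) (y 0 - rv 0)) = \<bar>x 0 + real_of_int X / 1024\<bar>"
      unfolding r1 y0 quad_def by simp
    then have 1: "sqrt (quad (x 0 - rv (-2 * H * X)) (y 0 - rv 0)) \<le> rv (2 * H * w)" using X unfolding r1 by (simp add: x_y_z_def)
    have r2: "rv (H * (zu - 9) + 1) = (real_of_int zu - 9) / 2048 + rv 1" unfolding rv_add rvH by simp
    have "9 / 1024 \<le> z 0" "z 0 \<le> real_of_int zu / 1024" using st zu by (auto simp: starts_def x_y_z_def zhi_def)
    then have "z 0 - (9 + real_of_int zu) / 2048 \<le> (real_of_int zu - 9) / 2048" "- (z 0 - (9 + real_of_int zu) / 2048) \<le> (real_of_int zu - 9) / 2048"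
      unfolding add_divide_distrib diff_divide_distrib by linarith+
    then have "\<bar>z 0 - (9 + real_of_int zu) / 2048\<bar> \<le> (real_of_int zu - 9) / 2048 + rv 1" using rv_one by linarith
    moreover have "rv (H * (9 + zu)) = (9 + real_of_int zu) / 2048" unfolding rvH by simp
    ultimately have "\<bar>z 0 - rv (H * (9 + zu))\<bar> \<le> rv (H * (zu - 9) + 1)" unfolding r2 by metis
    with 1 show ?thesis by simp
  qed
  have sl: "slots (A @ B @ C @ D @ G @ E @ F) \<le> 416" using ce by (simp add: tube_cert_def)
  have T: "16 * (128 * H) = 2048 * H" by simp
  obtain tE tF c where t: "1/2 \<le> tE" "tE < tF" "tF \<le> real (slots (A @ B @ C @ D @ G @ E @ F)) / 64" "0 < c" "c < tE" "x c = 0" "0 < xd c"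
    and only: "\<And>s. s \<in> {0..tF} \<Longrightarrow> x s = 0 \<Longrightarrow> 0 < xd s \<Longrightarrow> s = c"
    and yy: "0 < y tE" "y tF < 0" and yE: "\<And>s. s \<in> {tE..tF} \<Longrightarrow> yd s < 0" and xE: "\<And>s. s \<in> {tE..tF} \<Longrightarrow> x s < 0"
    and yn: "\<And>s. s \<in> {0<..tE} \<Longrightarrow> x s < 0 \<Longrightarrow> y s \<noteq> 0"
    and hE: "\<And>s. s \<in> {tE - 1/2..tF} \<Longrightarrow> inb (hist_box H) (x s) (y s) (z s)"
    and bE: "\<And>s. s \<in> {tE..tF} \<Longrightarrow> zband (2 * H * xl, 2 * H * xu) (x s)" "\<And>s. s \<in> {tE..tF} \<Longrightarrow> zband (18 * H, 92 * H) (z s)"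
      "\<And>s. s \<in> {tE..tF} \<Longrightarrow> x s \<le> - rv (11480 * H) \<Longrightarrow> zband (18 * H, 52 * H) (z s)"
    and bd: "\<And>s. s \<in> {-1/2..tF} \<Longrightarrow> \<bar>x s\<bar> \<le> 100 \<and> \<bar>y s\<bar> \<le> 100 \<and> \<bar>z s\<bar> \<le> 100"
    by (rule tube[OF conjunct1[OF ce[unfolded tube_cert_def]] T hist est y0]) blast+
  have "continuous_on {tE..tF} y" by (rule DERIV_continuous_on[OF dy]) (use t in auto)
  \<comment> \<open>y strictly decreases between \<open>tE\<close> and \<open>tF\<close>, so this
    zero is the only one there and the return is the first.\<close>
  then obtain T where T: "tE \<le> T" "T \<le> tF" "y T = 0" using IVT2'[of y tF 0 tE] yy t(2) by auto
  have Tm: "T \<in> {tE..tF}" using T by simp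
  have Tl: "tE < T" using T yy(1) by (cases "T = tE") auto
  have first: "u s $ 2 \<noteq> 0" if s: "s \<in> {0<..<T}" "u s $ 1 < 0" for s
  proof (cases "s \<le> tE")
    case True
    then show ?thesis using yn[of s] s by (auto simp: x_y_z_def)
  next
    case False
    have "y T < y s"
      by (rule decreasing_of_negative_rate[where f' = yd]) (use False s T t yE in \<open>auto intro!: dy\<close>)
    then show ?thesis using T(3) by (simp add: x_y_z_def)
  qed
  have r3: "rv (2 * H * n) = real_of_int n / 1024" for n using Hp by simp
  have xb: "real_of_int xl / 1024 \<le> u T $ 1" "u T $ 1 \<le> real_of_int xu / 1024"
    using bE(1)[OF Tm] unfolding zband_def fst_conv snd_conv r3 by (simp_all add: x_y_z_def)
  have zb: "9 / 1024 \<le> u T $ 3" "u T $ 3 \<le> zhi True" using bE(2)[OF Tm] unfolding zband_def fst_conv snd_conv rvH by (simp_all add: x_y_z_def zhi_def)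
  have zb2: "u T $ 3 \<le> zhi False" if "u T $ 1 \<le> - xlo False"
    using bE(3)[OF Tm] that unfolding zband_def fst_conv snd_conv rvH by (simp add: x_y_z_def zhi_def xlo_def)
  have i3: "(\<forall>i. \<bar>v $ i\<bar> \<le> 100) \<longleftrightarrow> \<bar>v $ 1\<bar> \<le> 100 \<and> \<bar>v $ 2\<bar> \<le> 100 \<and> \<bar>v $ 3\<bar> \<le> 100" for v :: "real^3"
    by (simp add: forall_3)
  have "returns b u T c"
    unfolding returns_def
  proof (intro conjI)
    show "first_down u T" unfolding first_down_def using T t first xE[OF Tm] by (simp add: x_y_z_def)
    show "1/2 \<le> T" "T \<le> 13/2" using T t sl by linarith+
    show "rate 100 (u T) (u (T - 1 / 2)) $ 2 < 0" using yE[OF Tm] by (simp add: rates)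
    show "0 < c" "c < T" using t Tl by auto
    show "u c $ 1 = 0" using t(6) by (simp add: x_y_z_def)
    show "0 < rate 100 (u c) (u (c - 1 / 2)) $ 1" using t(7) unfolding rates .
    show "\<forall>s\<in>{0..T}. u s $ 1 = 0 \<longrightarrow> 0 < rate 100 (u s) (u (s - 1 / 2)) $ 1 \<longrightarrow> s = c"
      using only T by (auto simp: rates[symmetric] x_y_z_def)
    show "\<forall>s\<in>{T - 1 / 2..T}. hbox (u s)" using hE T unfolding hb by auto
    show "\<forall>s\<in>{- 1 / 2..T}. \<forall>i. \<bar>u s $ i\<bar> \<le> 100" unfolding i3 using bd T by (auto simp: x_y_z_def)
    show "u T $ 1 \<le> - xlo False \<longrightarrow> u T $ 3 \<le> zhi False" using zb2 by blast
    show "b \<longrightarrow> u 0 $ 1 = - xlo True \<longrightarrow> - xlo False < u T $ 1" using ends(1) xb by (force simp: xlo_def)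
    show "b \<longrightarrow> u 0 $ 1 = - xhi True \<longrightarrow> u T $ 1 < - xhi False" using ends(2) xb by (force simp: xhi_def)
    show "\<not> b \<longrightarrow> u 0 $ 1 = - xlo False \<longrightarrow> u T $ 1 < - xhi False" using ends(3) xb by (force simp: xhi_def)
    show "\<not> b \<longrightarrow> u 0 $ 1 = - xhi False \<longrightarrow> - xlo True < u T $ 1" using ends(4) xb by (force simp: xlo_def)
  qed (use zb in auto)
  then show ?thesis by blast
qed

section \<open>Certificates\<close>

text \<open>The four runs for interval ends start at a single x (\<open>w = 0\<close>) and use the
  finer scale 2^22, since the covering inequalities are read off from them: their landing range
  stops one 1024th beyond the end to be passed. The arguments of \<open>ToV\<close> may be chosen
  freely, as \<open>exec\<close> checks that the new estimate follows from the old.\<close>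

lemma cert_l1: "tube_cert 22 2048 46 3157 0 (-5739) (-717)
    (replicate 23 (Step 4 3 PA))
    ([Step 4 3 PB])
    (replicate 28 (Step 4 3 PC))
    (replicate 40 (Step 4 3 PD))
    (replicate 7 (Step 4 3 PG) @ replicate 7 (Step 6 0 PG))
    (replicate 2 (Step 6 0 PE))
    ([Step 6 0 PF])"
  by code_simp

lemma cert_r1: "tube_cert 22 2048 46 5581 0 (-9830) (-8541)
    (replicate 23 (Step 4 3 PA))
    ([Step 4 3 PB])
    (replicate 22 (Step 4 3 PC) @ replicate 6 (Step 5 1 PC) @ [ToV 28307 5771643] @ replicate 4 (Step 5 1 PC))
    (replicate 44 (Step 5 1 PD) @ [ToA] @ replicate 18 (Step 4 3 PD))
    (replicate 7 (Step 4 3 PG) @ replicate 4 (Step 6 0 PG))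
    ([Step 6 0 PE])
    ([Step 6 0 PF])"
  by code_simp

lemma cert_l2: "tube_cert 22 2048 26 5740 0 (-9830) (-8541)
    (replicate 47 (Step 5 1 PA))
    ([Step 5 1 PB])
    (replicate 48 (Step 5 1 PC) @ [ToV 14685 5881811] @ replicate 6 (Step 5 1 PC))
    (replicate 45 (Step 5 1 PD) @ [ToA] @ replicate 34 (Step 5 1 PD))
    (replicate 14 (Step 5 1 PG) @ replicate 4 (Step 6 0 PG))
    (replicate 2 (Step 6 0 PE))
    ([Step 6 0 PF])"
  by code_simp

lemma cert_r2: "tube_cert 22 2048 26 8540 0 (-3156) (-717)
    (replicate 47 (Step 5 1 PA))
    ([Step 5 1 PB])
    (replicate 30 (Step 5 1 PC) @ replicate 17 (Step 6 0 PC) @ [ToV 15615 4112468] @ replicate 34 (Step 6 0 PC))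
    (replicate 65 (Step 6 0 PD) @ [Step 5 1 PD, ToA] @ replicate 4 (Step 5 1 PD))
    (replicate 9 (Step 5 1 PG) @ replicate 15 (Step 6 0 PG))
    (replicate 3 (Step 6 0 PE))
    ([Step 6 0 PF])"
  by code_simp

text \<open>From here on whole subintervals, overlapping slightly, are run at the scale 2^18.
  Nothing is asked of the landing point beyond the x range of the history box and the bands for z.
  The pieces are much shorter for large -x, where the error has to be taken through the form
  \<open>MV\<close>.\<close>

lemma cert_1_3350: "tube_cert 18 128 46 3350 197 (-9830) (-717)
    (replicate 22 (Step 4 3 PA))
    (replicate 3 (Step 4 3 PB))
    (replicate 28 (Step 4 3 PC))
    (replicate 38 (Step 4 3 PD))
    (replicate 8 (Step 4 3 PG))
    (replicate 4 (Step 4 3 PE))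
    ([Step 4 3 PF])"
  by code_simp

lemma cert_1_3835: "tube_cert 18 128 46 3835 292 (-9830) (-717)
    (replicate 22 (Step 4 3 PA))
    (replicate 4 (Step 4 3 PB))
    (replicate 27 (Step 4 3 PC))
    (replicate 37 (Step 4 3 PD))
    (replicate 8 (Step 4 3 PG))
    (replicate 5 (Step 4 3 PE))
    ([Step 4 3 PF])"
  by code_simp

lemma cert_1_4399: "tube_cert 18 128 46 4399 276 (-9830) (-717)
    (replicate 22 (Step 4 3 PA))
    (replicate 3 (Step 4 3 PB))
    (replicate 28 (Step 4 3 PC))
    (replicate 37 (Step 4 3 PD))
    (replicate 8 (Step 4 3 PG))
    (replicate 5 (Step 4 3 PE))
    ([Step 4 3 PF])"
  by code_simp

lemma cert_1_4836: "tube_cert 18 128 46 4836 165 (-9830) (-717)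
    (replicate 22 (Step 4 3 PA))
    (replicate 3 (Step 4 3 PB))
    (replicate 27 (Step 4 3 PC))
    (replicate 38 (Step 4 3 PD))
    (replicate 8 (Step 4 3 PG))
    (replicate 5 (Step 4 3 PE))
    ([Step 4 3 PF])"
  by code_simp

lemma cert_1_5113: "tube_cert 18 128 46 5113 116 (-9830) (-717)
    (replicate 23 (Step 4 3 PA))
    (replicate 2 (Step 4 3 PB))
    (replicate 27 (Step 4 3 PC))
    (replicate 38 (Step 4 3 PD))
    (replicate 8 (Step 4 3 PG))
    (replicate 4 (Step 4 3 PE))
    ([Step 4 3 PF])"
  by code_simp

lemma cert_1_5328: "tube_cert 18 128 46 5328 103 (-9830) (-717)
    (replicate 23 (Step 4 3 PA))
    (replicate 2 (Step 4 3 PB))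
    (replicate 27 (Step 4 3 PC))
    (replicate 5 (Step 4 3 PD) @ [ToV 102229 255908] @ replicate 16 (Step 4 3 PD) @ [ToA] @ replicate 17 (Step 4 3 PD))
    (replicate 8 (Step 4 3 PG))
    (replicate 4 (Step 4 3 PE))
    ([Step 4 3 PF])"
  by code_simp

lemma cert_1_5516: "tube_cert 18 128 46 5516 89 (-9830) (-717)
    (replicate 23 (Step 4 3 PA))
    ([Step 4 3 PB])
    (replicate 28 (Step 4 3 PC))
    (replicate 3 (Step 4 3 PD) @ [ToV 82067 250630] @ replicate 18 (Step 4 3 PD) @ [ToA] @ replicate 16 (Step 4 3 PD))
    (replicate 8 (Step 4 3 PG))
    (replicate 4 (Step 4 3 PE))
    ([Step 4 3 PF])"
  by code_simp

lemma cert_2_5817: "tube_cert 18 128 26 5817 86 (-9830) (-717)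
    (replicate 23 (Step 4 3 PA))
    ([Step 4 3 PB])
    (replicate 28 (Step 4 3 PC))
    ([ToV 66154 259626] @ replicate 22 (Step 4 3 PD) @ [ToA] @ replicate 15 (Step 4 3 PD))
    (replicate 8 (Step 4 3 PG))
    (replicate 3 (Step 4 3 PE))
    ([Step 4 3 PF])"
  by code_simp

lemma cert_2_5990: "tube_cert 18 128 26 5990 91 (-9830) (-717)
    (replicate 23 (Step 4 3 PA))
    ([Step 4 3 PB])
    (replicate 27 (Step 4 3 PC) @ [ToV 68176 258818, Step 4 3 PC])
    (replicate 22 (Step 4 3 PD) @ [ToA] @ replicate 14 (Step 4 3 PD))
    (replicate 8 (Step 4 3 PG))
    (replicate 4 (Step 4 3 PE))
    ([Step 4 3 PF])"
  by code_simp

lemma cert_2_6156: "tube_cert 18 128 26 6156 79 (-9830) (-717)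
    (replicate 23 (Step 4 3 PA))
    ([Step 4 3 PB])
    (replicate 26 (Step 4 3 PC) @ [ToV 56749 261906] @ replicate 2 (Step 4 3 PC))
    (replicate 22 (Step 4 3 PD) @ [ToA] @ replicate 13 (Step 4 3 PD))
    (replicate 8 (Step 4 3 PG))
    (replicate 5 (Step 4 3 PE))
    ([Step 4 3 PF])"
  by code_simp

lemma cert_2_6302: "tube_cert 18 128 26 6302 71 (-9830) (-717)
    (replicate 23 (Step 4 3 PA))
    ([Step 4 3 PB])
    (replicate 26 (Step 4 3 PC) @ [ToV 55271 245458] @ replicate 2 (Step 4 3 PC))
    (replicate 22 (Step 4 3 PD) @ [ToA] @ replicate 13 (Step 4 3 PD))
    (replicate 8 (Step 4 3 PG))
    (replicate 4 (Step 4 3 PE))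
    ([Step 4 3 PF])"
  by code_simp

lemma cert_2_6443: "tube_cert 18 128 26 6443 74 (-9830) (-717)
    (replicate 23 (Step 4 3 PA))
    ([Step 4 3 PB])
    (replicate 25 (Step 4 3 PC) @ [ToV 53581 254730] @ replicate 3 (Step 4 3 PC))
    (replicate 22 (Step 4 3 PD) @ [ToA] @ replicate 12 (Step 4 3 PD))
    (replicate 8 (Step 4 3 PG))
    (replicate 5 (Step 4 3 PE))
    ([Step 4 3 PF])"
  by code_simp

lemma cert_2_6585: "tube_cert 18 128 26 6585 72 (-9830) (-717)
    (replicate 23 (Step 4 3 PA))
    ([Step 4 3 PB])
    (replicate 25 (Step 4 3 PC) @ [ToV 56129 239834] @ replicate 3 (Step 4 3 PC))
    (replicate 22 (Step 4 3 PD) @ [ToA] @ replicate 11 (Step 4 3 PD))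
    (replicate 8 (Step 4 3 PG))
    (replicate 5 (Step 4 3 PE))
    ([Step 4 3 PF])"
  by code_simp

lemma cert_2_6722: "tube_cert 18 128 26 6722 69 (-9830) (-717)
    (replicate 23 (Step 4 3 PA))
    ([Step 4 3 PB])
    (replicate 24 (Step 4 3 PC) @ [ToV 49356 252591] @ replicate 4 (Step 4 3 PC))
    (replicate 21 (Step 4 3 PD) @ [ToA] @ replicate 11 (Step 4 3 PD))
    (replicate 8 (Step 4 3 PG))
    (replicate 6 (Step 4 3 PE))
    ([Step 4 3 PF])"
  by code_simp

lemma cert_2_6851: "tube_cert 18 128 26 6851 64 (-9830) (-717)
    (replicate 23 (Step 4 3 PA))
    ([Step 4 3 PB])
    (replicate 24 (Step 4 3 PC) @ [ToV 48824 239819] @ replicate 4 (Step 4 3 PC))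
    (replicate 21 (Step 4 3 PD) @ [ToA] @ replicate 10 (Step 4 3 PD))
    (replicate 8 (Step 4 3 PG))
    (replicate 6 (Step 4 3 PE))
    ([Step 4 3 PF])"
  by code_simp

lemma cert_2_6968: "tube_cert 18 128 26 6968 57 (-9830) (-717)
    (replicate 23 (Step 4 3 PA))
    ([Step 4 3 PB])
    (replicate 23 (Step 4 3 PC) @ [ToV 39246 257557] @ replicate 5 (Step 4 3 PC))
    (replicate 21 (Step 4 3 PD) @ [ToA] @ replicate 9 (Step 4 3 PD))
    (replicate 8 (Step 4 3 PG))
    (replicate 7 (Step 4 3 PE))
    ([Step 4 3 PF])"
  by code_simp

lemma cert_2_7098: "tube_cert 18 128 26 7098 77 (-9830) (-717)
    (replicate 23 (Step 4 3 PA))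
    ([Step 4 3 PB])
    (replicate 18 (Step 4 3 PC) @ replicate 9 (Step 5 1 PC) @ [ToV 48273 260724] @ replicate 11 (Step 5 1 PC))
    (replicate 40 (Step 5 1 PD) @ [Step 4 3 PD, ToA] @ replicate 8 (Step 4 3 PD))
    (replicate 8 (Step 4 3 PG))
    (replicate 7 (Step 4 3 PE))
    ([Step 4 3 PF])"
  by code_simp

lemma cert_2_7240: "tube_cert 18 128 26 7240 69 (-9830) (-717)
    (replicate 23 (Step 4 3 PA))
    ([Step 4 3 PB])
    (replicate 17 (Step 4 3 PC) @ replicate 11 (Step 5 1 PC) @ [ToV 45474 247554] @ replicate 11 (Step 5 1 PC))
    (replicate 40 (Step 5 1 PD) @ [ToA] @ replicate 8 (Step 4 3 PD))
    (replicate 8 (Step 4 3 PG))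
    (replicate 7 (Step 4 3 PE))
    ([Step 4 3 PF])"
  by code_simp

lemma cert_2_7369: "tube_cert 18 128 26 7369 64 (-9830) (-717)
    (replicate 23 (Step 4 3 PA))
    ([Step 4 3 PB])
    (replicate 17 (Step 4 3 PC) @ replicate 10 (Step 5 1 PC) @ [ToV 41100 251968] @ replicate 12 (Step 5 1 PC))
    (replicate 38 (Step 5 1 PD) @ [Step 4 3 PD, ToA] @ replicate 7 (Step 4 3 PD))
    (replicate 8 (Step 4 3 PG))
    (replicate 7 (Step 4 3 PE))
    ([Step 4 3 PF])"
  by code_simp

lemma cert_2_7489: "tube_cert 18 128 26 7489 60 (-9830) (-717)
    (replicate 23 (Step 4 3 PA))
    ([Step 4 3 PB])
    (replicate 17 (Step 4 3 PC) @ replicate 9 (Step 5 1 PC) @ [ToV 37411 258116] @ replicate 13 (Step 5 1 PC))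
    (replicate 38 (Step 5 1 PD) @ [Step 4 3 PD, ToA] @ replicate 6 (Step 4 3 PD))
    (replicate 8 (Step 4 3 PG))
    (replicate 8 (Step 4 3 PE))
    ([Step 4 3 PF])"
  by code_simp

lemma cert_2_7598: "tube_cert 18 128 26 7598 53 (-9830) (-717)
    (replicate 23 (Step 4 3 PA))
    ([Step 4 3 PB])
    (replicate 17 (Step 4 3 PC) @ replicate 9 (Step 5 1 PC) @ [ToV 34634 248664] @ replicate 13 (Step 5 1 PC))
    (replicate 38 (Step 5 1 PD) @ [ToA] @ replicate 7 (Step 4 3 PD))
    (replicate 8 (Step 4 3 PG))
    (replicate 7 (Step 4 3 PE))
    ([Step 4 3 PF])"
  by code_simp

lemma cert_2_7693: "tube_cert 18 128 26 7693 46 (-9830) (-717)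
    (replicate 23 (Step 4 3 PA))
    ([Step 4 3 PB])
    (replicate 17 (Step 4 3 PC) @ replicate 8 (Step 5 1 PC) @ [ToV 29085 257943] @ replicate 14 (Step 5 1 PC))
    (replicate 37 (Step 5 1 PD) @ [ToA, Step 5 1 PD] @ replicate 6 (Step 4 3 PD))
    (replicate 8 (Step 4 3 PG))
    (replicate 7 (Step 4 3 PE))
    ([Step 4 3 PF])"
  by code_simp

lemma cert_2_7785: "tube_cert 18 128 26 7785 50 (-9830) (-717)
    (replicate 23 (Step 4 3 PA))
    ([Step 4 3 PB])
    (replicate 16 (Step 4 3 PC) @ replicate 10 (Step 5 1 PC) @ [ToV 31995 250218] @ replicate 14 (Step 5 1 PC))
    (replicate 36 (Step 5 1 PD) @ [Step 4 3 PD, ToA] @ replicate 5 (Step 4 3 PD))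
    (replicate 8 (Step 4 3 PG))
    (replicate 7 (Step 4 3 PE))
    ([Step 4 3 PF])"
  by code_simp

lemma cert_2_7886: "tube_cert 18 128 26 7886 55 (-9830) (-717)
    (replicate 23 (Step 4 3 PA))
    ([Step 4 3 PB])
    (replicate 16 (Step 4 3 PC) @ replicate 9 (Step 5 1 PC) @ [ToV 33424 259941] @ replicate 15 (Step 5 1 PC))
    (replicate 36 (Step 5 1 PD) @ [ToA] @ replicate 4 (Step 4 3 PD))
    (replicate 8 (Step 4 3 PG))
    (replicate 9 (Step 4 3 PE))
    ([Step 4 3 PF])"
  by code_simp

lemma cert_2_7990: "tube_cert 18 128 26 7990 53 (-9830) (-717)
    (replicate 23 (Step 4 3 PA))
    ([Step 4 3 PB])
    (replicate 16 (Step 4 3 PC) @ replicate 9 (Step 5 1 PC) @ [ToV 33339 251465] @ replicate 16 (Step 5 1 PC))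
    (replicate 35 (Step 5 1 PD) @ [ToA] @ replicate 3 (Step 4 3 PD))
    (replicate 8 (Step 4 3 PG))
    (replicate 9 (Step 4 3 PE))
    ([Step 4 3 PF])"
  by code_simp

lemma cert_2_8088: "tube_cert 18 128 26 8088 49 (-9830) (-717)
    (replicate 23 (Step 4 3 PA))
    ([Step 4 3 PB])
    (replicate 16 (Step 4 3 PC) @ replicate 9 (Step 5 1 PC) @ [ToV 32019 243679] @ replicate 16 (Step 5 1 PC))
    (replicate 33 (Step 5 1 PD) @ [Step 4 3 PD, ToA] @ replicate 2 (Step 4 3 PD))
    (replicate 8 (Step 4 3 PG))
    (replicate 9 (Step 4 3 PE))
    ([Step 4 3 PF])"
  by code_simp

lemma cert_2_8176: "tube_cert 18 128 26 8176 43 (-9830) (-717)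
    (replicate 23 (Step 4 3 PA))
    ([Step 4 3 PB])
    (replicate 16 (Step 4 3 PC) @ replicate 8 (Step 5 1 PC) @ [ToV 26908 255411] @ replicate 17 (Step 5 1 PC))
    (replicate 33 (Step 5 1 PD) @ [Step 4 3 PD, ToA] @ replicate 2 (Step 4 3 PD))
    (replicate 8 (Step 4 3 PG))
    (replicate 8 (Step 4 3 PE))
    ([Step 4 3 PF])"
  by code_simp

lemma cert_2_8255: "tube_cert 18 128 26 8255 40 (-9830) (-717)
    (replicate 23 (Step 4 3 PA))
    ([Step 4 3 PB])
    (replicate 16 (Step 4 3 PC) @ replicate 8 (Step 5 1 PC) @ [ToV 25803 249266] @ replicate 17 (Step 5 1 PC))
    (replicate 33 (Step 5 1 PD) @ [ToA] @ replicate 2 (Step 4 3 PD))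
    (replicate 8 (Step 4 3 PG))
    (replicate 8 (Step 4 3 PE))
    ([Step 4 3 PF])"
  by code_simp

lemma cert_2_8327: "tube_cert 18 128 26 8327 36 (-9830) (-717)
    (replicate 23 (Step 4 3 PA))
    ([Step 4 3 PB])
    (replicate 16 (Step 4 3 PC) @ replicate 8 (Step 5 1 PC) @ [ToV 24092 243786] @ replicate 17 (Step 5 1 PC))
    (replicate 33 (Step 5 1 PD) @ [ToA, Step 4 3 PD])
    (replicate 8 (Step 4 3 PG))
    (replicate 8 (Step 4 3 PE))
    ([Step 4 3 PF])"
  by code_simp

lemma cert_2_8389: "tube_cert 18 128 26 8389 30 (-9830) (-717)
    (replicate 23 (Step 4 3 PA))
    ([Step 4 3 PB])
    (replicate 16 (Step 4 3 PC) @ replicate 7 (Step 5 1 PC) @ [ToV 19294 258439] @ replicate 17 (Step 5 1 PC))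
    (replicate 34 (Step 5 1 PD) @ [ToA, Step 4 3 PD])
    (replicate 8 (Step 4 3 PG))
    (replicate 7 (Step 4 3 PE))
    ([Step 4 3 PF])"
  by code_simp

lemma cert_2_8446: "tube_cert 18 128 26 8446 31 (-9830) (-717)
    (replicate 23 (Step 4 3 PA))
    ([Step 4 3 PB])
    (replicate 16 (Step 4 3 PC) @ replicate 7 (Step 5 1 PC) @ [ToV 20176 254135] @ replicate 18 (Step 5 1 PC))
    (replicate 31 (Step 5 1 PD) @ [Step 4 3 PD])
    ([ToA] @ replicate 8 (Step 4 3 PG))
    (replicate 7 (Step 4 3 PE))
    ([Step 4 3 PF])"
  by code_simp

lemma cert_2_8497: "tube_cert 18 128 26 8497 24 (-9830) (-717)
    (replicate 23 (Step 4 3 PA))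
    ([Step 4 3 PB])
    (replicate 15 (Step 4 3 PC) @ replicate 9 (Step 5 1 PC) @ [ToV 16251 250310] @ replicate 17 (Step 5 1 PC))
    (replicate 32 (Step 5 1 PD) @ [Step 4 3 PD])
    ([ToA] @ replicate 8 (Step 4 3 PG))
    (replicate 6 (Step 4 3 PE))
    ([Step 4 3 PF])"
  by code_simp

lemma cert_2_8538: "tube_cert 18 128 26 8538 21 (-9830) (-717)
    (replicate 23 (Step 4 3 PA))
    ([Step 4 3 PB])
    (replicate 15 (Step 4 3 PC) @ replicate 9 (Step 5 1 PC) @ [ToV 14850 247297] @ replicate 17 (Step 5 1 PC))
    (replicate 32 (Step 5 1 PD))
    ([Step 4 3 PG, ToA] @ replicate 7 (Step 4 3 PG))
    (replicate 6 (Step 4 3 PE))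
    ([Step 4 3 PF])"
  by code_simp

lemma return_exists:
  assumes u: "solves u" and adm: "adm b u"
  shows "\<exists>T c. returns b u T c"
proof -
  have st: "- xhi b \<le> u 0 $ 1" "u 0 $ 1 \<le> - xlo b" using adm by (simp_all add: adm_def starts_def)
  have HH: "2048 * 2048 = (2 ^ 22 :: int)" "2048 * 128 = (2 ^ 18 :: int)" by simp_all
  show ?thesis
  proof (cases b)
    case True
    \<comment> \<open>On the pieces the end points are excluded, which makes the premises
      \<open>ends\<close> of \<open>tube_returns\<close> vacuous; at the end points the finer runs
      supply them.\<close>
    have "u 0 $ 1 = - (3157 / 1024) \<or> u 0 $ 1 = - (5581 / 1024) \<or> u 0 $ 1 \<noteq> - (3157 / 1024) \<and> u 0 $ 1 \<noteq> - (5581 / 1024) \<and>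
      (\<bar>u 0 $ 1 + 3350 / 1024\<bar> \<le> 197 / 1024 \<or>
       \<bar>u 0 $ 1 + 3835 / 1024\<bar> \<le> 292 / 1024 \<or>
       \<bar>u 0 $ 1 + 4399 / 1024\<bar> \<le> 276 / 1024 \<or>
       \<bar>u 0 $ 1 + 4836 / 1024\<bar> \<le> 165 / 1024 \<or>
       \<bar>u 0 $ 1 + 5113 / 1024\<bar> \<le> 116 / 1024 \<or>
       \<bar>u 0 $ 1 + 5328 / 1024\<bar> \<le> 103 / 1024 \<or>
       \<bar>u 0 $ 1 + 5516 / 1024\<bar> \<le> 89 / 1024)"
      using st True by (simp add: xlo_def xhi_def abs_le_iff) argo
    then consider (l) "u 0 $ 1 = - (3157 / 1024)" |
      (r) "u 0 $ 1 = - (5581 / 1024)" |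
      (i0) "u 0 $ 1 \<noteq> - (3157 / 1024)" "u 0 $ 1 \<noteq> - (5581 / 1024)" "\<bar>u 0 $ 1 + 3350 / 1024\<bar> \<le> 197 / 1024" |
      (i1) "u 0 $ 1 \<noteq> - (3157 / 1024)" "u 0 $ 1 \<noteq> - (5581 / 1024)" "\<bar>u 0 $ 1 + 3835 / 1024\<bar> \<le> 292 / 1024" |
      (i2) "u 0 $ 1 \<noteq> - (3157 / 1024)" "u 0 $ 1 \<noteq> - (5581 / 1024)" "\<bar>u 0 $ 1 + 4399 / 1024\<bar> \<le> 276 / 1024" |
      (i3) "u 0 $ 1 \<noteq> - (3157 / 1024)" "u 0 $ 1 \<noteq> - (5581 / 1024)" "\<bar>u 0 $ 1 + 4836 / 1024\<bar> \<le> 165 / 1024" |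
      (i4) "u 0 $ 1 \<noteq> - (3157 / 1024)" "u 0 $ 1 \<noteq> - (5581 / 1024)" "\<bar>u 0 $ 1 + 5113 / 1024\<bar> \<le> 116 / 1024" |
      (i5) "u 0 $ 1 \<noteq> - (3157 / 1024)" "u 0 $ 1 \<noteq> - (5581 / 1024)" "\<bar>u 0 $ 1 + 5328 / 1024\<bar> \<le> 103 / 1024" |
      (i6) "u 0 $ 1 \<noteq> - (3157 / 1024)" "u 0 $ 1 \<noteq> - (5581 / 1024)" "\<bar>u 0 $ 1 + 5516 / 1024\<bar> \<le> 89 / 1024"
      by blast
    then show ?thesis
    proof cases
      case l
      show ?thesis by (rule tube_returns[OF u adm HH(1) _ cert_l1]) (use l True in \<open>simp_all add: xlo_def xhi_def\<close>)
    next
      case r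
      show ?thesis by (rule tube_returns[OF u adm HH(1) _ cert_r1]) (use r True in \<open>simp_all add: xlo_def xhi_def\<close>)
    next
      case i0
      show ?thesis by (rule tube_returns[OF u adm HH(2) _ cert_1_3350]) (use i0 True in \<open>simp_all add: xlo_def xhi_def\<close>)
    next
      case i1
      show ?thesis by (rule tube_returns[OF u adm HH(2) _ cert_1_3835]) (use i1 True in \<open>simp_all add: xlo_def xhi_def\<close>)
    next
      case i2
      show ?thesis by (rule tube_returns[OF u adm HH(2) _ cert_1_4399]) (use i2 True in \<open>simp_all add: xlo_def xhi_def\<close>)
    next
      case i3
      show ?thesis by (rule tube_returns[OF u adm HH(2) _ cert_1_4836]) (use i3 True in \<open>simp_all add: xlo_def xhi_def\<close>)
    next
      case i4
      show ?thesis by (rule tube_returns[OF u adm HH(2) _ cert_1_5113]) (use i4 True in \<open>simp_all add: xlo_def xhi_def\<close>)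
    next
      case i5
      show ?thesis by (rule tube_returns[OF u adm HH(2) _ cert_1_5328]) (use i5 True in \<open>simp_all add: xlo_def xhi_def\<close>)
    next
      case i6
      show ?thesis by (rule tube_returns[OF u adm HH(2) _ cert_1_5516]) (use i6 True in \<open>simp_all add: xlo_def xhi_def\<close>)
    qed
  next
    case False
    have "u 0 $ 1 = - (5740 / 1024) \<or> u 0 $ 1 = - (8540 / 1024) \<or> u 0 $ 1 \<noteq> - (5740 / 1024) \<and> u 0 $ 1 \<noteq> - (8540 / 1024) \<and>
      (\<bar>u 0 $ 1 + 5817 / 1024\<bar> \<le> 86 / 1024 \<or>
       \<bar>u 0 $ 1 + 5990 / 1024\<bar> \<le> 91 / 1024 \<or>
       \<bar>u 0 $ 1 + 6156 / 1024\<bar> \<le> 79 / 1024 \<or>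
       \<bar>u 0 $ 1 + 6302 / 1024\<bar> \<le> 71 / 1024 \<or>
       \<bar>u 0 $ 1 + 6443 / 1024\<bar> \<le> 74 / 1024 \<or>
       \<bar>u 0 $ 1 + 6585 / 1024\<bar> \<le> 72 / 1024 \<or>
       \<bar>u 0 $ 1 + 6722 / 1024\<bar> \<le> 69 / 1024 \<or>
       \<bar>u 0 $ 1 + 6851 / 1024\<bar> \<le> 64 / 1024 \<or>
       \<bar>u 0 $ 1 + 6968 / 1024\<bar> \<le> 57 / 1024 \<or>
       \<bar>u 0 $ 1 + 7098 / 1024\<bar> \<le> 77 / 1024 \<or>
       \<bar>u 0 $ 1 + 7240 / 1024\<bar> \<le> 69 / 1024 \<or>
       \<bar>u 0 $ 1 + 7369 / 1024\<bar> \<le> 64 / 1024 \<or>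
       \<bar>u 0 $ 1 + 7489 / 1024\<bar> \<le> 60 / 1024 \<or>
       \<bar>u 0 $ 1 + 7598 / 1024\<bar> \<le> 53 / 1024 \<or>
       \<bar>u 0 $ 1 + 7693 / 1024\<bar> \<le> 46 / 1024 \<or>
       \<bar>u 0 $ 1 + 7785 / 1024\<bar> \<le> 50 / 1024 \<or>
       \<bar>u 0 $ 1 + 7886 / 1024\<bar> \<le> 55 / 1024 \<or>
       \<bar>u 0 $ 1 + 7990 / 1024\<bar> \<le> 53 / 1024 \<or>
       \<bar>u 0 $ 1 + 8088 / 1024\<bar> \<le> 49 / 1024 \<or>
       \<bar>u 0 $ 1 + 8176 / 1024\<bar> \<le> 43 / 1024 \<or>
       \<bar>u 0 $ 1 + 8255 / 1024\<bar> \<le> 40 / 1024 \<or>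
       \<bar>u 0 $ 1 + 8327 / 1024\<bar> \<le> 36 / 1024 \<or>
       \<bar>u 0 $ 1 + 8389 / 1024\<bar> \<le> 30 / 1024 \<or>
       \<bar>u 0 $ 1 + 8446 / 1024\<bar> \<le> 31 / 1024 \<or>
       \<bar>u 0 $ 1 + 8497 / 1024\<bar> \<le> 24 / 1024 \<or>
       \<bar>u 0 $ 1 + 8538 / 1024\<bar> \<le> 21 / 1024)"
      using st False by (simp add: xlo_def xhi_def abs_le_iff) argo
    then consider (l) "u 0 $ 1 = - (5740 / 1024)" |
      (r) "u 0 $ 1 = - (8540 / 1024)" |
      (i0) "u 0 $ 1 \<noteq> - (5740 / 1024)" "u 0 $ 1 \<noteq> - (8540 / 1024)" "\<bar>u 0 $ 1 + 5817 / 1024\<bar> \<le> 86 / 1024" |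
      (i1) "u 0 $ 1 \<noteq> - (5740 / 1024)" "u 0 $ 1 \<noteq> - (8540 / 1024)" "\<bar>u 0 $ 1 + 5990 / 1024\<bar> \<le> 91 / 1024" |
      (i2) "u 0 $ 1 \<noteq> - (5740 / 1024)" "u 0 $ 1 \<noteq> - (8540 / 1024)" "\<bar>u 0 $ 1 + 6156 / 1024\<bar> \<le> 79 / 1024" |
      (i3) "u 0 $ 1 \<noteq> - (5740 / 1024)" "u 0 $ 1 \<noteq> - (8540 / 1024)" "\<bar>u 0 $ 1 + 6302 / 1024\<bar> \<le> 71 / 1024" |
      (i4) "u 0 $ 1 \<noteq> - (5740 / 1024)" "u 0 $ 1 \<noteq> - (8540 / 1024)" "\<bar>u 0 $ 1 + 6443 / 1024\<bar> \<le> 74 / 1024" |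
      (i5) "u 0 $ 1 \<noteq> - (5740 / 1024)" "u 0 $ 1 \<noteq> - (8540 / 1024)" "\<bar>u 0 $ 1 + 6585 / 1024\<bar> \<le> 72 / 1024" |
      (i6) "u 0 $ 1 \<noteq> - (5740 / 1024)" "u 0 $ 1 \<noteq> - (8540 / 1024)" "\<bar>u 0 $ 1 + 6722 / 1024\<bar> \<le> 69 / 1024" |
      (i7) "u 0 $ 1 \<noteq> - (5740 / 1024)" "u 0 $ 1 \<noteq> - (8540 / 1024)" "\<bar>u 0 $ 1 + 6851 / 1024\<bar> \<le> 64 / 1024" |
      (i8) "u 0 $ 1 \<noteq> - (5740 / 1024)" "u 0 $ 1 \<noteq> - (8540 / 1024)" "\<bar>u 0 $ 1 + 6968 / 1024\<bar> \<le> 57 / 1024" |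
      (i9) "u 0 $ 1 \<noteq> - (5740 / 1024)" "u 0 $ 1 \<noteq> - (8540 / 1024)" "\<bar>u 0 $ 1 + 7098 / 1024\<bar> \<le> 77 / 1024" |
      (i10) "u 0 $ 1 \<noteq> - (5740 / 1024)" "u 0 $ 1 \<noteq> - (8540 / 1024)" "\<bar>u 0 $ 1 + 7240 / 1024\<bar> \<le> 69 / 1024" |
      (i11) "u 0 $ 1 \<noteq> - (5740 / 1024)" "u 0 $ 1 \<noteq> - (8540 / 1024)" "\<bar>u 0 $ 1 + 7369 / 1024\<bar> \<le> 64 / 1024" |
      (i12) "u 0 $ 1 \<noteq> - (5740 / 1024)" "u 0 $ 1 \<noteq> - (8540 / 1024)" "\<bar>u 0 $ 1 + 7489 / 1024\<bar> \<le> 60 / 1024" |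
      (i13) "u 0 $ 1 \<noteq> - (5740 / 1024)" "u 0 $ 1 \<noteq> - (8540 / 1024)" "\<bar>u 0 $ 1 + 7598 / 1024\<bar> \<le> 53 / 1024" |
      (i14) "u 0 $ 1 \<noteq> - (5740 / 1024)" "u 0 $ 1 \<noteq> - (8540 / 1024)" "\<bar>u 0 $ 1 + 7693 / 1024\<bar> \<le> 46 / 1024" |
      (i15) "u 0 $ 1 \<noteq> - (5740 / 1024)" "u 0 $ 1 \<noteq> - (8540 / 1024)" "\<bar>u 0 $ 1 + 7785 / 1024\<bar> \<le> 50 / 1024" |
      (i16) "u 0 $ 1 \<noteq> - (5740 / 1024)" "u 0 $ 1 \<noteq> - (8540 / 1024)" "\<bar>u 0 $ 1 + 7886 / 1024\<bar> \<le> 55 / 1024" |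
      (i17) "u 0 $ 1 \<noteq> - (5740 / 1024)" "u 0 $ 1 \<noteq> - (8540 / 1024)" "\<bar>u 0 $ 1 + 7990 / 1024\<bar> \<le> 53 / 1024" |
      (i18) "u 0 $ 1 \<noteq> - (5740 / 1024)" "u 0 $ 1 \<noteq> - (8540 / 1024)" "\<bar>u 0 $ 1 + 8088 / 1024\<bar> \<le> 49 / 1024" |
      (i19) "u 0 $ 1 \<noteq> - (5740 / 1024)" "u 0 $ 1 \<noteq> - (8540 / 1024)" "\<bar>u 0 $ 1 + 8176 / 1024\<bar> \<le> 43 / 1024" |
      (i20) "u 0 $ 1 \<noteq> - (5740 / 1024)" "u 0 $ 1 \<noteq> - (8540 / 1024)" "\<bar>u 0 $ 1 + 8255 / 1024\<bar> \<le> 40 / 1024" |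
      (i21) "u 0 $ 1 \<noteq> - (5740 / 1024)" "u 0 $ 1 \<noteq> - (8540 / 1024)" "\<bar>u 0 $ 1 + 8327 / 1024\<bar> \<le> 36 / 1024" |
      (i22) "u 0 $ 1 \<noteq> - (5740 / 1024)" "u 0 $ 1 \<noteq> - (8540 / 1024)" "\<bar>u 0 $ 1 + 8389 / 1024\<bar> \<le> 30 / 1024" |
      (i23) "u 0 $ 1 \<noteq> - (5740 / 1024)" "u 0 $ 1 \<noteq> - (8540 / 1024)" "\<bar>u 0 $ 1 + 8446 / 1024\<bar> \<le> 31 / 1024" |
      (i24) "u 0 $ 1 \<noteq> - (5740 / 1024)" "u 0 $ 1 \<noteq> - (8540 / 1024)" "\<bar>u 0 $ 1 + 8497 / 1024\<bar> \<le> 24 / 1024" |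
      (i25) "u 0 $ 1 \<noteq> - (5740 / 1024)" "u 0 $ 1 \<noteq> - (8540 / 1024)" "\<bar>u 0 $ 1 + 8538 / 1024\<bar> \<le> 21 / 1024"
      by blast
    then show ?thesis
    proof cases
      case l
      show ?thesis by (rule tube_returns[OF u adm HH(1) _ cert_l2]) (use l False in \<open>simp_all add: xlo_def xhi_def\<close>)
    next
      case r
      show ?thesis by (rule tube_returns[OF u adm HH(1) _ cert_r2]) (use r False in \<open>simp_all add: xlo_def xhi_def\<close>)
    next
      case i0
      show ?thesis by (rule tube_returns[OF u adm HH(2) _ cert_2_5817]) (use i0 False in \<open>simp_all add: xlo_def xhi_def\<close>)
    next
      case i1
      show ?thesis by (rule tube_returns[OF u adm HH(2) _ cert_2_5990]) (use i1 False in \<open>simp_all add: xlo_def xhi_def\<close>)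
    next
      case i2
      show ?thesis by (rule tube_returns[OF u adm HH(2) _ cert_2_6156]) (use i2 False in \<open>simp_all add: xlo_def xhi_def\<close>)
    next
      case i3
      show ?thesis by (rule tube_returns[OF u adm HH(2) _ cert_2_6302]) (use i3 False in \<open>simp_all add: xlo_def xhi_def\<close>)
    next
      case i4
      show ?thesis by (rule tube_returns[OF u adm HH(2) _ cert_2_6443]) (use i4 False in \<open>simp_all add: xlo_def xhi_def\<close>)
    next
      case i5
      show ?thesis by (rule tube_returns[OF u adm HH(2) _ cert_2_6585]) (use i5 False in \<open>simp_all add: xlo_def xhi_def\<close>)
    next
      case i6
      show ?thesis by (rule tube_returns[OF u adm HH(2) _ cert_2_6722]) (use i6 False in \<open>simp_all add: xlo_def xhi_def\<close>)
    next
      case i7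
      show ?thesis by (rule tube_returns[OF u adm HH(2) _ cert_2_6851]) (use i7 False in \<open>simp_all add: xlo_def xhi_def\<close>)
    next
      case i8
      show ?thesis by (rule tube_returns[OF u adm HH(2) _ cert_2_6968]) (use i8 False in \<open>simp_all add: xlo_def xhi_def\<close>)
    next
      case i9
      show ?thesis by (rule tube_returns[OF u adm HH(2) _ cert_2_7098]) (use i9 False in \<open>simp_all add: xlo_def xhi_def\<close>)
    next
      case i10
      show ?thesis by (rule tube_returns[OF u adm HH(2) _ cert_2_7240]) (use i10 False in \<open>simp_all add: xlo_def xhi_def\<close>)
    next
      case i11
      show ?thesis by (rule tube_returns[OF u adm HH(2) _ cert_2_7369]) (use i11 False in \<open>simp_all add: xlo_def xhi_def\<close>)
    next
      case i12
      show ?thesis by (rule tube_returns[OF u adm HH(2) _ cert_2_7489]) (use i12 False in \<open>simp_all add: xlo_def xhi_def\<close>)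
    next
      case i13
      show ?thesis by (rule tube_returns[OF u adm HH(2) _ cert_2_7598]) (use i13 False in \<open>simp_all add: xlo_def xhi_def\<close>)
    next
      case i14
      show ?thesis by (rule tube_returns[OF u adm HH(2) _ cert_2_7693]) (use i14 False in \<open>simp_all add: xlo_def xhi_def\<close>)
    next
      case i15
      show ?thesis by (rule tube_returns[OF u adm HH(2) _ cert_2_7785]) (use i15 False in \<open>simp_all add: xlo_def xhi_def\<close>)
    next
      case i16
      show ?thesis by (rule tube_returns[OF u adm HH(2) _ cert_2_7886]) (use i16 False in \<open>simp_all add: xlo_def xhi_def\<close>)
    next
      case i17
      show ?thesis by (rule tube_returns[OF u adm HH(2) _ cert_2_7990]) (use i17 False in \<open>simp_all add: xlo_def xhi_def\<close>)
    next
      case i18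
      show ?thesis by (rule tube_returns[OF u adm HH(2) _ cert_2_8088]) (use i18 False in \<open>simp_all add: xlo_def xhi_def\<close>)
    next
      case i19
      show ?thesis by (rule tube_returns[OF u adm HH(2) _ cert_2_8176]) (use i19 False in \<open>simp_all add: xlo_def xhi_def\<close>)
    next
      case i20
      show ?thesis by (rule tube_returns[OF u adm HH(2) _ cert_2_8255]) (use i20 False in \<open>simp_all add: xlo_def xhi_def\<close>)
    next
      case i21
      show ?thesis by (rule tube_returns[OF u adm HH(2) _ cert_2_8327]) (use i21 False in \<open>simp_all add: xlo_def xhi_def\<close>)
    next
      case i22
      show ?thesis by (rule tube_returns[OF u adm HH(2) _ cert_2_8389]) (use i22 False in \<open>simp_all add: xlo_def xhi_def\<close>)
    next
      case i23
      show ?thesis by (rule tube_returns[OF u adm HH(2) _ cert_2_8446]) (use i23 False in \<open>simp_all add: xlo_def xhi_def\<close>)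
    next
      case i24
      show ?thesis by (rule tube_returns[OF u adm HH(2) _ cert_2_8497]) (use i24 False in \<open>simp_all add: xlo_def xhi_def\<close>)
    next
      case i25
      show ?thesis by (rule tube_returns[OF u adm HH(2) _ cert_2_8538]) (use i25 False in \<open>simp_all add: xlo_def xhi_def\<close>)
    qed
  qed
qed

section \<open>Continuity of the return map\<close>

text \<open>Late returns are excluded by transversality, early ones by compactness: a limit of early
  return times would be an earlier return of \<open>v\<close>.\<close>

lemma return_time_tendsto:
  assumes U: "\<And>p. solves (U p)" and v: "solves v"
    and conv: "\<And>e. 0 < e \<Longrightarrow> \<forall>\<^sub>F p in sequentially. \<forall>t\<in>{-1/2..13/2}. norm (U p t - v t) \<le> e"
    and RU: "\<And>p. returns (b p) (U p) (T p) (c p)" and Rv: "returns b' v t0 c'"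
  shows "T \<longlonglongrightarrow> t0"
proof (rule LIMSEQ_I)
  fix r :: real assume r: "0 < r"
  have fd: "0 < t0" "v t0 $ 2 = 0" "v t0 $ 1 < 0" "rate 100 (v t0) (v (t0 - 1/2)) $ 2 < 0"
    "\<And>s. s \<in> {0<..<t0} \<Longrightarrow> v s $ 1 < 0 \<Longrightarrow> v s $ 2 \<noteq> 0" "1/2 \<le> t0" "t0 \<le> 13/2"
    using Rv by (auto simp: returns_def first_down_def)
  have Tb: "1/2 \<le> T p" "T p \<le> 13/2" "U p (T p) $ 2 = 0" "U p (T p) $ 1 \<le> -717/1024"
    "\<And>s. s \<in> {0<..<T p} \<Longrightarrow> U p s $ 1 < 0 \<Longrightarrow> U p s $ 2 \<noteq> 0" for p
    using RU[of p] by (auto simp: returns_def first_down_def hbox_def)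
  have cv: "continuous_on A (\<lambda>t. v t $ i)" and cU: "continuous_on A (\<lambda>t. U p t $ i)" for A i p
    using v U[of p] unfolding solves_def by (auto intro!: continuous_intros intro: continuous_on_subset)
  have comp: "\<bar>U p t $ i - v t $ i\<bar> \<le> norm (U p t - v t)" for p t i
    using component_le_norm_cart[of "U p t - v t" i] by simp
  have conv_seq: "(\<lambda>n. U (q n) (t n) $ i) \<longlonglongrightarrow> v l $ i"
    if q: "strict_mono (q :: nat \<Rightarrow> nat)" and t: "\<And>n. t n \<in> {-1/2..13/2}" and l: "t \<longlonglongrightarrow> l" for q t l i
  proof -
    have "(\<lambda>n. v (t n) $ i) \<longlonglongrightarrow> v l $ i"
      by (rule continuous_on_tendsto_compose[OF cv[of UNIV] l]) auto
    moreover have "(\<lambda>n. U (q n) (t n) $ i - v (t n) $ i) \<longlonglongrightarrow> 0"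
    proof (rule LIMSEQ_I)
      fix e :: real assume "0 < e"
      then have "\<forall>\<^sub>F p in sequentially. \<forall>t\<in>{-1/2..13/2}. norm (U p t - v t) \<le> e / 2" by (intro conv) simp
      then obtain N where N: "\<And>p t. N \<le> p \<Longrightarrow> t \<in> {-1/2..13/2} \<Longrightarrow> norm (U p t - v t) \<le> e / 2"
        unfolding eventually_sequentially by blast
      have "norm (U (q n) (t n) $ i - v (t n) $ i - 0) < e" if "N \<le> n" for n
      proof -
        have "N \<le> q n" using seq_suble[OF q, of n] that by simp
        from N[OF this t, of n] comp[of "q n" "t n" i] show ?thesis using \<open>0 < e\<close> by simp
      qed
      then show "\<exists>no. \<forall>n\<ge>no. norm (U (q n) (t n) $ i - v (t n) $ i - 0) < e" by blast
    qed
    ultimately show ?thesis using tendsto_add by fastforce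
  qed
  \<comment> \<open>Upper bound: \<open>v\<close> crosses transversally at \<open>t0\<close>, so nearby solutions cross soon after.\<close>
  have "(v has_vector_derivative rate 100 (v t0) (v (t0 - 1/2))) (at t0 within {0<..})"
    using v fd(1) unfolding solves_def by (intro has_vector_derivative_within_subset[of v _ t0 "{0..}" "{0<..}"]) auto
  then have "((\<lambda>t. v t $ 2) has_vector_derivative rate 100 (v t0) (v (t0 - 1/2)) $ 2) (at t0 within {0<..})"
    by (rule bounded_linear.has_vector_derivative[OF bounded_linear_vec_nth])
  then have dv: "DERIV (\<lambda>t. v t $ 2) t0 :> rate 100 (v t0) (v (t0 - 1/2)) $ 2"
    using fd(1) by (simp add: at_within_open[of t0 "{0<..}"] has_real_derivative_iff_has_vector_derivative)
  obtain d1 where d1: "0 < d1" "\<And>h. 0 < h \<Longrightarrow> h < d1 \<Longrightarrow> v (t0 + h) $ 2 < 0" "\<And>h. 0 < h \<Longrightarrow> h < d1 \<Longrightarrow> 0 < v (t0 - h) $ 2"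
  proof -
    obtain e1 where e1: "0 < e1" "\<forall>h>0. h < e1 \<longrightarrow> v (t0 + h) $ 2 < v t0 $ 2" using DERIV_neg_dec_right[OF dv fd(4)] by auto
    obtain e2 where e2: "0 < e2" "\<forall>h>0. h < e2 \<longrightarrow> v (t0 - h) $ 2 > v t0 $ 2" using DERIV_neg_dec_left[OF dv fd(4)] by auto
    show thesis by (rule that[of "min e1 e2"]) (use e1 e2 fd(2) in auto)
  qed
  have ub: "\<forall>\<^sub>F p in sequentially. T p < t0 + r"
  proof -
    have "isCont (\<lambda>t. v t $ 1) t0" using cv[of UNIV 1] by (simp add: continuous_on_eq_continuous_at)
    then have "\<forall>\<^sub>F t in at t0. v t $ 1 < v t0 $ 1 / 2"
      using fd(3) unfolding isCont_def by (intro order_tendstoD(2)) auto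
    then obtain d2 where d2: "0 < d2" "\<And>t. t \<noteq> t0 \<Longrightarrow> dist t t0 < d2 \<Longrightarrow> v t $ 1 < v t0 $ 1 / 2"
      unfolding eventually_at by auto
    \<comment> \<open>With 1/4 the interval around \<open>t0\<close> stays at positive times,
      because \<open>t0\<close> is at least 1/2.\<close>
    define h where "h = min (min (d1 / 2) (d2 / 2)) (min (r / 2) (1/4))"
    have h: "0 < h" "h < d1" "h < d2" "h < r" "h < t0" using d1 d2 r fd(6) by (auto simp: h_def min_less_iff_disj)
    show ?thesis
    proof (cases "t0 + h \<le> 13/2")
      case False
      then show ?thesis using Tb(2) h by (intro always_eventually) (smt (verit) Tb(2))
    next
      case True
      \<comment> \<open>So close, a solution keeps the signs of y at both ends of the interval and
        has x < 0 in between.\<close>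
      define e where "e = min (min (v (t0 - h) $ 2 / 2) (- v (t0 + h) $ 2 / 2)) (- v t0 $ 1 / 4)"
      have e: "0 < e" using d1 h fd(3) by (auto simp: e_def)
      show ?thesis using conv[OF e]
      proof eventually_elim
        case (elim p)
        have cl: "\<bar>U p t $ i - v t $ i\<bar> \<le> e" if "t \<in> {t0 - h..t0 + h}" for t i
        proof -
          have "t \<in> {-1/2..13/2}" using that True h(5) by auto
          then show ?thesis using order_trans[OF comp] elim by blast
        qed
        have e': "e \<le> v (t0 - h) $ 2 / 2" "e \<le> - v (t0 + h) $ 2 / 2" by (simp_all add: e_def)
        have "v (t0 + h) $ 2 < 0" "0 < v (t0 - h) $ 2" using d1 h by auto
        then have s: "U p (t0 + h) $ 2 \<le> 0" "0 \<le> U p (t0 - h) $ 2"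
          using cl[of "t0 + h" 2] cl[of "t0 - h" 2] h(1) e' by auto
        obtain t where t: "t0 - h \<le> t" "t \<le> t0 + h" "U p t $ 2 = 0"
          using IVT2'[of "\<lambda>t. U p t $ 2" "t0 + h" 0 "t0 - h"] s h(1) cU by auto
        have "v t $ 1 < v t0 $ 1 / 2"
          using d2(2)[of t] t h fd(3) by (cases "t = t0") (auto simp: dist_real_def)
        moreover have "e \<le> - v t0 $ 1 / 4" by (simp add: e_def)
        ultimately have "U p t $ 1 < 0" using cl[of t 1] t fd(3) by auto
        then have "\<not> t < T p" using Tb(5)[of t p] t h(5) by auto
        then show "T p < t0 + r" using t h by linarith
      qed
    qed
  qed
  \<comment> \<open>At an accumulation point \<open>l\<close> of return times y vanishes, and x is
    at most -717/1024 by the history box, so x < 0 survives the limit. As return times are at least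
    1/2, \<open>l\<close> is positive and contradicts the minimality of \<open>t0\<close>.\<close>
  have lb: "\<forall>\<^sub>F p in sequentially. t0 - r < T p"
  proof (rule ccontr)
    assume "\<not> ?thesis"
    then have "\<forall>n. \<exists>p>n. T p \<le> t0 - r" unfolding eventually_sequentially by (metis gt_ex leD le_less_linear less_le_trans)
    then have "infinite {p. T p \<le> t0 - r}" unfolding infinite_nat_iff_unbounded by auto
    then obtain q where q: "strict_mono (q :: nat \<Rightarrow> nat)" "\<And>n. T (q n) \<le> t0 - r"
      using infinite_enumerate by (metis mem_Collect_eq)
    have "\<forall>n. T (q n) \<in> {1/2..t0 - r}" using Tb q by auto
    then obtain l k where l: "l \<in> {1/2..t0 - r}" "strict_mono k" "((\<lambda>n. T (q n)) \<circ> k) \<longlonglongrightarrow> l"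
      using compact_Icc[of "1/2" "t0 - r"] unfolding compact_def by (metis (no_types, lifting))
    have *: "(\<lambda>n. U (q (k n)) (T (q (k n))) $ i) \<longlonglongrightarrow> v l $ i" for i
    proof (rule conv_seq[of "q \<circ> k" "\<lambda>n. T (q (k n))", unfolded o_def])
      show "strict_mono (\<lambda>n. q (k n))" using q(1) l(2) by (simp add: strict_mono_def)
      show "T (q (k n)) \<in> {- 1 / 2..13 / 2}" for n using Tb(1,2)[of "q (k n)"] by auto
      show "(\<lambda>n. T (q (k n))) \<longlonglongrightarrow> l" using l(3) by (simp add: o_def)
    qed
    have "v l $ 2 = 0" using *[of 2] Tb(3) LIMSEQ_unique[OF _ tendsto_const] by simp
    moreover have "v l $ 1 \<le> -717/1024" by (rule LIMSEQ_le_const2[OF *[of 1]]) (use Tb(4) in blast)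
    ultimately show False using fd(5)[of l] l(1) r by auto
  qed
  have "\<forall>\<^sub>F p in sequentially. norm (T p - t0) < r" using ub lb by eventually_elim auto
  then show "\<exists>no. \<forall>n\<ge>no. norm (T n - t0) < r" unfolding eventually_sequentially .
qed

text \<open>Continuous dependence spreads the convergence from the histories to all times up to
  13/2, and uniform continuity of \<open>v\<close> absorbs the shift of the return time.\<close>

lemma return_segment_tendsto:
  assumes U: "\<And>p. solves (U p)" and v: "solves v"
    and conv: "\<And>e. 0 < e \<Longrightarrow> \<forall>\<^sub>F p in sequentially. \<forall>t\<in>{-1/2..0}. norm (U p t - v t) \<le> e"
    and RU: "\<And>p. returns (b p) (U p) (T p) (c p)" and Rv: "returns b' v t0 c'" and e: "0 < e"
  shows "\<forall>\<^sub>F p in sequentially. \<forall>s\<in>{-1/2..0}. norm (U p (T p + s) - v (t0 + s)) \<le> e"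
proof -
  have conv': "\<forall>\<^sub>F p in sequentially. \<forall>t\<in>{-1/2..13/2}. norm (U p t - v t) \<le> e" if e: "0 < e" for e :: real
  proof -
    define C where "C = 2 * (1 + 210 * (13/2)) * exp (840 * (13/2 :: real))"
    have C: "0 < C" by (simp add: C_def)
    have "\<forall>\<^sub>F p in sequentially. \<forall>t\<in>{-1/2..0}. norm (U p t - v t) \<le> e / C" using e C by (intro conv) simp
    then show ?thesis
    proof eventually_elim
      case (elim p)
      show ?case
      proof
        fix t :: real assume t: "t \<in> {-1/2..13/2}"
        have "norm (U p t - v t) \<le> C * (e / C)" unfolding C_def[unfolded mult.assoc]
          using solves_dependence[OF U[of p] v, of "e / C" t "13/2"] elim t e C by (simp add: C_def)
        then show "norm (U p t - v t) \<le> e" using C by simp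
      qed
    qed
  qed
  have "T \<longlonglongrightarrow> t0" by (rule return_time_tendsto[OF U v conv' RU Rv])
  have "uniformly_continuous_on {-1/2..13/2} v"
    using v unfolding solves_def by (intro compact_uniformly_continuous) (auto intro: continuous_on_subset)
  then obtain d where d: "0 < d" "\<And>t t'. t \<in> {-1/2..13/2} \<Longrightarrow> t' \<in> {-1/2..13/2} \<Longrightarrow> dist t' t < d \<Longrightarrow> dist (v t') (v t) < e / 2"
    using e unfolding uniformly_continuous_on_def by (metis half_gt_zero)
  have "\<forall>\<^sub>F p in sequentially. dist (T p) t0 < d" by (rule tendstoD[OF \<open>T \<longlonglongrightarrow> t0\<close> d(1)])
  moreover have "\<forall>\<^sub>F p in sequentially. \<forall>t\<in>{-1/2..13/2}. norm (U p t - v t) \<le> e / 2" using e by (intro conv') simp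
  ultimately show ?thesis
  proof eventually_elim
    case (elim p)
    show ?case
    proof
      fix s :: real assume s: "s \<in> {-1/2..0}"
      have "T p + s \<in> {-1/2..13/2}" "t0 + s \<in> {-1/2..13/2}" using s RU[of p] Rv by (auto simp: returns_def)
      then have "norm (U p (T p + s) - v (T p + s)) \<le> e / 2" "norm (v (T p + s) - v (t0 + s)) < e / 2"
        using elim d(2)[of "t0 + s" "T p + s"] by (auto simp: dist_norm)
      moreover have "norm (U p (T p + s) - v (t0 + s)) \<le> norm (U p (T p + s) - v (T p + s)) + norm (v (T p + s) - v (t0 + s))"
        using norm_triangle_ineq[of "U p (T p + s) - v (T p + s)" "v (T p + s) - v (t0 + s)"] by simp
      ultimately show "norm (U p (T p + s) - v (t0 + s)) \<le> e" by linarith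
    qed
  qed
qed

section \<open>Cycles of the return map\<close>

definition hat :: "real \<Rightarrow> real" where "hat r = max 0 (1 - \<bar>r\<bar>)"

lemma hat_nonneg: "0 \<le> hat r" by (simp add: hat_def)

text \<open>The partial sums form a ramp, which is the shape that the induction needs; for r <= N
  the value is 1, so the hats are a partition of unity.\<close>

lemma hat_sum: "0 \<le> r \<Longrightarrow> (\<Sum>k\<le>N. hat (r - real k)) = max 0 (min 1 (real N + 1 - r))"
  by (induction N) (auto simp: hat_def max_def min_def abs_if)

text \<open>Piecewise linear with value \<open>p k\<close> at k / (2 N) - 1/2. Being a convex
  combination of the nodes, it stays in every box that contains them.\<close>

definition interp :: "nat \<Rightarrow> (nat \<Rightarrow> real^3) \<Rightarrow> real \<Rightarrow> real^3" where
  "interp N p s = (\<Sum>k\<le>N. hat (2 * real N * (s + 1/2) - real k) *\<^sub>R p k)"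

lemma interp_weights:
  assumes "s \<in> {-1/2..0}" shows "(\<Sum>k\<le>N. hat (2 * real N * (s + 1/2) - real k)) = 1"
proof -
  have "0 \<le> 2 * real N * (s + 1/2)" using assms by simp
  moreover have "2 * real N * (s + 1/2) \<le> 2 * real N * (1/2)" using assms by (intro mult_left_mono) auto
  ultimately show ?thesis by (subst hat_sum) auto
qed

lemma interp_0: "interp N p 0 = p N"
proof -
  have "interp N p 0 = (\<Sum>k\<le>N. if k = N then p N else 0)"
    unfolding interp_def by (intro sum.cong) (auto simp: hat_def)
  then show ?thesis by simp
qed

lemma interp_continuous: "continuous_on A (interp N p)"
  unfolding interp_def hat_def by (intro continuous_intros)

lemma interp_component: "interp N p s $ i = (\<Sum>k\<le>N. hat (2 * real N * (s + 1/2) - real k) * p k $ i)"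
  by (simp add: interp_def)

lemma interp_bounds:
  assumes s: "s \<in> {-1/2..0}" and p: "\<And>k. k \<le> N \<Longrightarrow> l \<le> p k $ i \<and> p k $ i \<le> h"
  shows "l \<le> interp N p s $ i" "interp N p s $ i \<le> h"
proof -
  let ?w = "\<lambda>k. hat (2 * real N * (s + 1/2) - real k)"
  have "l = (\<Sum>k\<le>N. ?w k * l)" using interp_weights[OF s, of N] by (simp only: sum_distrib_right[symmetric] mult_1_left)
  also have "\<dots> \<le> interp N p s $ i" unfolding interp_component using p hat_nonneg by (intro sum_mono mult_left_mono) auto
  finally show "l \<le> interp N p s $ i" .
  have "interp N p s $ i \<le> (\<Sum>k\<le>N. ?w k * h)" unfolding interp_component using p hat_nonneg by (intro sum_mono mult_left_mono) auto
  also have "\<dots> = h" using interp_weights[OF s, of N] by (simp only: sum_distrib_right[symmetric] mult_1_left)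
  finally show "interp N p s $ i \<le> h" .
qed

lemma interp_near:
  assumes s: "s \<in> {-1/2..0}"
    and p: "\<And>k. k \<le> N \<Longrightarrow> hat (2 * real N * (s + 1/2) - real k) \<noteq> 0 \<Longrightarrow> norm (p k - w) \<le> e"
  shows "norm (interp N p s - w) \<le> e"
proof -
  let ?w = "\<lambda>k. hat (2 * real N * (s + 1/2) - real k)"
  have "w = (\<Sum>k\<le>N. ?w k *\<^sub>R w)" using interp_weights[OF s, of N] by (simp only: scaleR_sum_left[symmetric] scaleR_one)
  then have "interp N p s - w = (\<Sum>k\<le>N. ?w k *\<^sub>R p k) - (\<Sum>k\<le>N. ?w k *\<^sub>R w)" unfolding interp_def by simp
  also have "\<dots> = (\<Sum>k\<le>N. ?w k *\<^sub>R (p k - w))" by (simp only: sum_subtractf scaleR_diff_right)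
  also have "norm \<dots> \<le> (\<Sum>k\<le>N. ?w k * e)"
  proof (rule sum_norm_le)
    fix k assume "k \<in> {..N}"
    then show "norm (?w k *\<^sub>R (p k - w)) \<le> ?w k * e"
      using p[of k] hat_nonneg[of "2 * real N * (s + 1/2) - real k"] by (cases "?w k = 0") (auto intro: mult_left_mono)
  qed
  also have "\<dots> = e" using interp_weights[OF s, of N] by (simp only: sum_distrib_right[symmetric] mult_1_left)
  finally show ?thesis .
qed

lemma interp_diff:
  assumes "s \<in> {-1/2..0}" "\<And>k. k \<le> N \<Longrightarrow> norm (p k - q k) \<le> e"
  shows "norm (interp N p s - interp N q s) \<le> e"
proof -
  have "interp N p s - interp N q s = interp N (\<lambda>k. p k - q k) s - 0"
    by (simp add: interp_def sum_subtractf scaleR_diff_right)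
  then show ?thesis using interp_near[OF assms(1), of N "\<lambda>k. p k - q k" 0 e] assms(2) by simp
qed

lemma interp_approx:
  assumes N: "0 < N" and s: "s \<in> {-1/2..0}"
    and L: "\<And>s s'. s \<in> {-1/2..0} \<Longrightarrow> s' \<in> {-1/2..0} \<Longrightarrow> norm (f s - f s') \<le> L * \<bar>s - s'\<bar>" and L0: "0 \<le> L"
  shows "norm (interp N (\<lambda>k. f (real k / (2 * real N) - 1/2)) s - f s) \<le> L / real N"
proof (rule interp_near[OF s])
  fix k assume k: "k \<le> N" and h: "hat (2 * real N * (s + 1/2) - real k) \<noteq> 0"
  have N': "0 < 2 * real N" using N by simp
  have "real k / (2 * real N) \<le> 1/2" using k N by (simp add: divide_le_eq)
  then have s': "real k / (2 * real N) - 1/2 \<in> {-1/2..0}" by simp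
  have "\<bar>2 * real N * (s + 1/2) - real k\<bar> \<le> 1" using h by (auto simp: hat_def max_def split: if_splits)
  moreover have "2 * real N * (s + 1/2) - real k = 2 * real N * (s - (real k / (2 * real N) - 1/2))" using N by (simp add: field_simps)
  ultimately have "2 * real N * \<bar>(real k / (2 * real N) - 1/2) - s\<bar> \<le> 1" using N by (simp add: abs_mult abs_minus_commute)
  then have "\<bar>(real k / (2 * real N) - 1/2) - s\<bar> \<le> 1 / (2 * real N)" using N' by (simp add: pos_le_divide_eq mult.commute)
  also have "\<dots> \<le> 1 / real N" using N by (simp add: field_simps)
  finally have "L * \<bar>(real k / (2 * real N) - 1/2) - s\<bar> \<le> L * (1 / real N)" by (rule mult_left_mono[OF _ L0])
  then show "norm (f (real k / (2 * real N) - 1/2) - f s) \<le> L / real N" using L[OF s' s] by simp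
qed

text \<open>A constant independent of the solution: it gives equicontinuity and bounds the error of
  interpolation.\<close>

lemma returns_lipschitz:
  assumes u: "solves u" and r: "returns b u T c" and s: "s \<in> {-1/2..0}" "s' \<in> {-1/2..0}"
  shows "norm (u (T + s) - u (T + s')) \<le> 25000 * \<bar>s - s'\<bar>"
proof -
  have b: "\<And>t i. t \<in> {-1/2..T} \<Longrightarrow> \<bar>u t $ i\<bar> \<le> 100" and T: "1/2 \<le> T" using r by (auto simp: returns_def)
  \<comment> \<open>200 + 120 + 10601 for the three components; twice 12000 is below 25000.\<close>
  have fb: "norm (field 100 v) \<le> 12000" if v: "\<And>i. \<bar>v $ i\<bar> \<le> 100" for v
  proof -
    have "\<bar>clamp 100 (v$3) * (clamp 100 (v$1) - 21/4)\<bar> \<le> 100 * (100 + 6)"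
      unfolding abs_mult by (intro mult_mono) (auto simp: clamp_def)
    then show ?thesis using v[of 1] v[of 2] v[of 3] by (intro order_trans[OF norm_le_sum3]) (simp add: field_def)
  qed
  have "norm (u (T + s) - u (T + s')) \<le> 25000 * norm ((T + s) - (T + s'))"
  proof (rule differentiable_bound[where S = "{0..T}" and f' = "\<lambda>t h. h *\<^sub>R rate 100 (u t) (u (t - 1/2))"])
    fix t assume t: "t \<in> {0..T}"
    show "(u has_derivative (\<lambda>h. h *\<^sub>R rate 100 (u t) (u (t - 1/2)))) (at t within {0..T})"
      using solves_derivative[OF u _ t] by (simp add: has_vector_derivative_def)
    have "norm (rate 100 (u t) (u (t - 1/2))) \<le> norm (field 100 (u t)) + norm ((1/10000) *\<^sub>R field 100 (u (t - 1/2)))"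
      unfolding rate_def by (rule norm_triangle_ineq)
    also have "\<dots> \<le> 12000 + 12000" 
      using fb[of "u t"] fb[of "u (t - 1/2)"] b t by (intro add_mono) auto
    finally have "norm (rate 100 (u t) (u (t - 1/2))) \<le> 25000" by simp
    then show "onorm (\<lambda>h. h *\<^sub>R rate 100 (u t) (u (t - 1/2))) \<le> 25000"
      by (intro onorm_le) (simp add: mult.commute[of 25000] mult_left_mono)
  qed (use s T in auto)
  then show ?thesis by simp
qed

lemma tendsto_of_norm_le: 
  fixes f :: "nat \<Rightarrow> real^3"
  assumes "\<And>e. 0 < e \<Longrightarrow> \<forall>\<^sub>F p in sequentially. norm (f p - l) \<le> e"
  shows "f \<longlonglongrightarrow> l"
proof (rule tendstoI)
  fix e :: real assume "0 < e"
  then have "\<forall>\<^sub>F p in sequentially. norm (f p - l) \<le> e / 2" by (intro assms) simp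
  then show "\<forall>\<^sub>F p in sequentially. dist (f p) l < e" by eventually_elim (use \<open>0 < e\<close> in \<open>simp add: dist_norm\<close>)
qed

locale cycle =
  fixes m :: nat and b :: "nat \<Rightarrow> bool"
  assumes m: "0 < m" and b: "\<And>i. i < m \<Longrightarrow> b i \<Longrightarrow> \<not> b (Suc i mod m)"
begin

definition prev :: "nat \<Rightarrow> nat" where "prev i = (i + (m - 1)) mod m"

lemma prev: "i < m \<Longrightarrow> prev i < m" "i < m \<Longrightarrow> Suc (prev i) mod m = i" "i < m \<Longrightarrow> prev (Suc i mod m) = i"
proof -
  show "i < m \<Longrightarrow> prev i < m" using m by (simp add: prev_def)
  assume i: "i < m"
  have e: "Suc (i + (m - 1)) = i + m" using m by simp
  show "Suc (prev i) mod m = i" unfolding prev_def mod_Suc_eq e using i by simp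
  have "prev (Suc i mod m) = (Suc i + (m - 1)) mod m" unfolding prev_def by (simp add: mod_add_left_eq)
  also have "Suc i + (m - 1) = i + m" using m by simp
  finally show "prev (Suc i mod m) = i" using i by simp
qed

text \<open>The unknowns are the coordinates of the nodes of all \<open>m\<close> histories, and
  each history is required to reproduce the nodes of the next one on return. This is a finite system
  with as many equations as unknowns.\<close>

lemma discrete_cycle:
  assumes N: "0 < (N :: nat)"
  shows "\<exists>W T c. \<forall>i<m. solves (W i) \<and> adm (b i) (W i) \<and> returns (b i) (W i) (T i) (c i) \<and>
    (\<forall>s\<in>{-1/2..0}. W (Suc i mod m) s = interp N (\<lambda>k. W i (T i + (real k / (2 * real N) - 1/2))) s)"
proof -
  \<comment> \<open>The y coordinate of the last node is no unknown: it is 0 on the section.\<close>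
  define I :: "(nat \<times> nat \<times> 3) set" where "I = {(i,k,c). i < m \<and> k \<le> N \<and> \<not> (k = N \<and> c = 2)}"
  define lo :: "nat \<times> nat \<times> 3 \<Rightarrow> real" where "lo = (\<lambda>(i,k,c). if k = N then (if c = 1 then - xhi (b i) else 9/1024)
     else if c = 1 then -9830/1024 else if c = 2 then -2662/1024 else -1)"
  define hi :: "nat \<times> nat \<times> 3 \<Rightarrow> real" where "hi = (\<lambda>(i,k,c). if k = N then (if c = 1 then - xlo (b i) else zhi (b i))
     else if c = 1 then -717/1024 else if c = 2 then 5529/1024 else 3)"
  define node :: "(nat \<times> nat \<times> 3 \<Rightarrow> real) \<Rightarrow> nat \<Rightarrow> nat \<Rightarrow> real^3" where "node u i k = (\<chi> c. if k = N \<and> c = 2 then 0 else u (i,k,c))" for u i k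
  define sk where "sk k = real k / (2 * real N) - 1/2" for k
  have sk: "sk k \<in> {-1/2..0}" if "k \<le> N" for k
  proof -
    have "real k / (2 * real N) \<le> 1/2" using that N by (simp add: divide_le_eq)
    then show ?thesis by (simp add: sk_def)
  qed
  have skN: "sk N = 0" using N by (simp add: sk_def)
  define ib where "ib u \<longleftrightarrow> (\<forall>j\<in>I. u j \<in> {lo j..hi j})" for u
  have fI: "finite I" by (rule finite_subset[of _ "{..<m} \<times> {..N} \<times> UNIV"]) (auto simp: I_def)
  have UN3: "c = 1 \<or> c = 2 \<or> c = 3" for c :: 3 using exhaust_3 by blast
  have memI: "(i,k,c) \<in> I \<longleftrightarrow> i < m \<and> k \<le> N \<and> \<not> (k = N \<and> c = 2)" for i k c by (simp add: I_def)
  have nodeN: "starts (b i) (node u i N)" if "ib u" "i < m" for u i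
  proof -
    have "u (i,N,1) \<in> {lo (i,N,1)..hi (i,N,1)}" "u (i,N,3) \<in> {lo (i,N,3)..hi (i,N,3)}"
      using that unfolding ib_def by (auto simp: memI)
    then show ?thesis by (simp add: starts_def node_def lo_def hi_def)
  qed
  have nodeH: "hbox (node u i k)" if "ib u" "i < m" "k \<le> N" for u i k
  proof (cases "k = N")
    case True
    then show ?thesis using nodeN[OF that(1,2)]
      by (cases "b i") (auto simp: starts_def hbox_def xlo_def xhi_def zhi_def)
  next
    case False
    have "u (i,k,c) \<in> {lo (i,k,c)..hi (i,k,c)}" for c using that False unfolding ib_def by (auto simp: memI)
    from this[of 1] this[of 2] this[of 3] show ?thesis using False by (simp add: hbox_def node_def lo_def hi_def)
  qed
  define V where "V u i = (SOME v. solves v \<and> (\<forall>t\<in>{-1/2..0}. v t = interp N (node u i) t))" for u i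
  have V: "solves (V u i)" "\<And>t. t \<in> {-1/2..0} \<Longrightarrow> V u i t = interp N (node u i) t" for u i
  proof -
    have "\<exists>v. solves v \<and> (\<forall>t\<in>{-1/2..0}. v t = interp N (node u i) t)"
      by (rule solves_exists[OF interp_continuous[of _ N "node u i"]]) blast
    then have "solves (V u i) \<and> (\<forall>t\<in>{-1/2..0}. V u i t = interp N (node u i) t)"
      unfolding V_def by (rule someI_ex)
    then show "solves (V u i)" "\<And>t. t \<in> {-1/2..0} \<Longrightarrow> V u i t = interp N (node u i) t" by auto
  qed
  have aV: "adm (b i) (V u i)" if "ib u" "i < m" for u i
    unfolding adm_def
  proof
    show "starts (b i) (V u i 0)" using nodeN[OF that] V(2)[of 0] by (simp add: interp_0)
    have "hbox (interp N (node u i) t)" if t: "t \<in> {-1/2..0}" for t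
      using nodeH[OF \<open>ib u\<close> \<open>i < m\<close>] unfolding hbox_def
      by (intro conjI interp_bounds[OF t, where l = "-9830/1024" and h = "-717/1024"]
        interp_bounds[OF t, where l = "-2662/1024" and h = "5529/1024"] interp_bounds[OF t, where l = "-1" and h = 3]) auto
    then show "\<forall>t\<in>{-1/2..0}. hbox (V u i t)" using V(2) by simp
  qed
  define T where "T u i = (SOME T. \<exists>c. returns (b i) (V u i) T c)" for u i
  define C where "C u i = (SOME c. returns (b i) (V u i) (T u i) c)" for u i
  have R: "returns (b i) (V u i) (T u i) (C u i)" if "ib u" "i < m" for u i
    unfolding C_def T_def by (rule someI_ex) (rule someI_ex[OF return_exists[OF V(1) aV[OF that]]])
  define P where "P u i s = V u i (T u i + s)" for u i and s :: real
  have Pc: "(\<lambda>p. P (u p) i s $ c) \<longlonglongrightarrow> P v i s $ c"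
    if ibu: "\<And>p. ib (u p)" and ibv: "ib v" and lim: "\<And>j. j \<in> I \<Longrightarrow> (\<lambda>p. u p j) \<longlonglongrightarrow> v j" and i: "i < m" and s: "s \<in> {-1/2..0}"
    for u v i s c
  proof -
    have nl: "(\<lambda>p. node (u p) i k) \<longlonglongrightarrow> node v i k" if "k \<le> N" for k
    proof (rule vec_tendstoI)
      fix c show "(\<lambda>p. node (u p) i k $ c) \<longlonglongrightarrow> node v i k $ c"
        using lim[of "(i,k,c)"] that i by (auto simp: node_def memI)
    qed
    have conv: "\<forall>\<^sub>F p in sequentially. \<forall>t\<in>{-1/2..0}. norm (V (u p) i t - V v i t) \<le> e" if "0 < e" for e
    proof -
      have "\<forall>\<^sub>F p in sequentially. \<forall>k\<in>{..N}. dist (node (u p) i k) (node v i k) < e"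
        by (rule eventually_ball_finite) (use nl that in \<open>auto dest: tendstoD\<close>)
      then show ?thesis
      proof eventually_elim
        case (elim p)
        show ?case
        proof
          fix t :: real assume t: "t \<in> {-1/2..0}"
          show "norm (V (u p) i t - V v i t) \<le> e" unfolding V(2)[OF t]
            by (rule interp_diff[OF t]) (use elim in \<open>auto simp: dist_norm less_imp_le\<close>)
        qed
      qed
    qed
    have "\<forall>\<^sub>F p in sequentially. norm (P (u p) i s - P v i s) \<le> e" if "0 < e" for e
      using return_segment_tendsto[OF V(1) V(1) conv R[OF ibu i] R[OF ibv i] that]
      by (rule eventually_mono) (use s in \<open>auto simp: P_def\<close>)
    then have "(\<lambda>p. P (u p) i s) \<longlonglongrightarrow> P v i s" by (rule tendsto_of_norm_le)
    then show ?thesis by (rule tendsto_vec_nth)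
  qed
  \<comment> \<open>The x coordinate of the last node steers where its own loop lands, so its
    equation concerns the next history; for the first interval landing increases with x, hence the
    change of sign. Any other coordinate is compared with the image of the preceding history,
    retracted onto its range.\<close>
  define f :: "nat \<times> nat \<times> 3 \<Rightarrow> (nat \<times> nat \<times> 3 \<Rightarrow> real) \<Rightarrow> real" where "f = (\<lambda>(i,k,c) u.
     if k = N \<and> c = 1 then (if b i then -1 else 1) * (P u i 0 $ 1 - u (Suc i mod m, N, 1))
     else max (lo (i,k,c)) (min (hi (i,k,c)) (P u (prev i) (sk k) $ c)) - u (i,k,c))"
  have lohi: "lo j < hi j" if "j \<in> I" for j
    using that by (auto simp: I_def lo_def hi_def xhi_def xlo_def zhi_def)
  have P1: "(b i \<longrightarrow> node u i N $ 1 = - xlo True \<longrightarrow> - xlo False < P u i 0 $ 1) \<and> (b i \<longrightarrow> node u i N $ 1 = - xhi True \<longrightarrow> P u i 0 $ 1 < - xhi False) \<and>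
     (\<not> b i \<longrightarrow> node u i N $ 1 = - xlo False \<longrightarrow> P u i 0 $ 1 < - xhi False) \<and> (\<not> b i \<longrightarrow> node u i N $ 1 = - xhi False \<longrightarrow> - xlo True < P u i 0 $ 1)"
    if "ib u" "i < m" for u i
    using R[OF that] V(2)[of 0 u i] unfolding returns_def P_def interp_0 by simp
  have nb: "- xhi (b i) \<le> u (i,N,1)" "u (i,N,1) \<le> - xlo (b i)" if "ib u" "i < m" for u i
    using nodeN[OF that] by (simp_all add: starts_def node_def)
  obtain u where u: "\<And>j. j \<in> I \<Longrightarrow> u j \<in> {lo j..hi j}" "\<And>j. j \<in> I \<Longrightarrow> f j u = 0"
  proof (rule poincare_miranda[OF fI lohi, where f = f])
    fix j u v assume j: "j \<in> I" and ub: "\<And>p i. i \<in> I \<Longrightarrow> u p i \<in> {lo i..hi i}" and lim: "\<And>i. i \<in> I \<Longrightarrow> (\<lambda>p. u p i) \<longlonglongrightarrow> v i"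
    obtain i k c where e: "j = (i,k,c)" by (metis prod.exhaust)
    have ikc: "i < m" "k \<le> N" using j unfolding e memI by auto
    have ibu: "ib (u p)" for p using ub by (auto simp: ib_def)
    have "v i \<in> {lo i..hi i}" if "i \<in> I" for i
      by (rule closed_sequentially[OF closed_atLeastAtMost _ lim[OF that]]) (use ub that in auto)
    then have ibv: "ib v" by (simp add: ib_def)
    have s: "Suc i mod m < m" using m by simp
    show "(\<lambda>p. f j (u p)) \<longlonglongrightarrow> f j v"
    proof (cases "k = N \<and> c = 1")
      case True
      have "(Suc i mod m, N, 1) \<in> I" using s by (simp add: memI)
      from tendsto_mult[OF tendsto_const tendsto_diff[OF Pc[OF ibu ibv lim ikc(1), of 0 1] lim[OF this]], of "if b i then -1 else 1"]
      show ?thesis using True by (simp add: f_def e)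
    next
      case False
      have "(\<lambda>p. max (lo (i,k,c)) (min (hi (i,k,c)) (P (u p) (prev i) (sk k) $ c)) - u p (i,k,c))
         \<longlonglongrightarrow> max (lo (i,k,c)) (min (hi (i,k,c)) (P v (prev i) (sk k) $ c)) - v (i,k,c)"
        using j by (intro tendsto_intros Pc[OF ibu ibv lim] prev ikc sk lim) (auto simp: e)
      moreover have "f j w = max (lo (i,k,c)) (min (hi (i,k,c)) (P w (prev i) (sk k) $ c)) - w (i,k,c)" for w
        unfolding e f_def using False by auto
      ultimately show ?thesis by simp
    qed
  next
    fix j u assume j: "j \<in> I" and ub: "\<And>i. i \<in> I \<Longrightarrow> u i \<in> {lo i..hi i}"
    obtain i k c where e: "j = (i,k,c)" by (metis prod.exhaust)
    have ikc: "i < m" "k \<le> N" using j unfolding e memI by auto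
    have ibu: "ib u" using ub by (simp add: ib_def)
    have s: "Suc i mod m < m" using m by simp
    have node1: "node u i N $ 1 = u (i,N,1)" by (simp add: node_def)
    note p1 = P1[OF ibu ikc(1), unfolded node1] and n = nb[OF ibu s] and bb = b[OF ikc(1)]
    show "u j = lo j \<Longrightarrow> 0 \<le> f j u"
    proof (cases "k = N \<and> c = 1")
      case True
      assume "u j = lo j"
      then have "u (i,N,1) = - xhi (b i)" using True by (simp add: e lo_def)
      then show ?thesis using True p1 n bb by (cases "b i"; cases "b (Suc i mod m)") (auto simp: f_def e xlo_def xhi_def)
    next
      case False
      assume "u j = lo j"
      then show ?thesis using False unfolding e f_def by auto
    qed
    show "u j = hi j \<Longrightarrow> f j u \<le> 0"
    proof (cases "k = N \<and> c = 1")
      case True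
      assume "u j = hi j"
      then have "u (i,N,1) = - xlo (b i)" using True by (simp add: e hi_def)
      then show ?thesis using True p1 n bb by (cases "b i"; cases "b (Suc i mod m)") (auto simp: f_def e xlo_def xhi_def)
    next
      case False
      assume "u j = hi j"
      then show ?thesis using False lohi[OF j] unfolding e f_def by auto
    qed
  next
    fix u assume "\<And>j. j \<in> I \<Longrightarrow> u j \<in> {lo j..hi j}" "\<And>j. j \<in> I \<Longrightarrow> f j u = 0"
    then show thesis by (rule that)
  qed
  have ibu: "ib u" using u(1) by (simp add: ib_def)
  \<comment> \<open>At the zero the retraction is inactive, because a return lies in the box that
    the retraction maps onto.\<close>
  have match: "node u i k = P u (prev i) (sk k)" if i: "i < m" and k: "k \<le> N" for i k
  proof -
    have pi: "prev i < m" by (rule prev(1)[OF i])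
    have r: "P u (prev i) 0 $ 2 = 0" "hbox (P u (prev i) (sk k))" "9/1024 \<le> P u (prev i) 0 $ 3" "P u (prev i) 0 $ 3 \<le> zhi True"
       "P u (prev i) 0 $ 1 \<le> - xlo False \<Longrightarrow> P u (prev i) 0 $ 3 \<le> zhi False"
      using R[OF ibu pi] sk[OF k] unfolding returns_def first_down_def P_def by auto
    have x1: "u (i,N,1) = P u (prev i) 0 $ 1"
      using u(2)[of "(prev i, N, 1)"] pi prev(2)[OF i] by (auto simp: memI f_def split: if_splits)
    have "node u i k $ c = P u (prev i) (sk k) $ c" for c
    proof (cases "k = N")
      case True
      consider "c = 1" | "c = 2" | "c = 3" using UN3 by blast
      then show ?thesis
      proof cases
        case 3
        \<comment> \<open>The narrower band for z in the second interval holds because x has landed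
          in that interval.\<close>
        have "P u (prev i) 0 $ 3 \<le> zhi (b i)" using r(4,5) x1 nb[OF ibu i] by (cases "b i") auto
        then have "max (lo (i,N,3)) (min (hi (i,N,3)) (P u (prev i) 0 $ 3)) = P u (prev i) 0 $ 3" using r(3) by (simp add: lo_def hi_def)
        then show ?thesis using u(2)[of "(i,N,3)"] i True 3 by (simp add: memI f_def skN node_def)
      qed (use True r x1 skN in \<open>simp_all add: node_def\<close>)
    next
      case False
      have "max (lo (i,k,c)) (min (hi (i,k,c)) (P u (prev i) (sk k) $ c)) = P u (prev i) (sk k) $ c"
        using r(2) False UN3[of c] by (auto simp: hbox_def lo_def hi_def)
      then show ?thesis using u(2)[of "(i,k,c)"] i k False by (simp add: memI f_def node_def)
    qed
    then show ?thesis by (simp add: vec_eq_iff)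
  qed
  have "V u (Suc i mod m) s = interp N (\<lambda>k. V u i (T u i + (real k / (2 * real N) - 1/2))) s" if i: "i < m" and s: "s \<in> {-1/2..0}" for i s
  proof -
    have "V u (Suc i mod m) s = interp N (node u (Suc i mod m)) s" by (rule V(2)[OF s])
    also have "\<dots> = interp N (\<lambda>k. V u i (T u i + (real k / (2 * real N) - 1/2))) s"
      unfolding interp_def by (intro sum.cong refl arg_cong2[where f = scaleR])
        (use match[of "Suc i mod m"] prev(3)[OF i] m in \<open>simp add: P_def sk_def\<close>)
    finally show ?thesis .
  qed
  then show ?thesis using V(1) aV[OF ibu] R[OF ibu] by (intro exI[of _ "V u"] exI[of _ "T u"] exI[of _ "C u"]) simp
qed

lemma closed_hbox: "closed {v. hbox v}" and closed_starts: "closed {v. starts j v}"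
  unfolding hbox_def starts_def
  by (intro closed_Collect_conj closed_Collect_le closed_Collect_eq continuous_intros)+

text \<open>The return segments are equibounded and equi-Lipschitz, so that a subsequence converges
  uniformly. The histories differ from them by the interpolation error 25000 / N only, hence the
  limits are reproduced exactly.\<close>

lemma cycle_exists:
  "\<exists>W T c. \<forall>i<m. solves (W i) \<and> adm (b i) (W i) \<and> returns (b i) (W i) (T i) (c i) \<and>
    (\<forall>s\<in>{-1/2..0}. W (Suc i mod m) s = W i (T i + s))"
proof -
  have "\<forall>n. \<exists>W T c. \<forall>i<m. solves (W i) \<and> adm (b i) (W i) \<and> returns (b i) (W i) (T i) (c i) \<and>
    (\<forall>s\<in>{-1/2..0}. W (Suc i mod m) s = interp (Suc n) (\<lambda>k. W i (T i + (real k / (2 * real (Suc n)) - 1/2))) s)"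
    using discrete_cycle by blast
  then obtain W T c where W: "\<And>n i. i < m \<Longrightarrow> solves (W n i)" "\<And>n i. i < m \<Longrightarrow> adm (b i) (W n i)"
    "\<And>n i. i < m \<Longrightarrow> returns (b i) (W n i) (T n i) (c n i)"
    "\<And>n i s. i < m \<Longrightarrow> s \<in> {-1/2..0} \<Longrightarrow> W n (Suc i mod m) s = interp (Suc n) (\<lambda>k. W n i (T n i + (real k / (2 * real (Suc n)) - 1/2))) s"
    by metis
  define psi where "psi n i s = W n i (T n i + s)" for n i and s :: real
  have lip: "norm (psi n i s - psi n i s') \<le> 25000 * \<bar>s - s'\<bar>" if "i < m" "s \<in> {-1/2..0}" "s' \<in> {-1/2..0}" for n i s s'
    unfolding psi_def by (rule returns_lipschitz[OF W(1) W(3)]) (use that in auto)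
  have pb: "norm (psi n i s) \<le> 300" if "i < m" "s \<in> {-1/2..0}" for n i s
  proof -
    have "\<bar>psi n i s $ c\<bar> \<le> 100" for c using W(3)[OF that(1), of n] that(2) unfolding psi_def returns_def by auto
    from this[of 1] this[of 2] this[of 3] show ?thesis using norm_le_sum3[of "psi n i s"] by linarith
  qed
  \<comment> \<open>The \<open>m\<close> segments are placed side by side on one compact set, so
    that a single application of Arzela--Ascoli treats all of them; the ceiling recovers the
    index.\<close>
  define S where "S = (\<Union>i<m. {real i - 1/2..real i})"
  define F where "F n t = psi n (nat \<lceil>t\<rceil>) (t - of_int \<lceil>t\<rceil>)" for n and t :: real
  have Fi: "F n t = psi n i (t - real i)" if "t \<in> {real i - 1/2..real i}" for n t i
  proof -
    have "\<lceil>t\<rceil> = int i" using that by (auto simp: ceiling_eq_iff)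
    then show ?thesis by (simp add: F_def)
  qed
  have tS: "\<exists>i<m. t \<in> {real i - 1/2..real i}" if "t \<in> S" for t using that by (auto simp: S_def)
  obtain g k where g: "continuous_on S g" "strict_mono (k :: nat \<Rightarrow> nat)"
    "\<And>e. 0 < e \<Longrightarrow> \<exists>N. \<forall>n x. n \<ge> N \<and> x \<in> S \<longrightarrow> norm (F (k n) x - g x) < e"
  proof (rule Arzela_Ascoli[of S F 300])
    show "compact S" unfolding S_def by (intro compact_UN) auto
    show "norm (F n t) \<le> 300" if t: "t \<in> S" for n t
    proof -
      obtain i where "i < m" "t \<in> {real i - 1/2..real i}" using tS[OF t] by blast
      then show ?thesis using pb[of i "t - real i" n] Fi[of t i n] by auto
    qed
    show "\<exists>d>0. \<forall>n y. y \<in> S \<and> norm (t - y) < d \<longrightarrow> norm (F n t - F n y) < e" if t: "t \<in> S" and e: "0 < e" for t e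
    \<comment> \<open>The pieces of \<open>S\<close> are 1/2 apart, so points at a smaller distance
      belong to the same piece.\<close>
    proof (intro exI[of _ "min (1/2) (e / 25000)"] conjI allI impI)
      fix n y assume y: "y \<in> S \<and> norm (t - y) < min (1/2) (e / 25000)"
      obtain i where i: "i < m" "t \<in> {real i - 1/2..real i}" using tS[OF t] by blast
      obtain j where j: "j < m" "y \<in> {real j - 1/2..real j}" using tS y by blast
      have "\<bar>t - y\<bar> < e / 25000" "\<bar>t - y\<bar> < 1/2" using y by auto
      then have d: "t - y < 1/2" "y - t < 1/2" by linarith+
      have "real i - 1/2 \<le> t" "t \<le> real i" "real j - 1/2 \<le> y" "y \<le> real j" using i(2) j(2) by auto
      then have "real i < real j + 1" "real j < real i + 1" using d by linarith+
      then have ij: "j = i" by linarith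
      have "norm (F n t - F n y) \<le> 25000 * \<bar>(t - real i) - (y - real i)\<bar>"
        unfolding Fi[OF i(2)] Fi[OF j(2)[unfolded ij]] using i j(2) unfolding ij by (intro lip) auto
      then show "norm (F n t - F n y) < e" using \<open>\<bar>t - y\<bar> < e / 25000\<close> by (simp add: less_divide_eq)
    qed (use e in auto)
  qed (blast intro: that)
  define G where "G i s = g (real i + s)" for i and s :: real
  have inS: "real i + s \<in> S" if "i < m" "s \<in> {-1/2..0}" for i s
    unfolding S_def using that by (intro UN_I[of i]) auto
  have cG: "continuous_on {-1/2..0} (G i)" if "i < m" for i
    unfolding G_def
  proof (rule continuous_on_compose2[OF g(1)])
    show "continuous_on {-1/2..0} (\<lambda>s. real i + s)" by (intro continuous_intros)
    show "(\<lambda>s. real i + s) ` {-1/2..0} \<subseteq> S" using inS[OF that] by blast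
  qed
  have unif: "\<forall>\<^sub>F n in sequentially. \<forall>s\<in>{-1/2..0}. norm (psi (k n) i s - G i s) \<le> e" if e: "0 < e" and i: "i < m" for e i
  proof -
    obtain N where N: "\<And>n x. n \<ge> N \<Longrightarrow> x \<in> S \<Longrightarrow> norm (F (k n) x - g x) < e" using g(3)[OF e] by blast
    have "norm (psi (k n) i s - G i s) \<le> e" if "n \<ge> N" "s \<in> {-1/2..0}" for n s
      using N[OF that(1) inS[OF i that(2)]] Fi[of "real i + s" i "k n"] that(2) by (simp add: G_def)
    then show ?thesis unfolding eventually_sequentially by blast
  qed
  have hist: "\<forall>\<^sub>F n in sequentially. \<forall>s\<in>{-1/2..0}. norm (W (k n) i s - G (prev i) s) \<le> e" if e: "0 < e" and i: "i < m" for e i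
  proof -
    let ?j = "prev i"
    have j: "?j < m" by (rule prev(1)[OF i])
    have "(\<lambda>n. 25000 * (1 / real (Suc n))) \<longlonglongrightarrow> 25000 * 0"
      by (intro tendsto_intros) (use LIMSEQ_inverse_real_of_nat in \<open>simp add: inverse_eq_divide\<close>)
    from LIMSEQ_subseq_LIMSEQ[OF this g(2)] have "(\<lambda>n. 25000 / real (Suc (k n))) \<longlonglongrightarrow> 0" by (simp add: o_def)
    then have "\<forall>\<^sub>F n in sequentially. 25000 / real (Suc (k n)) < e / 2" by (rule order_tendstoD(2)) (use e in simp)
    moreover have "\<forall>\<^sub>F n in sequentially. \<forall>s\<in>{-1/2..0}. norm (psi (k n) ?j s - G ?j s) \<le> e / 2" using e by (intro unif j) simp
    ultimately show ?thesis
    proof eventually_elim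
      case (elim n)
      show ?case
      proof
        fix s :: real assume s: "s \<in> {-1/2..0}"
        have "W (k n) i s = interp (Suc (k n)) (\<lambda>l. psi (k n) ?j (real l / (2 * real (Suc (k n))) - 1/2)) s"
          using W(4)[OF j s, of "k n"] prev(2)[OF i] by (simp add: psi_def)
        moreover have "norm (interp (Suc (k n)) (\<lambda>l. psi (k n) ?j (real l / (2 * real (Suc (k n))) - 1/2)) s - psi (k n) ?j s) \<le> 25000 / real (Suc (k n))"
          by (rule interp_approx[OF _ s lip[OF j]]) auto
        ultimately have "norm (W (k n) i s - psi (k n) ?j s) \<le> e / 2" using elim(1) by simp
        moreover have "norm (psi (k n) ?j s - G ?j s) \<le> e / 2" using elim(2) s by blast
        ultimately show "norm (W (k n) i s - G ?j s) \<le> e"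
          using norm_triangle_ineq[of "W (k n) i s - psi (k n) ?j s" "psi (k n) ?j s - G ?j s"] by simp
      qed
    qed
  qed
  have "\<forall>i<m. \<exists>v. solves v \<and> (\<forall>t\<in>{-1/2..0}. v t = G (prev i) t)"
    using solves_exists[OF cG[OF prev(1)]] by metis
  then obtain X where X: "\<And>i. i < m \<Longrightarrow> solves (X i)" "\<And>i t. i < m \<Longrightarrow> t \<in> {-1/2..0} \<Longrightarrow> X i t = G (prev i) t" by metis
  have Xlim: "(\<lambda>n. W (k n) i s) \<longlonglongrightarrow> X i s" if i: "i < m" and s: "s \<in> {-1/2..0}" for i s
  proof (rule tendsto_of_norm_le)
    fix e :: real assume "0 < e"
    from hist[OF this i] show "\<forall>\<^sub>F n in sequentially. norm (W (k n) i s - X i s) \<le> e"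
      by eventually_elim (use X(2)[OF i s] s in simp)
  qed
  have aX: "adm (b i) (X i)" if i: "i < m" for i
    unfolding adm_def
  proof (intro conjI ballI)
    fix s :: real assume s: "s \<in> {-1/2..0}"
    have "X i s \<in> {v. hbox v}"
      by (rule closed_sequentially[OF closed_hbox _ Xlim[OF i s]]) (use W(2)[OF i] s in \<open>auto simp: adm_def\<close>)
    then show "hbox (X i s)" by simp
  next
    have "X i 0 \<in> {v. starts (b i) v}"
      by (rule closed_sequentially[OF closed_starts _ Xlim[OF i]]) (use W(2)[OF i] in \<open>auto simp: adm_def\<close>)
    then show "starts (b i) (X i 0)" by simp
  qed
  have "\<forall>i<m. \<exists>t c. returns (b i) (X i) t c" using return_exists[OF X(1) aX] by blast
  then obtain t d where R: "\<And>i. i < m \<Longrightarrow> returns (b i) (X i) (t i) (d i)" by metis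
  have "X (Suc i mod m) s = X i (t i + s)" if i: "i < m" and s: "s \<in> {-1/2..0}" for i s
  proof -
    have "\<forall>\<^sub>F n in sequentially. \<forall>t\<in>{-1/2..0}. norm (W (k n) i t - X i t) \<le> e" if "0 < e" for e
      using hist[OF that i] X(2)[OF i] by simp
    note conv = this
    have "(\<lambda>n. psi (k n) i s) \<longlonglongrightarrow> X i (t i + s)"
    proof (rule tendsto_of_norm_le)
      fix e :: real assume e: "0 < e"
      show "\<forall>\<^sub>F n in sequentially. norm (psi (k n) i s - X i (t i + s)) \<le> e"
        using return_segment_tendsto[OF W(1)[OF i] X(1)[OF i] conv W(3)[OF i] R[OF i] e]
        by (rule eventually_mono) (use s in \<open>auto simp: psi_def\<close>)
    qed
    moreover have "(\<lambda>n. psi (k n) i s) \<longlonglongrightarrow> G i s"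
    proof (rule tendsto_of_norm_le)
      fix e :: real assume "0 < e"
      from unif[OF this i] show "\<forall>\<^sub>F n in sequentially. norm (psi (k n) i s - G i s) \<le> e"
        by eventually_elim (use s in blast)
    qed
    ultimately have "X i (t i + s) = G i s" by (rule LIMSEQ_unique)
    moreover have "X (Suc i mod m) s = G i s" using X(2)[OF _ s, of "Suc i mod m"] prev(3)[OF i] m by simp
    ultimately show ?thesis by simp
  qed
  then show ?thesis using X(1) aX R by blast
qed

end

section \<open>Periodic orbits\<close>

abbreviation ros :: "real^3 \<Rightarrow> real^3" where "ros \<equiv> rossler 5.25 0.2"

lemma rossler_eq_field: "\<bar>v $ 1\<bar> \<le> R \<Longrightarrow> \<bar>v $ 3\<bar> \<le> R \<Longrightarrow> ros v = field R v"
  by (simp add: rossler_def field_def clamp_id)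

lemma dde_rhs_eq_rate:
  assumes "\<And>i. \<bar>u t $ i\<bar> \<le> R" "\<And>i. \<bar>u (t - 1/2) $ i\<bar> \<le> R"
  shows "dde_rhs ros 0.5 0.0001 u t = rate R (u t) (u (t - 1/2))"
proof -
  have e: "ros (u t) = field R (u t)" "ros (u (t - 1/2)) = field R (u (t - 1/2))"
    by (rule rossler_eq_field; rule assms)+
  have h: "(0.5::real) = 1/2" "(0.0001::real) = 1/10000" by simp_all
  show ?thesis unfolding dde_rhs_def rate_def h e ..
qed

lemma up_crossing_iff:
  assumes "(u has_vector_derivative w) (at t)"
  shows "up_crossing u t \<longleftrightarrow> u t $ 1 = 0 \<and> 0 < w $ 1"
proof -
  have "((\<lambda>s. u s $ 1) has_vector_derivative w $ 1) (at t)"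
    by (rule bounded_linear.has_vector_derivative[OF bounded_linear_vec_nth assms])
  then have "deriv (\<lambda>s. u s $ 1) t = w $ 1"
    by (intro DERIV_imp_deriv) (simp add: has_real_derivative_iff_has_vector_derivative)
  then show ?thesis by (simp add: up_crossing_def)
qed

lemma has_vector_derivative_shift:
  assumes "(u has_vector_derivative w) (at (a + t) within S)" "\<And>s. s \<in> S' \<Longrightarrow> a + s \<in> S"
  shows "((\<lambda>s. u (a + s)) has_vector_derivative w) (at t within S')"
proof -
  have "((u \<circ> (+) a) has_vector_derivative (1 *\<^sub>R w)) (at t within S')"
  proof (rule vector_diff_chain_within)
    show "((+) a has_vector_derivative 1) (at t within S')"
      by (auto intro!: derivative_eq_intros simp: has_real_derivative_iff_has_vector_derivative[symmetric])
    show "(u has_vector_derivative w) (at (a + t) within (+) a ` S')"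
      by (rule has_vector_derivative_within_subset[OF assms(1)]) (use assms(2) in auto)
  qed
  then show ?thesis by (simp add: o_def)
qed

lemma solves_shift: "solves u \<Longrightarrow> 0 \<le> a \<Longrightarrow> solves (\<lambda>t. u (a + t))"
proof -
  assume u: "solves u" and a: "0 \<le> a"
  have "((\<lambda>s. u (a + s)) has_vector_derivative rate 100 (u (a + t)) (u (a + (t - 1/2)))) (at t within {0..})" if "0 \<le> t" for t
  proof (rule has_vector_derivative_shift[where S = "{0..}"])
    have "(u has_vector_derivative rate 100 (u (a + t)) (u (a + t - 1/2))) (at (a + t) within {0..})"
      using u a that unfolding solves_def by auto
    then show "(u has_vector_derivative rate 100 (u (a + t)) (u (a + (t - 1/2)))) (at (a + t) within {0..})"
      by (simp add: add_diff_eq)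
  qed (use a in auto)
  moreover have "continuous_on UNIV (\<lambda>t. u (a + t))"
    using u unfolding solves_def by (auto intro!: continuous_intros intro: continuous_on_compose2)
  ultimately show "solves (\<lambda>t. u (a + t))" by (simp add: solves_def)
qed

text \<open>The original field is only locally Lipschitz. On a compact time interval both solutions
  are bounded by some \<open>R\<close>, so they solve the system truncated at \<open>R\<close> and
  the dependence estimate with \<delta> = 0 applies.\<close>

lemma ivp_solution_unique:
  assumes v: "dde_solution ros 0.5 0.0001 v" and u: "dde_ivp_solution ros 0.5 0.0001 (segment 0.5 v a) T u"
    and t: "t \<in> {-1/2..<T}"
  shows "u t = v (a + t)"
proof -
  have hist: "u s = v (a + s)" if "s \<in> {-1/2..0}" for s
  proof -
    have "segment 0.5 u 0 s = segment 0.5 v a s" using u by (simp add: dde_ivp_solution_def)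
    then show ?thesis using that by (simp add: segment_def)
  qed
  show ?thesis
  proof (cases "t \<le> 0")
    case True
    then show ?thesis using hist t by simp
  next
    case False
    have cv: "continuous_on A v" for A
      using v unfolding dde_solution_def
      by (intro continuous_at_imp_continuous_on) (auto intro: has_vector_derivative_continuous)
    have "continuous_on {-1/2..t} u"
      using u t unfolding dde_ivp_solution_def by (auto intro: continuous_on_subset)
    then have "bounded (u ` {-1/2..t})" by (intro compact_imp_bounded compact_continuous_image) auto
    then obtain B1 where "\<forall>x\<in>u ` {-1/2..t}. norm x \<le> B1" unfolding bounded_iff by blast
    then have B1: "\<And>s. s \<in> {-1/2..t} \<Longrightarrow> norm (u s) \<le> B1" by blast
    have "bounded (v ` {a-1/2..a+t})" by (intro compact_imp_bounded compact_continuous_image cv) auto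
    then obtain B2 where "\<forall>x\<in>v ` {a-1/2..a+t}. norm x \<le> B2" unfolding bounded_iff by blast
    then have B2: "\<And>s. s \<in> {a-1/2..a+t} \<Longrightarrow> norm (v s) \<le> B2" by blast
    define R where "R = max 0 (max B1 B2)"
    have R0: "0 \<le> R" by (simp add: R_def)
    have Ru: "\<bar>u s $ i\<bar> \<le> R" if "s \<in> {-1/2..t}" for s i
      using order_trans[OF component_le_norm_cart B1[OF that], of i] by (simp add: R_def le_max_iff_disj)
    have Rv: "\<bar>v (a + s) $ i\<bar> \<le> R" if "s \<in> {-1/2..t}" for s i
      proof -
      have "a + s \<in> {a - 1/2..a + t}" using that by auto
      from order_trans[OF component_le_norm_cart B2[OF this], of i] show ?thesis by (simp add: R_def le_max_iff_disj)
    qed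
    have "norm (u t - v (a + t)) \<le> 2 * (1 + (2 * R + 10) * t) * exp (4 * (2 * R + 10) * t) * 0"
    proof (rule dde_dependence[where F = "rate R" and \<tau> = "1/2" and v = "\<lambda>s. v (a + s)"])
      show "norm (rate R a b - rate R a' b') \<le> (2 * R + 10) * (norm (a - a') + norm (b - b'))" for a b a' b'
        by (rule rate_lipschitz[OF R0])
      fix s assume s: "s \<in> {0..t}"
      have "(u has_vector_derivative dde_rhs ros 0.5 0.0001 u s) (at s within {0..<T})"
        using u s t unfolding dde_ivp_solution_def by auto
      moreover have "dde_rhs ros 0.5 0.0001 u s = rate R (u s) (u (s - 1/2))"
        by (rule dde_rhs_eq_rate) (use Ru s in auto)
      ultimately show "(u has_vector_derivative rate R (u s) (u (s - 1/2))) (at s within {0..t})"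
        using t by (auto intro: has_vector_derivative_within_subset)
      have "((\<lambda>s. v (a + s)) has_vector_derivative dde_rhs ros 0.5 0.0001 v (a + s)) (at s within {0..t})"
        by (rule has_vector_derivative_shift[where S = UNIV]) (use v in \<open>auto simp: dde_solution_def\<close>)
      moreover have "dde_rhs ros 0.5 0.0001 v (a + s) = rate R (v (a + s)) (v (a + s - 1/2))"
        by (rule dde_rhs_eq_rate) (use Rv[of s] Rv[of "s - 1/2"] s in \<open>auto simp: add_diff_eq\<close>)
      ultimately show "((\<lambda>s. v (a + s)) has_vector_derivative rate R (v (a + s)) (v (a + (s - 1/2)))) (at s within {0..t})"
        by (simp add: add_diff_eq)
    next
      fix s assume "s \<in> {- (1/2)..0::real}"
      then show "norm (u s - v (a + s)) \<le> 0" using hist[of s] by simp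
    qed (use R0 False in auto)
    then show ?thesis by simp
  qed
qed

text \<open>The map is defined only where the first return is unique, hence every competing solution
  has to be identified with \<open>v\<close>. This also transfers its crossings.\<close>

lemma poincare_map_next_crossing:
  assumes v: "dde_solution ros 0.5 0.0001 v" and a: "v a $ 1 = 0" and ab: "a < b"
    and upb: "up_crossing v b" and no: "\<And>s. a < s \<Longrightarrow> s < b \<Longrightarrow> \<not> up_crossing v s"
  shows "poincare_map ros 0.5 0.0001 (segment 0.5 v a) = Some (segment 0.5 v b)"
proof -
  have dv: "(v has_vector_derivative dde_rhs ros 0.5 0.0001 v t) (at t within A)" for t A
    using v unfolding dde_solution_def by (blast intro: has_vector_derivative_at_within)
  have cv: "continuous_on A v" for A
    by (rule continuous_on_vector_derivative) (rule dv)
  have cva: "continuous_on A (\<lambda>s. v (a + s))" for A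
    by (rule continuous_on_compose2[OF cv[of UNIV]]) (auto intro!: continuous_intros)
  have "segment 0.5 v a \<in> poincare_section 0.5"
    unfolding poincare_section_def phase_space_def segment_def
    using a by (auto intro!: continuous_on_eq[OF cva])
  moreover have up_shift: "up_crossing (\<lambda>s. v (a + s)) t \<longleftrightarrow> up_crossing v (a + t)" for t
    using up_crossing_iff[OF dv, of "a + t"] up_crossing_iff[OF has_vector_derivative_shift[where a = a and t = t and S = UNIV and S' = UNIV, OF dv UNIV_I]] by simp
  moreover have "first_return ros 0.5 0.0001 (segment 0.5 v a) (segment 0.5 v b)"
    unfolding first_return_def
  proof (rule exI[of _ "b - a + 1"], rule exI[of _ "\<lambda>s. v (a + s)"], rule exI[of _ "b - a"], intro conjI ballI)
    show "dde_ivp_solution ros 0.5 0.0001 (segment 0.5 v a) (b - a + 1) (\<lambda>s. v (a + s))"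
      unfolding dde_ivp_solution_def
    proof (intro conjI ballI)
      show "segment 0.5 (\<lambda>s. v (a + s)) 0 = segment 0.5 v a" by (simp add: segment_def)
      show "continuous_on {- 0.5..<b - a + 1} (\<lambda>s. v (a + s))" by (rule cva)
      fix t
      have "dde_rhs ros 0.5 0.0001 (\<lambda>s. v (a + s)) t = dde_rhs ros 0.5 0.0001 v (a + t)"
        by (simp add: dde_rhs_def add_diff_eq)
      then show "((\<lambda>s. v (a + s)) has_vector_derivative dde_rhs ros 0.5 0.0001 (\<lambda>s. v (a + s)) t) (at t within {0..<b - a + 1})"
        using has_vector_derivative_shift[where S = UNIV, OF dv UNIV_I] by simp
    qed
    have ab': "a + (b - a) = b" by simp
    show "up_crossing (\<lambda>s. v (a + s)) (b - a)" unfolding up_shift ab' by (rule upb)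
    show "\<not> up_crossing (\<lambda>s. v (a + s)) s" if "s \<in> {0<..<b - a}" for s
      using no[of "a + s"] that unfolding up_shift by auto
    show "segment 0.5 v b = segment 0.5 (\<lambda>s. v (a + s)) (b - a)" by (simp add: segment_def)
  qed (use ab in auto)
  moreover have "\<psi> = segment 0.5 v b" if fr: "first_return ros 0.5 0.0001 (segment 0.5 v a) \<psi>" for \<psi>
  proof -
    obtain T u t where u: "dde_ivp_solution ros 0.5 0.0001 (segment 0.5 v a) T u" and t: "0 < t" "t < T" "up_crossing u t"
      and first: "\<And>s. s \<in> {0<..<t} \<Longrightarrow> \<not> up_crossing u s" and psi: "\<psi> = segment 0.5 u t"
      using fr unfolding first_return_def by blast
    note eq = ivp_solution_unique[OF v u]
    have up: "up_crossing u s \<longleftrightarrow> up_crossing v (a + s)" if s: "0 < s" "s < T" for s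
    proof -
      have "(u has_vector_derivative dde_rhs ros 0.5 0.0001 v (a + s)) (at s)"
        by (rule has_vector_derivative_transform_within_open[OF has_vector_derivative_shift[where S = UNIV, OF dv UNIV_I], of "{0<..<T}"])
           (use s eq in auto)
      then show ?thesis using up_crossing_iff[OF dv, of "a + s"] up_crossing_iff eq[of s] s by fastforce
    qed
    have "t = b - a"
    proof (rule ccontr)
      assume "t \<noteq> b - a"
      then consider "t < b - a" | "b - a < t" by linarith
      then show False
      proof cases
        case 1 then show False using no[of "a + t"] up[of t] t by auto
      next
        case 2 then show False using first[of "b - a"] up[of "b - a"] upb t ab by auto
      qed
    qed
    moreover have "segment 0.5 u t = segment 0.5 (\<lambda>s. v (a + s)) t"
      unfolding segment_def using eq t by (intro restrict_ext) auto
    ultimately show ?thesis using psi by (simp add: segment_def)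
  qed
  ultimately have "\<exists>!\<psi>. first_return ros 0.5 0.0001 (segment 0.5 v a) \<psi>" "segment 0.5 v a \<in> poincare_section 0.5"
    "first_return ros 0.5 0.0001 (segment 0.5 v a) (segment 0.5 v b)" by blast+
  then show ?thesis unfolding poincare_map_def by (auto simp: the1_equality)
qed

text \<open>The loops are glued to a forward solution that is periodic, and the periodic extension
  provides the past. The crossings, one per loop, are the iterates of the map.\<close>

lemma periodic_orbit_from_cycle:
  fixes b :: "nat \<Rightarrow> bool" and W :: "nat \<Rightarrow> real \<Rightarrow> real^3"
  assumes m: "0 < m" and b: "\<And>i. i < m \<Longrightarrow> b i \<longleftrightarrow> 2 \<le> m \<and> i = 1"
    and W: "\<And>i. i < m \<Longrightarrow> solves (W i)" and aW: "\<And>i. i < m \<Longrightarrow> adm (b i) (W i)"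
    and R: "\<And>i. i < m \<Longrightarrow> returns (b i) (W i) (T i) (c i)"
    and succ: "\<And>i s. i < m \<Longrightarrow> s \<in> {-1/2..0} \<Longrightarrow> W (Suc i mod m) s = W i (T i + s)"
  shows "\<exists>u. m_periodic_orbit ros 0.5 0.0001 m u"
proof -
  define w where "w i = W (i mod m)" for i
  define \<tau> where "\<tau> i = T (i mod m)" for i
  define \<gamma> where "\<gamma> i = c (i mod m)" for i
  define \<Theta> where "\<Theta> n = (\<Sum>j<n. \<tau> j)" for n
  have im: "i mod m < m" for i using m by simp
  have r: "first_down (w i) (\<tau> i)" "1/2 \<le> \<tau> i" "0 < \<gamma> i" "\<gamma> i < \<tau> i" "w i (\<gamma> i) $ 1 = 0"
    "0 < rate 100 (w i (\<gamma> i)) (w i (\<gamma> i - 1/2)) $ 1"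
    "\<And>s. s \<in> {0..\<tau> i} \<Longrightarrow> w i s $ 1 = 0 \<Longrightarrow> 0 < rate 100 (w i s) (w i (s - 1/2)) $ 1 \<Longrightarrow> s = \<gamma> i"
    "\<And>s j. s \<in> {-1/2..\<tau> i} \<Longrightarrow> \<bar>w i s $ j\<bar> \<le> 100" for i
    using R[OF im[of i]] unfolding returns_def w_def \<tau>_def \<gamma>_def by blast+
  have Th: "\<Theta> 0 = 0" "\<Theta> (Suc n) = \<Theta> n + \<tau> n" for n by (simp_all add: \<Theta>_def)
  have ThSuc: "\<Theta> n < \<Theta> (Suc n)" for n using r(2)[of n] by (simp add: Th)
  have Thge: "real n / 2 \<le> \<Theta> n" for n
  proof (induction n)
    case (Suc n)
    then show ?case using r(2)[of n] by (simp add: Th add_divide_distrib)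
  qed (simp add: Th)
  define u where "u = w 0"
  have su: "solves u" unfolding u_def w_def by (rule W[OF im])
  \<comment> \<open>Each loop starts with the history with which the preceding one returns, so
    uniqueness identifies them.\<close>
  have shift: "u (\<Theta> i + t) = w i t" if "-1/2 \<le> t" for i t
    using that
  proof (induction i arbitrary: t)
    case (Suc i)
    have "w (Suc i) t = (\<lambda>t. w i (\<tau> i + t)) t"
    proof (rule solves_unique[OF _ _ _ Suc.prems])
      show "solves (w (Suc i))" unfolding w_def by (rule W[OF im])
      show "solves (\<lambda>t. w i (\<tau> i + t))" using r(2)[of i] unfolding w_def by (intro solves_shift W[OF im]) simp
      show "w (Suc i) s = w i (\<tau> i + s)" if "s \<in> {-1/2..0}" for s
        using succ[OF im[of i] that] unfolding w_def \<tau>_def by (simp add: mod_Suc_eq)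
    qed
    then show ?case using Suc.IH[of "\<tau> i + t"] r(2)[of i] Suc.prems by (simp add: Th add.assoc)
  qed (simp add: Th u_def)
  define p where "p = \<Theta> m"
  have pm: "1/2 \<le> p"
  proof -
    have "1 / 2 \<le> real m / 2" using m by simp
    also have "\<dots> \<le> p" unfolding p_def by (rule Thge)
    finally show ?thesis .
  qed
  then have p: "0 < p" by simp
  have frac: "0 \<le> t - p * of_int \<lfloor>t / p\<rfloor>" for t
  proof -
    have "p * of_int \<lfloor>t / p\<rfloor> \<le> p * (t / p)" using p by (intro mult_left_mono of_int_floor_le) simp
    then show ?thesis using p by simp
  qed
  have per0: "u (p + t) = u t" if "-1/2 \<le> t" for t using shift[OF that, of m] by (simp add: p_def u_def w_def)
  have pern: "u (real k * p + t) = u t" if "-1/2 \<le> t" for k t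
  proof (induction k)
    case (Suc k)
    have "u (p + (real k * p + t)) = u (real k * p + t)" by (rule per0) (use that p in \<open>simp add: add_increasing\<close>)
    then show ?case using Suc by (simp add: algebra_simps)
  qed simp
  \<comment> \<open>\<open>u\<close> is known to solve the equation at nonnegative times only;
    reducing time modulo \<open>p\<close> extends it to the past.\<close>
  define U where "U t = u (t - p * of_int \<lfloor>t / p\<rfloor>)" for t
  have Uu: "U t = u t" if "-1/2 \<le> t" for t
  proof -
    define q where "q = t - p * of_int \<lfloor>t / p\<rfloor>"
    have q: "0 \<le> q" unfolding q_def by (rule frac)
    show ?thesis
    proof (cases "0 \<le> t")
      case True
      then have "0 \<le> \<lfloor>t / p\<rfloor>" using p by simp
      then have "t = real (nat \<lfloor>t / p\<rfloor>) * p + q" by (simp add: q_def)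
      then show ?thesis using pern[of q "nat \<lfloor>t / p\<rfloor>"] q by (simp add: U_def q_def[symmetric])
    next
      case False
      \<comment> \<open>The delay is at most one period, since every loop lasts at least
        1/2.\<close>
      have "\<lfloor>t / p\<rfloor> = -1" using that False p pm by (intro floor_unique) (auto simp: field_simps)
      then show ?thesis using per0[OF that] by (simp add: U_def add.commute)
    qed
  qed
  have Uper: "U (t + p) = U t" for t
  proof -
    have "(t + p) / p = t / p + 1" using p by (simp add: field_simps)
    then have "\<lfloor>(t + p) / p\<rfloor> = \<lfloor>t / p\<rfloor> + 1" by simp
    then show ?thesis by (simp add: U_def algebra_simps)
  qed
  have Upern: "U (t + real k * p) = U t" for t k
  proof (induction k)
    case (Suc k)
    have "U (t + real (Suc k) * p) = U ((t + real k * p) + p)" by (simp add: algebra_simps)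
    then show ?case using Suc Uper by simp
  qed simp
  have Uw: "U (\<Theta> i + t) = w i t" if "-1/2 \<le> t" for i t
  proof -
    have "0 \<le> \<Theta> i" by (rule order_trans[OF _ Thge]) simp
    then show ?thesis using Uu[of "\<Theta> i + t"] shift[OF that, of i] that by simp
  qed
  have loc: "\<exists>i. t \<in> {\<Theta> i..\<Theta> (Suc i)}" if "0 \<le> t" for t
  proof -
    obtain n where "2 * t \<le> real n" using real_arch_simple by blast
    then have "t \<le> \<Theta> n" using Thge[of n] by linarith
    then have "\<exists>n. t \<le> \<Theta> n" by blast
    then have L: "t \<le> \<Theta> (LEAST n. t \<le> \<Theta> n)" by (rule LeastI_ex)
    show ?thesis
    proof (cases "LEAST n. t \<le> \<Theta> n")
      case 0
      then show ?thesis using L that Th ThSuc[of 0] by (intro exI[of _ 0]) auto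
    next
      case (Suc i)
      then have "\<not> t \<le> \<Theta> i" by (metis lessI not_less_Least)
      then show ?thesis using L Suc by (intro exI[of _ i]) auto
    qed
  qed
  have Ub: "\<bar>U t $ j\<bar> \<le> 100" for t j
  proof -
    define q where "q = t - p * of_int \<lfloor>t / p\<rfloor>"
    have q: "0 \<le> q" unfolding q_def by (rule frac)
    obtain i where i: "q \<in> {\<Theta> i..\<Theta> (Suc i)}" using loc[OF q] by blast
    have "u q = w i (q - \<Theta> i)" using shift[of "q - \<Theta> i" i] i by simp
    then show ?thesis using r(8)[of "q - \<Theta> i" i j] i by (simp add: U_def q_def[symmetric] Th)
  qed
  have dU: "(U has_vector_derivative rate 100 (U t) (U (t - 1/2))) (at t)" for t
  proof -
    \<comment> \<open>Enough periods are added to reach times beyond 1, where \<open>u\<close>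
      satisfies the equation with a two-sided derivative and \<open>U\<close> agrees with
      it.\<close>
    obtain k where k: "1 - t < real k * p" using reals_Archimedean3[OF p] by blast
    let ?t = "real k * p + t"
    have "(u has_vector_derivative rate 100 (u ?t) (u (?t - 1/2))) (at ?t within {0..})" using su k unfolding solves_def by auto
    then have "(u has_vector_derivative rate 100 (u ?t) (u (?t - 1/2))) (at ?t within {0<..})" by (rule has_vector_derivative_within_subset) auto
    then have "(u has_vector_derivative rate 100 (u ?t) (u (?t - 1/2))) (at ?t)"
      using k by (simp add: at_within_open[of ?t "{0<..}"])
    from has_vector_derivative_shift[where S = UNIV and S' = UNIV and a = "real k * p" and t = t, OF this UNIV_I]
    have d1: "((\<lambda>s. u (real k * p + s)) has_vector_derivative rate 100 (u ?t) (u (?t - 1/2))) (at t)" by simp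
    have e: "u (real k * p + s) = U s" if "t - 1 < s" for s
      using Uu[of "real k * p + s"] Upern[of s k] that k by (simp add: add.commute)
    have "(U has_vector_derivative rate 100 (u ?t) (u (?t - 1/2))) (at t)"
      by (rule has_vector_derivative_transform_within_open[OF d1, of "{t - 1<..}"]) (use e in auto)
    moreover have "?t - 1/2 = real k * p + (t - 1/2)" by simp
    ultimately show ?thesis using e[of t] e[of "t - 1/2"] by simp
  qed
  have solU: "dde_solution ros 0.5 0.0001 (\<lambda>t. U (a + t))" for a
    unfolding dde_solution_def
  proof
    fix t
    have "((\<lambda>t. U (a + t)) has_vector_derivative rate 100 (U (a + t)) (U (a + t - 1/2))) (at t)"
      by (rule has_vector_derivative_shift[OF dU]) simp
    moreover have "dde_rhs ros 0.5 0.0001 (\<lambda>t. U (a + t)) t = rate 100 (U (a + t)) (U (a + (t - 1/2)))"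
      by (rule dde_rhs_eq_rate) (use Ub in auto)
    ultimately show "((\<lambda>t. U (a + t)) has_vector_derivative dde_rhs ros 0.5 0.0001 (\<lambda>t. U (a + t)) t) (at t)"
      by (simp add: add_diff_eq)
  qed
  have upU: "up_crossing (\<lambda>t. U (a + t)) t \<longleftrightarrow> U (a + t) $ 1 = 0 \<and> 0 < rate 100 (U (a + t)) (U (a + t - 1/2)) $ 1" for a t
    by (rule up_crossing_iff, rule has_vector_derivative_shift[OF dU]) simp
  define C where "C i = \<Theta> i + \<gamma> i" for i
  have Cup: "U (C i) $ 1 = 0" "0 < rate 100 (U (C i)) (U (C i - 1/2)) $ 1" for i
  proof -
    have "U (C i) = w i (\<gamma> i)" "U (C i - 1/2) = w i (\<gamma> i - 1/2)"
      using Uw[of "\<gamma> i" i] Uw[of "\<gamma> i - 1/2" i] r(3)[of i] by (simp_all add: C_def add_diff_eq)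
    then show "U (C i) $ 1 = 0" "0 < rate 100 (U (C i)) (U (C i - 1/2)) $ 1" using r(5,6) by simp_all
  qed
  have Conly: "t = C i" if "t \<in> {\<Theta> i..\<Theta> (Suc i)}" "U t $ 1 = 0" "0 < rate 100 (U t) (U (t - 1/2)) $ 1" for i t
  proof -
    have "U t = w i (t - \<Theta> i)" "U (t - 1/2) = w i (t - \<Theta> i - 1/2)"
      using Uw[of "t - \<Theta> i" i] Uw[of "t - \<Theta> i - 1/2" i] that(1) by (simp_all add: add_diff_eq)
    then have "t - \<Theta> i = \<gamma> i" using that by (intro r(7)) (auto simp: Th)
    then show ?thesis by (simp add: C_def)
  qed
  have CSuc: "C i < C (Suc i)" "C i < \<Theta> (Suc i)" "\<Theta> (Suc i) < C (Suc i)" "C i > \<Theta> i" for i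
    using r(3)[of i] r(3)[of "Suc i"] r(4)[of i] by (auto simp: C_def Th)
  \<comment> \<open>Time is shifted to the first crossing because an orbit must have its crossing at
    time 0.\<close>
  define v where "v t = U (C 0 + t)" for t
  have vsol: "dde_solution ros 0.5 0.0001 v" unfolding v_def by (rule solU)
  define seg where "seg i = segment 0.5 v (C i - C 0)" for i
  have step: "poincare_map ros 0.5 0.0001 (seg i) = Some (seg (Suc i))" for i
    unfolding seg_def
  proof (rule poincare_map_next_crossing[OF vsol])
    show "v (C i - C 0) $ 1 = 0" using Cup(1) by (simp add: v_def)
    show "C i - C 0 < C (Suc i) - C 0" using CSuc by simp
    show "up_crossing v (C (Suc i) - C 0)" unfolding v_def upU using Cup by simp
    fix s assume s: "C i - C 0 < s" "s < C (Suc i) - C 0"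
    show "\<not> up_crossing v s"
    proof
      assume "up_crossing v s"
      then have up: "U (C 0 + s) $ 1 = 0" "0 < rate 100 (U (C 0 + s)) (U (C 0 + s - 1/2)) $ 1" unfolding v_def upU by auto
      \<comment> \<open>Times between successive crossings belong to two loops, each with a single
        crossing.\<close>
      have "C 0 + s \<in> {\<Theta> i..\<Theta> (Suc i)} \<or> C 0 + s \<in> {\<Theta> (Suc i)..\<Theta> (Suc (Suc i))}"
        using s CSuc[of i] CSuc[of "Suc i"] by auto
      then have "C 0 + s = C i \<or> C 0 + s = C (Suc i)" using Conly up by blast
      then show False using s by linarith
    qed
  qed
  have iter: "partial_iterate (poincare_map ros 0.5 0.0001) k (seg 0) = Some (seg k)" for k
  proof (induction k)
    case (Suc k)
    have "partial_iterate P k x = Some y \<Longrightarrow> partial_iterate P (Suc k) x = P y"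
      for P :: "(real \<Rightarrow> real^3) \<Rightarrow> (real \<Rightarrow> real^3) option" and x y by (simp add: partial_iterate_def)
    from this[OF Suc.IH] show ?case unfolding step .
  qed (simp add: partial_iterate_def)
  have Cm: "C m = p + C 0" by (simp add: C_def p_def \<gamma>_def Th)
  have vm: "v (C m - C 0 + s) = v (C 0 - C 0 + s)" for s
    using Uper[of "C 0 + s"] unfolding v_def Cm by (simp add: algebra_simps)
  have segm: "seg m = seg 0" unfolding seg_def segment_def vm ..
  have solvesU: "solves (\<lambda>t. U (a + t))" for a
    unfolding solves_def
  proof (intro conjI allI impI)
    have cU: "continuous_on UNIV U" by (rule continuous_on_vector_derivative) (rule has_vector_derivative_at_within[OF dU])
    show "continuous_on UNIV (\<lambda>t. U (a + t))" by (rule continuous_on_compose2[OF cU]) (auto intro!: continuous_intros)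
    fix t :: real
    show "((\<lambda>t. U (a + t)) has_vector_derivative rate 100 (U (a + t)) (U (a + (t - 1/2)))) (at t within {0..})"
      using has_vector_derivative_shift[where S = UNIV and S' = UNIV and a = a and t = t, OF dU UNIV_I] by (auto simp: add_diff_eq intro: has_vector_derivative_at_within)
  qed
  have fd: "first_down (\<lambda>t. U (C i + t)) (\<tau> i - \<gamma> i)" for i
  proof -
    have e: "U (C i + t) = w i (\<gamma> i + t)" if "- \<gamma> i \<le> t" for t
      using Uw[of "\<gamma> i + t" i] that by (simp add: C_def add.assoc)
    have "w i s $ 2 \<noteq> 0" if "s \<in> {0<..<\<tau> i}" "w i s $ 1 < 0" for s using r(1)[of i] that by (simp add: first_down_def)
    moreover have "w i (\<tau> i) $ 2 = 0" "w i (\<tau> i) $ 1 < 0" using r(1)[of i] by (simp_all add: first_down_def)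
    ultimately show ?thesis unfolding first_down_def using r(3,4)[of i] e by (auto simp: e)
  qed
  have start: "starts (b (i mod m)) (U (\<Theta> i))" for i
    using aW[OF im[of i]] Uw[of 0 i] by (simp add: adm_def w_def)
  \<comment> \<open>Equal segments at two crossings have equal futures, hence equal next returns to
    y = 0; but those returns lie in disjoint intervals.\<close>
  have ne: "seg k \<noteq> seg 0" if k: "0 < k" "k < m" for k
  proof
    assume eq: "seg k = seg 0"
    have h: "U (C k + s) = U (C 0 + s)" if "s \<in> {-1/2..0}" for s
      using fun_cong[OF eq, of s] that by (simp add: seg_def segment_def v_def)
    have eqU: "U (C k + t) = U (C 0 + t)" if "0 \<le> t" for t
      by (rule solves_unique[OF solvesU solvesU h]) (use that in auto)
    have "first_down (\<lambda>t. U (C 0 + t)) (\<tau> k - \<gamma> k)"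
      using fd[of k] eqU r(4)[of k] unfolding first_down_def by simp
    then have "\<tau> k - \<gamma> k = \<tau> 0 - \<gamma> 0" using fd[of 0] first_down_unique by blast
    then have "U (\<Theta> (Suc k)) = U (\<Theta> (Suc 0))"
    proof -
      have e: "C i + (\<tau> i - \<gamma> i) = \<Theta> (Suc i)" for i by (simp add: C_def Th)
      have "U (C k + (\<tau> 0 - \<gamma> 0)) = U (C 0 + (\<tau> 0 - \<gamma> 0))" by (rule eqU) (use r(4)[of 0] in simp)
      then show ?thesis using e[of k] e[of 0] \<open>\<tau> k - \<gamma> k = \<tau> 0 - \<gamma> 0\<close> by simp
    qed
    \<comment> \<open>The comparison is with the return that starts loop 1, the only visit to the
      first interval: for 0 < k < m the index k + 1 is not congruent to 1.\<close>
    moreover have "b (Suc 0 mod m)" using b[of "Suc 0 mod m"] k m by simp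
    moreover have "\<not> b (Suc k mod m)"
    proof -
      have "Suc k mod m \<noteq> 1" using k by (cases "Suc k = m") auto
      then show ?thesis using b[of "Suc k mod m"] m by simp
    qed
    ultimately show False using start[of "Suc k"] start[of "Suc 0"] by (simp add: starts_def xlo_def xhi_def)
  qed
  have "m_periodic_orbit ros 0.5 0.0001 m v"
    unfolding m_periodic_orbit_def has_least_period_def
  proof (intro conjI)
    show "dde_solution ros 0.5 0.0001 v" by (rule vsol)
    show "\<exists>p>0. \<forall>t. v (t + p) = v t" using p Uper unfolding v_def by (metis add.assoc)
    show "up_crossing v 0" unfolding v_def upU using Cup[of 0] by simp
    have s0: "segment 0.5 v 0 = seg 0" by (simp add: seg_def)
    show "partial_iterate (poincare_map ros 0.5 0.0001) m (segment 0.5 v 0) = Some (segment 0.5 v 0)"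
      unfolding s0 iter segm ..
    show "\<forall>k. 0 < k \<and> k < m \<longrightarrow> partial_iterate (poincare_map ros 0.5 0.0001) k (segment 0.5 v 0) \<noteq> Some (segment 0.5 v 0)"
      unfolding s0 iter using ne by simp
  qed (rule m)
  then show ?thesis by blast
qed

theorem theorem29:
  fixes m :: nat
  assumes "m \<ge> 1"
  shows "\<exists>u. m_periodic_orbit (rossler 5.25 0.2) 0.5 0.0001 m u"
proof -
  define b :: "nat \<Rightarrow> bool" where "b i \<longleftrightarrow> 2 \<le> m \<and> i = 1" for i
  interpret cycle m b
  proof
    show "0 < m" using assms by simp
    fix i assume "i < m" "b i"
    then have "i = 1" "2 \<le> m" by (auto simp: b_def)
    then show "\<not> b (Suc i mod m)" by (cases "m = 2") (auto simp: b_def)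
  qed
  obtain W T c where "\<forall>i<m. solves (W i) \<and> adm (b i) (W i) \<and> returns (b i) (W i) (T i) (c i) \<and>
    (\<forall>s\<in>{-1/2..0}. W (Suc i mod m) s = W i (T i + s))" using cycle_exists by blast
  then show ?thesis by (intro periodic_orbit_from_cycle[of m b W T c]) (use assms in \<open>auto simp: b_def\<close>)
qed

end
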